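(* Consider the $\mathbb Z_4$-symmetric family of systems $$ \begin{aligned} \dot{u}&=(-\gamma+i \beta )\, u+a_0 \, zu^* + a_1\, u^2u^*+a_2\, z^2 u + a_3\, (u^* )^3+O_4, \\ \dot{z}&=\mu\, z+b_0\, u^2+b_0^*\, (u^* )^2 +b_1\, z^3+ b_2\, zuu^*+O_4, \end{aligned} $$ with small real parameters $(\gamma,\beta,\mu)$, and let its coefficients satisfy $$b_1<0,\qquad \mathrm{Re}(a_0b_0)<0 .$$ Then there exists a smooth function $h(\beta,\mu)$, defined for all sufficiently small $\beta$ and all sufficiently small $\mu\ge 0$, such that $h(0,0)=0$ and the system at $\gamma=h(\beta,\mu)$ has an $S$-symmetric four-winged heteroclinic connection such that the one-dimensional unstable separatrices of the equilibrium states $O^+$ and $O^-$ tend to the equilibrium state $O$ as $t\to+\infty$.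
   Context: Here $u=x+iy\in\mathbb C$, $u^*=x-iy$, $z\in\mathbb R$; $S$ is the linear map $(u,u^*,z)\mapsto(iu,-iu^*,-z)$ and the smooth system is invariant under $S$. The coefficients $a_j,b_0\in\mathbb C$, $b_1,b_2\in\mathbb R$ are smooth functions of $(\gamma,\beta,\mu)$; $O_4$ denotes terms of order $4$ and higher. By symmetry the $z$-axis is invariant and $O=(0,0,0)$ is an equilibrium. For $b_1<0$ and small $\mu>0$ there are two more equilibria on the $z$-axis, $O^{+}=(0,0,z_0)$ and $O^-=(0,0,-z_0)$ with $z_0=\sqrt{\mu/|b_1|}+O(\mu)$, exchanged by $S$. In the situation considered, each of $O^\pm$ is a saddle with a one-dimensional unstable manifold (consisting, apart from the equilibrium, of two trajectories called unstable separatrices) and a two-dimensional stable manifold, while $O$ has a two-dimensional stable manifold and a one-dimensional unstable manifold (the segment of the $z$-axis between $O^-$ and $O^+$).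
   Formalization: "All sufficiently small β" becomes |β| ≤ κ√μ, the connection is for μ > 0, and h is smooth inside this region, continuous on it, and smooth up to μ=0 in (β/√μ, √μ): for fixed β≠0, μ→0, O^± has no 1-dimensional unstable manifold, and h(0,μ) ~ c√μ is not smooth at μ=0. *)

theory Defs
  imports "HOL-Analysis.Analysis"
begin

type_synonym param = "real \<times> real \<times> real"  \<comment> \<open>\<open>(\<gamma>, \<beta>, \<mu>)\<close>\<close>
type_synonym phase = "complex \<times> real"  \<comment> \<open>\<open>(u, z)\<close>; the conjugate variable \<open>u\<^sup>*\<close> is \<open>cnj u\<close>\<close>

subsection \<open>Smoothness\<close>

text \<open>Smooth means \<open>C\<^sup>\<infinity>\<close>; the definitions are meant for open sets \<open>X\<close>.\<close>

primrec higher_differentiable_on ::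
    "nat \<Rightarrow> 'a::real_normed_vector set \<Rightarrow> ('a \<Rightarrow> 'b::real_normed_vector) \<Rightarrow> bool" where
  "higher_differentiable_on 0 X f \<longleftrightarrow> continuous_on X f"
| "higher_differentiable_on (Suc n) X f \<longleftrightarrow>
     (\<forall>x\<in>X. f differentiable (at x)) \<and>
     (\<forall>v. higher_differentiable_on n X (\<lambda>x. frechet_derivative f (at x) v))"

definition smooth_on :: "'a::real_normed_vector set \<Rightarrow> ('a \<Rightarrow> 'b::real_normed_vector) \<Rightarrow> bool" where
  "smooth_on X f \<longleftrightarrow> (\<forall>n. higher_differentiable_on n X f)"

subsection \<open>The family of systems\<close>

definition Z4_sym :: "phase \<Rightarrow> phase" where
  "Z4_sym = (\<lambda>(u, z). (\<i> * u, - z))"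

text \<open>The explicit terms of the right-hand side. The expression under \<open>Re\<close> is real already.\<close>

definition cubic_part ::
    "(param \<Rightarrow> complex) \<Rightarrow> (param \<Rightarrow> complex) \<Rightarrow> (param \<Rightarrow> complex) \<Rightarrow> (param \<Rightarrow> complex) \<Rightarrow>
     (param \<Rightarrow> complex) \<Rightarrow> (param \<Rightarrow> real) \<Rightarrow> (param \<Rightarrow> real) \<Rightarrow> param \<Rightarrow> phase \<Rightarrow> phase" where
  "cubic_part a0 a1 a2 a3 b0 b1 b2 = (\<lambda>(\<gamma>, \<beta>, \<mu>) (u, z).
     let p = (\<gamma>, \<beta>, \<mu>) in
     ((- of_real \<gamma> + \<i> * of_real \<beta>) * u + a0 p * of_real z * cnj u
        + a1 p * u\<^sup>2 * cnj u + a2 p * (of_real z)\<^sup>2 * u + a3 p * (cnj u) ^ 3,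
      \<mu> * z + Re (b0 p * u\<^sup>2 + cnj (b0 p) * (cnj u)\<^sup>2) + b1 p * z ^ 3
        + b2 p * z * Re (u * cnj u)))"

subsection \<open>Trajectories, saddles and unstable manifolds\<close>

definition trajectory :: "(phase \<Rightarrow> phase) \<Rightarrow> phase set \<Rightarrow> real set \<Rightarrow> (real \<Rightarrow> phase) \<Rightarrow> bool" where
  "trajectory f W T \<phi> \<longleftrightarrow>
     (\<forall>t\<in>T. \<phi> t \<in> W \<and> (\<phi> has_vector_derivative f (\<phi> t)) (at t within T))"

definition unstable_manifold :: "(phase \<Rightarrow> phase) \<Rightarrow> phase set \<Rightarrow> phase \<Rightarrow> phase set" where
  "unstable_manifold f W e =
     {x. \<exists>\<phi>. trajectory f W {..0} \<phi> \<and> \<phi> 0 = x \<and> (\<phi> \<longlongrightarrow> e) at_bot}"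

text \<open>The operator \<open>A\<close> is real, so \<open>v + i w\<close> stands for a vector of the complexified subspace \<open>E\<close>.\<close>

definition eigenvalue_on :: "(phase \<Rightarrow> phase) \<Rightarrow> phase set \<Rightarrow> complex \<Rightarrow> bool" where
  "eigenvalue_on A E c \<longleftrightarrow>
     (\<exists>v\<in>E. \<exists>w\<in>E. (v, w) \<noteq> (0, 0) \<and>
        A v = Re c *\<^sub>R v - Im c *\<^sub>R w \<and> A w = Im c *\<^sub>R v + Re c *\<^sub>R w)"

text \<open>A hyperbolic equilibrium with two-dimensional stable and one-dimensional unstable manifold,
  expressed by the invariant splitting of the linearization.\<close>

definition saddle :: "(phase \<Rightarrow> phase) \<Rightarrow> phase \<Rightarrow> bool" where
  "saddle f e \<longleftrightarrow> f e = 0 \<and> f differentiable (at e) \<and>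
     (let A = frechet_derivative f (at e) in
      \<exists>Es Eu. subspace Es \<and> subspace Eu \<and> dim Es = 2 \<and> dim Eu = 1 \<and>
        A ` Es \<subseteq> Es \<and> A ` Eu \<subseteq> Eu \<and>
        (\<forall>c. eigenvalue_on A Es c \<longrightarrow> Re c < 0) \<and>
        (\<forall>c. eigenvalue_on A Eu c \<longrightarrow> Re c > 0))"

text \<open>The four wings are the orbits of \<open>\<phi>\<close>, \<open>Z4_sym \<circ> \<phi>\<close>, \<open>Z4_sym\<^sup>2 \<circ> \<phi>\<close>, \<open>Z4_sym\<^sup>3 \<circ> \<phi>\<close>. As \<open>Z4_sym\<^sup>2\<close> fixes the
  \<open>z\<close>-axis, the even ones are the two separatrices of \<open>O\<^sup>+ = (0, z0)\<close> and the odd ones those of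
  \<open>O\<^sup>- = (0, - z0)\<close>.\<close>

definition four_winged_connection :: "(phase \<Rightarrow> phase) \<Rightarrow> phase set \<Rightarrow> real \<Rightarrow> bool" where
  "four_winged_connection f W z0 \<longleftrightarrow>
     0 < z0 \<and> saddle f (0, 0) \<and> saddle f (0, z0) \<and> saddle f (0, - z0) \<and>
     unstable_manifold f W (0, 0) = {0} \<times> {- z0<..<z0} \<and>
     (\<exists>\<phi>.
        (\<forall>k<4. trajectory f W UNIV ((Z4_sym ^^ k) \<circ> \<phi>) \<and>
               (((Z4_sym ^^ k) \<circ> \<phi>) \<longlongrightarrow> (0, (- 1) ^ k * z0)) at_bot \<and>
               (((Z4_sym ^^ k) \<circ> \<phi>) \<longlongrightarrow> (0, 0)) at_top) \<and>
        (\<forall>j<4. \<forall>k<4. j \<noteq> k \<longrightarrow> range ((Z4_sym ^^ j) \<circ> \<phi>) \<inter> range ((Z4_sym ^^ k) \<circ> \<phi>) = {}) \<and>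
        unstable_manifold f W (0, z0) - {(0, z0)} = range \<phi> \<union> range ((Z4_sym ^^ 2) \<circ> \<phi>) \<and>
        unstable_manifold f W (0, - z0) - {(0, - z0)} =
          range (Z4_sym \<circ> \<phi>) \<union> range ((Z4_sym ^^ 3) \<circ> \<phi>))"

subsection \<open>Domain and smoothness of the bifurcation function\<close>

text \<open>
  How small \<open>\<beta>\<close> has to be depends on \<open>\<mu>\<close>: the linearization at \<open>O\<^sup>\<plusminus>\<close> has the invariant block
  \<open>u \<mapsto> (- \<gamma> + i \<beta> + O(\<mu>)) u + (\<plusminus> a0 z0 + O(\<mu>)) u\<^sup>*\<close> with determinant
  \<open>\<bar>- \<gamma> + i \<beta> + O(\<mu>)\<bar>\<^sup>2 - \<bar>a0 z0 + O(\<mu>)\<bar>\<^sup>2\<close>. A one-dimensional unstable manifold needs this to be negative,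
  hence \<open>\<beta> = O(\<surd>\<mu>)\<close>, since \<open>z0 \<sim> \<surd>(\<mu> / \<bar>b1\<bar>)\<close>.
\<close>

definition small_region :: "real \<Rightarrow> real \<Rightarrow> (real \<times> real) set" where
  "small_region \<kappa> \<mu>0 = {(\<beta>, \<mu>). 0 \<le> \<mu> \<and> \<mu> < \<mu>0 \<and> \<bar>\<beta>\<bar> \<le> \<kappa> * sqrt \<mu>}"

text \<open>
  On the connection \<open>\<gamma>\<close> is of order \<open>\<surd>\<mu>\<close> as well: for \<open>\<beta> = 0\<close> it is asymptotic to
  \<open>(\<bar>a0\<bar> / 2) \<surd>(\<mu> / \<bar>b1\<bar>)\<close>. So \<open>h\<close> is not differentiable in \<open>\<mu>\<close> at \<open>\<mu> = 0\<close>, and smoothness up to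
  \<open>\<mu> = 0\<close> refers to the natural scale \<open>\<beta> = \<epsilon> B\<close>, \<open>\<mu> = \<epsilon>\<^sup>2\<close>.
\<close>

definition smooth_bifurcation_function :: "real \<Rightarrow> real \<Rightarrow> (real \<Rightarrow> real \<Rightarrow> real) \<Rightarrow> bool" where
  "smooth_bifurcation_function \<kappa> \<mu>0 h \<longleftrightarrow>
     continuous_on (small_region \<kappa> \<mu>0) (\<lambda>(\<beta>, \<mu>). h \<beta> \<mu>) \<and>
     smooth_on (interior (small_region \<kappa> \<mu>0)) (\<lambda>(\<beta>, \<mu>). h \<beta> \<mu>) \<and>
     (\<exists>H. smooth_on ({- \<kappa><..<\<kappa>} \<times> {- sqrt \<mu>0<..<sqrt \<mu>0}) H \<and>
          (\<forall>B\<in>{- \<kappa><..<\<kappa>}. \<forall>\<epsilon>\<in>{0..<sqrt \<mu>0}. h (\<epsilon> * B) (\<epsilon>\<^sup>2) = H (B, \<epsilon>)))"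

end

theory Submission
  imports Defs
begin

text \<open>
  Put \<open>\<epsilon> = \<surd>\<mu>\<close>, \<open>\<gamma> = \<epsilon> \<nu> (1 + d)\<close>, \<open>\<beta> = \<epsilon> \<nu> b\<close>, \<open>u = \<epsilon> A V\<close>, \<open>z = \<epsilon> Z0 Z\<close> and rescale time by \<open>\<epsilon> \<nu>\<close>,
  with \<open>O\<^sup>+\<close> at \<open>(V, Z) = (0, 1)\<close>. As \<open>\<epsilon> \<rightarrow> 0\<close> the family becomes
  \<open>V' = (- (1 + d) + i b) V + 2 Z V\<^sup>*\<close>, \<open>Z' = Re (\<kappa> V\<^sup>2)\<close> with \<open>Re \<kappa> = - 1 / 2\<close>, whose \<open>Z\<close>-axis consists
  of equilibria and which for \<open>d = b = 0\<close> has the orbit \<open>V = sech t\<close>, \<open>Z = (1 - tanh t) / 2\<close> from \<open>(0, 1)\<close> to \<open>(0, 0)\<close>.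
  A connecting orbit of the perturbed system is sought as this orbit plus \<open>(sech t)\<^bsup>1/2\<^esup> v(t)\<close> with \<open>v\<close> bounded
  and continuous. In this weighted space the linearized equation is solvable up to a single scalar condition,
  which is met by adjusting \<open>d\<close>. The pair \<open>(v, d)\<close> is thus a fixed point depending smoothly on \<open>(b, \<epsilon>)\<close>,
  and \<open>h = \<epsilon> \<nu> (1 + d)\<close>. The symmetry carries the orbit to the other three wings; they exhaust the unstable
  manifolds, because an indefinite quadratic form forbids two distinct trajectories leaving a saddle
  in the same direction.
\<close>

subsection \<open>Calculus of smooth maps\<close>

text \<open>In the limit the \<open>Z\<close>-axis consists of equilibria, so the axis direction is
  neutral at both ends of the orbit and the connection is not one between hyperbolic points. The
  weight decays like exp (- |t| / 2), at a rate strictly between the neutral rate 0 and the rate 1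
  at which the limiting orbit leaves and arrives. In this weighted space one direction is admissible
  at -\<infinity> and two at +\<infinity>, so the linearized equation has index 1 + 2 - 3 = 0. Its
  kernel contains the time derivative of the orbit; this is why one scalar condition appears and one
  parameter is needed. The condition becomes explicit because for d = b = 0 motions with real V
  conserve V^2 + (2 Z - 1)^2. Once the imaginary part is solved for, the variation of this quantity
  obeys an equation consisting of forcing only, and d enters it through - 2 d sech^2, whose integral
  over the line is not 0. The sign of Re (a0 b0) is what lets \<open>Z\<close> fall from 1 to 0:
  when u is rotated so that a0 acts as a positive number, it is the sign of Re \<kappa>, and the
  unit of amplitude then makes the value - 1 / 2.\<close>

lemma higher_differentiable_on_SucI:
  assumes "open X" "\<And>x. x \<in> X \<Longrightarrow> (f has_derivative f' x) (at x)"
    and "\<And>v. higher_differentiable_on n X (\<lambda>x. f' x v)"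
  shows "higher_differentiable_on (Suc n) X f"
proof -
  \<comment> \<open>The definition speaks of \<open>frechet_derivative\<close>, which agrees with
    the given f' only on X. As X is open, derivatives at its points depend on the values on X alone,
    so the agreement can be carried through all orders.\<close>
  have cong: "higher_differentiable_on n X g"
    if "open X" "\<And>x. x \<in> X \<Longrightarrow> f x = g x" "higher_differentiable_on n X f" for n X and f g :: "'a \<Rightarrow> 'b"
    using that
  proof (induction n arbitrary: f g)
    case 0
    then show ?case by (simp cong: continuous_on_cong)
  next
    case (Suc n)
    have "g differentiable (at x)" "frechet_derivative f (at x) = frechet_derivative g (at x)" if "x \<in> X" for x
    proof -
      have "f differentiable (at x)" using Suc that by auto
      then obtain D where "(f has_derivative D) (at x)" by (auto simp: differentiable_def)
      then show "g differentiable (at x)"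
        using has_derivative_transform_within_open[of f D x UNIV X g] Suc that by (auto simp: differentiable_def)
      show "frechet_derivative f (at x) = frechet_derivative g (at x)"
        using frechet_derivative_transform_within_open[of f x X g] Suc that \<open>f differentiable (at x)\<close> by auto
    qed
    then show ?case using Suc.IH[of "\<lambda>x. frechet_derivative f (at x) v" "\<lambda>x. frechet_derivative g (at x) v" for v] Suc.prems
      by auto
  qed
  have *: "frechet_derivative f (at x) = f' x" if "x \<in> X" for x
    using assms(2)[OF that] frechet_derivative_at by metis
  show ?thesis using assms cong[of X "\<lambda>x. f' x v" "\<lambda>x. frechet_derivative f (at x) v" n for v]
    by (auto simp: differentiable_def *)
qed

lemma higher_differentiable_on_SucD:
  "higher_differentiable_on (Suc n) X f \<Longrightarrow> x \<in> X \<Longrightarrow> (f has_derivative frechet_derivative f (at x)) (at x)"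
  "higher_differentiable_on (Suc n) X f \<Longrightarrow> higher_differentiable_on n X (\<lambda>x. frechet_derivative f (at x) v)"
  by (auto simp: frechet_derivative_works)

lemma higher_differentiable_on_Suc_imp: "higher_differentiable_on (Suc n) X f \<Longrightarrow> higher_differentiable_on n X f"
proof (induction n arbitrary: f)
  case 0
  then show ?case
    by (auto intro!: continuous_at_imp_continuous_on differentiable_imp_continuous_within)
qed auto

lemma higher_differentiable_on_continuous: "higher_differentiable_on n X f \<Longrightarrow> continuous_on X f"
  by (induction n) (auto dest: higher_differentiable_on_Suc_imp simp del: higher_differentiable_on.simps(2))

lemma higher_differentiable_on_subset: "higher_differentiable_on n X f \<Longrightarrow> Y \<subseteq> X \<Longrightarrow> higher_differentiable_on n Y f"
  by (induction n arbitrary: f) (auto intro: continuous_on_subset)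

lemma higher_differentiable_on_const: "open X \<Longrightarrow> higher_differentiable_on n X (\<lambda>x. c)"
proof (induction n arbitrary: c)
  case (Suc n)
  show ?case by (rule higher_differentiable_on_SucI[where f'="\<lambda>_ _. 0"]) (use Suc in auto)
qed auto

lemma higher_differentiable_on_linear:
  assumes "open X" "bounded_linear f"
  shows "higher_differentiable_on n X f"
proof (cases n)
  case 0
  then show ?thesis using assms by (auto simp: linear_continuous_on)
next
  case (Suc m)
  show ?thesis unfolding Suc
    by (rule higher_differentiable_on_SucI[where f'="\<lambda>_. f"])
        (use assms higher_differentiable_on_const in \<open>auto intro: bounded_linear_imp_has_derivative\<close>)
qed

lemma higher_differentiable_on_linear_compose:
  assumes "open X" "bounded_linear L" "higher_differentiable_on n X f"
  shows "higher_differentiable_on n X (\<lambda>x. L (f x))"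
  using assms(3)
proof (induction n arbitrary: f)
  case 0
  then show ?case using assms by (auto intro: bounded_linear.continuous_on)
next
  case (Suc n)
  show ?case
    by (rule higher_differentiable_on_SucI[where f'="\<lambda>x v. L (frechet_derivative f (at x) v)"])
      (use assms Suc.IH higher_differentiable_on_SucD[OF Suc.prems] in \<open>auto intro: bounded_linear.has_derivative\<close>)
qed

lemma higher_differentiable_on_add:
  assumes "open X" "higher_differentiable_on n X f" "higher_differentiable_on n X g"
  shows "higher_differentiable_on n X (\<lambda>x. f x + g x)"
  using assms(2,3)
proof (induction n arbitrary: f g)
  case 0
  then show ?case by (auto intro: continuous_intros)
next
  case (Suc n)
  show ?case
    by (rule higher_differentiable_on_SucI[where f'="\<lambda>x v. frechet_derivative f (at x) v + frechet_derivative g (at x) v"])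
      (use assms(1) Suc.IH higher_differentiable_on_SucD[OF Suc.prems(1)] higher_differentiable_on_SucD[OF Suc.prems(2)]
          in \<open>auto intro: has_derivative_add\<close>)
qed

lemma higher_differentiable_on_bilinear:
  assumes "open X" "bounded_bilinear b" "higher_differentiable_on n X f" "higher_differentiable_on n X g"
  shows "higher_differentiable_on n X (\<lambda>x. b (f x) (g x))"
  using assms(3,4)
proof (induction n arbitrary: f g)
  case 0
  then show ?case using bounded_bilinear.continuous_on[OF assms(2)] by auto
next
  case (Suc n)
  show ?case
  proof (rule higher_differentiable_on_SucI[where f'="\<lambda>x v. b (f x) (frechet_derivative g (at x) v)
      + b (frechet_derivative f (at x) v) (g x)"])
    show "((\<lambda>x. b (f x) (g x)) has_derivative
          (\<lambda>v. b (f x) (frechet_derivative g (at x) v) + b (frechet_derivative f (at x) v) (g x))) (at x)"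
      if "x \<in> X" for x
      using bounded_bilinear.FDERIV[OF assms(2) higher_differentiable_on_SucD(1)[OF Suc.prems(1) that]
          higher_differentiable_on_SucD(1)[OF Suc.prems(2) that]]
      by simp
  qed (use assms(1) Suc.IH higher_differentiable_on_SucD[OF Suc.prems(1)] higher_differentiable_on_SucD[OF Suc.prems(2)]
      Suc.prems[THEN higher_differentiable_on_Suc_imp]
      in \<open>auto intro!: higher_differentiable_on_add\<close>)
qed

lemma higher_differentiable_on_minus: "open X \<Longrightarrow> higher_differentiable_on n X f \<Longrightarrow> higher_differentiable_on n X (\<lambda>x. - f x)"
  by (rule higher_differentiable_on_linear_compose[OF _ bounded_linear_minus[OF bounded_linear_ident]])

lemma higher_differentiable_on_diff:
  "open X \<Longrightarrow> higher_differentiable_on n X f \<Longrightarrow> higher_differentiable_on n X g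
    \<Longrightarrow> higher_differentiable_on n X (\<lambda>x. f x - g x)"
  using higher_differentiable_on_add[of X n f "\<lambda>x. - g x"] higher_differentiable_on_minus[of X n g] by simp

lemma higher_differentiable_on_scaleR:
  "open X \<Longrightarrow> higher_differentiable_on n X f \<Longrightarrow> higher_differentiable_on n X g
    \<Longrightarrow> higher_differentiable_on n X (\<lambda>x. f x *\<^sub>R g x)"
  by (rule higher_differentiable_on_bilinear[OF _ bounded_bilinear_scaleR])

lemma higher_differentiable_on_mult:
  fixes f g :: "_ \<Rightarrow> 'a::real_normed_algebra"
  shows "open X \<Longrightarrow> higher_differentiable_on n X f \<Longrightarrow> higher_differentiable_on n X g
    \<Longrightarrow> higher_differentiable_on n X (\<lambda>x. f x * g x)"
  by (rule higher_differentiable_on_bilinear[OF _ bounded_bilinear_mult])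

lemma higher_differentiable_on_sum:
  assumes "open X" "\<And>i. i \<in> I \<Longrightarrow> higher_differentiable_on n X (f i)"
  shows "higher_differentiable_on n X (\<lambda>x. \<Sum>i\<in>I. f i x)"
  using assms(2) by (induction I rule: infinite_finite_induct) (auto simp: assms(1)
      higher_differentiable_on_const higher_differentiable_on_add)

lemma higher_differentiable_on_Pair:
  assumes "open X" "higher_differentiable_on n X f" "higher_differentiable_on n X g"
  shows "higher_differentiable_on n X (\<lambda>x. (f x, g x))"
proof -
  have "higher_differentiable_on n X (\<lambda>x. (f x, 0) + (0, g x))"
    by (intro higher_differentiable_on_add assms higher_differentiable_on_linear_compose[of X "\<lambda>z. (z, 0)"]
        higher_differentiable_on_linear_compose[of X "\<lambda>z. (0, z)"])
      (auto intro: bounded_linear_Pair bounded_linear_ident bounded_linear_zero)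
  then show ?thesis by simp
qed

text \<open>Expanding the outer derivative over \<open>Basis\<close> turns the chain rule into a
  finite sum of scalar functions times partial derivatives composed with f. Each factor is again a
  function that the induction on the order can treat.\<close>

lemma has_derivative_compose_basis:
  fixes f :: "'a::real_normed_vector \<Rightarrow> 'b::euclidean_space" and g :: "'b \<Rightarrow> 'c::real_normed_vector"
  assumes "(f has_derivative f') (at x)" "(g has_derivative g') (at (f x))"
  shows "((\<lambda>x. g (f x)) has_derivative (\<lambda>v. \<Sum>i\<in>Basis. (f' v \<bullet> i) *\<^sub>R g' i)) (at x)"
proof -
  interpret g': bounded_linear g' using assms(2) by (rule has_derivative_bounded_linear)
  have "g' y = (\<Sum>i\<in>Basis. (y \<bullet> i) *\<^sub>R g' i)" for y
  proof -
    have "g' y = g' (\<Sum>i\<in>Basis. (y \<bullet> i) *\<^sub>R i)" by (simp only: euclidean_representation)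
    then show ?thesis by (simp only: g'.sum g'.scaleR)
  qed
  then have "g' \<circ> f' = (\<lambda>v. \<Sum>i\<in>Basis. (f' v \<bullet> i) *\<^sub>R g' i)" unfolding o_def by blast
  with diff_chain_at[OF assms] show ?thesis unfolding o_def by (simp only:)
qed

text \<open>Only \<open>g\<close> varies in the induction: the chain rule produces its partial
  derivatives composed with the same \<open>f\<close>, and \<open>f\<close> is needed at the lower
  order too.\<close>

lemma higher_differentiable_on_compose:
  fixes f :: "'a::real_normed_vector \<Rightarrow> 'b::euclidean_space" and g :: "'b \<Rightarrow> 'c::real_normed_vector"
  assumes "open X" "open Y" "higher_differentiable_on n X f" "higher_differentiable_on n Y g"
    and "\<And>x. x \<in> X \<Longrightarrow> f x \<in> Y"
  shows "higher_differentiable_on n X (\<lambda>x. g (f x))"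
  using assms(3,4)
proof (induction n arbitrary: g)
  case 0
  then show ?case using assms(5) by (auto intro: continuous_on_compose2)
next
  case (Suc n)
  show ?case
  proof (rule higher_differentiable_on_SucI[OF assms(1)])
    show "((\<lambda>x. g (f x)) has_derivative
        (\<lambda>v. \<Sum>i\<in>Basis. (frechet_derivative f (at x) v \<bullet> i) *\<^sub>R frechet_derivative g (at (f x)) i)) (at x)"
      if "x \<in> X" for x
      using higher_differentiable_on_SucD(1)[OF Suc.prems(1)] higher_differentiable_on_SucD(1)[OF Suc.prems(2)] assms(5) that
      by (intro has_derivative_compose_basis) auto
    show "higher_differentiable_on n X
          (\<lambda>x. \<Sum>i\<in>Basis. (frechet_derivative f (at x) v \<bullet> i) *\<^sub>R frechet_derivative g (at (f x)) i)" for v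
      by (intro higher_differentiable_on_sum higher_differentiable_on_scaleR assms(1)
          higher_differentiable_on_linear_compose[where L="\<lambda>z. z \<bullet> i" for i] bounded_linear_inner_left
          Suc.IH higher_differentiable_on_SucD[OF Suc.prems(1)] higher_differentiable_on_SucD[OF Suc.prems(2)]
              higher_differentiable_on_Suc_imp[OF Suc.prems(1)])
  qed
qed

lemma higher_differentiable_on_inverse:
  fixes f :: "_ \<Rightarrow> real"
  assumes "open X" "higher_differentiable_on n X f" "\<And>x. x \<in> X \<Longrightarrow> f x \<noteq> 0"
  shows "higher_differentiable_on n X (\<lambda>x. inverse (f x))"
  using assms(2)
proof (induction n)
  case 0
  then show ?case using assms(3) by (auto intro!: continuous_intros)
next
  case (Suc n)
  show ?case
  proof (rule higher_differentiable_on_SucI[OF assms(1)])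
    show "((\<lambda>x. inverse (f x)) has_derivative
        (\<lambda>v. - (inverse (f x) * frechet_derivative f (at x) v * inverse (f x)))) (at x)" if "x \<in> X" for x
      using higher_differentiable_on_SucD(1)[OF Suc.prems that] assms(3)[OF that] by (auto intro: Deriv.has_derivative_inverse)
  qed (intro higher_differentiable_on_minus higher_differentiable_on_mult Suc.IH assms(1)
      higher_differentiable_on_SucD[OF Suc.prems] higher_differentiable_on_Suc_imp[OF Suc.prems])+
qed

lemma higher_differentiable_on_sqrt:
  fixes f :: "_ \<Rightarrow> real"
  assumes "open X" "higher_differentiable_on n X f" "\<And>x. x \<in> X \<Longrightarrow> f x > 0"
  shows "higher_differentiable_on n X (\<lambda>x. sqrt (f x))"
  using assms(2)
proof (induction n)
  case 0
  then show ?case by (auto intro!: continuous_intros)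
next
  case (Suc n)
  show ?case
  proof (rule higher_differentiable_on_SucI[OF assms(1)])
    show "((\<lambda>x. sqrt (f x)) has_derivative
        (\<lambda>v. frechet_derivative f (at x) v * (inverse (sqrt (f x)) * (1/2)))) (at x)" if "x \<in> X" for x
      using higher_differentiable_on_SucD(1)[OF Suc.prems that] assms(3)[OF that]
      by (auto intro!: derivative_eq_intros simp: divide_simps)
    show "higher_differentiable_on n X (\<lambda>x. frechet_derivative f (at x) v * (inverse (sqrt (f x)) * (1/2)))" for v
      using assms(3)
      by (intro higher_differentiable_on_mult higher_differentiable_on_const higher_differentiable_on_inverse Suc.IH assms(1) higher_differentiable_on_SucD[OF Suc.prems] higher_differentiable_on_Suc_imp[OF Suc.prems])
        (auto dest: assms(3))
  qed
qed

section \<open>Smooth maps and their closure properties\<close>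

lemma smooth_on_imp_higher_differentiable_on: "smooth_on X f \<Longrightarrow> higher_differentiable_on n X f"
  by (simp add: smooth_on_def)

lemma smooth_on_subset: "smooth_on X f \<Longrightarrow> Y \<subseteq> X \<Longrightarrow> smooth_on Y f"
  by (auto simp: smooth_on_def intro: higher_differentiable_on_subset)

lemma smooth_on_continuous: "smooth_on X f \<Longrightarrow> continuous_on X f"
  by (auto simp: smooth_on_def intro: higher_differentiable_on_continuous)

lemma smooth_on_has_derivative:
  "smooth_on X f \<Longrightarrow> x \<in> X \<Longrightarrow> (f has_derivative frechet_derivative f (at x)) (at x)"
  by (rule higher_differentiable_on_SucD(1)[OF smooth_on_imp_higher_differentiable_on])

lemma smooth_on_derivative: "smooth_on X f \<Longrightarrow> smooth_on X (\<lambda>x. frechet_derivative f (at x) v)"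
  unfolding smooth_on_def by (intro allI higher_differentiable_on_SucD(2)) auto

lemma smooth_on_compose:
  fixes f :: "'a::real_normed_vector \<Rightarrow> 'b::euclidean_space" and g :: "'b \<Rightarrow> 'c::real_normed_vector"
  assumes "smooth_on Y g" "smooth_on X f" "open X" "open Y" "\<And>x. x \<in> X \<Longrightarrow> f x \<in> Y"
  shows "smooth_on X (\<lambda>x. g (f x))"
  unfolding smooth_on_def
  by (intro allI, rule higher_differentiable_on_compose[OF assms(3,4) smooth_on_imp_higher_differentiable_on[OF assms(2)]
      smooth_on_imp_higher_differentiable_on[OF assms(1)] assms(5)])

lemma smooth_on_linear: "open X \<Longrightarrow> bounded_linear f \<Longrightarrow> smooth_on X f"
  by (simp add: smooth_on_def higher_differentiable_on_linear)

lemma smooth_on_linear_compose: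
  "open X \<Longrightarrow> bounded_linear L \<Longrightarrow> smooth_on X f \<Longrightarrow> smooth_on X (\<lambda>x. L (f x))"
  by (simp add: smooth_on_def higher_differentiable_on_linear_compose)

named_theorems smooth_intros

lemma smooth_on_const [smooth_intros]: "open X \<Longrightarrow> smooth_on X (\<lambda>x. c)"
  by (simp add: smooth_on_def higher_differentiable_on_const)

lemma smooth_on_ident [smooth_intros]: "open X \<Longrightarrow> smooth_on X (\<lambda>x. x)"
  by (simp add: smooth_on_linear bounded_linear_ident)

lemma smooth_on_arith [smooth_intros]:
  assumes "open X" "smooth_on X f" "smooth_on X g"
  shows "smooth_on X (\<lambda>x. f x + g x)" "smooth_on X (\<lambda>x. f x - g x)"
  using assms by (simp_all add: smooth_on_def higher_differentiable_on_add higher_differentiable_on_diff)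

lemma smooth_on_minus [smooth_intros]: "open X \<Longrightarrow> smooth_on X f \<Longrightarrow> smooth_on X (\<lambda>x. - f x)"
  by (simp add: smooth_on_def higher_differentiable_on_minus)

lemma smooth_on_scaleR [smooth_intros]:
  "open X \<Longrightarrow> smooth_on X f \<Longrightarrow> smooth_on X g \<Longrightarrow> smooth_on X (\<lambda>x. f x *\<^sub>R g x)"
  by (simp add: smooth_on_def higher_differentiable_on_scaleR)

lemma smooth_on_mult [smooth_intros]:
  fixes f g :: "_ \<Rightarrow> 'a::real_normed_algebra"
  shows "open X \<Longrightarrow> smooth_on X f \<Longrightarrow> smooth_on X g \<Longrightarrow> smooth_on X (\<lambda>x. f x * g x)"
  by (simp add: smooth_on_def higher_differentiable_on_mult)

lemma smooth_on_Pair [smooth_intros]: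
  "open X \<Longrightarrow> smooth_on X f \<Longrightarrow> smooth_on X g \<Longrightarrow> smooth_on X (\<lambda>x. (f x, g x))"
  by (simp add: smooth_on_def higher_differentiable_on_Pair)

lemma smooth_on_fst [smooth_intros]: "open X \<Longrightarrow> smooth_on X f \<Longrightarrow> smooth_on X (\<lambda>x. fst (f x))"
  and smooth_on_snd [smooth_intros]: "open X \<Longrightarrow> smooth_on X f \<Longrightarrow> smooth_on X (\<lambda>x. snd (f x))"
  by (auto intro: smooth_on_linear_compose bounded_linear_fst bounded_linear_snd)

lemma smooth_on_complex [smooth_intros]:
  assumes "open X" 
  shows "smooth_on X f \<Longrightarrow> smooth_on X (\<lambda>x. Re (f x))" "smooth_on X f \<Longrightarrow> smooth_on X (\<lambda>x. Im (f x))"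
    "smooth_on X f \<Longrightarrow> smooth_on X (\<lambda>x. cnj (f x))" "smooth_on X g \<Longrightarrow> smooth_on X (\<lambda>x. complex_of_real (g x))"
  using assms by (auto intro: smooth_on_linear_compose bounded_linear_Re bounded_linear_Im bounded_linear_cnj bounded_linear_of_real)

lemma smooth_on_inverse [smooth_intros]:
  fixes f :: "_ \<Rightarrow> real"
  shows "open X \<Longrightarrow> smooth_on X f \<Longrightarrow> (\<And>x. x \<in> X \<Longrightarrow> f x \<noteq> 0) \<Longrightarrow> smooth_on X (\<lambda>x. inverse (f x))"
  by (simp add: smooth_on_def higher_differentiable_on_inverse)

lemma smooth_on_divide [smooth_intros]:
  fixes f g :: "_ \<Rightarrow> real"
  shows "open X \<Longrightarrow> smooth_on X f \<Longrightarrow> smooth_on X g \<Longrightarrow> (\<And>x. x \<in> X \<Longrightarrow> g x \<noteq> 0) \<Longrightarrow> smooth_on X (\<lambda>x. f x / g x)"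
  unfolding divide_inverse by (intro smooth_intros)

lemma smooth_on_sqrt [smooth_intros]:
  fixes f :: "_ \<Rightarrow> real"
  shows "open X \<Longrightarrow> smooth_on X f \<Longrightarrow> (\<And>x. x \<in> X \<Longrightarrow> f x > 0) \<Longrightarrow> smooth_on X (\<lambda>x. sqrt (f x))"
  by (simp add: smooth_on_def higher_differentiable_on_sqrt)

lemma smooth_on_power [smooth_intros]:
  fixes f :: "_ \<Rightarrow> 'a::real_normed_algebra_1"
  shows "open X \<Longrightarrow> smooth_on X f \<Longrightarrow> smooth_on X (\<lambda>x. f x ^ n)"
  by (induction n) (auto intro: smooth_intros)

text \<open>Differentiation under the integral sign replaces \<open>G\<close> by a partial
  derivative in a direction of y and leaves an integral of the same form, so the induction runs over
  all \<open>G\<close>.\<close>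

lemma higher_differentiable_on_param_integral:
  fixes G :: "real \<times> 'a::euclidean_space \<Rightarrow> 'c::euclidean_space"
  assumes "open Y" "higher_differentiable_on n W G" "{0..1} \<times> Y \<subseteq> W"
  shows "higher_differentiable_on n Y (\<lambda>y. integral {0..1} (\<lambda>t. G (t, y)))"
  using assms(2)
proof (induction n arbitrary: G)
  case 0
  have "continuous_on (Y \<times> cbox 0 1) (\<lambda>(y, t). G (t, y))"
    unfolding split_beta using 0 assms(3)
    by (auto intro!: continuous_on_compose2[of W G] continuous_intros)
  from integral_continuous_on_param[OF this] show ?case by simp
next
  case (Suc n)
  note D = higher_differentiable_on_SucD[OF Suc.prems]
  have Gc: "continuous_on W G" and Dc: "continuous_on W (\<lambda>x. frechet_derivative G (at x) v)" for v
    using higher_differentiable_on_continuous Suc.prems D(2) by blast+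
  \<comment> \<open>The Leibniz rule takes the derivative as a bounded linear operator depending
    continuously on \<open>(x, t)\<close>; in finite dimension its continuity can be checked on
    basis vectors.\<close>
  define fx where "fx y t = Blinfun (\<lambda>v. frechet_derivative G (at (t, y)) (0, v))" for y t
  have bl: "bounded_linear (\<lambda>v. frechet_derivative G (at (t, y)) (0, v))" if "(t, y) \<in> W" for t y
    by (rule bounded_linear_compose[OF has_derivative_bounded_linear[OF D(1)[OF that]]])
      (rule bounded_linear_Pair[OF bounded_linear_zero bounded_linear_ident])
  have fx: "blinfun_apply (fx y t) = (\<lambda>v. frechet_derivative G (at (t, y)) (0, v))" if "(t, y) \<in> W" for t y
    unfolding fx_def using bl[OF that] by (rule bounded_linear_Blinfun_apply)
  show ?case
  proof (rule higher_differentiable_on_SucI[OF assms(1),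
      where f'="\<lambda>y v. integral {0..1} (\<lambda>t. frechet_derivative G (at (t, y)) (0, v))"])
    fix y assume "y \<in> Y"
    then obtain r where r: "r > 0" "ball y r \<subseteq> Y" using assms(1) openE by blast
    then have sub: "(t, x) \<in> W" if "x \<in> ball y r" "t \<in> cbox 0 1" for x t
      using assms(3) that r by (auto simp: subset_iff)
    have cont: "continuous_on (ball y r \<times> cbox 0 1) (\<lambda>(x, t). fx x t)"
    proof (rule continuous_on_blinfun_componentwise)
      fix i :: 'a assume "i \<in> Basis"
      have "continuous_on (ball y r \<times> cbox 0 1) (\<lambda>z. frechet_derivative G (at (snd z, fst z)) (0, i))"
        by (rule continuous_on_compose2[OF Dc[of "(0, i)"]]) (use sub in \<open>auto intro!: continuous_intros\<close>)
      then show "continuous_on (ball y r \<times> cbox 0 1) (\<lambda>x. blinfun_apply (case x of (x, t) \<Rightarrow> fx x t) i)"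
        by (rule continuous_on_eq) (auto simp: fx[OF sub])
    qed
    have "((\<lambda>x. integral (cbox 0 1) (\<lambda>t. G (t, x))) has_derivative integral (cbox 0 1) (fx y)) (at y within ball y r)"
    proof (rule leibniz_rule[OF _ _ cont])
      show "((\<lambda>x. G (t, x)) has_derivative blinfun_apply (fx x t)) (at x within ball y r)"
        if "x \<in> ball y r" "t \<in> cbox 0 1" for x t
      proof (rule has_derivative_at_withinI)
        have "((\<lambda>x. (t, x)) has_derivative (\<lambda>v. (0, v))) (at x)" by (auto intro!: derivative_eq_intros)
        from diff_chain_at[OF this D(1)[OF sub[OF that]]]
        show "((\<lambda>x. G (t, x)) has_derivative blinfun_apply (fx x t)) (at x)"
          unfolding fx[OF sub[OF that]] by (simp add: o_def)
      qed
      show "(\<lambda>t. G (t, x)) integrable_on cbox 0 1" if "x \<in> ball y r" for x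
        by (rule integrable_continuous, rule continuous_on_compose2[OF Gc]) (use sub that in \<open>auto intro!: continuous_intros\<close>)
    qed (use r in auto)
    moreover have int: "fx y integrable_on cbox 0 1"
    proof (rule integrable_continuous)
      have "continuous_on (cbox 0 1) (\<lambda>t. (\<lambda>(x, t). fx x t) (y, t))"
        by (rule continuous_on_compose2[OF cont]) (use r in \<open>auto intro!: continuous_intros\<close>)
      then show "continuous_on (cbox 0 1) (fx y)" by simp
    qed
    have "blinfun_apply (integral (cbox 0 1) (fx y)) v = integral {0..1} (\<lambda>t. frechet_derivative G (at (t, y)) (0, v))" for v
    proof -
      have "blinfun_apply (integral (cbox 0 1) (fx y)) v = integral (cbox 0 1) (\<lambda>t. blinfun_apply (fx y t) v)"
        using blinfun_apply_integral[OF int] by simp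
      also have "\<dots> = integral (cbox 0 1) (\<lambda>t. frechet_derivative G (at (t, y)) (0, v))"
        by (rule integral_cong) (use fx sub r in simp)
      finally show ?thesis by (simp only: cbox_interval)
    qed
    then have "blinfun_apply (integral (cbox 0 1) (fx y)) = (\<lambda>v. integral {0..1} (\<lambda>t. frechet_derivative G (at (t, y)) (0, v)))"
      by blast
    ultimately show "((\<lambda>y. integral {0..1} (\<lambda>t. G (t, y))) has_derivative
         (\<lambda>v. integral {0..1} (\<lambda>t. frechet_derivative G (at (t, y)) (0, v)))) (at y)"
      using r by (simp add: at_within_open[of y "ball y r"] cbox_interval)
  qed (rule Suc.IH[OF D(2)])
qed

lemma smooth_on_param_integral:
  fixes G :: "real \<times> 'a::euclidean_space \<Rightarrow> 'c::euclidean_space"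
  shows "open Y \<Longrightarrow> smooth_on W G \<Longrightarrow> {0..1} \<times> Y \<subseteq> W \<Longrightarrow> smooth_on Y (\<lambda>y. integral {0..1} (\<lambda>t. G (t, y)))"
  unfolding smooth_on_def by (intro allI, rule higher_differentiable_on_param_integral) auto

text \<open>Hadamard's lemma: the quotient is the average over t in [0, 1] of the derivative at
  \<open>(t * s, x)\<close> in the direction \<open>(1, 0)\<close>, an expression that is smooth
  across s = 0. By \<open>star\<close> the segment of integration stays in \<open>D\<close>.\<close>

lemma smooth_on_division:
  fixes g :: "real \<times> 'a::euclidean_space \<Rightarrow> 'c::euclidean_space"
  assumes "smooth_on D g" "open D" and star: "\<And>s x t. (s, x) \<in> D \<Longrightarrow> 0 \<le> t \<Longrightarrow> t \<le> 1 \<Longrightarrow> (t * s, x) \<in> D"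
    and zero: "\<And>x. (0, x) \<in> D \<Longrightarrow> g (0, x) = 0"
  obtains k where "smooth_on D k" "\<And>s x. (s, x) \<in> D \<Longrightarrow> g (s, x) = s *\<^sub>R k (s, x)"
proof
  let ?G = "\<lambda>(t, s, x). frechet_derivative g (at (t * s, x)) (1, 0)"
  let ?k = "\<lambda>y. integral {0..1} (\<lambda>t. ?G (t, y))"
  define W where "W = (\<lambda>z::real \<times> real \<times> 'a. (fst z * fst (snd z), snd (snd z))) -` D"
  have oW: "open W" unfolding W_def
    by (rule open_vimage[OF assms(2)]) (auto intro!: continuous_intros)
  have "smooth_on W (\<lambda>z. frechet_derivative g (at (fst z * fst (snd z), snd (snd z))) (1, 0))"
    by (rule smooth_on_compose[OF smooth_on_derivative[OF assms(1)] _ oW assms(2)])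
      ((intro smooth_intros oW)?, simp add: W_def)+
  then have "smooth_on W ?G" unfolding split_beta .
  then show "smooth_on D ?k"
    by (rule smooth_on_param_integral[OF assms(2)]) (use star in \<open>auto simp: W_def\<close>)
  fix s x assume sx: "(s, x) \<in> D"
  have "((\<lambda>t. s *\<^sub>R frechet_derivative g (at (t * s, x)) (1, 0)) has_integral g (1 * s, x) - g (0 * s, x)) {0..1}"
  proof (rule fundamental_theorem_of_calculus)
    fix t :: real assume t: "t \<in> {0..1}"
    let ?D = "frechet_derivative g (at (t * s, x))"
    have d: "(g has_derivative ?D) (at (t * s, x))"
      using smooth_on_has_derivative[OF assms(1)] star sx t by auto
    interpret D: bounded_linear ?D using d by (rule has_derivative_bounded_linear)
    have "((\<lambda>t. (t * s, x)) has_derivative (\<lambda>h. (h * s, 0))) (at t)" by (auto intro!: derivative_eq_intros)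
    from diff_chain_at[OF this d] have "((\<lambda>t. g (t * s, x)) has_derivative (\<lambda>h. ?D (h * s, 0))) (at t)"
      by (simp add: o_def)
    moreover have "?D (h * s, 0) = h *\<^sub>R s *\<^sub>R ?D (1, 0)" for h
      using D.scaleR[of "h * s" "(1, 0)"] by simp
    ultimately show "((\<lambda>t. g (t * s, x)) has_vector_derivative s *\<^sub>R ?D (1, 0)) (at t within {0..1})"
      by (simp add: has_vector_derivative_def has_derivative_at_withinI)
  qed simp
  then have "integral {0..1} (\<lambda>t. s *\<^sub>R frechet_derivative g (at (t * s, x)) (1, 0)) = g (1 * s, x) - g (0 * s, x)"
    by (rule integral_unique)
  moreover have "g (0, x) = 0" using zero star[OF sx, of 0] by simp
  ultimately show "g (s, x) = s *\<^sub>R ?k (s, x)" by simp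
qed

text \<open>A finite limit of g / s^m forces g to vanish at s = 0, so one factor s can be removed at
  a time. The hypothesis is a limit rather than the vanishing of derivatives because an order
  estimate of a remainder yields limits directly; the limit also identifies the quotient at s =
  0.\<close>

lemma smooth_on_division_power:
  fixes g :: "real \<times> 'a::euclidean_space \<Rightarrow> 'c::euclidean_space"
  assumes "smooth_on (ball 0 r \<times> Y) g" "open Y" "r > 0"
    and "\<And>x. x \<in> Y \<Longrightarrow> ((\<lambda>s. inverse (s ^ m) *\<^sub>R g (s, x)) \<longlongrightarrow> L x) (at 0)"
  obtains k where "smooth_on (ball 0 r \<times> Y) k"
    "\<And>s x. s \<in> ball 0 r \<Longrightarrow> x \<in> Y \<Longrightarrow> g (s, x) = s ^ m *\<^sub>R k (s, x)" "\<And>x. x \<in> Y \<Longrightarrow> k (0, x) = L x"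
  using assms(1,4)
proof (induction m arbitrary: g thesis)
  case 0
  show ?case
  proof (rule "0.prems"(1)[OF "0.prems"(2)])
    fix x assume x: "x \<in> Y"
    have "continuous_on (ball 0 r) (\<lambda>s. g (s, x))"
      by (rule continuous_on_compose2[OF smooth_on_continuous[OF "0.prems"(2)]]) (use x in \<open>auto intro!: continuous_intros\<close>)
    then have "((\<lambda>s. g (s, x)) \<longlongrightarrow> g (0, x)) (at 0)"
      using assms(3) by (auto simp: continuous_on_eq_continuous_at continuous_at)
    moreover have "((\<lambda>s. g (s, x)) \<longlongrightarrow> L x) (at 0)" using "0.prems"(3)[OF x] by simp
    ultimately show "g (0, x) = L x" using tendsto_unique trivial_limit_at by blast
  qed simp
next
  case (Suc m)
  have zero: "g (0, x) = 0" if x: "x \<in> Y" for x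
  proof -
    have "continuous_on (ball 0 r) (\<lambda>s. g (s, x))"
      by (rule continuous_on_compose2[OF smooth_on_continuous[OF Suc.prems(2)]]) (use x in \<open>auto intro!: continuous_intros\<close>)
    then have "((\<lambda>s. g (s, x)) \<longlongrightarrow> g (0, x)) (at 0)"
      using assms(3) by (auto simp: continuous_on_eq_continuous_at continuous_at)
    moreover have "((\<lambda>s. s ^ Suc m *\<^sub>R (inverse (s ^ Suc m) *\<^sub>R g (s, x))) \<longlongrightarrow> 0 ^ Suc m *\<^sub>R L x) (at 0)"
      by (intro tendsto_intros Suc.prems(3) x)
    moreover have "\<forall>\<^sub>F s in at 0. s ^ Suc m *\<^sub>R (inverse (s ^ Suc m) *\<^sub>R g (s, x)) = g (s, x)"
      unfolding eventually_at_filter by (intro always_eventually allI impI) (simp add: divide_simps)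
    ultimately have "((\<lambda>s. g (s, x)) \<longlongrightarrow> g (0, x)) (at 0)" "((\<lambda>s. g (s, x)) \<longlongrightarrow> 0) (at 0)"
      by (simp_all add: tendsto_cong)
    then show ?thesis using tendsto_unique trivial_limit_at by blast
  qed
  obtain k where k: "smooth_on (ball 0 r \<times> Y) k" "\<And>s x. (s, x) \<in> ball 0 r \<times> Y \<Longrightarrow> g (s, x) = s *\<^sub>R k (s, x)"
  proof (rule smooth_on_division[OF Suc.prems(2)])
    fix s :: real and x t assume "(s, x) \<in> ball 0 r \<times> Y" "0 \<le> t" "t \<le> (1::real)"
    then show "(t * s, x) \<in> ball 0 r \<times> Y"
      using mult_left_le_one_le[of "\<bar>s\<bar>" t] by (auto simp: abs_mult)
  qed (use zero assms(2) in \<open>auto intro: open_Times\<close>)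
  have "((\<lambda>s. inverse (s ^ m) *\<^sub>R k (s, x)) \<longlongrightarrow> L x) (at 0)" if x: "x \<in> Y" for x
  proof (rule tendsto_cong[THEN iffD1, OF _ Suc.prems(3)[OF x]])
    have "\<forall>\<^sub>F s::real in nhds 0. s \<in> ball 0 r"
      by (rule eventually_nhds_in_open) (use assms(3) in auto)
    then show "\<forall>\<^sub>F s in at 0. inverse (s ^ Suc m) *\<^sub>R g (s, x) = inverse (s ^ m) *\<^sub>R k (s, x)"
      unfolding eventually_at_filter by eventually_elim (use x k(2) in auto)
  qed
  from Suc.IH[OF _ k(1) this] obtain k' where "smooth_on (ball 0 r \<times> Y) k'"
    "\<And>s x. s \<in> ball 0 r \<Longrightarrow> x \<in> Y \<Longrightarrow> k (s, x) = s ^ m *\<^sub>R k' (s, x)" "\<And>x. x \<in> Y \<Longrightarrow> k' (0, x) = L x"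
    by metis
  then show ?case using k(2) by (intro Suc.prems(1)) auto
qed

subsection \<open>Superposition operators on bounded continuous functions\<close>

instance bcontfun :: (metric_space, banach) banach ..

lemma apply_Bcontfun:
  fixes f :: "'s::metric_space \<Rightarrow> 'b::real_normed_vector"
  assumes "continuous_on UNIV f" "\<And>s. norm (f s) \<le> b"
  shows "apply_bcontfun (Bcontfun f) = f"
  using assms by (intro Bcontfun_inverse bcontfun_normI)

definition bmap :: "('b::real_normed_vector \<Rightarrow> 'c::real_normed_vector) \<Rightarrow> ('s::metric_space \<Rightarrow>\<^sub>C 'b) \<Rightarrow> 's \<Rightarrow>\<^sub>C 'c" where
  "bmap L x = Bcontfun (\<lambda>s. L (apply_bcontfun x s))"

definition bmult :: "('s::metric_space \<Rightarrow>\<^sub>C real) \<Rightarrow> ('s \<Rightarrow>\<^sub>C 'c::real_normed_vector) \<Rightarrow> 's \<Rightarrow>\<^sub>C 'c" where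
  "bmult a y = Bcontfun (\<lambda>s. apply_bcontfun a s *\<^sub>R apply_bcontfun y s)"

lemma apply_bmap:
  assumes "bounded_linear L"
  shows "apply_bcontfun (bmap L x) = (\<lambda>s. L (apply_bcontfun x s))"
proof -
  obtain K where K: "\<And>x. norm (L x) \<le> norm x * K" "K \<ge> 0"
    using bounded_linear.nonneg_bounded[OF assms] by blast
  show ?thesis unfolding bmap_def
  proof (rule apply_Bcontfun)
    show "norm (L (apply_bcontfun x s)) \<le> norm x * K" for s
      using K(1)[of "apply_bcontfun x s"] mult_right_mono[OF norm_bounded[of x s] K(2)] by simp
  qed (intro bounded_linear.continuous_on[OF assms] continuous_on_apply_bcontfun)
qed

lemma bounded_linear_bmap:
  assumes "bounded_linear L"
  shows "bounded_linear (bmap L :: ('s::metric_space \<Rightarrow>\<^sub>C _) \<Rightarrow> _)"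
proof -
  interpret L: bounded_linear L by fact
  obtain K where K: "\<And>x. norm (L x) \<le> norm x * K" "K \<ge> 0"
    using L.nonneg_bounded by blast
  show ?thesis
  proof (rule bounded_linear_intro[where K=K])
    show "norm (bmap L x) \<le> norm x * K" for x :: "'s \<Rightarrow>\<^sub>C _"
    proof (rule norm_bound)
      show "norm (apply_bcontfun (bmap L x) s) \<le> norm x * K" for s
        using K(1)[of "apply_bcontfun x s"] mult_right_mono[OF norm_bounded[of x s] K(2)]
        by (simp add: apply_bmap[OF assms])
    qed
  qed (auto intro!: bcontfun_eqI simp: apply_bmap[OF assms] L.add L.scaleR)
qed

lemma apply_bmult: "apply_bcontfun (bmult a y) = (\<lambda>s. apply_bcontfun a s *\<^sub>R apply_bcontfun y s)"
  unfolding bmult_def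
proof (rule apply_Bcontfun)
  show "norm (apply_bcontfun a s *\<^sub>R apply_bcontfun y s) \<le> norm a * norm y" for s
    using norm_bounded[of a s] norm_bounded[of y s] by (auto intro!: mult_mono)
qed (intro continuous_intros continuous_on_apply_bcontfun)

lemma norm_bmult: "norm (bmult a y) \<le> norm a * norm y"
proof (rule norm_bound)
  show "norm (apply_bcontfun (bmult a y) s) \<le> norm a * norm y" for s
    using norm_bounded[of a s] norm_bounded[of y s] by (auto intro!: mult_mono simp: apply_bmult)
qed

lemma bounded_bilinear_bmult: "bounded_bilinear bmult"
proof
  show "\<exists>K. \<forall>a b. norm (bmult a b) \<le> norm a * norm b * K"
    by (rule exI[of _ 1]) (auto simp: norm_bmult)
qed (auto intro!: bcontfun_eqI simp: apply_bmult algebra_simps)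

lemma bounded_linear_const_bcontfun: "bounded_linear (const_bcontfun :: 'b::real_normed_vector \<Rightarrow> 's::metric_space \<Rightarrow>\<^sub>C 'b)"
  by (rule bounded_linear_intro[where K=1])
    (auto intro!: bcontfun_eqI norm_bound simp: const_bcontfun.rep_eq)

text \<open>The superposition operator. \<open>Bcontfun\<close> represents the composition only
  where it is bounded and continuous; below this is secured by confining the range of x to a compact
  set in the domain of g.\<close>

definition nemytskii :: "('b::real_normed_vector \<Rightarrow> 'c::real_normed_vector) \<Rightarrow> ('s::metric_space \<Rightarrow>\<^sub>C 'b) \<Rightarrow> 's \<Rightarrow>\<^sub>C 'c" where
  "nemytskii g x = Bcontfun (\<lambda>s. g (apply_bcontfun x s))"

lemma apply_nemytskii:
  assumes "continuous_on K g" "compact K" "\<And>s. apply_bcontfun x s \<in> K"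
  shows "apply_bcontfun (nemytskii g x) = (\<lambda>s. g (apply_bcontfun x s))"
proof -
  have "bounded (g ` K)" using compact_continuous_image[OF assms(1,2)] compact_imp_bounded by blast
  then obtain b where "\<And>y. y \<in> K \<Longrightarrow> norm (g y) \<le> b" by (auto simp: bounded_iff)
  then show ?thesis unfolding nemytskii_def
    by (intro apply_Bcontfun[of _ b] continuous_on_compose2[OF assms(1)] continuous_on_apply_bcontfun) (use assms(3) in auto)
qed

text \<open>Only the first point of the pair lies in \<open>K\<close>, since perturbed functions
  leave it. Uniform continuity is therefore taken on a slightly larger compact neighbourhood that
  still lies in \<open>Y\<close>.\<close>

lemma uniformly_continuous_nbhd:
  fixes K :: "'b::euclidean_space set" and g :: "'b \<Rightarrow> 'c::real_normed_vector"
  assumes "compact K" "K \<subseteq> Y" "open Y" "continuous_on Y g" "e > 0"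
  obtains d where "d > 0" "\<And>x y. x \<in> K \<Longrightarrow> dist x y < d \<Longrightarrow> y \<in> Y \<and> dist (g x) (g y) < e"
proof (cases "K = {}")
  case False
  obtain e1 where e1: "e1 > 0" "{x. infdist x K \<le> e1} \<subseteq> Y"
    using compact_in_open_separated[OF False assms(1,3,2)] by blast
  let ?K = "{x. infdist x K \<le> e1}"
  have "compact ?K" using compact_infdist_le[OF False assms(1) e1(1)] .
  then have "uniformly_continuous_on ?K g"
    using compact_uniformly_continuous continuous_on_subset[OF assms(4) e1(2)] by blast
  then obtain d where d: "d > 0" "\<And>x y. x \<in> ?K \<Longrightarrow> y \<in> ?K \<Longrightarrow> dist y x < d \<Longrightarrow> dist (g y) (g x) < e"
    using \<open>e > 0\<close> unfolding uniformly_continuous_on_def by meson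
  show ?thesis
  proof (rule that[of "min d e1"])
    fix x y assume x: "x \<in> K" and xy: "dist x y < min d e1"
    have "infdist y K \<le> dist y x" using x by (rule infdist_le)
    then have "y \<in> ?K" using xy by (simp add: dist_commute)
    moreover have "x \<in> ?K" using x e1 by simp
    ultimately show "y \<in> Y \<and> dist (g x) (g y) < e"
      using d(2)[of y x] xy e1(2) by (auto simp: dist_commute)
  qed (use d e1 in auto)
qed (use that[of 1] in auto)

text \<open>In the supremum norm the pointwise mean value estimate holds uniformly in s, because the
  range of \<open>x0\<close> lies in a compact set. The derivative is written through superposition
  operators of the partial derivatives, that is, through operators of the same kind, so it can be
  differentiated again.\<close>

lemma nemytskii_has_derivative:
  fixes g :: "'b::euclidean_space \<Rightarrow> 'c::real_normed_vector" and x0 :: "'s::metric_space \<Rightarrow>\<^sub>C 'b"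
  assumes g: "smooth_on Y g" and Y: "open Y" and K: "compact K" "K \<subseteq> Y" "\<And>s. apply_bcontfun x0 s \<in> K"
  shows "(nemytskii g has_derivative
           (\<lambda>h. \<Sum>i\<in>Basis. bmult (bmap (\<lambda>z. z \<bullet> i) h) (nemytskii (\<lambda>y. frechet_derivative g (at y) i) x0))) (at x0)"
    (is "(_ has_derivative ?D) _")
proof -
  define g' where "g' i y = frechet_derivative g (at y) i" for i y
  have g'_cont: "continuous_on Y (g' i)" for i
    unfolding g'_def using smooth_on_continuous smooth_on_derivative g by blast
  have g_der: "(g has_derivative (\<lambda>v. \<Sum>i\<in>Basis. (v \<bullet> i) *\<^sub>R g' i y)) (at y)" if "y \<in> Y" for y
    using has_derivative_compose_basis[OF has_derivative_ident[of "at y"] smooth_on_has_derivative[OF g that]]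
    by (simp add: g'_def)
  have nemytskii_g': "apply_bcontfun (nemytskii (g' i) x0) = (\<lambda>s. g' i (apply_bcontfun x0 s))" for i
    by (rule apply_nemytskii[OF continuous_on_subset[OF g'_cont K(2)] K(1,3)])
  have bl: "bounded_linear ?D"
    by (intro bounded_linear_sum bounded_linear_compose[OF bounded_bilinear.bounded_linear_left[OF bounded_bilinear_bmult]]
        bounded_linear_bmap bounded_linear_inner_left)
  have Dapp: "apply_bcontfun (?D h) s = (\<Sum>i\<in>Basis. (apply_bcontfun h s \<bullet> i) *\<^sub>R g' i (apply_bcontfun x0 s))" for h s
  proof -
    have sum: "apply_bcontfun (\<Sum>i\<in>A. q i) s = (\<Sum>i\<in>A. apply_bcontfun (q i) s)"
      for A :: "'b set" and q :: "'b \<Rightarrow> 's \<Rightarrow>\<^sub>C 'c"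
      by (induction A rule: infinite_finite_induct) auto
    show ?thesis unfolding g'_def[symmetric, abs_def]
      by (simp add: sum apply_bmult apply_bmap bounded_linear_inner_left nemytskii_g')
  qed
  show ?thesis unfolding has_derivative_at_alt
  proof (intro conjI allI impI bl)
    fix e :: real assume "e > 0"
    define N where "N = real DIM('b)"
    have N: "N > 0" by (simp add: N_def)
    obtain d0 where d0: "d0 > 0" "\<And>x y. x \<in> K \<Longrightarrow> dist x y < d0 \<Longrightarrow> y \<in> Y \<and> dist (g x) (g y) < 1"
      using uniformly_continuous_nbhd[OF K(1,2) Y smooth_on_continuous[OF g], of 1] by auto
    have "\<exists>d>0. \<forall>x y. x \<in> K \<longrightarrow> dist x y < d \<longrightarrow> y \<in> Y \<and> dist (g' i x) (g' i y) < e / N" for i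
      using uniformly_continuous_nbhd[OF K(1,2) Y g'_cont[of i], of "e / N"] \<open>e > 0\<close> N
      by (metis divide_pos_pos)
    then obtain d where d: "\<And>i. d i > 0" "\<And>i x y. x \<in> K \<Longrightarrow> dist x y < d i \<Longrightarrow> y \<in> Y \<and> dist (g' i x) (g' i y) < e / N"
      by metis
    \<comment> \<open>\<open>d0\<close> keeps the composition with y bounded, so that
      \<open>Bcontfun\<close> represents it. The radii \<open>d i\<close> let each of the
      \<open>N\<close> partial derivatives vary by less than e / N, hence their combination by at
      most e.\<close>
    define r where "r = min d0 (Min (d ` Basis))"
    have r: "r > 0" "r \<le> d0" "\<And>i. i \<in> Basis \<Longrightarrow> r \<le> d i" unfolding r_def using d d0 by (auto intro: min.coboundedI2)
    show "\<exists>r>0. \<forall>y. norm (y - x0) < r \<longrightarrow> norm (nemytskii g y - nemytskii g x0 - ?D (y - x0)) \<le> e * norm (y - x0)"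
    proof (intro exI conjI allI impI)
      fix y :: "'s \<Rightarrow>\<^sub>C 'b" assume yx: "norm (y - x0) < r"
      have dst: "dist (apply_bcontfun x0 s) (apply_bcontfun y s) < r" for s
        using norm_bounded[of "y - x0" s] yx by (simp add: dist_norm norm_minus_commute)
      have "bounded (g ` K)" using compact_continuous_image[OF continuous_on_subset[OF smooth_on_continuous[OF g] K(2)] K(1)]
          compact_imp_bounded by blast
      then obtain b where b: "\<And>y. y \<in> K \<Longrightarrow> norm (g y) \<le> b" by (auto simp: bounded_iff)
      have nemy: "apply_bcontfun (nemytskii g y) = (\<lambda>s. g (apply_bcontfun y s))" unfolding nemytskii_def
      proof (rule apply_Bcontfun)
        show "continuous_on UNIV (\<lambda>s. g (apply_bcontfun y s))"
          by (rule continuous_on_compose2[OF smooth_on_continuous[OF g] continuous_on_apply_bcontfun])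
            (use dst d0(2) K(3) r(2) order.strict_trans2 in blast)
        show "norm (g (apply_bcontfun y s)) \<le> b + 1" for s
        proof -
          have "dist (g (apply_bcontfun x0 s)) (g (apply_bcontfun y s)) < 1"
            using d0(2)[OF K(3)] dst[of s] r(2) by auto
          then show ?thesis using b[OF K(3), of s] norm_triangle_ineq2[of "g (apply_bcontfun y s)" "g (apply_bcontfun x0 s)"]
            by (simp add: dist_norm norm_minus_commute)
        qed
      qed
      have nemx: "apply_bcontfun (nemytskii g x0) = (\<lambda>s. g (apply_bcontfun x0 s))"
        by (rule apply_nemytskii[OF continuous_on_subset[OF smooth_on_continuous[OF g] K(2)] K(1,3)])
      show "norm (nemytskii g y - nemytskii g x0 - ?D (y - x0)) \<le> e * norm (y - x0)"
      proof (rule norm_bound)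
        fix s
        let ?a = "apply_bcontfun x0 s" and ?b = "apply_bcontfun y s"
        let ?f = "\<lambda>y v. \<Sum>i\<in>Basis. (v \<bullet> i) *\<^sub>R g' i y"
        have "norm (g ?b - g ?a - ?f ?a (?b - ?a)) \<le> norm (?b - ?a) * e"
        proof (rule differentiable_bound_linearization[where S="ball ?a r"])
          show "?a + t *\<^sub>R (?b - ?a) \<in> ball ?a r" if t: "t \<in> {0..1}" for t
          proof -
            have "dist ?a (?a + t *\<^sub>R (?b - ?a)) = \<bar>t\<bar> * dist ?a ?b" by (simp add: dist_norm norm_minus_commute)
            also have "\<dots> \<le> dist ?a ?b" using t by (simp add: mult_left_le_one_le)
            finally show ?thesis using dst[of s] by simp
          qed
          fix z assume "z \<in> ball ?a r"
          then have z: "dist ?a z < r" by simp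
          then have "z \<in> Y" using d0(2)[OF K(3)] r(2) by (meson order.strict_trans2)
          then show "(g has_derivative ?f z) (at z within ball ?a r)" using g_der has_derivative_at_withinI by blast
          show "onorm (?f z - ?f ?a) \<le> e"
          proof (rule onorm_le)
            fix v
            have "(?f z - ?f ?a) v = (\<Sum>i\<in>Basis. (v \<bullet> i) *\<^sub>R (g' i z - g' i ?a))"
              by (simp add: sum_subtractf algebra_simps)
            also have "norm \<dots> \<le> (\<Sum>i\<in>(Basis::'b set). norm v * (e / N))"
            proof (rule sum_norm_le)
              fix i :: 'b assume i: "i \<in> Basis"
              have "dist (g' i ?a) (g' i z) < e / N" using d(2)[OF K(3)] z r(3)[OF i] by (meson order.strict_trans2)
              then show "norm ((v \<bullet> i) *\<^sub>R (g' i z - g' i ?a)) \<le> norm v * (e / N)"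
                using Basis_le_norm[OF i, of v] mult_mono[of "\<bar>v \<bullet> i\<bar>" "norm v" "norm (g' i z - g' i ?a)" "e / N"]
                by (simp add: dist_norm norm_minus_commute)
            qed
            also have "\<dots> = e * norm v" using N by (simp add: N_def)
            finally show "norm ((?f z - ?f ?a) v) \<le> e * norm v" .
          qed
        qed (use r in auto)
        also have "\<dots> \<le> e * norm (y - x0)"
          using norm_bounded[of "y - x0" s] \<open>e > 0\<close> by simp
        finally show "norm (apply_bcontfun (nemytskii g y - nemytskii g x0 - ?D (y - x0)) s) \<le> e * norm (y - x0)"
          unfolding minus_bcontfun.rep_eq Dapp nemy nemx by simp
      qed
    qed (use r in auto)
  qed
qed

lemma higher_differentiable_on_nemytskii:
  fixes g :: "'b::euclidean_space \<Rightarrow> 'c::real_normed_vector"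
    and x :: "'p::real_normed_vector \<Rightarrow> 's::metric_space \<Rightarrow>\<^sub>C 'b"
  assumes "smooth_on Y g" "open Y" "open U" "higher_differentiable_on n U x"
    and "\<And>p. p \<in> U \<Longrightarrow> \<exists>K. compact K \<and> K \<subseteq> Y \<and> (\<forall>s. apply_bcontfun (x p) s \<in> K)"
  shows "higher_differentiable_on n U (\<lambda>p. nemytskii g (x p))"
  using assms(1,4)
proof (induction n arbitrary: g)
  case 0
  have "isCont (nemytskii g) (x p)" if "p \<in> U" for p
    using assms(5)[OF that] nemytskii_has_derivative[OF 0(1) assms(2)] has_derivative_continuous by blast
  then have "isCont (\<lambda>p. nemytskii g (x p)) p" if "p \<in> U" for p
    using 0(2) that assms(3) by (auto simp: continuous_on_eq_continuous_at intro: isCont_o2)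
  then show ?case by (auto intro: continuous_at_imp_continuous_on)
next
  case (Suc n)
  note Dx = higher_differentiable_on_SucD[OF Suc.prems(2)]
  let ?D = "\<lambda>p v. \<Sum>i\<in>Basis. bmult (bmap (\<lambda>z. z \<bullet> i) (frechet_derivative x (at p) v))
                (nemytskii (\<lambda>y. frechet_derivative g (at y) i) (x p))"
  show ?case
  proof (rule higher_differentiable_on_SucI[OF assms(3), where f' = ?D])
    fix p assume p: "p \<in> U"
    then obtain K where "compact K" "K \<subseteq> Y" "\<And>s. apply_bcontfun (x p) s \<in> K" using assms(5) by blast
    from diff_chain_at[OF Dx(1)[OF p] nemytskii_has_derivative[OF Suc.prems(1) assms(2) this]]
    show "((\<lambda>p. nemytskii g (x p)) has_derivative ?D p) (at p)" by (simp add: o_def)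
  next
    fix v
    show "higher_differentiable_on n U (\<lambda>p. ?D p v)"
      by (intro higher_differentiable_on_sum higher_differentiable_on_bilinear[OF _ bounded_bilinear_bmult] assms(3) Suc.IH
          higher_differentiable_on_linear_compose[OF assms(3) bounded_linear_bmap[OF bounded_linear_inner_left]] Dx(2)
          smooth_on_derivative Suc.prems(1) higher_differentiable_on_Suc_imp[OF Suc.prems(2)])
  qed
qed

subsection \<open>Smooth dependence of fixed points on parameters\<close>

text \<open>R is found as the fixed point of R to id + A R, a contraction with constant 1/2 on the
  Banach space of operators; it is a right inverse of id - A.\<close>

lemma neumann_inverse:
  fixes A :: "'x::banach \<Rightarrow>\<^sub>L 'x"
  assumes "norm A \<le> 1/2"
  obtains R :: "'x \<Rightarrow>\<^sub>L 'x" where "\<And>y. blinfun_apply R y = y + blinfun_apply A (blinfun_apply R y)"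
proof -
  have "\<exists>!R. id_blinfun + (A o\<^sub>L R) = R"
  proof (rule banach_fix_type[of "1/2"], safe)
    fix R S :: "'x \<Rightarrow>\<^sub>L 'x"
    have "dist (id_blinfun + (A o\<^sub>L R)) (id_blinfun + (A o\<^sub>L S)) = norm (A o\<^sub>L (R - S))"
      by (simp add: dist_norm bounded_bilinear.diff_right[OF bounded_bilinear_blinfun_compose])
    also have "\<dots> \<le> norm A * norm (R - S)" by (rule norm_blinfun_compose)
    also have "\<dots> \<le> 1/2 * dist R S" using mult_right_mono[OF assms norm_ge_zero[of "R - S"]] by (simp add: dist_norm)
    finally show "dist (id_blinfun + (A o\<^sub>L R)) (id_blinfun + (A o\<^sub>L S)) \<le> 1/2 * dist R S" .
  qed auto
  then obtain R where R: "id_blinfun + (A o\<^sub>L R) = R" by blast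
  have "blinfun_apply R y = y + blinfun_apply A (blinfun_apply R y)" for y
    using arg_cong[OF R, of "\<lambda>R. blinfun_apply R y"] by (simp add: blinfun.add_left)
  then show ?thesis by (rule that)
qed

text \<open>Implicit differentiation: the error \<open>q\<close> of the linear prediction satisfies
  q - A q = remainder, and norm A \<le> 1/2 allows norm q to be absorbed. Continuity of x at
  \<open>p0\<close> is thereby upgraded to differentiability.\<close>

lemma fixed_point_has_derivative:
  fixes \<Psi> :: "'x::banach \<times> 'p::real_normed_vector \<Rightarrow> 'x" and A R :: "'x \<Rightarrow>\<^sub>L 'x"
  assumes "open U" "p0 \<in> U" and fp: "\<And>p. p \<in> U \<Longrightarrow> x p = \<Psi> (x p, p)" and cont: "isCont x p0"
    and der: "(\<Psi> has_derivative (\<lambda>(h, v). blinfun_apply A h + b v)) (at (x p0, p0))"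
    and A: "norm A \<le> 1/2" and R: "\<And>y. blinfun_apply R y = y + blinfun_apply A (blinfun_apply R y)"
  shows "(x has_derivative (\<lambda>v. blinfun_apply R (b v))) (at p0)"
proof -
  have "bounded_linear (\<lambda>v. (0::'x, v::'p))" by (rule bounded_linear_Pair[OF bounded_linear_zero bounded_linear_ident])
  from bounded_linear_compose[OF has_derivative_bounded_linear[OF der] this] have bb: "bounded_linear b"
    by (simp add: blinfun.zero_right)
  then have Rb: "bounded_linear (\<lambda>v. blinfun_apply R (b v))" by (rule bounded_linear_compose[OF blinfun.bounded_linear_right])
  then obtain C where C: "C > 0" "\<And>v. norm (blinfun_apply R (b v)) \<le> norm v * C" using bounded_linear.pos_bounded by blast
  show ?thesis unfolding has_derivative_at_alt
  proof (intro conjI allI impI Rb)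
    fix e :: real assume e: "e > 0"
    \<comment> \<open>Below, norm q \<le> 1/2 norm q + e' (norm q + (C + 1) norm v). With e' \<le>
      1/4 at most three quarters of norm q stand on the right, which leaves norm q \<le> 4 e' (C +
      1) norm v; the second bound on e' makes this at most e norm v.\<close>
    define e' where "e' = min (1/4) (e / (4 * (C + 1)))"
    have "e' \<le> 1/4" unfolding e'_def by (rule min.cobounded1)
    then have e': "e' > 0" "e' \<le> 1/4" "4 * e' * (C + 1) \<le> e" 
    proof -
      have "e' \<le> e / (4 * (C + 1))" by (simp add: e'_def)
      then show "4 * e' * (C + 1) \<le> e" using C(1) by (simp add: pos_le_divide_eq algebra_simps)
    qed (use e C in \<open>auto simp: e'_def\<close>)
    obtain d where d: "d > 0" "\<And>z. norm (z - (x p0, p0)) < d \<Longrightarrow>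
        norm (\<Psi> z - \<Psi> (x p0, p0) - (case z - (x p0, p0) of (h, v) \<Rightarrow> blinfun_apply A h + b v)) \<le> e' * norm (z - (x p0, p0))"
      using der e'(1) unfolding has_derivative_at_alt by blast
    have "isCont (\<lambda>p. (x p, p)) p0" using cont by (intro continuous_intros)
    then obtain d1 where d1: "d1 > 0" "\<And>p. dist p p0 < d1 \<Longrightarrow> dist (x p, p) (x p0, p0) < d"
      using d(1) unfolding continuous_at_eps_delta by metis
    obtain d2 where d2: "d2 > 0" "ball p0 d2 \<subseteq> U" using assms(1,2) openE by blast
    show "\<exists>d>0. \<forall>y. norm (y - p0) < d \<longrightarrow> norm (x y - x p0 - blinfun_apply R (b (y - p0))) \<le> e * norm (y - p0)"
    proof (intro exI conjI allI impI)
      fix p assume p: "norm (p - p0) < min d1 d2"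
      then have pU: "p \<in> U" using d2 by (auto simp: dist_norm norm_minus_commute)
      let ?y = "x p - x p0" and ?v = "p - p0"
      define q where "q = ?y - blinfun_apply R (b ?v)"
      have "norm ((x p, p) - (x p0, p0)) < d" using d1(2)[of p] p by (simp add: dist_norm)
      from d(2)[OF this] have 1: "norm (?y - (blinfun_apply A ?y + b ?v)) \<le> e' * norm (?y, ?v)"
        using fp[OF pU] fp[OF assms(2)] by simp
      have "?y - (blinfun_apply A ?y + b ?v) = q - blinfun_apply A q"
        unfolding q_def blinfun.diff_right by (subst R) (simp add: algebra_simps)
      then have "norm q \<le> norm (blinfun_apply A q) + e' * norm (?y, ?v)"
        using 1 norm_triangle_ineq2[of q "blinfun_apply A q"] by simp
      moreover have "norm (blinfun_apply A q) \<le> 1/2 * norm q"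
        using norm_blinfun[of A q] mult_right_mono[OF A norm_ge_zero[of q]] by simp
      moreover have "norm (?y, ?v) \<le> norm q + (C + 1) * norm ?v"
      proof -
        have "norm (?y, ?v) \<le> norm ?y + norm ?v" by (rule norm_Pair_le)
        moreover have "norm ?y \<le> norm q + norm (blinfun_apply R (b ?v))"
          unfolding q_def using norm_triangle_ineq[of "?y - blinfun_apply R (b ?v)" "blinfun_apply R (b ?v)"] by simp
        ultimately show ?thesis using C(2)[of ?v] by (simp add: algebra_simps)
      qed
      then have "e' * norm (?y, ?v) \<le> e' * (norm q + (C + 1) * norm ?v)" using e' by simp
      moreover have "e' * norm q \<le> 1/4 * norm q" using e' by (intro mult_right_mono) auto
      ultimately have "norm q \<le> 4 * e' * (C + 1) * norm ?v" by (simp add: algebra_simps)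
      also have "\<dots> \<le> e * norm ?v" using e'(3) by (intro mult_right_mono) auto
      finally show "norm (x p - x p0 - blinfun_apply R (b (p - p0))) \<le> e * norm (p - p0)" by (simp add: q_def)
    qed (use d1 d2 in auto)
  qed
qed

text \<open>The derivative of y in a direction v solves an equation with the same operators
  \<open>A p\<close> and the inhomogeneity A'(v) y + b'(v), which has one order of regularity less.
  The induction over all \<open>b\<close> and \<open>y\<close> thus never differentiates the inverse
  of id - A.\<close>

lemma higher_differentiable_on_linear_fixed_point:
  fixes A :: "'p::real_normed_vector \<Rightarrow> 'x::banach \<Rightarrow>\<^sub>L 'x"
  assumes "open U" and A: "\<And>p. p \<in> U \<Longrightarrow> norm (A p) \<le> 1/2"
    and "higher_differentiable_on n U A" "higher_differentiable_on n U b"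
    and "\<And>p. p \<in> U \<Longrightarrow> y p = blinfun_apply (A p) (y p) + b p"
  shows "higher_differentiable_on n U y"
  using assms(3-5)
proof (induction n arbitrary: b y)
  case 0
  have "isCont y p0" if p0: "p0 \<in> U" for p0
  proof -
    have AC: "isCont A p0" "isCont b p0" using 0 p0 assms(1) by (auto simp: continuous_on_eq_continuous_at)
    have "((\<lambda>p. 2 * norm (blinfun_apply (A p - A p0) (y p0) + (b p - b p0))) \<longlongrightarrow> 2 * norm (blinfun_apply (A p0 - A p0)
        (y p0) + (b p0 - b p0))) (at p0)"
      using AC unfolding continuous_at by (intro tendsto_intros)
    then have lim: "((\<lambda>p. 2 * norm (blinfun_apply (A p - A p0) (y p0) + (b p - b p0))) \<longlongrightarrow> 0) (at p0)"
      by (simp add: blinfun.zero_left)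
    have "norm (y p - y p0) \<le> 2 * norm (blinfun_apply (A p - A p0) (y p0) + (b p - b p0))" if p: "p \<in> U" for p
    proof -
      have "y p - y p0 = blinfun_apply (A p) (y p - y p0) + (blinfun_apply (A p - A p0) (y p0) + (b p - b p0))"
        using 0(3)[OF p] 0(3)[OF p0] by (simp add: blinfun.diff_right blinfun.diff_left algebra_simps)
      then have "norm (y p - y p0) \<le> norm (blinfun_apply (A p) (y p - y p0)) + norm (blinfun_apply (A p - A p0) (y p0)
          + (b p - b p0))"
        by (metis norm_triangle_ineq)
      moreover have "norm (blinfun_apply (A p) (y p - y p0)) \<le> 1/2 * norm (y p - y p0)"
        using norm_blinfun[of "A p" "y p - y p0"] mult_right_mono[OF A[OF p] norm_ge_zero[of "y p - y p0"]] by simp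
      ultimately show ?thesis by simp
    qed
    then have "\<forall>\<^sub>F p in at p0. norm (y p - y p0) \<le> 2 * norm (blinfun_apply (A p - A p0) (y p0) + (b p - b p0))"
      using assms(1) p0 eventually_at_topological by blast
    then have "((\<lambda>p. y p - y p0) \<longlongrightarrow> 0) (at p0)" by (rule Lim_null_comparison[OF _ lim])
    then show ?thesis unfolding continuous_at using LIM_zero_iff by blast
  qed
  then show ?case by (auto intro: continuous_at_imp_continuous_on)
next
  case (Suc n)
  note DA = higher_differentiable_on_SucD[OF Suc.prems(1)] and Db = higher_differentiable_on_SucD[OF Suc.prems(2)]
  have yn: "higher_differentiable_on n U y"
    by (rule Suc.IH[OF higher_differentiable_on_Suc_imp[OF Suc.prems(1)]
        higher_differentiable_on_Suc_imp[OF Suc.prems(2)] Suc.prems(3)])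
  have "\<forall>p\<in>U. \<exists>R. \<forall>y. blinfun_apply R y = y + blinfun_apply (A p) (blinfun_apply R y)"
    using neumann_inverse A by metis
  then obtain R where R: "\<And>p y. p \<in> U \<Longrightarrow> blinfun_apply (R p) y = y + blinfun_apply (A p) (blinfun_apply (R p) y)"
    by metis
  let ?b = "\<lambda>p v. blinfun_apply (frechet_derivative A (at p) v) (y p) + frechet_derivative b (at p) v"
  show ?case
  proof (rule higher_differentiable_on_SucI[OF assms(1), where f'="\<lambda>p v. blinfun_apply (R p) (?b p v)"])
    fix p assume p: "p \<in> U"
    show "(y has_derivative (\<lambda>v. blinfun_apply (R p) (?b p v))) (at p)"
    proof (rule fixed_point_has_derivative[where \<Psi>="\<lambda>z. blinfun_apply (A (snd z)) (fst z) + b (snd z)" and A="A p" and U=U])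
      have s: "(snd has_derivative snd) (at (y p, p))" by (auto intro!: derivative_eq_intros)
      have A': "((\<lambda>z. A (snd z)) has_derivative (\<lambda>z. frechet_derivative A (at p) (snd z))) (at (y p, p))"
        using diff_chain_at[OF s, of A] DA(1)[OF p] by (simp add: o_def)
      have b': "((\<lambda>z. b (snd z)) has_derivative (\<lambda>z. frechet_derivative b (at p) (snd z))) (at (y p, p))"
        using diff_chain_at[OF s, of b] Db(1)[OF p] by (simp add: o_def)
      have f: "(fst has_derivative fst) (at (y p, p))" by (auto intro!: derivative_eq_intros)
      have "((\<lambda>z. blinfun_apply (A (snd z)) (fst z) + b (snd z)) has_derivative
          (\<lambda>z. (blinfun_apply (A (snd (y p, p))) (fst z) + blinfun_apply (frechet_derivative A (at p) (snd z)) (fst (y p,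
              p))) + frechet_derivative b (at p) (snd z))) (at (y p, p))"
        by (intro has_derivative_add blinfun.FDERIV A' b' f)
      then show "((\<lambda>z. blinfun_apply (A (snd z)) (fst z) + b (snd z)) has_derivative (\<lambda>(h, v). blinfun_apply (A p) h +
          ?b p v)) (at (y p, p))"
        by (simp add: split_def algebra_simps)
      show "isCont y p" using higher_differentiable_on_continuous[OF yn] assms(1) p by (auto simp: continuous_on_eq_continuous_at)
    qed (use assms(1) p Suc.prems(3) A R in auto)
  next
    fix v
    show "higher_differentiable_on n U (\<lambda>p. blinfun_apply (R p) (?b p v))"
    proof (rule Suc.IH[OF higher_differentiable_on_Suc_imp[OF Suc.prems(1)]])
      show "higher_differentiable_on n U (\<lambda>p. ?b p v)"
        by (intro higher_differentiable_on_add higher_differentiable_on_bilinear[OF _ bounded_bilinear_blinfun_apply]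
            assms(1) DA Db yn)
      show "blinfun_apply (R p) (?b p v) = blinfun_apply (A p) (blinfun_apply (R p) (?b p v)) + ?b p v" if "p \<in> U" for p
        using R[OF that, of "?b p v"] by (metis add.commute)
    qed
  qed
qed

text \<open>Differentiating the fixed point equation, the derivative of \<open>x\<close> solves a linear fixed point equation
  whose coefficients are as regular as \<open>x\<close>; so \<open>x\<close> gains one order of regularity at a time.\<close>

lemma smooth_on_fixed_point:
  fixes \<Psi> :: "'x::banach \<times> 'p::real_normed_vector \<Rightarrow> 'x" and A :: "'p \<Rightarrow> 'x \<Rightarrow>\<^sub>L 'x"
  assumes U: "open U" and fp: "\<And>p. p \<in> U \<Longrightarrow> x p = \<Psi> (x p, p)" and cont: "continuous_on U x"
    and der: "\<And>p. p \<in> U \<Longrightarrow> (\<Psi> has_derivative (\<lambda>(h, v). blinfun_apply (A p) h + B p v)) (at (x p, p))"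
    and A: "\<And>p. p \<in> U \<Longrightarrow> norm (A p) \<le> 1/2"
    and AB: "\<And>n. higher_differentiable_on n U x \<Longrightarrow> higher_differentiable_on n U A"
      "\<And>n v. higher_differentiable_on n U x \<Longrightarrow> higher_differentiable_on n U (\<lambda>p. B p v)"
  shows "smooth_on U x"
  unfolding smooth_on_def
proof
  fix n
  show "higher_differentiable_on n U x"
  proof (induction n)
    case 0
    then show ?case using cont by simp
  next
    case (Suc n)
    have "\<forall>p\<in>U. \<exists>R. \<forall>y. blinfun_apply R y = y + blinfun_apply (A p) (blinfun_apply R y)"
      using neumann_inverse A by metis
    then obtain R where R: "\<And>p y. p \<in> U \<Longrightarrow> blinfun_apply (R p) y = y + blinfun_apply (A p) (blinfun_apply (R p) y)"
      by metis
    show ?case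
    proof (rule higher_differentiable_on_SucI[OF U, where f'="\<lambda>p v. blinfun_apply (R p) (B p v)"])
      show "(x has_derivative (\<lambda>v. blinfun_apply (R p) (B p v))) (at p)" if "p \<in> U" for p
        using U that cont by (intro fixed_point_has_derivative[OF U that fp _ der A R])
          (auto simp: continuous_on_eq_continuous_at)
      show "higher_differentiable_on n U (\<lambda>p. blinfun_apply (R p) (B p v))" for v
        by (rule higher_differentiable_on_linear_fixed_point[OF U A AB(1)[OF Suc] AB(2)[OF Suc, of v]])
          (use R in \<open>auto simp: add.commute\<close>)
    qed
  qed
qed

text \<open>\<open>n\<close> and its derivative in the unknown vanish at the zero solution. So
  however large \<open>L\<close> is, x to L (n (c, x, p)) has Lipschitz constant 1/2 on a small
  ball. The curve \<open>c\<close> enters only through its compact range, which makes all estimates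
  uniform in s. The theorem serves twice: for the connecting orbit and, with constant data, as an
  implicit function theorem.\<close>

theorem smooth_fixed_point:
  fixes c :: "'s::metric_space \<Rightarrow>\<^sub>C 'c::euclidean_space"
    and n :: "'c \<times> 'x::euclidean_space \<times> 'p::euclidean_space \<Rightarrow> 'y::euclidean_space"
    and L :: "('s \<Rightarrow>\<^sub>C 'y) \<Rightarrow> 's \<Rightarrow>\<^sub>C 'x"
  assumes K: "compact K" "\<And>s. apply_bcontfun c s \<in> K"
    and Y: "open Y" "\<And>k. k \<in> K \<Longrightarrow> (k, 0, 0) \<in> Y"
    and n: "smooth_on Y n"
    and L: "bounded_linear L"
    and n0: "\<And>k. k \<in> K \<Longrightarrow> n (k, 0, 0) = 0"
    and n1: "\<And>k h. k \<in> K \<Longrightarrow> frechet_derivative n (at (k, 0, 0)) (0, h, 0) = 0"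
    and "\<eta> > 0"
  obtains r x where "r > 0" "smooth_on (ball 0 r) x" "x 0 = 0"
    "\<And>p. p \<in> ball 0 r \<Longrightarrow> norm (x p) \<le> \<eta>"
    "\<And>p s. p \<in> ball 0 r \<Longrightarrow> (apply_bcontfun c s, apply_bcontfun (x p) s, p) \<in> Y"
    "\<And>p. p \<in> ball 0 r \<Longrightarrow> \<exists>y. x p = L y \<and> (\<forall>s. apply_bcontfun y s = n (apply_bcontfun c s, apply_bcontfun (x p) s, p))"
proof -
  define K0 where "K0 = K \<times> {(0::'x, 0::'p)}"
  have K0: "compact K0" "K0 \<subseteq> Y" using K(1) Y(2) by (auto simp: K0_def intro: compact_Times)
  obtain C where C: "C > 0" "\<And>y. norm (L y) \<le> norm y * C" using bounded_linear.pos_bounded[OF L] by blast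
  define N where "N = real DIM('x)"
  have N: "N > 0" by (simp add: N_def)
  define g' where "g' i z = frechet_derivative n (at z) i" for i z
  have g'_smooth: "smooth_on Y (g' i)" for i
    unfolding g'_def by (rule smooth_on_derivative[OF n])
  \<comment> \<open>C bounds \<open>L\<close> and N counts the partial derivatives in x. The
    derivative assembled from them then has norm at most 1 / (2 C), and followed by \<open>L\<close>
    at most 1/2.\<close>
  have dn: "\<exists>d>0. \<forall>x y. x \<in> K0 \<longrightarrow> dist x y < d \<longrightarrow> y \<in> Y \<and> dist (g' (0, i, 0) x) (g' (0, i, 0) y) < 1 / (2 * C * N)" for i
    using uniformly_continuous_nbhd[OF K0 Y(1) smooth_on_continuous[OF g'_smooth[of "(0, i, 0)"]], of "1 / (2 * C * N)"] C N
    by (metis divide_pos_pos mult_pos_pos zero_less_numeral zero_less_one)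
  then obtain d where d: "\<And>i. d i > 0" "\<And>i x y. x \<in> K0 \<Longrightarrow> dist x y < d i \<Longrightarrow>
      y \<in> Y \<and> dist (g' (0, i, 0) x) (g' (0, i, 0) y) < 1 / (2 * C * N)" by metis
  \<comment> \<open>The quotient by 4 leaves room for x and p together: norm (x, p) \<le> 2 \<rho>
    is below every \<open>d i\<close>.\<close>
  define \<rho> where "\<rho> = min (\<eta>) (Min (d ` Basis) / 4)"
  have md: "Min (d ` Basis) > 0" using d by simp
  have \<rho>: "\<rho> > 0" "\<rho> \<le> \<eta>" using md assms(9) by (auto simp: \<rho>_def)
  have \<rho>d: "2 * \<rho> < d i" if "i \<in> Basis" for i
  proof -
    have "Min (d ` Basis) \<le> d i" using that by simp
    moreover have "\<rho> \<le> Min (d ` Basis) / 4" unfolding \<rho>_def by (rule min.cobounded2)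
    ultimately show ?thesis using d(1)[of i] md by linarith
  qed
  have near: "dist (k, 0, 0) (k, x, p) < d i" if "norm x \<le> \<rho>" "norm p \<le> \<rho>" "i \<in> Basis" for k :: 'c and x :: 'x and p :: 'p and i
  proof -
    have "dist (k, 0, 0) (k, x, p) = norm (x, p)" by (simp add: dist_Pair_Pair norm_Pair)
    then show ?thesis using norm_Pair_le[of x p] \<rho>d[OF that(3)] that(1,2) by simp
  qed
  obtain i0 :: 'x where i0: "i0 \<in> Basis" using nonempty_Basis by blast
  have inY: "(k, x, p) \<in> Y" if "k \<in> K" "norm x \<le> \<rho>" "norm p \<le> \<rho>" for k x p
    using d(2)[of "(k, 0, 0)" "(k, x, p)" i0] near[OF that(2,3) i0, of k] that(1) by (auto simp: K0_def)
  have small: "norm (g' (0, i, 0) (k, x, p)) \<le> 1 / (2 * C * N)"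
    if "k \<in> K" "norm x \<le> \<rho>" "norm p \<le> \<rho>" "i \<in> Basis" for k x p i
    using d(2)[of "(k, 0, 0)" "(k, x, p)" i] near[OF that(2-4), of k] n1[OF that(1), of i] that(1)
    by (auto simp: K0_def g'_def)
  \<comment> \<open>Smallness of \<open>n\<close> at x = 0 and small p: after \<open>L\<close> it
    contributes \<rho> / 2, the Lipschitz bound another \<rho> / 2, so the ball of radius \<rho> is
    mapped into itself.\<close>
  obtain d0 where d0: "d0 > 0" "\<And>x y. x \<in> K0 \<Longrightarrow> dist x y < d0 \<Longrightarrow> y \<in> Y \<and> dist (n x) (n y) < \<rho> / (2 * C)"
    using uniformly_continuous_nbhd[OF K0 Y(1) smooth_on_continuous[OF n], of "\<rho> / (2 * C)"] \<rho> C by auto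
  define r where "r = min \<rho> d0"
  have r: "r > 0" "r \<le> \<rho>" using \<rho> d0 by (auto simp: r_def)
  have n_small: "norm (n (k, 0, p)) \<le> \<rho> / (2 * C)" if "k \<in> K" "norm p < r" for k p
    using d0(2)[of "(k, 0, 0)" "(k, 0, p)"] that n0[OF that(1)]
    by (auto simp: K0_def dist_Pair_Pair r_def dist_norm)
  define \<Phi> where "\<Phi> k p h = (\<Sum>i\<in>Basis. (h \<bullet> i) *\<^sub>R g' (0, i, 0) (k, p))" for k and p :: "'x \<times> 'p" and h :: 'x
  have \<Phi>_norm: "norm (\<Phi> k (x, p) h) \<le> 1 / (2 * C) * norm h" if "k \<in> K" "norm x \<le> \<rho>" "norm p \<le> \<rho>" for k x p h
  proof -
    have "norm (\<Phi> k (x, p) h) \<le> (\<Sum>i\<in>(Basis::'x set). norm h * (1 / (2 * C * N)))"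
      unfolding \<Phi>_def
    proof (rule sum_norm_le)
      fix i :: 'x assume i: "i \<in> Basis"
      show "norm ((h \<bullet> i) *\<^sub>R g' (0, i, 0) (k, x, p)) \<le> norm h * (1 / (2 * C * N))"
        using mult_mono[OF Basis_le_norm[OF i, of h] small[OF that i] norm_ge_zero norm_ge_zero] by simp
    qed
    also have "\<dots> = 1 / (2 * C) * norm h" using N by (simp add: N_def)
    finally show ?thesis .
  qed
  have \<Phi>_eq: "frechet_derivative n (at (k, x, p)) (0, h, 0) = \<Phi> k (x, p) h" if "(k, x, p) \<in> Y" for k x p h
  proof -
    let ?D = "frechet_derivative n (at (k, x, p))"
    have "bounded_linear ?D" using smooth_on_has_derivative[OF n that] by (rule has_derivative_bounded_linear)
    moreover have "bounded_linear (\<lambda>h::'x. (0::'c, h, 0::'p))"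
      by (intro bounded_linear_Pair bounded_linear_zero bounded_linear_ident)
    ultimately interpret D': bounded_linear "\<lambda>h. ?D (0, h, 0)" by (rule bounded_linear_compose)
    have "?D (0, h, 0) = ?D (0, (\<Sum>i\<in>Basis. (h \<bullet> i) *\<^sub>R i), 0)" by (simp only: euclidean_representation)
    then show ?thesis by (simp only: D'.sum D'.scaleR \<Phi>_def g'_def)
  qed
  have n_der: "((\<lambda>x. n (k, x, p)) has_derivative \<Phi> k (x, p)) (at x)" if "(k, x, p) \<in> Y" for k x p
  proof -
    let ?D = "frechet_derivative n (at (k, x, p))"
    have d: "(n has_derivative ?D) (at (k, x, p))" by (rule smooth_on_has_derivative[OF n that])
    have "((\<lambda>x. (k, x, p)) has_derivative (\<lambda>h. (0, h, 0))) (at x)" by (auto intro!: derivative_eq_intros)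
    from diff_chain_at[OF this d] have "((\<lambda>x. n (k, x, p)) has_derivative (\<lambda>h. ?D (0, h, 0))) (at x)" by (simp add: o_def)
    then show ?thesis by (simp add: \<Phi>_eq[OF that])
  qed
  have lip: "norm (n (k, x, p) - n (k, x', p)) \<le> 1 / (2 * C) * norm (x - x')"
    if "k \<in> K" "norm p \<le> \<rho>" "norm x \<le> \<rho>" "norm x' \<le> \<rho>" for k x x' p
  proof (rule differentiable_bound[where S="cball 0 \<rho>"])
    fix y :: 'x assume "y \<in> cball 0 \<rho>"
    then have y: "norm y \<le> \<rho>" by simp
    show "((\<lambda>x. n (k, x, p)) has_derivative \<Phi> k (y, p)) (at y within cball 0 \<rho>)"
      using n_der[OF inY[OF that(1) y that(2)]] by (rule has_derivative_at_withinI)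
    show "onorm (\<Phi> k (y, p)) \<le> 1 / (2 * C)"
      by (rule onorm_le) (rule \<Phi>_norm[OF that(1) y that(2)])
  qed (use that in auto)
  \<comment> \<open>\<open>J\<close> is the affine map that feeds (c, x, p) into \<open>n\<close>,
    with p as a constant function, and \<open>J'\<close> is its linear part. The derivative of the
    superposition operator along \<open>J\<close> then yields the derivative of \<Psi> in x and p at
    once.\<close>
  define J :: "('s \<Rightarrow>\<^sub>C 'x) \<times> 'p \<Rightarrow> 's \<Rightarrow>\<^sub>C ('c \<times> 'x \<times> 'p)"
    where "J z = bmap (\<lambda>k. (k, 0, 0)) c + (bmap (\<lambda>x. (0, x, 0)) (fst z) + bmap (\<lambda>p. (0, 0, p)) (const_bcontfun (snd z)))" for z
  define J' :: "('s \<Rightarrow>\<^sub>C 'x) \<times> 'p \<Rightarrow> 's \<Rightarrow>\<^sub>C ('c \<times> 'x \<times> 'p)"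
    where "J' z = bmap (\<lambda>x. (0, x, 0)) (fst z) + bmap (\<lambda>p. (0, 0, p)) (const_bcontfun (snd z))" for z
  have l1: "bounded_linear (\<lambda>k. (k, 0, 0) :: 'c \<times> 'x \<times> 'p)" and l2: "bounded_linear (\<lambda>x. (0, x, 0) :: 'c \<times> 'x \<times> 'p)"
    and l3: "bounded_linear (\<lambda>p. (0, 0, p) :: 'c \<times> 'x \<times> 'p)"
    by (intro bounded_linear_Pair bounded_linear_zero bounded_linear_ident)+
  have J_apply: "apply_bcontfun (J (x, p)) s = (apply_bcontfun c s, apply_bcontfun x s, p)" for x p s
    by (simp add: J_def apply_bmap l1 l2 l3 const_bcontfun.rep_eq)
  have J'_lin: "bounded_linear J'" unfolding J'_def
    by (intro bounded_linear_add bounded_linear_compose[OF bounded_linear_bmap] l2 l3 bounded_linear_fst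
        bounded_linear_compose[OF bounded_linear_const_bcontfun] bounded_linear_snd)
  have J_der: "(J has_derivative J') (at z)" for z
  proof -
    have "J = (\<lambda>z. bmap (\<lambda>k. (k, 0, 0)) c + J' z)" by (auto simp: J_def J'_def)
    then show ?thesis using has_derivative_add[OF has_derivative_const bounded_linear_imp_has_derivative[OF J'_lin]] by auto
  qed
  define Kr where "Kr = K \<times> cball (0::'x) \<rho> \<times> cball (0::'p) \<rho>"
  have Kr: "compact Kr" "Kr \<subseteq> Y" using K(1) inY by (auto simp: Kr_def intro!: compact_Times)
  have J_in: "apply_bcontfun (J (x, p)) s \<in> Kr" if "norm x \<le> \<rho>" "norm p \<le> \<rho>" for x p s
    using that K(2) norm_bounded[of x s] by (auto simp: Kr_def J_apply)
  define \<Psi> where "\<Psi> z = L (nemytskii n (J z))" for z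
  have nemytskii_apply: "apply_bcontfun (nemytskii n (J (x, p))) s = n (apply_bcontfun c s, apply_bcontfun x s, p)"
    if "norm x \<le> \<rho>" "norm p \<le> \<rho>" for x p s
    using apply_nemytskii[OF continuous_on_subset[OF smooth_on_continuous[OF n] Kr(2)] Kr(1), of "J (x, p)"] J_in[OF that]
    by (simp add: J_apply)
  interpret L: bounded_linear L by (rule L)
  have \<Psi>_lip: "norm (\<Psi> (x, p) - \<Psi> (x', p)) \<le> 1/2 * norm (x - x')"
    if "norm p \<le> \<rho>" "norm x \<le> \<rho>" "norm x' \<le> \<rho>" for x x' p
  proof -
    have "norm (nemytskii n (J (x, p)) - nemytskii n (J (x', p))) \<le> 1 / (2 * C) * norm (x - x')"
    proof (rule norm_bound)
      fix s
      have "norm (apply_bcontfun x s) \<le> \<rho>" "norm (apply_bcontfun x' s) \<le> \<rho>"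
        using norm_bounded[of x s] norm_bounded[of x' s] that by auto
      note lip[OF K(2)[of s] that(1) this]
      also have "1 / (2 * C) * norm (apply_bcontfun x s - apply_bcontfun x' s) \<le> 1 / (2 * C) * norm (x - x')"
        using norm_bounded[of "x - x'" s] C by (intro mult_left_mono) auto
      finally show "norm (apply_bcontfun (nemytskii n (J (x, p)) - nemytskii n (J (x', p))) s) \<le> 1 / (2 * C) * norm (x - x')"
        by (simp add: nemytskii_apply that)
    qed
    then have "norm (nemytskii n (J (x, p)) - nemytskii n (J (x', p))) * C \<le> 1 / (2 * C) * norm (x - x') * C"
      using C by (intro mult_right_mono) auto
    with C show ?thesis using C(2)[of "nemytskii n (J (x, p)) - nemytskii n (J (x', p))"] by (simp add: \<Psi>_def L.diff)
  qed
  have \<Psi>_0: "norm (\<Psi> (0, p)) \<le> \<rho> / 2" if "norm p < r" for p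
  proof -
    have "norm (nemytskii n (J (0, p))) \<le> \<rho> / (2 * C)"
      using n_small[OF K(2) that] that r \<rho> by (intro norm_bound) (simp add: nemytskii_apply)
    then have "norm (nemytskii n (J (0, p))) * C \<le> \<rho> / (2 * C) * C" using C by (intro mult_right_mono) auto
    then have "norm (nemytskii n (J (0, p))) * C \<le> \<rho> / 2" using C(1) by simp
    then show ?thesis using C(2)[of "nemytskii n (J (0, p))"] unfolding \<Psi>_def by linarith
  qed
  have ex: "\<exists>!x\<in>cball 0 \<rho>. \<Psi> (x, p) = x" if "norm p < r" for p
  proof (rule Banach_fix[where c="1/2"])
    show "complete (cball (0::'s \<Rightarrow>\<^sub>C 'x) \<rho>)" by (simp add: complete_eq_closed)
    show "(\<lambda>x. \<Psi> (x, p)) ` cball 0 \<rho> \<subseteq> cball 0 \<rho>"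
    proof safe
      fix x :: "'s \<Rightarrow>\<^sub>C 'x" assume "x \<in> cball 0 \<rho>"
      then have "norm (\<Psi> (x, p) - \<Psi> (0, p)) \<le> 1/2 * norm x" using \<Psi>_lip[of p x 0] that r \<rho> by simp
      then show "\<Psi> (x, p) \<in> cball 0 \<rho>"
        using \<Psi>_0[OF that] norm_triangle_ineq[of "\<Psi> (x, p) - \<Psi> (0, p)" "\<Psi> (0, p)"] \<open>x \<in> cball 0 \<rho>\<close> by simp
    qed
  qed (use \<Psi>_lip that r \<rho> in \<open>auto simp: dist_norm\<close>)
  define x where "x p = (THE x. x \<in> cball 0 \<rho> \<and> \<Psi> (x, p) = x)" for p
  have x: "norm (x p) \<le> \<rho>" "\<Psi> (x p, p) = x p" if "norm p < r" for p
    using theI'[OF ex[OF that]] unfolding x_def by auto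
  define f where "f i h = bmap (\<lambda>z. z \<bullet> i) (J' (h, 0))" for i h
  have f_lin: "bounded_linear (f i)" for i unfolding f_def
    by (intro bounded_linear_compose[OF bounded_linear_bmap[OF bounded_linear_inner_left]]
        bounded_linear_compose[OF J'_lin] bounded_linear_Pair bounded_linear_ident bounded_linear_zero)
  have bilin: "bounded_bilinear (\<lambda>h (a::'s \<Rightarrow>\<^sub>C 'y). bmult (f i h) a)" for i
    by (rule bounded_bilinear.comp[OF bounded_bilinear_bmult f_lin bounded_linear_ident])
  define G where "G i p = nemytskii (g' i) (J (x p, p))" for i p
  \<comment> \<open>Written with \<open>prod_left\<close>, \<open>A p\<close> depends on the
    functions \<open>G i p\<close> through bounded linear maps, so it inherits their regularity in
    the operator norm.\<close>
  define A where "A p = Blinfun L o\<^sub>L (\<Sum>i\<in>Basis. bounded_bilinear.prod_left (\<lambda>h a. bmult (f i h) a) (G i p))" for p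
  define B where "B p v = L (\<Sum>i\<in>Basis. bmult (bmap (\<lambda>z. z \<bullet> i) (J' (0, v))) (G i p))" for p v
  have A_apply: "blinfun_apply (A p) h = L (\<Sum>i\<in>Basis. bmult (f i h) (G i p))" for p h
    by (simp add: A_def bounded_linear_Blinfun_apply[OF L] blinfun.sum_left bounded_bilinear.prod_left.rep_eq[OF bilin])
  interpret J': bounded_linear J' by (rule J'_lin)
  have \<Psi>_der: "(\<Psi> has_derivative (\<lambda>(h, v). blinfun_apply (A p) h + B p v)) (at (x p, p))" if p: "p \<in> ball 0 r" for p
  proof -
    have "apply_bcontfun (J (x p, p)) s \<in> Kr" for s using J_in x(1)[of p] p r by auto
    from bounded_linear.has_derivative[OF L diff_chain_at[OF J_der nemytskii_has_derivative[OF n Y(1) Kr this]]]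
    have "(\<Psi> has_derivative (\<lambda>z. L (\<Sum>i\<in>Basis. bmult (bmap (\<lambda>w. w \<bullet> i) (J' z)) (G i p)))) (at (x p, p))"
      by (simp add: o_def \<Psi>_def[abs_def] G_def g'_def[abs_def])
    moreover have "L (\<Sum>i\<in>Basis. bmult (bmap (\<lambda>w. w \<bullet> i) (J' (h, v))) (G i p)) = blinfun_apply (A p) h + B p v" for h v
    proof -
      have "J' (h, v) = J' (h, 0) + J' (0, v)" by (simp add: J'.add[symmetric])
      then show ?thesis
        by (simp add: A_apply B_def f_def L.add[symmetric] sum.distrib[symmetric]
            linear_add[OF bounded_linear.linear[OF bounded_linear_bmap[OF bounded_linear_inner_left]]]
            bounded_bilinear.add_left[OF bounded_bilinear_bmult])
    qed
    then have "(\<lambda>z. L (\<Sum>i\<in>Basis. bmult (bmap (\<lambda>w. w \<bullet> i) (J' z)) (G i p))) = (\<lambda>(h, v). blinfun_apply (A p) h + B p v)"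
      by (auto simp: fun_eq_iff)
    ultimately show ?thesis by simp
  qed
  have A_norm: "norm (A p) \<le> 1/2" if p: "p \<in> ball 0 r" for p
  proof (rule norm_blinfun_bound)
    fix h :: "'s \<Rightarrow>\<^sub>C 'x"
    have xp: "norm (x p) \<le> \<rho>" "norm p \<le> \<rho>" using p x(1)[of p] r by auto
    have "norm (\<Sum>i\<in>Basis. bmult (f i h) (G i p)) \<le> 1 / (2 * C) * norm h"
    proof (rule norm_bound)
      fix s
      let ?z = "(apply_bcontfun c s, apply_bcontfun (x p) s, p)"
      have xs: "norm (apply_bcontfun (x p) s) \<le> \<rho>" using norm_bounded[of "x p" s] xp by simp
      have zY: "?z \<in> Y" by (rule inY[OF K(2) xs xp(2)])
      interpret D: bounded_linear "frechet_derivative n (at ?z)"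
        using smooth_on_has_derivative[OF n zY] by (rule has_derivative_bounded_linear)
      have sum: "apply_bcontfun (\<Sum>i\<in>I. q i) s = (\<Sum>i\<in>I. apply_bcontfun (q i) s)"
        for I :: "('c \<times> 'x \<times> 'p) set" and q :: "_ \<Rightarrow> 's \<Rightarrow>\<^sub>C 'y"
        by (induction I rule: infinite_finite_induct) auto
      have Ga: "apply_bcontfun (G i p) s = g' i ?z" for i
        using apply_nemytskii[OF continuous_on_subset[OF smooth_on_continuous[OF g'_smooth[of i]] Kr(2)] Kr(1) J_in[OF xp]]
        by (simp add: G_def J_apply)
      have fa: "apply_bcontfun (f i h) s = (0, apply_bcontfun h s, 0) \<bullet> i" for i
        by (simp add: f_def apply_bmap bounded_linear_inner_left J'_def l2 l3 const_bcontfun.rep_eq)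
      have "apply_bcontfun (\<Sum>i\<in>Basis. bmult (f i h) (G i p)) s
          = (\<Sum>i\<in>Basis. ((0, apply_bcontfun h s, 0) \<bullet> i) *\<^sub>R g' i ?z)"
        by (simp only: sum apply_bmult fa Ga)
      also have "\<dots> = frechet_derivative n (at ?z) (\<Sum>i\<in>Basis. ((0, apply_bcontfun h s, 0) \<bullet> i) *\<^sub>R i)"
        by (simp only: D.sum D.scaleR g'_def)
      also have "\<dots> = \<Phi> (apply_bcontfun c s) (apply_bcontfun (x p) s, p) (apply_bcontfun h s)"
        by (simp only: euclidean_representation \<Phi>_eq[OF zY])
      also have "norm \<dots> \<le> 1 / (2 * C) * norm (apply_bcontfun h s)"
        by (rule \<Phi>_norm[OF K(2) xs xp(2)])
      also have "\<dots> \<le> 1 / (2 * C) * norm h" using norm_bounded[of h s] C by (intro mult_left_mono) auto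
      finally show "norm (apply_bcontfun (\<Sum>i\<in>Basis. bmult (f i h) (G i p)) s) \<le> 1 / (2 * C) * norm h" .
    qed
    then have "norm (\<Sum>i\<in>Basis. bmult (f i h) (G i p)) * C \<le> 1 / (2 * C) * norm h * C"
      using C by (intro mult_right_mono) auto
    then have "norm (\<Sum>i\<in>Basis. bmult (f i h) (G i p)) * C \<le> 1/2 * norm h" using C(1) by simp
    then show "norm (blinfun_apply (A p) h) \<le> 1/2 * norm h"
      using C(2)[of "\<Sum>i\<in>Basis. bmult (f i h) (G i p)"] unfolding A_apply by linarith
  qed simp
  \<comment> \<open>The parameter is changed with the point frozen at \<open>x p0\<close>; the
    contraction absorbs half of the remaining difference.\<close>
  have x_cont: "isCont x p0" if p0: "p0 \<in> ball 0 r" for p0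
  proof -
    have 1: "isCont \<Psi> (x p0, p0)" using \<Psi>_der[OF p0] has_derivative_continuous by blast
    have "isCont (\<lambda>p. (x p0, p)) p0" by (intro continuous_intros)
    from isCont_o2[OF this 1] have "isCont (\<lambda>p. \<Psi> (x p0, p)) p0" .
    then have "((\<lambda>p. 2 * norm (\<Psi> (x p0, p) - \<Psi> (x p0, p0))) \<longlongrightarrow> 2 * norm (\<Psi> (x p0, p0) - \<Psi> (x p0, p0))) (at p0)"
      unfolding continuous_at by (intro tendsto_intros)
    then have lim: "((\<lambda>p. 2 * norm (\<Psi> (x p0, p) - \<Psi> (x p0, p0))) \<longlongrightarrow> 0) (at p0)" by simp
    have "norm (x p - x p0) \<le> 2 * norm (\<Psi> (x p0, p) - \<Psi> (x p0, p0))" if p: "p \<in> ball 0 r" for p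
    proof -
      have "x p - x p0 = (\<Psi> (x p, p) - \<Psi> (x p0, p)) + (\<Psi> (x p0, p) - \<Psi> (x p0, p0))" using x(2) p p0 by simp
      then have "norm (x p - x p0) \<le> norm (\<Psi> (x p, p) - \<Psi> (x p0, p)) + norm (\<Psi> (x p0, p) - \<Psi> (x p0, p0))"
        by (metis norm_triangle_ineq)
      moreover have "norm (\<Psi> (x p, p) - \<Psi> (x p0, p)) \<le> 1/2 * norm (x p - x p0)"
        using p p0 r x(1) by (intro \<Psi>_lip) auto
      ultimately show ?thesis by simp
    qed
    then have "\<forall>\<^sub>F p in at p0. norm (x p - x p0) \<le> 2 * norm (\<Psi> (x p0, p) - \<Psi> (x p0, p0))"
      using p0 unfolding eventually_at_topological by (intro exI[of _ "ball 0 r"]) auto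
    then have "((\<lambda>p. x p - x p0) \<longlongrightarrow> 0) (at p0)" by (rule Lim_null_comparison[OF _ lim])
    then show ?thesis unfolding continuous_at using LIM_zero_iff by blast
  qed
  have "smooth_on (ball 0 r) x"
  proof (rule smooth_on_fixed_point[of _ x \<Psi> A B])
    fix n' v assume xh: "higher_differentiable_on n' (ball 0 r) x"
    have Jh: "higher_differentiable_on n' (ball 0 r) (\<lambda>p. J (x p, p))"
    proof -
      have "higher_differentiable_on n' (ball 0 r) (\<lambda>p. bmap (\<lambda>k. (k, 0, 0)) c + J' (x p, p))"
        by (intro higher_differentiable_on_add higher_differentiable_on_const higher_differentiable_on_linear_compose[OF _ J'_lin] higher_differentiable_on_Pair xh open_ball
            higher_differentiable_on_linear[OF _ bounded_linear_ident])
      then show ?thesis by (simp add: J_def J'_def)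
    qed
    have Gh: "higher_differentiable_on n' (ball 0 r) (G i)" for i unfolding G_def
    proof (rule higher_differentiable_on_nemytskii[OF g'_smooth Y(1) open_ball Jh])
      fix p :: 'p assume "p \<in> ball 0 r"
      then have "norm (x p) \<le> \<rho>" "norm p \<le> \<rho>" using x(1)[of p] r by auto
      then show "\<exists>K. compact K \<and> K \<subseteq> Y \<and> (\<forall>s. apply_bcontfun (J (x p, p)) s \<in> K)"
        using Kr J_in by blast
    qed
    show "higher_differentiable_on n' (ball 0 r) A" unfolding A_def
      by (intro higher_differentiable_on_linear_compose[OF _ bounded_bilinear.bounded_linear_right[OF bounded_bilinear_blinfun_compose]]
          higher_differentiable_on_sum open_ball higher_differentiable_on_linear_compose[OF _ bounded_bilinear.bounded_linear_prod_left[OF bilin]] Gh)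
    show "higher_differentiable_on n' (ball 0 r) (\<lambda>p. B p v)" unfolding B_def
      by (intro higher_differentiable_on_linear_compose[OF _ L] higher_differentiable_on_sum open_ball
          higher_differentiable_on_linear_compose[OF _ bounded_bilinear.bounded_linear_right[OF bounded_bilinear_bmult]] Gh)
  qed (use x(2) x_cont \<Psi>_der A_norm in \<open>auto intro: continuous_at_imp_continuous_on\<close>)
  moreover have "x 0 = 0"
  proof -
    have "nemytskii n (J (0, 0)) = 0"
      by (rule bcontfun_eqI) (use n0[OF K(2)] \<rho> in \<open>simp add: nemytskii_apply\<close>)
    then have "\<Psi> (0, 0) = 0" by (simp add: \<Psi>_def L.zero)
    moreover have "\<Psi> (x 0, 0) = x 0" "norm (x 0) \<le> \<rho>" using x[of 0] r by auto
    moreover have "0 \<in> cball (0::'s \<Rightarrow>\<^sub>C 'x) \<rho>" using \<rho> by simp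
    ultimately show ?thesis using ex[of 0] r by (metis mem_cball_0 norm_zero)
  qed
  ultimately show ?thesis
  proof (rule that[OF r(1)])
    fix p :: 'p assume p: "p \<in> ball 0 r"
    then have xp: "norm (x p) \<le> \<rho>" "norm p \<le> \<rho>" using x(1)[of p] r by auto
    then show "norm (x p) \<le> \<eta>" using \<rho> by simp
    show "(apply_bcontfun c s, apply_bcontfun (x p) s, p) \<in> Y" for s
      using inY[OF K(2) _ xp(2)] norm_bounded[of "x p" s] xp(1) by simp
    show "\<exists>y. x p = L y \<and> (\<forall>s. apply_bcontfun y s = n (apply_bcontfun c s, apply_bcontfun (x p) s, p))"
      using x(2)[of p] p xp by (intro exI[of _ "nemytskii n (J (x p, p))"]) (auto simp: nemytskii_apply \<Psi>_def)
  qed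
qed

subsection \<open>The linearization along the limiting orbit\<close>

definition root_sech :: "real \<Rightarrow> real" where "root_sech t = 1 / sqrt (cosh t)"
definition front :: "real \<Rightarrow> real" where "front t = (1 - tanh t) / 2"

lemma root_sech_pos: "root_sech t > 0" by (simp add: root_sech_def cosh_real_pos)
lemma root_sech_nz: "root_sech t \<noteq> 0" using root_sech_pos[of t] by simp
lemma root_sech_le_1: "root_sech t \<le> 1" using cosh_real_ge_1[of t] by (simp add: root_sech_def)
lemma root_sech_0: "root_sech 0 = 1" by (simp add: root_sech_def)
lemma root_sech_sq: "root_sech t ^ 2 * cosh t = 1"
  using cosh_real_pos[of t] by (simp add: root_sech_def power_divide)
lemma root_sech_minus: "root_sech (- t) = root_sech t" by (simp add: root_sech_def)
lemma root_sech_sq_sinh: "root_sech t ^ 2 * sinh t = tanh t"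
  using cosh_real_pos[of t] by (simp add: root_sech_def power_divide tanh_def)
lemma root_sech_4: "root_sech t ^ 4 = 1 - tanh t ^ 2"
proof -
  have "root_sech t ^ 4 = (root_sech t ^ 2)^2" by simp
  also have "root_sech t ^ 2 = 1 / cosh t" using cosh_real_pos[of t] by (simp add: root_sech_def power_divide)
  also have "(1 / cosh t)^2 = 1 - tanh t ^ 2"
    using cosh_real_pos[of t] by (simp add: tanh_def power_divide sinh_square_eq diff_divide_distrib)
  finally show ?thesis .
qed

lemma root_sech_deriv: "(root_sech has_real_derivative - (tanh t * root_sech t / 2)) (at t)"
proof -
  have c: "cosh t > 0" by (rule cosh_real_pos)
  have "((\<lambda>t. 1 / sqrt (cosh t)) has_real_derivative
      - (sinh t * (inverse (sqrt (cosh t)) / 2)) / (sqrt (cosh t) * sqrt (cosh t))) (at t)"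
    by (auto intro!: derivative_eq_intros simp: divide_simps) (metis c less_asym)
  moreover have "- (sinh t * (inverse (sqrt (cosh t)) / 2)) / (sqrt (cosh t) * sqrt (cosh t)) = - (tanh t * root_sech t / 2)"
    using c by (simp add: root_sech_def tanh_def field_simps)
  ultimately show ?thesis unfolding root_sech_def[abs_def] by simp
qed

lemma tanh_deriv: "(tanh has_real_derivative root_sech t ^ 4) (at t)"
  using cosh_real_pos[of t] by (auto intro!: derivative_eq_intros simp: root_sech_4 field_simps)

lemma front_deriv: "(front has_real_derivative - (root_sech t ^ 4 / 2)) (at t)"
  unfolding front_def[abs_def] by (auto intro!: derivative_eq_intros simp: root_sech_4 field_simps)

lemma front_range: "0 \<le> front t" "front t \<le> 1"
  using tanh_real_bounds[of t] by (auto simp: front_def)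

text \<open>This is the conservation law V^2 + (2 Z - 1)^2 = 1 on the limiting orbit. It makes the
  field on the axis, a multiple of Z (1 - Z), divisible by the weight along the front.\<close>

lemma front_root_sech: "front t * (1 - front t) = root_sech t ^ 4 / 4"
  by (simp add: front_def root_sech_4 power2_eq_square field_simps)

lemma continuous_root_sech: "continuous_on A root_sech" and continuous_front: "continuous_on A front"
    and continuous_tanh: "continuous_on A (tanh :: real \<Rightarrow> real)"
  using root_sech_deriv front_deriv tanh_deriv by (meson DERIV_isCont continuous_at_imp_continuous_on)+

lemma root_sech_lower: "exp (- \<bar>t\<bar> / 2) \<le> root_sech t"
proof -
  have "cosh t \<le> exp \<bar>t\<bar>" unfolding cosh_def by (cases "t \<ge> 0") auto
  then have "sqrt (cosh t) \<le> sqrt (exp \<bar>t\<bar>)" by simp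
  also have "sqrt (exp \<bar>t\<bar>) = exp (\<bar>t\<bar> / 2)"
    by (rule real_sqrt_unique) (auto simp: power2_eq_square mult_exp_exp)
  finally have "1 / exp (\<bar>t\<bar> / 2) \<le> root_sech t"
    unfolding root_sech_def using cosh_real_pos[of t] by (intro divide_left_mono) auto
  moreover have "exp (- \<bar>t\<bar> / 2) = 1 / exp (\<bar>t\<bar> / 2)"
    using exp_minus[of "\<bar>t\<bar> / 2"] by (simp only: inverse_eq_divide minus_divide_left)
  ultimately show ?thesis by simp
qed

lemma root_sech_upper: "root_sech t \<le> 2 * exp (- \<bar>t\<bar> / 2)"
proof -
  have "exp \<bar>t\<bar> / 4 \<le> cosh t" unfolding cosh_def by (cases "t \<ge> 0") (auto simp: field_simps)
  then have "sqrt (exp \<bar>t\<bar> / 4) \<le> sqrt (cosh t)" by simp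
  also have "sqrt (exp \<bar>t\<bar> / 4) = exp (\<bar>t\<bar> / 2) / 2"
    by (rule real_sqrt_unique) (auto simp: power2_eq_square mult_exp_exp)
  finally have "root_sech t \<le> 1 / (exp (\<bar>t\<bar> / 2) / 2)"
    unfolding root_sech_def using cosh_real_pos[of t] by (intro divide_left_mono) auto
  moreover have "exp (- \<bar>t\<bar> / 2) = 1 / exp (\<bar>t\<bar> / 2)"
    using exp_minus[of "\<bar>t\<bar> / 2"] by (simp only: inverse_eq_divide minus_divide_left)
  ultimately show ?thesis by simp
qed

lemma root_sech_limits: "(root_sech \<longlongrightarrow> 0) at_top" "(root_sech \<longlongrightarrow> 0) at_bot"
proof -
  have "filterlim (\<lambda>t. sqrt (cosh t)) at_top at_top" "filterlim (\<lambda>t. sqrt (cosh t)) at_top at_bot"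
    by (rule filterlim_compose[OF sqrt_at_top] cosh_real_at_top cosh_real_at_bot)+
  then show "(root_sech \<longlongrightarrow> 0) at_top" "(root_sech \<longlongrightarrow> 0) at_bot" unfolding root_sech_def[abs_def]
    by (auto intro: tendsto_divide_0 filterlim_at_top_imp_at_infinity)
qed

lemma front_limits: "(front \<longlongrightarrow> 0) at_top" "(front \<longlongrightarrow> 1) at_bot"
proof -
  have "((\<lambda>t::real. (1 - tanh t) / 2) \<longlongrightarrow> (1 - 1) / 2) at_top" "((\<lambda>t::real. (1 - tanh t) / 2) \<longlongrightarrow> (1 - (-1)) / 2) at_bot"
    by (intro tendsto_intros tanh_real_at_top tanh_real_at_bot; simp)+
  then show "(front \<longlongrightarrow> 0) at_top" "(front \<longlongrightarrow> 1) at_bot" unfolding front_def[abs_def] by simp_all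
qed

text \<open>Two integrals because \<open>integral {0..t} h\<close> is 0 for negative t; their
  difference is the oriented integral from 0 to t.\<close>

definition primitive :: "(real \<Rightarrow> real) \<Rightarrow> real \<Rightarrow> real" where
  "primitive h t = integral {0..t} h - integral {t..0} h"

lemma primitive_0 [simp]: "primitive h 0 = 0" by (simp add: primitive_def)

lemma primitive_deriv:
  assumes "continuous_on UNIV h"
  shows "(primitive h has_real_derivative h t) (at t)"
proof -
  define a where "a = - \<bar>t\<bar> - 1"
  define b where "b = \<bar>t\<bar> + 1"
  have ab: "a < 0" "0 < b" "a < t" "t < b" by (auto simp: a_def b_def)
  have int: "h integrable_on {c..d}" for c d
    by (rule integrable_continuous_interval) (rule continuous_on_subset[OF assms subset_UNIV])
  have "((\<lambda>u. integral {a..u} h) has_real_derivative h t) (at t within {a..b})"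
    by (rule integral_has_real_derivative) (use assms ab continuous_on_subset in auto)
  then have "((\<lambda>u. integral {a..u} h) has_real_derivative h t) (at t)"
    using ab by (simp only: at_within_Icc_at)
  then have "((\<lambda>u. integral {a..u} h - integral {a..0} h) has_real_derivative h t - 0) (at t)"
    by (intro DERIV_diff) auto
  moreover have "primitive h u = integral {a..u} h - integral {a..0} h" if "u \<in> {a<..<b}" for u
  proof (cases "u \<ge> 0")
    case True
    then show ?thesis using Henstock_Kurzweil_Integration.integral_combine[of a 0 u h] int ab
      by (cases "u = 0") (auto simp: primitive_def)
  next
    case False
    then show ?thesis using Henstock_Kurzweil_Integration.integral_combine[of a u 0 h] int that by (auto simp: primitive_def)
  qed
  ultimately show ?thesis
    using has_field_derivative_transform_within_open[of _ "h t" t "{a<..<b}" "primitive h"] ab by auto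
qed

lemma primitive_linear:
  assumes "continuous_on UNIV h" "continuous_on UNIV k"
  shows "primitive (\<lambda>t. h t + k t) t = primitive h t + primitive k t" "primitive (\<lambda>t. c * h t) t = c * primitive h t"
proof -
  have int: "h integrable_on {c..d}" "k integrable_on {c..d}" for c d :: real
    by (rule integrable_continuous_interval, rule continuous_on_subset[OF assms(1) subset_UNIV])
       (rule integrable_continuous_interval, rule continuous_on_subset[OF assms(2) subset_UNIV])
  show "primitive (\<lambda>t. h t + k t) t = primitive h t + primitive k t" "primitive (\<lambda>t. c * h t) t = c * primitive h t"
    using int by (auto simp: primitive_def Henstock_Kurzweil_Integration.integral_add algebra_simps)
qed

text \<open>The bound |F'| \<le> b P' makes b P + F and b P - F nondecreasing. Explicit majorants
  \<open>P\<close> take the place of estimates of integrals in the sequel.\<close>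

lemma abs_diff_le_by_derivative:
  fixes F P \<psi> g :: "real \<Rightarrow> real"
  assumes "\<And>t. (F has_real_derivative \<psi> t * g t) (at t)" "\<And>t. (P has_real_derivative P' t) (at t)"
    and "\<And>t. 0 \<le> \<psi> t" "\<And>t. \<psi> t \<le> P' t" "\<And>t. \<bar>g t\<bar> \<le> b" "s \<le> t"
  shows "\<bar>F t - F s\<bar> \<le> b * (P t - P s)"
proof -
  have bd: "\<bar>\<psi> t * g t\<bar> \<le> b * P' t" for t
  proof -
    have "\<psi> t * \<bar>g t\<bar> \<le> P' t * b" using assms(3)[of t] assms(4)[of t] assms(5)[of t] by (intro mult_mono) auto
    then show ?thesis using assms(3)[of t] by (simp add: abs_mult mult.commute)
  qed
  have d: "((\<lambda>t. b * P t + F t) has_real_derivative b * P' t + \<psi> t * g t) (at t)"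
     "((\<lambda>t. b * P t - F t) has_real_derivative b * P' t - \<psi> t * g t) (at t)" for t
    by (auto intro!: derivative_eq_intros assms)
  have "b * P s + F s \<le> b * P t + F t" "b * P s - F s \<le> b * P t - F t"
  proof -
    have nn: "0 \<le> b * P' t + \<psi> t * g t" "0 \<le> b * P' t - \<psi> t * g t" for t using bd[of t] by linarith+
    show "b * P s + F s \<le> b * P t + F t"
      by (rule DERIV_nonneg_imp_nondecreasing[OF assms(6)]) (use d(1) nn(1) in blast)
    show "b * P s - F s \<le> b * P t - F t"
      by (rule DERIV_nonneg_imp_nondecreasing[OF assms(6)]) (use d(2) nn(2) in blast)
  qed
  then show ?thesis by (simp add: algebra_simps abs_le_iff)
qed

lemma bcontfun_operator:
  fixes S :: "(real \<Rightarrow>\<^sub>C real) \<Rightarrow> real \<Rightarrow> real"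
  assumes "\<And>g. continuous_on UNIV (S g)" "\<And>g h t. S (g + h) t = S g t + S h t"
    and "\<And>c g t. S (c *\<^sub>R g) t = c * S g t" "\<And>g t. \<bar>S g t\<bar> \<le> C * norm g"
  obtains E :: "(real \<Rightarrow>\<^sub>C real) \<Rightarrow> real \<Rightarrow>\<^sub>C real" where "bounded_linear E" "\<And>g t. apply_bcontfun (E g) t = S g t"
proof
  have a: "apply_bcontfun (Bcontfun (S g)) = S g" for g
    using assms by (intro apply_Bcontfun[of _ "C * norm g"]) auto
  show "bounded_linear (\<lambda>g. Bcontfun (S g))"
  proof (rule bounded_linear_intro[where K=C])
    show "norm (Bcontfun (S g)) \<le> norm g * C" for g
      by (rule norm_bound) (use assms(4)[of g] in \<open>simp add: a mult.commute\<close>)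
  qed (auto intro!: bcontfun_eqI simp: a assms)
  show "apply_bcontfun (Bcontfun (S g)) t = S g t" for g t by (simp add: a)
qed

lemma bounded_bcontfun: "\<bar>apply_bcontfun g t\<bar> \<le> norm g" for g :: "real \<Rightarrow>\<^sub>C real"
  using norm_bounded[of g t] by simp

lemma continuous_bcontfun_mult:
  "continuous_on UNIV \<psi> \<Longrightarrow> continuous_on UNIV (\<lambda>t. \<psi> t * apply_bcontfun g t)" for g :: "real \<Rightarrow>\<^sub>C real"
  by (intro continuous_intros) auto

text \<open>Variation of constants: \<open>m\<close> solves the homogeneous equation, and \<open>P\<close> majorizes the integral from \<open>0\<close>.\<close>

lemma centered_operator:
  fixes m P P' a :: "real \<Rightarrow> real"
  assumes m: "\<And>t. (m has_real_derivative a t * m t) (at t)" "\<And>t. m t > 0"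
    and P: "\<And>t. (P has_real_derivative P' t) (at t)" "P 0 = 0" "\<And>t. root_sech t / m t \<le> P' t" "\<And>t. m t * \<bar>P t\<bar> \<le> C * root_sech t"
  obtains E :: "(real \<Rightarrow>\<^sub>C real) \<Rightarrow> real \<Rightarrow>\<^sub>C real" where "bounded_linear E" "\<And>g. apply_bcontfun (E g) 0 = 0"
    "\<And>g t. ((\<lambda>t. root_sech t * apply_bcontfun (E g) t) has_real_derivative
         a t * (root_sech t * apply_bcontfun (E g) t) + root_sech t * apply_bcontfun g t) (at t)"
proof -
  let ?F = "\<lambda>g. primitive (\<lambda>t. (root_sech t / m t) * apply_bcontfun g t)"
  have cm: "continuous_on UNIV m" using m(1) by (meson DERIV_isCont continuous_at_imp_continuous_on)
  have c\<psi>: "continuous_on UNIV (\<lambda>t. root_sech t / m t)"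
    by (intro continuous_intros continuous_root_sech cm) (use m(2) in \<open>auto simp: less_imp_neq\<close>, metis less_irrefl)
  note ch = continuous_bcontfun_mult[OF c\<psi>]
  note F_deriv = primitive_deriv[OF ch]
  have F_bound: "\<bar>?F g t\<bar> \<le> norm g * \<bar>P t\<bar>" for g t
  proof (cases "t \<ge> 0")
    case True
    have "\<bar>?F g t - ?F g 0\<bar> \<le> norm g * (P t - P 0)"
      by (rule abs_diff_le_by_derivative[OF F_deriv P(1) _ P(3) bounded_bcontfun True])
        (use m(2) root_sech_pos in \<open>auto simp: less_imp_le\<close>)
    also have "\<dots> \<le> norm g * \<bar>P t\<bar>" using P(2) by (intro mult_left_mono) auto
    finally show ?thesis by simp
  next
    case False
    then have "t \<le> 0" by simp
    have "\<bar>?F g 0 - ?F g t\<bar> \<le> norm g * (P 0 - P t)"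
      by (rule abs_diff_le_by_derivative[OF F_deriv P(1) _ P(3) bounded_bcontfun \<open>t \<le> 0\<close>])
        (use m(2) root_sech_pos in \<open>auto simp: less_imp_le\<close>)
    also have "\<dots> \<le> norm g * \<bar>P t\<bar>" using P(2) by (intro mult_left_mono) auto
    finally show ?thesis by simp
  qed
  have cF: "continuous_on UNIV (?F g)" for g
    using F_deriv by (meson DERIV_isCont continuous_at_imp_continuous_on)
  \<comment> \<open>Division by \<open>root_sech t\<close> passes from the solution to its factor,
    and the bound on \<open>m t * \<bar>P t\<bar>\<close> says exactly that this factor stays
    bounded.\<close>
  obtain E where E: "bounded_linear E" "\<And>g t. apply_bcontfun (E g) t = m t / root_sech t * ?F g t"
  proof (rule bcontfun_operator[where S="\<lambda>g t. m t / root_sech t * ?F g t" and C=C])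
    show "continuous_on UNIV (\<lambda>t. m t / root_sech t * ?F g t)" for g
      by (intro continuous_intros cm cF continuous_root_sech) (metis root_sech_pos less_irrefl)
    show "m t / root_sech t * ?F (g + h) t = m t / root_sech t * ?F g t + m t / root_sech t * ?F h t" for g h t
      using primitive_linear(1)[OF ch ch, of g h t] by (simp add: algebra_simps)
    show "m t / root_sech t * ?F (c *\<^sub>R g) t = c * (m t / root_sech t * ?F g t)" for c g t
      using primitive_linear(2)[OF ch ch, of c g t] by (simp add: algebra_simps)
    show "\<bar>m t / root_sech t * ?F g t\<bar> \<le> C * norm g" for g t
    proof -
      have "\<bar>m t / root_sech t * ?F g t\<bar> = m t * \<bar>?F g t\<bar> / root_sech t" using m(2)[of t] root_sech_pos[of t]
          by (simp add: abs_mult)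
      also have "\<dots> \<le> m t * (norm g * \<bar>P t\<bar>) / root_sech t"
        using F_bound[of g t] m(2)[of t] root_sech_pos[of t] by (intro divide_right_mono mult_left_mono) auto
      also have "\<dots> = norm g * (m t * \<bar>P t\<bar>) / root_sech t" by simp
      also have "\<dots> \<le> norm g * (C * root_sech t) / root_sech t"
        using P(4)[of t] root_sech_pos[of t] by (intro divide_right_mono mult_left_mono) auto
      finally show ?thesis using root_sech_pos[of t] by (simp add: mult.commute)
    qed
  qed (rule that)
  show ?thesis
  proof (rule that[OF E(1)])
    fix g t
    show "apply_bcontfun (E g) 0 = 0" by (simp add: E)
    have eq: "root_sech t * apply_bcontfun (E g) t = m t * ?F g t" for t using root_sech_pos[of t] by (simp add: E)
    have "((\<lambda>t. m t * ?F g t) has_real_derivative a t * (m t * ?F g t) + root_sech t * apply_bcontfun g t) (at t)"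
      by (rule derivative_eq_intros m(1) F_deriv)+ (use m(2)[of t] in \<open>simp add: field_simps\<close>)
    then show "((\<lambda>t. root_sech t * apply_bcontfun (E g) t) has_real_derivative
         a t * (root_sech t * apply_bcontfun (E g) t) + root_sech t * apply_bcontfun g t) (at t)" by (simp only: eq)
  qed
qed

text \<open>\<open>I g\<close> is the primitive vanishing at -\<infinity>. Along the times -n both b
  P + F and b P are monotone and bounded below, so their difference F converges, and subtracting the
  limit gives \<open>I g\<close>.\<close>

lemma improper_integral_operator:
  fixes \<psi> P P' :: "real \<Rightarrow> real"
  assumes \<psi>: "continuous_on UNIV \<psi>" "\<And>t. 0 \<le> \<psi> t"
    and P: "\<And>t. (P has_real_derivative P' t) (at t)" "\<And>t. 0 \<le> P t" "\<And>t. \<psi> t \<le> P' t"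
  obtains I :: "(real \<Rightarrow>\<^sub>C real) \<Rightarrow> real \<Rightarrow> real" where
    "\<And>g t. (I g has_real_derivative \<psi> t * apply_bcontfun g t) (at t)" "\<And>g t. \<bar>I g t\<bar> \<le> norm g * P t"
    "\<And>g h t. I (g + h) t = I g t + I h t" "\<And>c g t. I (c *\<^sub>R g) t = c * I g t"
proof -
  let ?F = "\<lambda>g. primitive (\<lambda>t. \<psi> t * apply_bcontfun g t)"
  note ch = continuous_bcontfun_mult[OF \<psi>(1)]
  note F_deriv = primitive_deriv[OF ch]
  have F_bound: "\<bar>?F g t - ?F g s\<bar> \<le> norm g * (P t - P s)" if "s \<le> t" for g s t
    by (rule abs_diff_le_by_derivative[OF F_deriv P(1) \<psi>(2) P(3) bounded_bcontfun that])
  have conv: "convergent (\<lambda>n. ?F g (- real n))" for g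
  proof -
    let ?b = "norm g"
    have P_mono: "P s \<le> P t" if "s \<le> t" for s t
      by (rule DERIV_nonneg_imp_nondecreasing[OF that]) (use P(1,3) \<psi>(2) order_trans in blast)
    have dec: "decseq (\<lambda>n. ?b * P (- real n) + ?F g (- real n))" "decseq (\<lambda>n. ?b * P (- real n))"
    proof -
      show "decseq (\<lambda>n. ?b * P (- real n) + ?F g (- real n))"
      proof (rule decseq_SucI)
        fix n
        show "?b * P (- real (Suc n)) + ?F g (- real (Suc n)) \<le> ?b * P (- real n) + ?F g (- real n)"
          using F_bound[of "- real (Suc n)" "- real n" g] by (simp add: algebra_simps abs_le_iff)
      qed
      show "decseq (\<lambda>n. ?b * P (- real n))"
        by (rule decseq_SucI) (auto intro!: mult_left_mono P_mono)
    qed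
    have "- (?b * P 0) \<le> ?b * P (- real n) + ?F g (- real n)" for n
    proof -
      have "\<bar>?F g (- real n)\<bar> \<le> ?b * P 0 - ?b * P (- real n)"
        using F_bound[of "- real n" 0 g] by (simp add: right_diff_distrib)
      moreover have "0 \<le> ?b * P (- real n)" using P(2) by simp
      ultimately show ?thesis by linarith
    qed
    then have "\<forall>n. - (?b * P 0) \<le> ?b * P (- real n) + ?F g (- real n)" ..
    from decseq_convergent[OF dec(1) this] have "convergent (\<lambda>n. ?b * P (- real n) + ?F g (- real n))"
      using convergentI by blast
    moreover have "\<forall>n. 0 \<le> ?b * P (- real n)" using P(2) by simp
    from decseq_convergent[OF dec(2) this] have "convergent (\<lambda>n. ?b * P (- real n))"
      using convergentI by blast
    ultimately have "convergent (\<lambda>n. (?b * P (- real n) + ?F g (- real n)) - ?b * P (- real n))"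
      by (rule convergent_diff)
    then show ?thesis by simp
  qed
  define I where "I g t = ?F g t - lim (\<lambda>n. ?F g (- real n))" for g t
  have I_lim: "(\<lambda>n. ?F g t - ?F g (- real n)) \<longlonglongrightarrow> I g t" for g t
    unfolding I_def using conv[of g] by (intro tendsto_intros) (simp add: convergent_LIMSEQ_iff)
  show ?thesis
  proof (rule that[of I])
    show "(I g has_real_derivative \<psi> t * apply_bcontfun g t) (at t)" for g t
      unfolding I_def by (rule derivative_eq_intros F_deriv)+ auto
    show "\<bar>I g t\<bar> \<le> norm g * P t" for g t
    proof (rule LIMSEQ_le_const2[OF tendsto_rabs[OF I_lim]], intro exI allI impI)
      fix n assume "n \<ge> nat \<lceil>- t\<rceil>"
      then have "- real n \<le> t" by linarith
      then have "\<bar>?F g t - ?F g (- real n)\<bar> \<le> norm g * (P t - P (- real n))" by (rule F_bound)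
      also have "\<dots> \<le> norm g * P t" using P(2)[of "- real n"] by (intro mult_left_mono) auto
      finally show "\<bar>?F g t - ?F g (- real n)\<bar> \<le> norm g * P t" .
    qed
    have F_add: "?F (g + h) t = ?F g t + ?F h t" for g h t
      using primitive_linear(1)[OF ch ch, of g h t] by (simp add: algebra_simps)
    have F_scale: "?F (c *\<^sub>R g) t = c * ?F g t" for c g t
      using primitive_linear(2)[OF ch ch, of c g t] by (simp add: algebra_simps)
    show "I (g + h) t = I g t + I h t" for g h t
    proof (rule LIMSEQ_unique[OF I_lim])
      show "(\<lambda>n. ?F (g + h) t - ?F (g + h) (- real n)) \<longlonglongrightarrow> I g t + I h t"
        using tendsto_add[OF I_lim[of g t] I_lim[of h t]] unfolding F_add by (simp add: algebra_simps)
    qed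
    show "I (c *\<^sub>R g) t = c * I g t" for c g t
    proof (rule LIMSEQ_unique[OF I_lim])
      show "(\<lambda>n. ?F (c *\<^sub>R g) t - ?F (c *\<^sub>R g) (- real n)) \<longlonglongrightarrow> c * I g t"
        using tendsto_mult[OF tendsto_const[of c] I_lim[of g t]] unfolding F_scale by (simp add: algebra_simps)
    qed
  qed
qed

text \<open>The equation of the imaginary part of V. Its homogeneous solution exp (- 2 t) cosh t
  blows up at -\<infinity>, so the solution has to be integrated from there; at +\<infinity> it
  decays like exp (- t), faster than the weight. Hence there is neither freedom nor
  obstruction.\<close>

lemma weighted_inverse_tanh_minus_2:
  obtains E :: "(real \<Rightarrow>\<^sub>C real) \<Rightarrow> real \<Rightarrow>\<^sub>C real" where "bounded_linear E"
    "\<And>g t. ((\<lambda>t. root_sech t * apply_bcontfun (E g) t) has_real_derivative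
         (tanh t - 2) * (root_sech t * apply_bcontfun (E g) t) + root_sech t * apply_bcontfun g t) (at t)"
proof -
  \<comment> \<open>The weight divided by the homogeneous solution exp (- 2 t) cosh t. The factor of
    the weight in the solution is then the primitive divided by \<psi> itself.\<close>
  define \<psi> where "\<psi> t = root_sech t ^ 3 * exp (2 * t)" for t
  have c\<psi>: "continuous_on UNIV \<psi>" unfolding \<psi>_def by (intro continuous_intros continuous_root_sech)
  \<comment> \<open>Since 4 - 3 tanh t > 1, the derivative of 2 \<psi> exceeds \<psi>. So 2 \<psi>
    majorizes the primitive, and the quotient is bounded by 2.\<close>
  have P: "((\<lambda>t. 2 * \<psi> t) has_real_derivative \<psi> t * (4 - 3 * tanh t)) (at t)" for t
    unfolding \<psi>_def by (rule derivative_eq_intros root_sech_deriv refl)+ (simp add: algebra_simps power3_eq_cube power2_eq_square)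
  have \<psi>0: "\<psi> t > 0" for t using root_sech_pos by (simp add: \<psi>_def)
  have le: "\<psi> t \<le> \<psi> t * (4 - 3 * tanh t)" for t
    using \<psi>0[of t] tanh_real_lt_1[of t] by simp
  obtain I where I: "\<And>g t. (I g has_real_derivative \<psi> t * apply_bcontfun g t) (at t)" "\<And>g t. \<bar>I g t\<bar> \<le> norm g * (2 * \<psi> t)"
    "\<And>g h t. I (g + h) t = I g t + I h t" "\<And>c g t. I (c *\<^sub>R g) t = c * I g t"
    by (rule improper_integral_operator[OF c\<psi> _ P _ le]) (use \<psi>0 in \<open>auto simp: less_imp_le\<close>)
  have cI: "continuous_on UNIV (I g)" for g
    using I(1) by (meson DERIV_isCont continuous_at_imp_continuous_on)
  obtain E where E: "bounded_linear E" "\<And>g t. apply_bcontfun (E g) t = I g t / \<psi> t"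
  proof (rule bcontfun_operator[where S="\<lambda>g t. I g t / \<psi> t" and C=2])
    show "continuous_on UNIV (\<lambda>t. I g t / \<psi> t)" for g
      by (intro continuous_intros continuous_root_sech c\<psi> cI) (metis root_sech_pos \<psi>0 less_irrefl)+
    show "\<bar>I g t / \<psi> t\<bar> \<le> 2 * norm g" for g t
      using I(2)[of g t] \<psi>0[of t] root_sech_pos[of t] by (simp add: abs_mult field_simps)
  qed (simp_all add: I(3,4) add_divide_distrib)
  show ?thesis
  proof (rule that[OF E(1)])
    fix g t
    have eq: "root_sech t * apply_bcontfun (E g) t = (root_sech t / \<psi> t) * I g t" for t by (simp add: E)
    have p: "\<psi> t \<noteq> 0" using \<psi>0[of t] by simp
    have d\<psi>: "(\<psi> has_real_derivative \<psi> t * (2 - 3/2 * tanh t)) (at t)"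
      using DERIV_cmult[OF P[of t], of "1/2"] by (simp add: algebra_simps)
    have "((\<lambda>t. root_sech t / \<psi> t * I g t) has_real_derivative (tanh t - 2) * (root_sech t / \<psi> t * I g t)
        + root_sech t * apply_bcontfun g t) (at t)"
      by (rule derivative_eq_intros root_sech_deriv d\<psi> I(1) refl p)+ (use p in \<open>simp add: field_simps\<close>)
    then show "((\<lambda>t. root_sech t * apply_bcontfun (E g) t) has_real_derivative
         (tanh t - 2) * (root_sech t * apply_bcontfun (E g) t) + root_sech t * apply_bcontfun g t) (at t)" by (simp only: eq)
  qed
qed

text \<open>The homogeneous solution sech^2 decays faster than the weight at both ends, so the value
  at one point can be prescribed. The integrand to be majorized is cosh t / root_sech t, and
  differentiating sinh t / root_sech t gives this plus a nonnegative term.\<close>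

lemma weighted_inverse_minus_2_tanh:
  obtains E :: "(real \<Rightarrow>\<^sub>C real) \<Rightarrow> real \<Rightarrow>\<^sub>C real" where "bounded_linear E" "\<And>g. apply_bcontfun (E g) 0 = 0"
    "\<And>g t. ((\<lambda>t. root_sech t * apply_bcontfun (E g) t) has_real_derivative
         (- 2 * tanh t) * (root_sech t * apply_bcontfun (E g) t) + root_sech t * apply_bcontfun g t) (at t)"
proof (rule centered_operator[where m="\<lambda>t. root_sech t ^ 4" and a="\<lambda>t. - 2 * tanh t" and P="\<lambda>t. sinh t / root_sech t"
      and P'="\<lambda>t. (cosh t + sinh t * tanh t / 2) / root_sech t" and C=1])
  fix t
  have o: "root_sech t \<noteq> 0" "root_sech t > 0" using root_sech_pos[of t] by auto
  show "((\<lambda>t. root_sech t ^ 4) has_real_derivative - 2 * tanh t * root_sech t ^ 4) (at t)"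
    by (rule derivative_eq_intros root_sech_deriv refl)+ (simp add: algebra_simps eval_nat_numeral)
  show "((\<lambda>t. sinh t / root_sech t) has_real_derivative (cosh t + sinh t * tanh t / 2) / root_sech t) (at t)"
    by (rule derivative_eq_intros root_sech_deriv refl o)+ (use o in \<open>simp add: field_simps\<close>)
  have "sinh t * tanh t \<ge> 0" using cosh_real_pos[of t] by (simp add: tanh_def)
  moreover have "root_sech t / root_sech t ^ 4 = cosh t / root_sech t"
    using root_sech_sq[of t] o by (simp add: field_simps eval_nat_numeral)
  ultimately show "root_sech t / root_sech t ^ 4 \<le> (cosh t + sinh t * tanh t / 2) / root_sech t"
    using o by (simp add: divide_right_mono)
  have "root_sech t ^ 4 * \<bar>sinh t / root_sech t\<bar> = root_sech t * \<bar>root_sech t ^ 2 * sinh t\<bar>"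
    using o by (simp add: abs_mult eval_nat_numeral)
  also have "\<dots> \<le> root_sech t * 1" unfolding root_sech_sq_sinh using o tanh_real_bounds[of t] by (intro mult_left_mono) auto
  finally show "root_sech t ^ 4 * \<bar>sinh t / root_sech t\<bar> \<le> 1 * root_sech t" by simp
qed (use root_sech_pos root_sech_nz that in auto)

text \<open>Here the homogeneous solution is sech. The factor 2 in \<open>P\<close> pays for the
  negative term that arises when \<open>root_sech\<close> is differentiated, because sinh t tanh t
  \<le> cosh t.\<close>

lemma weighted_inverse_minus_tanh:
  obtains E :: "(real \<Rightarrow>\<^sub>C real) \<Rightarrow> real \<Rightarrow>\<^sub>C real" where "bounded_linear E" "\<And>g. apply_bcontfun (E g) 0 = 0"
    "\<And>g t. ((\<lambda>t. root_sech t * apply_bcontfun (E g) t) has_real_derivative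
         (- tanh t) * (root_sech t * apply_bcontfun (E g) t) + root_sech t * apply_bcontfun g t) (at t)"
proof (rule centered_operator[where m="\<lambda>t. root_sech t ^ 2" and a="\<lambda>t. - tanh t" and P="\<lambda>t. 2 * (sinh t * root_sech t)"
      and P'="\<lambda>t. 2 * cosh t * root_sech t - sinh t * tanh t * root_sech t" and C=2])
  fix t
  have o: "root_sech t \<noteq> 0" "root_sech t > 0" using root_sech_pos[of t] by auto
  show "((\<lambda>t. root_sech t ^ 2) has_real_derivative - tanh t * root_sech t ^ 2) (at t)"
    by (rule derivative_eq_intros root_sech_deriv refl)+ (simp add: algebra_simps eval_nat_numeral)
  show "((\<lambda>t. 2 * (sinh t * root_sech t)) has_real_derivative 2 * cosh t * root_sech t - sinh t * tanh t * root_sech t) (at t)"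
    by (rule derivative_eq_intros root_sech_deriv refl o)+ (simp add: algebra_simps)
  have "sinh t * tanh t = tanh t ^ 2 * cosh t" using cosh_real_pos[of t] by (simp add: tanh_def power2_eq_square)
  moreover have "tanh t ^ 2 * cosh t \<le> 1 * cosh t"
  proof (rule mult_right_mono)
    have "0 \<le> root_sech t ^ 4" by simp
    then show "tanh t ^ 2 \<le> 1" unfolding root_sech_4 by simp
  qed (simp add: cosh_real_pos less_imp_le)
  ultimately have "sinh t * tanh t \<le> cosh t" by simp
  moreover have "root_sech t / root_sech t ^ 2 = cosh t * root_sech t"
    using root_sech_sq[of t] o by (simp add: field_simps eval_nat_numeral)
  ultimately show "root_sech t / root_sech t ^ 2 \<le> 2 * cosh t * root_sech t - sinh t * tanh t * root_sech t"
    using o mult_right_mono[of "sinh t * tanh t" "cosh t" "root_sech t"] by simp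
  have "root_sech t ^ 2 * \<bar>2 * (sinh t * root_sech t)\<bar> = 2 * root_sech t * \<bar>root_sech t ^ 2 * sinh t\<bar>"
    using o by (simp add: abs_mult eval_nat_numeral)
  also have "\<dots> \<le> 2 * root_sech t * 1" unfolding root_sech_sq_sinh using o tanh_real_bounds[of t] by (intro mult_left_mono) auto
  finally show "root_sech t ^ 2 * \<bar>2 * (sinh t * root_sech t)\<bar> \<le> 2 * root_sech t" by simp
qed (use root_sech_pos root_sech_nz that in auto)

lemma constant_if_derivative_0:
  assumes "\<And>t. (f has_real_derivative 0) (at t)"
  shows "f t = f (0::real)"
  using DERIV_isconst_all assms by blast

lemma tanh_bound: "1 + tanh t \<le> 2 * root_sech t" if "t \<le> 0"
proof -
  have "1 + tanh t = exp t / cosh t"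
    using cosh_real_pos[of t] cosh_plus_sinh[of t] by (simp add: tanh_def field_simps)
  also have "\<dots> = root_sech t * (exp t * root_sech t)"
    using cosh_real_pos[of t] by (simp add: root_sech_def)
  also have "\<dots> \<le> root_sech t * (1 * 1)" using that root_sech_pos[of t] root_sech_le_1[of t]
      by (intro mult_left_mono mult_mono) auto
  finally show ?thesis using root_sech_pos[of t] by simp
qed

text \<open>The primitive vanishing at \<open>-\<infinity>\<close> decays at \<open>+\<infinity>\<close> only if the integral over the whole line is zero;
  subtracting a multiple of the derivative \<open>root_sech\<^sup>4\<close> of \<open>tanh\<close> achieves this.\<close>

lemma weighted_inverse_0_modulo_range:
  obtains E :: "(real \<Rightarrow>\<^sub>C real) \<Rightarrow> real \<Rightarrow>\<^sub>C real" and T :: "(real \<Rightarrow>\<^sub>C real) \<Rightarrow> real"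
  where "bounded_linear E" "bounded_linear T"
    "\<And>g t. ((\<lambda>t. root_sech t * apply_bcontfun (E g) t) has_real_derivative
         root_sech t * apply_bcontfun g t - T g * root_sech t ^ 4) (at t)"
proof -
  \<comment> \<open>The derivative 2 exp (t / 2) dominates 2 exp (- |t| / 2), hence the weight, for
    either sign of t. For t \<le> 0 \<open>P\<close> is in turn bounded by a multiple of the weight,
    which gives the decay at -\<infinity>.\<close>
  define P where "P t = 4 * exp (t / 2)" for t :: real
  have P: "(P has_real_derivative P t / 2) (at t)" for t
    unfolding P_def[abs_def] by (auto intro!: derivative_eq_intros)
  have P0: "0 \<le> P t" for t by (simp add: P_def)
  have omP: "root_sech t \<le> P t / 2" for t
  proof -
    have "exp (- \<bar>t\<bar> / 2) \<le> exp (t / 2)" by simp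
    then show ?thesis using root_sech_upper[of t] unfolding P_def by linarith
  qed
  have Pom: "P t \<le> 4 * root_sech t" if "t \<le> 0" for t using root_sech_lower[of t] that by (simp add: P_def)
  obtain I where I: "\<And>g t. (I g has_real_derivative root_sech t * apply_bcontfun g t) (at t)" "\<And>g t. \<bar>I g t\<bar> \<le> norm g * P t"
    "\<And>g h t. I (g + h) t = I g t + I h t" "\<And>c g t. I (c *\<^sub>R g) t = c * I g t"
    by (rule improper_integral_operator[OF continuous_root_sech _ P P0 omP]) (use root_sech_pos in \<open>auto simp: less_imp_le\<close>)
  \<comment> \<open>Time reversal: the primitive from +\<infinity> is the one from -\<infinity> of
    the reflected function.\<close>
  define R :: "(real \<Rightarrow>\<^sub>C real) \<Rightarrow> real \<Rightarrow>\<^sub>C real" where "R g = Bcontfun (\<lambda>t. apply_bcontfun g (- t))" for g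
  have R: "apply_bcontfun (R g) t = apply_bcontfun g (- t)" for g t
  proof -
    have "continuous_on UNIV (\<lambda>t. apply_bcontfun g (- t))"
      by (rule continuous_on_compose2[OF continuous_on_apply_bcontfun[of UNIV g]]) (auto intro!: continuous_intros)
    then show ?thesis unfolding R_def by (subst apply_Bcontfun[of _ "norm g"]) (auto simp: bounded_bcontfun)
  qed
  have R_lin: "R (g + h) = R g + R h" "R (c *\<^sub>R g) = c *\<^sub>R R g" for g h c
    by (auto intro!: bcontfun_eqI simp: R)
  have R_norm: "norm (R g) \<le> norm g" for g by (rule norm_bound) (simp add: R bounded_bcontfun)
  have I_deriv': "((\<lambda>t. I (R g) (- t)) has_real_derivative - (root_sech t * apply_bcontfun g t)) (at t)" for g t
  proof -
    have "((\<lambda>t. I (R g) (- t)) has_real_derivative (root_sech (- t) * apply_bcontfun (R g) (- t)) * (- 1)) (at t)"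
      by (rule DERIV_chain2[OF I(1)]) (auto intro!: derivative_eq_intros)
    then show ?thesis by (simp add: R root_sech_minus)
  qed
  \<comment> \<open>Half of the integral of \<open>root_sech t * g t\<close> over the line; the half
    because sech^2 has integral 2.\<close>
  define T where "T g = (I g 0 + I (R g) 0) / 2" for g
  have total: "I g t + I (R g) (- t) = 2 * T g" for g t
  proof -
    have "((\<lambda>t. I g t + I (R g) (- t)) has_real_derivative 0) (at t)" for t
      by (rule derivative_eq_intros I(1) I_deriv')+ simp
    from constant_if_derivative_0[OF this, of t] show ?thesis by (simp add: T_def)
  qed
  have T_lin: "T (g + h) = T g + T h" "T (c *\<^sub>R g) = c * T g" for g h c
    by (simp_all add: T_def I(3,4) R_lin field_simps)
  have IRb: "\<bar>I (R g) t\<bar> \<le> norm g * P t" for g t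
    using I(2)[of "R g" t] mult_right_mono[OF R_norm P0, of g t] by simp
  have T_bound: "\<bar>T g\<bar> \<le> 4 * norm g" for g
    using I(2)[of g 0] IRb[of g 0] by (simp add: T_def P_def)
  have T_bl: "bounded_linear T"
    by (rule bounded_linear_intro[where K=4]) (use T_lin T_bound in \<open>auto simp: mult.commute\<close>)
  let ?S = "\<lambda>g t. (I g t - T g * (1 + tanh t)) / root_sech t"
  have cI: "continuous_on UNIV (I g)" for g
    using I(1) by (meson DERIV_isCont continuous_at_imp_continuous_on)
  \<comment> \<open>Each half line is estimated from its own end: for t > 0 the same expression is
    written through the integral from t to +\<infinity> and 1 - tanh t.\<close>
  have bound: "\<bar>I g t - T g * (1 + tanh t)\<bar> \<le> 12 * norm g * root_sech t" for g t
  proof -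
    have aux: "\<bar>J\<bar> + \<bar>T g\<bar> * \<bar>1 + tanh s\<bar> \<le> 12 * norm g * root_sech s" if "s \<le> 0" "\<bar>J\<bar> \<le> norm g * P s" for s J
    proof -
      have "\<bar>J\<bar> \<le> norm g * (4 * root_sech s)" using that(2) mult_left_mono[OF Pom[OF that(1)], of "norm g"] by simp
      moreover have "\<bar>T g\<bar> * \<bar>1 + tanh s\<bar> \<le> (4 * norm g) * (2 * root_sech s)"
        using T_bound[of g] tanh_bound[OF that(1)] tanh_real_bounds[of s] by (intro mult_mono) auto
      ultimately show ?thesis by simp
    qed
    show ?thesis
    proof (cases "t \<le> 0")
      case True
      then show ?thesis using aux[OF True I(2)[of g t]] abs_triangle_ineq4[of "I g t" "T g * (1 + tanh t)"]
        by (simp add: abs_mult)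
    next
      case False
      then have t: "- t \<le> 0" by simp
      have "I g t - T g * (1 + tanh t) = T g * (1 + tanh (- t)) - I (R g) (- t)"
        using total[of g t] by (simp add: algebra_simps)
      then show ?thesis using aux[OF t IRb[of g "- t"]] abs_triangle_ineq4[of "T g * (1 + tanh (- t))" "I (R g) (- t)"]
        by (simp add: abs_mult root_sech_minus)
    qed
  qed
  obtain E where E: "bounded_linear E" "\<And>g t. apply_bcontfun (E g) t = ?S g t"
  proof (rule bcontfun_operator[where S="?S" and C=12])
    show "continuous_on UNIV (?S g)" for g
      by (intro continuous_intros continuous_root_sech cI continuous_tanh) (metis root_sech_pos less_irrefl)
    show "\<bar>?S g t\<bar> \<le> 12 * norm g" for g t
      using bound[of g t] root_sech_pos[of t] by (simp add: pos_divide_le_eq)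
  qed (simp_all add: I(3,4) T_lin diff_divide_distrib add_divide_distrib algebra_simps)
  show ?thesis
  proof (rule that[OF E(1) T_bl])
    fix g t
    have eq: "root_sech t * apply_bcontfun (E g) t = I g t - T g * (1 + tanh t)" for t using root_sech_pos[of t] by (simp add: E)
    have "((\<lambda>t. I g t - T g * (1 + tanh t)) has_real_derivative root_sech t * apply_bcontfun g t - T g * root_sech t ^ 4) (at t)"
      by (rule derivative_eq_intros I(1) tanh_deriv refl)+ simp
    then show "((\<lambda>t. root_sech t * apply_bcontfun (E g) t) has_real_derivative
         root_sech t * apply_bcontfun g t - T g * root_sech t ^ 4) (at t)" by (simp only: eq)
  qed
qed

text \<open>The linearization of the limiting system along its orbit \<open>(w\<^sup>2, s)\<close>, acting on the factor \<open>v\<close>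
  of a perturbation \<open>w v\<close>, where \<open>w = root_sech t\<close> and \<open>s = front t\<close>.\<close>

definition linearization :: "complex \<Rightarrow> real \<Rightarrow> real \<Rightarrow> phase \<Rightarrow> phase" where
  "linearization \<kappa> w s v = (Complex ((2 * s - 1) * Re (fst v) + 2 * w\<^sup>2 * snd v) (- (1 + 2 * s) * Im (fst v)),
      2 * w\<^sup>2 * Re (\<kappa> * fst v))"

text \<open>The imaginary part \<open>y\<close> decouples and is solved first. Times the weight,
  \<open>e\<close> is the variation of the conserved quantity X^2 + (2 Z - 1)^2 with X = Re V, so
  its equation contains forcing only. It eliminates x from the equation of \<open>z\<close>, and
  \<open>x\<close> then follows from \<open>z\<close>. The parameter, returned as the constant
  second component, is the number that makes the equation of \<open>e\<close> solvable.\<close>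

lemma linear_solution:
  assumes \<kappa>: "Re \<kappa> = - 1 / 2"
  obtains L :: "(real \<Rightarrow>\<^sub>C phase) \<Rightarrow> real \<Rightarrow>\<^sub>C (phase \<times> real)" where "bounded_linear L"
    "\<And>g t. snd (apply_bcontfun (L g) t) = snd (apply_bcontfun (L g) 0)"
    "\<And>g t. ((\<lambda>t. root_sech t *\<^sub>R fst (apply_bcontfun (L g) t)) has_vector_derivative
        root_sech t *\<^sub>R (linearization \<kappa> (root_sech t) (front t) (fst (apply_bcontfun (L g) t)) + apply_bcontfun g t
          - (of_real (snd (apply_bcontfun (L g) t) * root_sech t), 0))) (at t)"
proof -
  obtain OY where Y: "bounded_linear OY" "\<And>g t. ((\<lambda>t. root_sech t * apply_bcontfun (OY g) t) has_real_derivative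
         (tanh t - 2) * (root_sech t * apply_bcontfun (OY g) t) + root_sech t * apply_bcontfun g t) (at t)"
    by (rule weighted_inverse_tanh_minus_2) blast
  obtain OZ where Z: "bounded_linear OZ" "\<And>g. apply_bcontfun (OZ g) 0 = 0"
    "\<And>g t. ((\<lambda>t. root_sech t * apply_bcontfun (OZ g) t) has_real_derivative
         (- 2 * tanh t) * (root_sech t * apply_bcontfun (OZ g) t) + root_sech t * apply_bcontfun g t) (at t)"
    by (rule weighted_inverse_minus_2_tanh) blast
  obtain OX where X: "bounded_linear OX" "\<And>g. apply_bcontfun (OX g) 0 = 0"
    "\<And>g t. ((\<lambda>t. root_sech t * apply_bcontfun (OX g) t) has_real_derivative
         (- tanh t) * (root_sech t * apply_bcontfun (OX g) t) + root_sech t * apply_bcontfun g t) (at t)"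
    by (rule weighted_inverse_minus_tanh) blast
  obtain OE TE where E: "bounded_linear OE" "bounded_linear TE"
    "\<And>g t. ((\<lambda>t. root_sech t * apply_bcontfun (OE g) t) has_real_derivative
         root_sech t * apply_bcontfun g t - TE g * root_sech t ^ 4) (at t)"
    by (rule weighted_inverse_0_modulo_range) blast
  define bom where "bom = Bcontfun root_sech"
  define bth :: "real \<Rightarrow>\<^sub>C real" where "bth = Bcontfun tanh"
  have bom: "apply_bcontfun bom = root_sech" unfolding bom_def
    by (rule apply_Bcontfun[of _ 1]) (use continuous_root_sech root_sech_pos root_sech_le_1 in \<open>auto simp: less_imp_le\<close>)
  have bth: "apply_bcontfun bth = tanh" unfolding bth_def
    by (rule apply_Bcontfun[of _ 1]) (use continuous_tanh tanh_real_bounds in \<open>auto simp: abs_le_iff less_imp_le minus_le_iff\<close>)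
  define om2 where "om2 = bmult bom bom"
  have om2: "apply_bcontfun om2 = (\<lambda>t. root_sech t ^ 2)" by (simp add: om2_def apply_bmult bom power2_eq_square)
  have bm: "bounded_linear (bmult a :: (real \<Rightarrow>\<^sub>C real) \<Rightarrow> _)" for a
    by (rule bounded_bilinear.bounded_linear_right[OF bounded_bilinear_bmult])
  have l1: "bounded_linear (\<lambda>v::phase. Re (fst v))" and l2: "bounded_linear (\<lambda>v::phase. Im (fst v))"
      and l3: "bounded_linear (\<lambda>v::phase. snd v)"
    by (intro bounded_linear_compose[OF bounded_linear_Re] bounded_linear_compose[OF bounded_linear_Im]
        bounded_linear_fst bounded_linear_snd)+
  define G1 :: "(real \<Rightarrow>\<^sub>C phase) \<Rightarrow> _" where "G1 = bmap (\<lambda>v. Re (fst v))"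
  define G2 :: "(real \<Rightarrow>\<^sub>C phase) \<Rightarrow> _" where "G2 = bmap (\<lambda>v. Im (fst v))"
  define G3 :: "(real \<Rightarrow>\<^sub>C phase) \<Rightarrow> _" where "G3 = bmap (\<lambda>v. snd v)"
  have G: "bounded_linear G1" "bounded_linear G2" "bounded_linear G3"
    unfolding G1_def G2_def G3_def by (intro bounded_linear_bmap l1 l2 l3)+
  define y where "y g = OY (G2 g)" for g
  have bl_y: "bounded_linear y" unfolding y_def by (intro bounded_linear_compose[OF Y(1)] G)
  \<comment> \<open>Forcing of the z equation, including the coupling to the known \<open>y\<close>
    that a nonreal \<kappa> creates.\<close>
  define h where "h g = G3 g - (2 * Im \<kappa>) *\<^sub>R bmult om2 (y g)" for g
  have bl_h: "bounded_linear h" unfolding h_def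
    by (intro bounded_linear_sub G bounded_linear_compose[OF bounded_linear_scaleR_right] bounded_linear_compose[OF bm] bl_y)
  \<comment> \<open>Forcing of the conserved quantity: along the orbit its gradient is 2 sech in the
    direction of X and 4 (2 Z - 1) = - 4 tanh in that of Z.\<close>
  define k where "k g = 2 *\<^sub>R bmult om2 (G1 g) - 4 *\<^sub>R bmult bth (h g)" for g
  have bl_k: "bounded_linear k" unfolding k_def
    by (intro bounded_linear_sub G bounded_linear_compose[OF bounded_linear_scaleR_right] bounded_linear_compose[OF bm] bl_h)
  define e where "e g = OE (k g)" for g
  have bl_e: "bounded_linear e" unfolding e_def by (intro bounded_linear_compose[OF E(1)] bl_k)
  \<comment> \<open>The parameter contributes - \<delta> sech to the equation of the weighted x,
    hence - 2 \<delta> sech^2 to that of the weighted e. Matching this with the correction by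
    \<open>TE\<close> gives the factor 1/2.\<close>
  define \<delta> where "\<delta> g = (1/2) *\<^sub>R TE (k g)" for g
  have bl_\<delta>: "bounded_linear \<delta>" unfolding \<delta>_def
    by (intro bounded_linear_compose[OF bounded_linear_scaleR_right] bounded_linear_compose[OF E(2)] bl_k)
  \<comment> \<open>\<open>OZ\<close> gives the value 0 at time 0. This phase condition singles out
    one solution modulo the time derivative of the orbit, whose Z component at time 0 is - 1 /
    2.\<close>
  define z where "z g = OZ (h g - (1/2) *\<^sub>R e g)" for g
  have bl_z: "bounded_linear z" unfolding z_def
    by (intro bounded_linear_compose[OF Z(1)] bounded_linear_sub bl_h bounded_linear_compose[OF bounded_linear_scaleR_right] bl_e)
  have bl_0: "bounded_linear (\<lambda>g :: real \<Rightarrow>\<^sub>C real. apply_bcontfun g 0)"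
    by (rule bounded_linear_intro[where K=1]) (auto simp: bounded_bcontfun)
  \<comment> \<open>The multiple of \<open>bom\<close> adds the homogeneous solution sech, so that x
    = e / 2 at time 0; this is the relation between x, z and e at that time.\<close>
  define x where "x g = OX (2 *\<^sub>R bmult om2 (z g) - \<delta> g *\<^sub>R bom + G1 g) + (apply_bcontfun (e g) 0 / 2) *\<^sub>R bom" for g
  have bl_x: "bounded_linear x" unfolding x_def divide_inverse
    by (intro bounded_linear_add bounded_linear_sub bounded_linear_compose[OF X(1)] G bl_z bounded_linear_compose[OF bm]
        bounded_linear_compose[OF bounded_linear_scaleR_right] bounded_linear_compose[OF bounded_linear_scaleR_left] bl_\<delta>
        bounded_linear_compose[OF bounded_linear_mult_left] bounded_linear_compose[OF bl_0] bl_e)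
  define A B C :: "real \<Rightarrow> phase" where "A r = (of_real r, 0)" and "B r = (\<i> * of_real r, 0)" and "C r = (0, r)" for r
  have ABC: "bounded_linear A" "bounded_linear B" "bounded_linear C" unfolding A_def B_def C_def
    by (intro bounded_linear_Pair bounded_linear_zero bounded_linear_of_real bounded_linear_ident
        bounded_linear_compose[OF bounded_linear_mult_right])+
  define D :: "phase \<Rightarrow> phase \<times> real" where "D v = (v, 0)" for v
  define D' :: "real \<Rightarrow> phase \<times> real" where "D' r = (0, r)" for r
  have D: "bounded_linear D" "bounded_linear D'" unfolding D_def D'_def
    by (intro bounded_linear_Pair bounded_linear_zero bounded_linear_ident)+
  define L where "L g = bmap D (bmap A (x g) + bmap B (y g) + bmap C (z g)) + bmap D' (const_bcontfun (\<delta> g))" for g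
  have L: "bounded_linear L" unfolding L_def
    by (intro bounded_linear_add bounded_linear_compose[OF bounded_linear_bmap] ABC D bl_x bl_y bl_z bl_\<delta>
        bounded_linear_compose[OF bounded_linear_const_bcontfun])
  have Lapp: "apply_bcontfun (L g) t = ((Complex (apply_bcontfun (x g) t) (apply_bcontfun (y g) t), apply_bcontfun (z g)
      t), \<delta> g)" for g t
    unfolding L_def by (simp add: apply_bmap ABC D const_bcontfun.rep_eq)
      (simp add: A_def B_def C_def D_def D'_def complex_eq_iff zero_prod_def)
  show ?thesis
  proof (rule that[OF L])
    show "snd (apply_bcontfun (L g) t) = snd (apply_bcontfun (L g) 0)" for g t by (simp add: Lapp)
    fix g t
    let ?x = "apply_bcontfun (x g)" and ?y = "apply_bcontfun (y g)" and ?z = "apply_bcontfun (z g)" and ?e =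
        "apply_bcontfun (e g)"
    let ?g1 = "\<lambda>t. Re (fst (apply_bcontfun g t))" and ?g2 = "\<lambda>t. Im (fst (apply_bcontfun g t))" and ?g3 =
        "\<lambda>t. snd (apply_bcontfun g t)"
    have Ga: "apply_bcontfun (G1 g) = ?g1" "apply_bcontfun (G2 g) = ?g2" "apply_bcontfun (G3 g) = ?g3"
      by (simp_all add: G1_def G2_def G3_def apply_bmap l1 l2 l3)
    have ha: "apply_bcontfun (h g) t = ?g3 t - 2 * Im \<kappa> * root_sech t ^ 2 * ?y t" for t
      by (simp add: h_def apply_bmult om2 Ga)
    have dy: "((\<lambda>t. root_sech t * ?y t) has_real_derivative (tanh t - 2) * (root_sech t * ?y t) + root_sech t * ?g2 t)
        (at t)" for t
      using Y(2)[of "G2 g" t] by (simp add: y_def Ga)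
    have de: "((\<lambda>t. root_sech t * ?e t) has_real_derivative
        root_sech t * (2 * root_sech t ^ 2 * ?g1 t - 4 * tanh t * apply_bcontfun (h g) t) - 2 * \<delta> g * root_sech t ^ 4)
            (at t)" for t
      using E(3)[of "k g" t] by (simp add: e_def \<delta>_def k_def apply_bmult om2 bth Ga mult.assoc)
    have dz: "((\<lambda>t. root_sech t * ?z t) has_real_derivative
        - 2 * tanh t * (root_sech t * ?z t) + root_sech t * (apply_bcontfun (h g) t - ?e t / 2)) (at t)" for t
      using Z(3)[of "h g - (1/2) *\<^sub>R e g" t] by (simp add: z_def)
    have dx: "((\<lambda>t. root_sech t * ?x t) has_real_derivative
        - tanh t * (root_sech t * ?x t) + root_sech t * (2 * root_sech t ^ 2 * ?z t - \<delta> g * root_sech t + ?g1 t)) (at t)" for t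
    proof -
      let ?q = "2 *\<^sub>R bmult om2 (z g) - \<delta> g *\<^sub>R bom + G1 g"
      have "((\<lambda>t. root_sech t * apply_bcontfun (OX ?q) t + ?e 0 / 2 * (root_sech t * root_sech t)) has_real_derivative
         ((- tanh t) * (root_sech t * apply_bcontfun (OX ?q) t) + root_sech t * apply_bcontfun ?q t)
           + ?e 0 / 2 * (- (tanh t * root_sech t / 2) * root_sech t + - (tanh t * root_sech t / 2) * root_sech t)) (at t)"
        by (intro DERIV_add X(3) DERIV_cmult DERIV_mult root_sech_deriv)
      moreover have "root_sech t * ?x t = root_sech t * apply_bcontfun (OX ?q) t + ?e 0 / 2 * (root_sech t * root_sech t)" for t
        by (simp add: x_def bom algebra_simps)
      ultimately show ?thesis by (simp add: apply_bmult om2 bom Ga algebra_simps)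
    qed
    have x0: "?x 0 = ?e 0 / 2" by (simp add: x_def X(2) bom root_sech_0)
    have z0: "?z 0 = 0" by (simp add: z_def Z(2))
    \<comment> \<open>\<open>e\<close> was constructed from its own equation; \<open>r\<close>
      measures its deviation from the variation it stands for. From r' = - 2 tanh r the product r
      cosh^2 is constant, and it vanishes at time 0.\<close>
    define r where "r t = 2 * root_sech t ^ 2 * (root_sech t * ?x t) - 4 * tanh t * (root_sech t * ?z t)
        - root_sech t * ?e t" for t
    have dr: "(r has_real_derivative - 2 * tanh t * r t) (at t)" for t
    proof -
      have "(r has_real_derivative
          (2 * (2 * root_sech t * (- (tanh t * root_sech t / 2))) * (root_sech t * ?x t)
              + 2 * root_sech t ^ 2 * (- tanh t * (root_sech t * ?x t) + root_sech t * (2 * root_sech t ^ 2 * ?z t -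
              \<delta> g * root_sech t + ?g1 t)))
          - (4 * root_sech t ^ 4 * (root_sech t * ?z t) + 4 * tanh t * (- 2 * tanh t * (root_sech t * ?z t)
              + root_sech t * (apply_bcontfun (h g) t - ?e t / 2)))
          - (root_sech t * (2 * root_sech t ^ 2 * ?g1 t - 4 * tanh t * apply_bcontfun (h g) t)
              - 2 * \<delta> g * root_sech t ^ 4)) (at t)"
        unfolding r_def by (rule derivative_eq_intros dx dz de root_sech_deriv tanh_deriv refl)+ (simp add: algebra_simps)
      then show ?thesis by (rule DERIV_cong) (simp add: r_def field_simps eval_nat_numeral)
    qed
    have "((\<lambda>t. r t * cosh t ^ 2) has_real_derivative 0) (at t)" for t
    proof -
      have "((\<lambda>t. r t * cosh t ^ 2) has_real_derivative (- 2 * tanh t * r t) * cosh t ^ 2 + (2 * cosh t * sinh t) * r t) (at t)"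
        by (rule derivative_eq_intros dr refl)+ (simp add: algebra_simps)
      then show ?thesis by (rule DERIV_cong) (use cosh_real_pos[of t] in \<open>simp add: tanh_def field_simps power2_eq_square\<close>)
    qed
    from constant_if_derivative_0[OF this, of t] have "r t = 0"
      using cosh_real_pos[of t] by (simp add: r_def x0 z0 root_sech_0)
    then have e_eq: "root_sech t * ?e t = 2 * root_sech t ^ 2 * (root_sech t * ?x t) - 4 * tanh t * (root_sech t * ?z t)"
        by (simp add: r_def)
    have th: "tanh t = 1 - 2 * front t" by (simp add: front_def field_simps)
    let ?l = "linearization \<kappa> (root_sech t) (front t) (fst (apply_bcontfun (L g) t)) + apply_bcontfun g t -
        (of_real (snd (apply_bcontfun (L g) t) * root_sech t), 0)"
    let ?dx = "- tanh t * (root_sech t * ?x t) + root_sech t * (2 * root_sech t ^ 2 * ?z t - \<delta> g * root_sech t + ?g1 t)"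
    let ?dy = "(tanh t - 2) * (root_sech t * ?y t) + root_sech t * ?g2 t"
    let ?dz = "- 2 * tanh t * (root_sech t * ?z t) + root_sech t * (apply_bcontfun (h g) t - ?e t / 2)"
    have dz_eq: "?dz = root_sech t * (2 * root_sech t ^ 2 * (- (?x t) / 2 - Im \<kappa> * ?y t) + ?g3 t)"
      using e_eq by (simp add: ha algebra_simps)
    have "((\<lambda>t. A (root_sech t * ?x t) + B (root_sech t * ?y t) + C (root_sech t * ?z t)) has_vector_derivative A ?dx +
        B ?dy + C ?dz) (at t)"
      using dx[of t] dy[of t] dz[of t] unfolding has_real_derivative_iff_has_vector_derivative
      by (intro has_vector_derivative_add bounded_linear.has_vector_derivative[OF ABC(1)]
          bounded_linear.has_vector_derivative[OF ABC(2)] bounded_linear.has_vector_derivative[OF ABC(3)])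
    moreover have "A ?dx + B ?dy + C ?dz = root_sech t *\<^sub>R ?l"
      unfolding dz_eq
      by (simp add: A_def B_def C_def linearization_def Lapp th \<kappa> prod_eq_iff complex_eq_iff algebra_simps)
    moreover have "A (root_sech t * ?x t) + B (root_sech t * ?y t) + C (root_sech t * ?z t)
        = root_sech t *\<^sub>R fst (apply_bcontfun (L g) t)" for t
      by (simp add: A_def B_def C_def Lapp complex_eq_iff)
    ultimately show "((\<lambda>t. root_sech t *\<^sub>R fst (apply_bcontfun (L g) t)) has_vector_derivative root_sech t *\<^sub>R ?l) (at t)"
      by simp
  qed
qed

subsection \<open>The connecting orbit of the normal form\<close>

lemma norm_fst_le': "norm (fst z) \<le> norm z" and norm_snd_le': "norm (snd z) \<le> norm z"
  by (cases z; simp add: norm_fst_le norm_snd_le)+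

text \<open>For an orbit \<open>(root_sech ^ 2, front) + root_sech * v\<close> every term of the
  equation for v contains a factor \<open>root_sech\<close>. Dividing it out leaves a smooth
  function of the bounded quantities \<open>root_sech\<close>, \<open>front\<close>, v and the
  parameters in which time no longer occurs, so the problem becomes an instance of
  \<open>smooth_fixed_point\<close>.\<close>

theorem connecting_orbit:
  fixes f :: "param \<times> phase \<Rightarrow> phase" and m :: "param \<times> real \<Rightarrow> real"
  assumes "r > 0" and f: "smooth_on (ball 0 r \<times> ball 0 10) f" and m: "smooth_on (ball 0 r \<times> ball 0 2) m"
    and f0: "\<And>d b V Z. norm (d, b, 0::real) < r \<Longrightarrow> norm (V, Z) < 10 \<Longrightarrow>
        f ((d, b, 0), (V, Z)) = ((- of_real (1 + d) + \<i> * of_real b) * V + 2 * of_real Z * cnj V, Re (\<kappa> * V\<^sup>2))"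
    and fax: "\<And>q Z. norm q < r \<Longrightarrow> \<bar>Z\<bar> < 2 \<Longrightarrow> f (q, (0, Z)) = (0, snd (snd q) * (Z * (1 - Z)) * m (q, Z))"
    and \<kappa>: "Re \<kappa> = - 1 / 2" and "\<eta> > 0"
  obtains r' D where "r' > 0" "smooth_on (ball 0 r') D" "D 0 = 0"
    "\<And>p. p \<in> ball 0 r' \<Longrightarrow> \<bar>D p\<bar> \<le> \<eta>" "\<And>p. p \<in> ball 0 r' \<Longrightarrow> (D p, p) \<in> ball 0 r"
    "\<And>p. p \<in> ball 0 r' \<Longrightarrow> \<exists>w. (\<forall>t. (w has_vector_derivative f ((D p, p), w t)) (at t)) \<and> (\<forall>t. norm (w t) < 4) \<and>
        (w \<longlongrightarrow> (0, 1)) at_bot \<and> (w \<longlongrightarrow> (0, 0)) at_top \<and> fst (w 0) \<noteq> 0"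
proof -
  \<comment> \<open>The radii keep the points inserted into f in its domain: 2 + 2 * 3 < 10.\<close>
  define D0 :: "(real \<times> (param \<times> (real \<times> phase))) set" where "D0 = ball 0 2 \<times> (ball 0 r \<times> (ball 0 2 \<times> ball 0 3))"
  have D0: "open D0" by (auto simp: D0_def intro!: open_Times)
  \<comment> \<open>Subtracting the field on the axis makes the difference vanish at weight 0, so
    Hadamard's lemma gives a smooth quotient \<open>k\<close>. The axis part is divisible for
    another reason: along the front it contains Z (1 - Z), a multiple of the fourth power of the
    weight.\<close>
  define G where "G z = f (fst (snd z), (0, fst (snd (snd z))) + fst z *\<^sub>R snd (snd (snd z))) - f (fst (snd z), (0,
      fst (snd (snd z))))"
    for z :: "real \<times> (param \<times> (real \<times> phase))"
  have in10: "(0, s) + w *\<^sub>R v \<in> ball (0::phase) 10" if "\<bar>s\<bar> < 2" "\<bar>w\<bar> < 2" "norm v < 3" for s w :: real and v :: phase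
  proof -
    have "norm ((0, s) + w *\<^sub>R v) \<le> norm (0::complex, s) + norm (w *\<^sub>R v)" by (rule norm_triangle_ineq)
    also have "norm (w *\<^sub>R v) \<le> 2 * 3" using mult_mono[of "\<bar>w\<bar>" 2 "norm v" 3] that by simp
    finally show ?thesis using that by (simp add: norm_Pair)
  qed
  have G: "smooth_on D0 G" unfolding G_def
  proof (intro smooth_on_arith(2) D0 smooth_on_compose[OF f])
    show "open (ball (0::param) r \<times> ball (0::phase) 10)" by (intro open_Times open_ball)
    then show "open (ball (0::param) r \<times> ball (0::phase) 10)" .
    show "smooth_on D0 (\<lambda>z. (fst (snd z), (0, fst (snd (snd z))) + fst z *\<^sub>R snd (snd (snd z))))"
      "smooth_on D0 (\<lambda>z. (fst (snd z), 0, fst (snd (snd z))))"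
      by (intro smooth_intros D0)+
    fix z assume z: "z \<in> D0"
    show "(fst (snd z), (0, fst (snd (snd z))) + fst z *\<^sub>R snd (snd (snd z))) \<in> ball 0 r \<times> ball 0 10"
      using z in10[of "fst (snd (snd z))" "fst z" "snd (snd (snd z))"] by (auto simp: D0_def)
    show "(fst (snd z), 0, fst (snd (snd z))) \<in> ball 0 r \<times> ball 0 10"
    proof -
      obtain a q c v where "z = (a, q, c, v)" by (metis surj_pair)
      then show ?thesis using z by (simp add: D0_def) (simp add: zero_prod_def dist_Pair_Pair)
    qed
  qed
  obtain k where k: "smooth_on D0 k" "\<And>s x. (s, x) \<in> D0 \<Longrightarrow> G (s, x) = s *\<^sub>R k (s, x)"
  proof (rule smooth_on_division[OF G D0])
    fix s :: real and x and t :: real assume "(s, x) \<in> D0" "0 \<le> t" "t \<le> 1"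
    then show "(t * s, x) \<in> D0" using mult_left_le_one_le[of "\<bar>s\<bar>" t] by (auto simp: D0_def abs_mult)
  qed (auto simp: G_def)
  have k0: "k (w, (d, b, 0), s, (V, Z)) = ((- of_real (1 + d) + \<i> * of_real b) * V + 2 * of_real (s + w * Z) * cnj V,
      w * Re (\<kappa> * V\<^sup>2))"
    (is "_ = ?R w")
    if h: "norm (d, b, 0::real) < r" "\<bar>s\<bar> < 2" "\<bar>w\<bar> < 2" "norm (V, Z) < 3" for d b w s V Z
  proof -
    let ?k = "\<lambda>w. k (w, (d, b, 0), s, (V, Z))"
    have nz: "?k w = ?R w" if w: "\<bar>w\<bar> < 2" "w \<noteq> 0" for w
    proof -
      have in0: "(w, (d, b, 0), s, (V, Z)) \<in> D0" using w h by (auto simp: D0_def)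
      have "norm (of_real w * V, s + w * Z) < 10"
        using in10[of s w "(V, Z)"] h w by (simp add: scaleR_conv_of_real)
      moreover have "norm (0::complex, s) < 10" using h by (simp add: norm_Pair)
      ultimately have "G (w, (d, b, 0), s, (V, Z)) = w *\<^sub>R ?R w"
        using f0[OF \<open>norm (d, b, 0) < r\<close>, of "of_real w * V" "s + w * Z"] f0[OF \<open>norm (d, b, 0) < r\<close>, of 0 s]
        by (simp add: G_def scaleR_conv_of_real algebra_simps power2_eq_square complex_eq_iff)
      then have "w *\<^sub>R ?k w = w *\<^sub>R ?R w" using k(2)[OF in0] by simp
      then show ?thesis using w(2) by (simp only: scaleR_cancel_left) simp
    qed
    show ?thesis
    proof (cases "w = 0")
      case True
      have "continuous_on (ball 0 2) ?k"
        by (rule continuous_on_compose2[OF smooth_on_continuous[OF k(1)]])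
            (use h in \<open>auto simp: D0_def intro!: continuous_intros\<close>)
      then have "(?k \<longlongrightarrow> ?k 0) (at 0)" by (auto simp: continuous_on_eq_continuous_at continuous_at)
      moreover have "(?R \<longlongrightarrow> ?R 0) (at 0)" by (intro tendsto_intros)
      moreover have "\<forall>\<^sub>F w in at 0. ?k w = ?R w"
        unfolding eventually_at by (rule exI[of _ 2]) (use nz in auto)
      ultimately have "(?k \<longlongrightarrow> ?k 0) (at 0)" "(?k \<longlongrightarrow> ?R 0) (at 0)" by (auto simp: tendsto_cong)
      then show ?thesis unfolding True using tendsto_unique trivial_limit_at by blast
    qed (use nz h in auto)
  qed
  define n :: "(real \<times> real) \<times> (phase \<times> real) \<times> (real \<times> real) \<Rightarrow> phase" where
    "n z = k (fst (fst z), (snd (fst (snd z)), snd (snd z)), snd (fst z), (of_real (fst (fst z)), 0) + fst (fst (snd z)))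
       + (0, snd (snd (snd z)) * (fst (fst z) ^ 3 / 4) * m ((snd (fst (snd z)), snd (snd z)), snd (fst z)))
       - linearization \<kappa> (fst (fst z)) (snd (fst z)) (fst (fst (snd z)))
       + (of_real (snd (fst (snd z)) * fst (fst z)), 0)
       - (of_real ((2 * snd (fst z) - 1) * fst (fst z)), - (fst (fst z) ^ 3 / 2))" for z
  define J :: "(real \<times> real) \<times> (phase \<times> real) \<times> (real \<times> real) \<Rightarrow> (real \<times> (param \<times> (real \<times> phase)))" where
    "J z = (fst (fst z), (snd (fst (snd z)), snd (snd z)), snd (fst z), (of_real (fst (fst z)), 0) + fst (fst (snd z)))" for z
  define Y where "Y = J -` D0"
  have J: "smooth_on UNIV J" unfolding J_def by (intro smooth_intros open_UNIV)
  have Y: "open Y" unfolding Y_def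
    using D0 smooth_on_continuous[OF J] by (rule open_vimage)
  have linearization_eq: "linearization \<kappa> w s v = (of_real ((2 * s - 1) * Re (fst v) + 2 * w\<^sup>2 * snd v)
      + \<i> * of_real (- (1 + 2 * s) * Im (fst v)), 2 * w\<^sup>2 * Re (\<kappa> * fst v))" for w s v
    by (simp add: linearization_def complex_eq_iff)
  have n: "smooth_on Y n"
  proof -
    have 1: "smooth_on Y (\<lambda>z. k (J z))"
      by (rule smooth_on_compose[OF k(1) smooth_on_subset[OF J] Y D0]) (auto simp: Y_def)
    have 2: "smooth_on Y (\<lambda>z. m ((snd (fst (snd z)), snd (snd z)), snd (fst z)))"
      by (rule smooth_on_compose[OF m]; (intro smooth_intros Y open_Times open_ball)?) (auto simp: Y_def J_def D0_def)
    show ?thesis unfolding n_def linearization_eq divide_inverse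
      using 1 unfolding J_def by (intro smooth_intros Y 2)
  qed
  define K :: "(real \<times> real) set" where "K = {0..1} \<times> {0..1}"
  have K: "compact K" unfolding K_def by (intro compact_Times compact_Icc)
  have nearY: "((w, s), ((V, Z), d), 0) \<in> Y" if "(w, s) \<in> K" "norm (V, Z) < 1" "\<bar>d\<bar> < r" for w s V Z d
  proof -
    have "norm ((of_real w, 0) + (V, Z)) \<le> norm (of_real w :: complex, 0::real) + norm (V, Z)" by (rule norm_triangle_ineq)
    moreover have "norm (of_real w :: complex, 0::real) = \<bar>w\<bar>" "norm (d, 0::real \<times> real) = \<bar>d\<bar>" by (simp_all add: norm_Pair)
    moreover have "\<bar>w\<bar> \<le> 1" "\<bar>s\<bar> \<le> 1" using that(1) by (auto simp: K_def)
    ultimately show ?thesis using that by (simp add: Y_def J_def D0_def)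
  qed
  \<comment> \<open>At b = \<epsilon> = 0 the terms of order 0 cancel because the limiting orbit
    solves the limiting system, which uses Re \<kappa> = - 1 / 2; those of order 1 are the removed
    linearization. What remains is quadratic in (V, Z, d).\<close>
  have n_quad: "n ((w, s), ((V, Z), d), 0) = (- of_real d * V + 2 * of_real (w * Z) * cnj V, w * Re (\<kappa> * V\<^sup>2))"
    if "(w, s) \<in> K" "norm (V, Z) < 1" "\<bar>d\<bar> < r" for w s V Z d
  proof -
    have in0: "norm (of_real w + V, Z) < 3" "\<bar>s\<bar> < 2" "\<bar>w\<bar> < 2" using nearY[OF that] by (auto simp: Y_def J_def D0_def)
    have "k (w, (d, 0, 0), s, of_real w + V, Z) = ((- of_real (1 + d)) * (of_real w + V) + 2 * of_real (s + w * Z)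
        * cnj (of_real w + V), w * Re (\<kappa> * (of_real w + V)\<^sup>2))"
      using k0[of d 0 s w "of_real w + V" Z] in0 that(3) by (simp add: norm_Pair)
    then show ?thesis using \<kappa>
      by (simp add: n_def linearization_def zero_prod_def complex_eq_iff algebra_simps power2_eq_square power3_eq_cube)
  qed
  define c where "c = Bcontfun (\<lambda>t. (root_sech t, front t))"
  have c: "apply_bcontfun c = (\<lambda>t. (root_sech t, front t))" unfolding c_def
  proof (rule apply_Bcontfun[of _ 2])
    show "norm (root_sech t, front t) \<le> 2" for t
      using norm_Pair_le[of "root_sech t" "front t"] root_sech_pos[of t] root_sech_le_1[of t] front_range[of t] by simp
  qed (intro continuous_intros continuous_root_sech continuous_front)
  have cK: "apply_bcontfun c t \<in> K" for t
    using root_sech_pos[of t] root_sech_le_1[of t] front_range[of t] by (simp add: c K_def)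
  obtain L where L: "bounded_linear L"
    "\<And>g t. snd (apply_bcontfun (L g) t) = snd (apply_bcontfun (L g) 0)"
    "\<And>g t. ((\<lambda>t. root_sech t *\<^sub>R fst (apply_bcontfun (L g) t)) has_vector_derivative
        root_sech t *\<^sub>R (linearization \<kappa> (root_sech t) (front t) (fst (apply_bcontfun (L g) t)) + apply_bcontfun g t
          - (of_real (snd (apply_bcontfun (L g) t) * root_sech t), 0))) (at t)"
    using linear_solution[OF \<kappa>] by blast
  obtain r' x where x: "r' > 0" "smooth_on (ball 0 r') x" "x 0 = 0"
    "\<And>p. p \<in> ball 0 r' \<Longrightarrow> norm (x p) \<le> min \<eta> (1/2)"
    "\<And>p s. p \<in> ball 0 r' \<Longrightarrow> (apply_bcontfun c s, apply_bcontfun (x p) s, p) \<in> Y"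
    "\<And>p. p \<in> ball 0 r' \<Longrightarrow> \<exists>y. x p = L y \<and> (\<forall>s. apply_bcontfun y s = n (apply_bcontfun c s, apply_bcontfun (x p) s, p))"
  proof (rule smooth_fixed_point[OF K cK Y _ n L(1)])
    fix k0 assume k0: "k0 \<in> K"
    obtain w s where ws: "k0 = (w, s)" by (cases k0)
    show "(k0, 0, 0) \<in> Y" using nearY[of w s 0 0 0] k0 ws \<open>r > 0\<close> by (simp add: zero_prod_def)
    then have d: "(n has_derivative frechet_derivative n (at (k0, 0, 0))) (at (k0, 0, 0))"
      by (rule smooth_on_has_derivative[OF n])
    show "n (k0, 0, 0) = 0" using n_quad[of w s 0 0 0] k0 ws \<open>r > 0\<close> by (simp add: zero_prod_def)
    fix h :: "phase \<times> real"
    obtain V Z e where h: "h = ((V, Z), e)" by (metis surj_pair)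
    have "((\<lambda>t::real. (k0, t *\<^sub>R h, 0::real \<times> real)) has_derivative (\<lambda>t. (0, t *\<^sub>R h, 0))) (at 0)"
      by (auto intro!: derivative_eq_intros)
    moreover have "(n has_derivative frechet_derivative n (at (k0, 0, 0))) (at (k0, 0 *\<^sub>R h, 0))" using d by simp
    ultimately have 1: "((\<lambda>t. n (k0, t *\<^sub>R h, 0)) has_derivative (\<lambda>t. frechet_derivative n (at (k0, 0, 0)) (0, t *\<^sub>R h,
        0))) (at 0)"
      using diff_chain_at[of "\<lambda>t::real. (k0, t *\<^sub>R h, 0::real \<times> real)"] by (fastforce simp: o_def)
    define Q where "Q = (- of_real e * V + 2 * of_real (w * Z) * cnj V, w * Re (\<kappa> * V\<^sup>2))"
    have 2: "((\<lambda>t. t\<^sup>2 *\<^sub>R Q) has_derivative (\<lambda>t. 0)) (at 0)"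
      by (auto intro!: derivative_eq_intros)
    \<comment> \<open>The derivative needs only t near 0; the two bounds keep t (V, Z) below norm 1
      and t e below r, where the quadratic formula holds.\<close>
    define b where "b = min (1 / (1 + norm (V, Z))) (r / (1 + \<bar>e\<bar>))"
    have b: "b > 0" using \<open>r > 0\<close> by (auto simp: b_def intro!: divide_pos_pos add_pos_nonneg)
    have "t\<^sup>2 *\<^sub>R Q = n (k0, t *\<^sub>R h, 0)" if t: "t \<in> ball 0 b" for t
    proof -
      have t': "\<bar>t\<bar> < 1 / (1 + norm (V, Z))" "\<bar>t\<bar> < r / (1 + \<bar>e\<bar>)" using t by (auto simp: b_def)
      have "norm (t *\<^sub>R (V, Z)) < 1"
      proof -
        have "\<bar>t\<bar> * (1 + norm (V, Z)) < 1" using t'(1) by (subst (asm) pos_less_divide_eq) (auto intro: add_pos_nonneg)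
        then show ?thesis using abs_ge_zero[of t] unfolding norm_scaleR distrib_left by linarith
      qed
      then have a: "norm (of_real t * V, t * Z) < 1" by (simp add: scaleR_conv_of_real)
      have "\<bar>t * e\<bar> < r"
      proof -
        have "\<bar>t\<bar> * (1 + \<bar>e\<bar>) < r" using t'(2) by (subst (asm) pos_less_divide_eq) auto
        then show ?thesis using abs_ge_zero[of t] unfolding abs_mult distrib_left by linarith
      qed
      from n_quad[OF _ a this, of w s] k0 show ?thesis
        by (simp add: ws h Q_def scaleR_conv_of_real power2_eq_square algebra_simps complex_eq_iff)
    qed
    then have "((\<lambda>t. n (k0, t *\<^sub>R h, 0)) has_derivative (\<lambda>t. 0)) (at 0)"
      using has_derivative_transform_within_open[OF 2, of "ball 0 b"] b by simp
    from has_derivative_unique[OF 1 this] have "frechet_derivative n (at (k0, 0, 0)) (0, 1 *\<^sub>R h, 0) = 0"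
      by (rule fun_cong)
    then show "frechet_derivative n (at (k0, 0, 0)) (0, h, 0) = 0" by simp
  next
    \<comment> \<open>The bound 1/2 on v keeps the orbit within norm 4 and off the axis at time 0,
      where its u component is 1 plus that of v.\<close>
    show "min \<eta> (1/2) > 0" using \<open>\<eta> > 0\<close> by simp
  qed (rule that)
  have bl: "bounded_linear (\<lambda>g :: real \<Rightarrow>\<^sub>C (phase \<times> real). snd (apply_bcontfun g 0))"
    by (intro bounded_linear_compose[OF bounded_linear_snd] bounded_linear_intro[where K=1]) (auto simp: norm_bounded)
  define D where "D p = snd (apply_bcontfun (x p) 0)" for p
  have "smooth_on (ball 0 r') D" unfolding D_def by (rule smooth_on_linear_compose[OF open_ball bl x(2)])
  then show ?thesis
  proof (rule that[OF x(1)])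
    show "D 0 = 0" by (simp add: D_def x(3))
    fix p :: "real \<times> real" assume p: "p \<in> ball 0 r'"
    obtain y where y: "x p = L y" "\<And>s. apply_bcontfun y s = n (apply_bcontfun c s, apply_bcontfun (x p) s, p)"
      using x(6)[OF p] by blast
    have xs: "norm (apply_bcontfun (x p) t) \<le> min \<eta> (1/2)" for t
      using norm_bounded[of "x p" t] x(4)[OF p] by linarith
    show "\<bar>D p\<bar> \<le> \<eta>"
      using xs[of 0] norm_snd_le'[of "apply_bcontfun (x p) 0"] by (simp add: D_def)
    define v where "v t = fst (apply_bcontfun (x p) t)" for t
    have xv: "apply_bcontfun (x p) t = (v t, D p)" for t
      using L(2)[of y t] by (simp add: v_def D_def y(1)[symmetric] prod_eq_iff)
    have v: "norm (v t) \<le> 1/2" for t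
      using xs[of t] norm_fst_le'[of "apply_bcontfun (x p) t"] by (simp add: v_def)
    have inD0: "(root_sech t, (D p, p), front t, (of_real (root_sech t), 0) + v t) \<in> D0" for t
      using x(5)[OF p, of t] by (simp add: Y_def J_def c xv)
    then show q: "(D p, p) \<in> ball 0 r" by (auto simp: D0_def)
    define w where "w t = (of_real (root_sech t ^ 2), front t) + root_sech t *\<^sub>R v t" for t
    have wd: "(w has_vector_derivative f ((D p, p), w t)) (at t)" for t
    proof -
      have v1: "((\<lambda>t. root_sech t *\<^sub>R v t) has_vector_derivative
          root_sech t *\<^sub>R (linearization \<kappa> (root_sech t) (front t) (v t) + n ((root_sech t, front t), (v t, D p), p)
              - (of_real (D p * root_sech t), 0))) (at t)"
        using L(3)[of y t] by (simp add: y(1)[symmetric] xv y(2) c)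
      have th: "tanh t = 1 - 2 * front t" by (simp add: front_def field_simps)
      have "((\<lambda>t. root_sech t ^ 2) has_real_derivative root_sech t * ((2 * front t - 1) * root_sech t)) (at t)"
        by (rule derivative_eq_intros root_sech_deriv refl)+ (simp add: th field_simps power2_eq_square)
      then have v2: "((\<lambda>t. (of_real (root_sech t ^ 2) :: complex, front t)) has_vector_derivative
          (of_real (root_sech t * ((2 * front t - 1) * root_sech t)), - (root_sech t ^ 4 / 2))) (at t)"
        using front_deriv[of t] unfolding has_real_derivative_iff_has_vector_derivative
        by (intro has_vector_derivative_Pair bounded_linear.has_vector_derivative[OF bounded_linear_of_real])
      have wt: "w t = (0, front t) + root_sech t *\<^sub>R ((of_real (root_sech t), 0) + v t)"
        by (simp add: w_def prod_eq_iff scaleR_conv_of_real power2_eq_square algebra_simps)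
      have k': "root_sech t *\<^sub>R k (root_sech t, (D p, p), front t, (of_real (root_sech t), 0) + v t) = f ((D p, p), w t)
          - f ((D p, p), (0, front t))"
        using k(2)[OF inD0, of t] by (simp add: G_def wt)
      have fx: "f ((D p, p), (0, front t)) = (0, root_sech t *\<^sub>R (snd p * (root_sech t ^ 3 / 4) * m ((D p, p), front t)))"
        using fax[of "(D p, p)" "front t"] q front_range[of t] by (simp add: front_root_sech eval_nat_numeral)
      have "(of_real (root_sech t * ((2 * front t - 1) * root_sech t)), - (root_sech t ^ 4 / 2))
          + root_sech t *\<^sub>R (linearization \<kappa> (root_sech t) (front t) (v t) + n ((root_sech t, front t), (v t, D p), p)
              - (of_real (D p * root_sech t), 0))
          = root_sech t *\<^sub>R k (root_sech t, (D p, p), front t, (of_real (root_sech t), 0) + v t) + (0,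
              root_sech t *\<^sub>R (snd p * (root_sech t ^ 3 / 4) * m ((D p, p), front t)))"
        by (simp add: n_def prod_eq_iff scaleR_conv_of_real algebra_simps eval_nat_numeral)
      also have "\<dots> = f ((D p, p), w t)" unfolding k' fx by simp
      finally show ?thesis using has_vector_derivative_add[OF v2 v1] unfolding w_def[abs_def] by simp
    qed
    have wn: "norm (w t) < 4" for t
    proof -
      have "norm (w t) \<le> norm (of_real (root_sech t ^ 2) :: complex, front t) + norm (root_sech t *\<^sub>R v t)"
          unfolding w_def by (rule norm_triangle_ineq)
      also have "norm (of_real (root_sech t ^ 2) :: complex, front t) \<le> 1 + 1"
        using norm_Pair_le[of "of_real (root_sech t ^ 2) :: complex" "front t"] front_range[of t] root_sech_pos[of t]
            root_sech_le_1[of t]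
          power_le_one[of "root_sech t" 2] by (simp add: norm_power)
      also have "norm (root_sech t *\<^sub>R v t) \<le> 1 * (1/2)"
        using root_sech_pos[of t] root_sech_le_1[of t] v[of t] by (simp only: norm_scaleR) (intro mult_mono, auto)
      finally show ?thesis by simp
    qed
    have lim: "(w \<longlongrightarrow> (0, l)) F" if "(root_sech \<longlongrightarrow> 0) F" "(front \<longlongrightarrow> l) F" for F l
    proof -
      have "((\<lambda>t. root_sech t *\<^sub>R v t) \<longlongrightarrow> 0) F"
      proof (rule Lim_null_comparison[OF _ that(1)])
        have "norm (root_sech t *\<^sub>R v t) \<le> root_sech t" for t
          using root_sech_pos[of t] v[of t] mult_left_mono[of "norm (v t)" 1 "root_sech t"] by simp
        then show "\<forall>\<^sub>F t in F. norm (root_sech t *\<^sub>R v t) \<le> root_sech t" by simp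
      qed
      then have "(w \<longlongrightarrow> (of_real (0 ^ 2), l) + 0) F" unfolding w_def[abs_def] by (intro tendsto_intros that)
      then show ?thesis by simp
    qed
    have "fst (w 0) \<noteq> 0"
    proof
      assume "fst (w 0) = 0"
      then have "1 + fst (v 0) = 0" by (simp add: w_def root_sech_0)
      then have "fst (v 0) = - 1" by (simp add: add_eq_0_iff)
      then show False using v[of 0] norm_fst_le'[of "v 0"] by simp
    qed
    then show "\<exists>w. (\<forall>t. (w has_vector_derivative f ((D p, p), w t)) (at t)) \<and> (\<forall>t. norm (w t) < 4) \<and>
        (w \<longlongrightarrow> (0, 1)) at_bot \<and> (w \<longlongrightarrow> (0, 0)) at_top \<and> fst (w 0) \<noteq> 0"
      using wd wn lim[OF root_sech_limits(2) front_limits(2)] lim[OF root_sech_limits(1) front_limits(1)] by blast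
  qed
qed

subsection \<open>Rescaling the family to its normal form\<close>

locale z4_family =
  fixes F :: "param \<Rightarrow> phase \<Rightarrow> phase" and P :: "param set" and W :: "phase set"
    and a0 a1 a2 a3 b0 :: "param \<Rightarrow> complex" and b1 b2 :: "param \<Rightarrow> real"
  assumes P: "open P" "0 \<in> P" and W: "open W" "0 \<in> W" "Z4_sym ` W = W"
    and F: "smooth_on (P \<times> W) (\<lambda>(p, w). F p w)"
    and coeffs: "smooth_on P a0" "smooth_on P a1" "smooth_on P a2" "smooth_on P a3" "smooth_on P b0" "smooth_on P b1"
        "smooth_on P b2"
    and equivariant: "\<forall>p\<in>P. \<forall>w\<in>W. F p (Z4_sym w) = Z4_sym (F p w)"
    and jet: "(\<lambda>(p, w). norm (F p w - cubic_part a0 a1 a2 a3 b0 b1 b2 p w)) \<in> O[nhds (0, 0)](\<lambda>(p, w). norm w ^ 4)"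
    and b1_neg: "b1 0 < 0" and ab_neg: "Re (a0 0 * b0 0) < 0"
begin

abbreviation "cubic \<equiv> cubic_part a0 a1 a2 a3 b0 b1 b2"

lemma jet_bound:
  obtains C r where "C > 0" "r > 0" "ball 0 r \<subseteq> P" "ball 0 r \<subseteq> W"
    "\<And>p w. p \<in> ball 0 r \<Longrightarrow> w \<in> ball 0 r \<Longrightarrow> norm (F p w - cubic p w) \<le> C * norm w ^ 4"
proof -
  obtain C where C: "C > 0" "\<forall>\<^sub>F z in nhds (0, 0). norm (case z of (p, w) \<Rightarrow> norm (F p w - cubic p w)) \<le>
      C * norm (case z of (p, w) \<Rightarrow> norm w ^ 4)"
    using jet by (elim landau_o.bigE)
  then obtain d where d: "d > 0" "\<And>z. dist z (0, 0) < d \<Longrightarrow> norm (case z of (p, w) \<Rightarrow> norm (F p w - cubic p w)) \<le>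
      C * norm (case z of (p, w) \<Rightarrow> norm w ^ 4)"
    unfolding eventually_nhds_metric by blast
  obtain r1 r2 where r: "r1 > 0" "ball 0 r1 \<subseteq> P" "r2 > 0" "ball 0 r2 \<subseteq> W"
    using P W openE by metis
  show ?thesis
  proof (rule that[of C "min (d/2) (min r1 r2)"])
    fix p :: param and w :: phase assume pw: "p \<in> ball 0 (min (d/2) (min r1 r2))" "w \<in> ball 0 (min (d/2) (min r1 r2))"
    have "dist (p, w) (0, 0) \<le> norm p + norm w" unfolding dist_Pair_Pair by (simp add: sqrt_sum_squares_le_sum)
    then show "norm (F p w - cubic p w) \<le> C * norm w ^ 4" using d(2)[of "(p, w)"] pw by simp
  qed (use C d r in auto)
qed

lemma F_0: "F p 0 = 0" if "p \<in> P"
proof -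
  have "F p (Z4_sym 0) = Z4_sym (F p 0)" using equivariant that W by blast
  moreover have "Z4_sym 0 = 0" by (simp add: Z4_sym_def zero_prod_def)
  ultimately have "Z4_sym (F p 0) = F p 0" by simp
  then show ?thesis unfolding Z4_sym_def split_beta
    by (auto simp: prod_eq_iff complex_eq_iff)
qed

text \<open>The square of \<open>Z4_sym\<close> maps (u, z) to (- u, z), so its fixed set, the axis,
  is invariant.\<close>

lemma F_axis: "fst (F p (0, z)) = 0" if "p \<in> P" "(0, z) \<in> W"
proof -
  have "Z4_sym (0, z) \<in> W" using that(2) W by blast
  then have "F p (Z4_sym (Z4_sym (0, z))) = Z4_sym (Z4_sym (F p (0, z)))" using equivariant that by metis
  then have "F p (0, z) = Z4_sym (Z4_sym (F p (0, z)))" by (simp add: Z4_sym_def)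
  then have "fst (F p (0, z)) = - fst (F p (0, z))"
    by (metis Z4_sym_def case_prod_beta' complex_i_mult_minus fst_conv mult.commute)
  then show ?thesis by simp
qed

lemma coeff_tendsto:
  assumes "(f \<longlongrightarrow> 0) (at (0::real))"
  shows "((\<lambda>e. a0 (f e)) \<longlongrightarrow> a0 0) (at 0)" "((\<lambda>e. a1 (f e)) \<longlongrightarrow> a1 0) (at 0)" "((\<lambda>e. a2 (f e)) \<longlongrightarrow> a2 0) (at 0)"
    "((\<lambda>e. a3 (f e)) \<longlongrightarrow> a3 0) (at 0)" "((\<lambda>e. b0 (f e)) \<longlongrightarrow> b0 0) (at 0)" "((\<lambda>e. b1 (f e)) \<longlongrightarrow> b1 0) (at 0)"
    "((\<lambda>e. b2 (f e)) \<longlongrightarrow> b2 0) (at 0)"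
proof -
  have *: "((\<lambda>e. g (f e)) \<longlongrightarrow> g 0) (at 0)" if "smooth_on P g" for g :: "param \<Rightarrow> 'x::real_normed_vector"
    using smooth_on_continuous[OF that] P assms isCont_tendsto_compose[of 0 g f "at 0"]
        by (simp add: continuous_on_eq_continuous_at)
  show "((\<lambda>e. a0 (f e)) \<longlongrightarrow> a0 0) (at 0)" "((\<lambda>e. a1 (f e)) \<longlongrightarrow> a1 0) (at 0)" "((\<lambda>e. a2 (f e)) \<longlongrightarrow> a2 0) (at 0)"
    "((\<lambda>e. a3 (f e)) \<longlongrightarrow> a3 0) (at 0)" "((\<lambda>e. b0 (f e)) \<longlongrightarrow> b0 0) (at 0)" "((\<lambda>e. b1 (f e)) \<longlongrightarrow> b1 0) (at 0)"
    "((\<lambda>e. b2 (f e)) \<longlongrightarrow> b2 0) (at 0)" by (intro * coeffs)+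
qed

definition rescaled_params :: "real \<Rightarrow> real \<Rightarrow> real \<times> real \<Rightarrow> param" where
  "rescaled_params \<nu> e x = (e * (\<nu> * (1 + fst x)), e * (\<nu> * snd x), e\<^sup>2)"

lemma rescaled_params_tendsto: "((\<lambda>e. rescaled_params \<nu> e x) \<longlongrightarrow> 0) (at 0)"
proof -
  have "((\<lambda>e. rescaled_params \<nu> e x) \<longlongrightarrow> (0 * (\<nu> * (1 + fst x)), 0 * (\<nu> * snd x), 0\<^sup>2)) (at 0)"
    unfolding rescaled_params_def by (intro tendsto_intros)
  then show ?thesis by (simp add: zero_prod_def)
qed

text \<open>At this scale the linear terms in u and the quadratic terms are all of order e^2; on the
  axis these vanish in the z component, which is of order e^3. The jet is known through an order
  estimate only, so the smooth quotients come from division with known limits. The last estimate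
  keeps b1 at the actual parameters, which is what locates O+ with error O(\<mu>).\<close>

lemma rescaled_field:
  assumes \<nu>: "\<nu> > 0" and R: "R > 0"
  obtains e0 C f g where "e0 > 0" "C > 0"
    "\<And>e x. e \<in> ball 0 e0 \<Longrightarrow> x \<in> ball 0 1 \<Longrightarrow> rescaled_params \<nu> e x \<in> P"
    "\<And>e w. e \<in> ball 0 e0 \<Longrightarrow> w \<in> ball 0 R \<Longrightarrow> e *\<^sub>R w \<in> W"
    "smooth_on (ball 0 e0 \<times> (ball 0 1 \<times> ball 0 R)) f"
    "\<And>e x w. e \<in> ball 0 e0 \<Longrightarrow> x \<in> ball 0 1 \<Longrightarrow> w \<in> ball 0 R \<Longrightarrow> F (rescaled_params \<nu> e x) (e *\<^sub>R w) = e\<^sup>2 *\<^sub>R f (e, x, w)"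
    "\<And>x w. x \<in> ball 0 1 \<Longrightarrow> w \<in> ball 0 R \<Longrightarrow> f (0, x, w) =
       ((- of_real (\<nu> * (1 + fst x)) + \<i> * of_real (\<nu> * snd x)) * fst w + a0 0 * of_real (snd w) * cnj (fst w),
           2 * Re (b0 0 * (fst w)\<^sup>2))"
    "smooth_on (ball 0 e0 \<times> (ball 0 1 \<times> ball 0 R)) g"
    "\<And>e x z. e \<in> ball 0 e0 \<Longrightarrow> x \<in> ball 0 1 \<Longrightarrow> z \<in> ball 0 R \<Longrightarrow> snd (f (e, x, (0, z))) = e * g (e, x, z)"
    "\<And>x z. x \<in> ball 0 1 \<Longrightarrow> z \<in> ball 0 R \<Longrightarrow> g (0, x, z) = z + b1 0 * z ^ 3"
    "\<And>e x z. e \<in> ball 0 e0 \<Longrightarrow> x \<in> ball 0 1 \<Longrightarrow> z \<in> ball 0 R \<Longrightarrow> e \<noteq> 0 \<Longrightarrow> \<bar>g (e, x, z) - (z + b1 (rescaled_params \<nu> e x)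
        * z ^ 3)\<bar> \<le> C * \<bar>e\<bar> * z ^ 4"
proof -
  obtain C r where C: "C > 0" "r > 0" "ball 0 r \<subseteq> P" "ball 0 r \<subseteq> W"
    "\<And>p w. p \<in> ball 0 r \<Longrightarrow> w \<in> ball 0 r \<Longrightarrow> norm (F p w - cubic p w) \<le> C * norm w ^ 4"
    by (rule jet_bound) blast
  \<comment> \<open>|e| M bounds both the rescaled parameters, at most |e| (3 \<nu> + 1) as |e| < 1,
    and the rescaled phase point, at most |e| R.\<close>
  define M where "M = 3 * \<nu> + 1 + R"
  have M: "M > 0" using assms by (simp add: M_def)
  define e0 where "e0 = min 1 (r / M)"
  have e0: "e0 > 0" using C M by (simp add: e0_def)
  have e0r: "\<bar>e\<bar> < 1 \<and> \<bar>e\<bar> * M < r" if "e \<in> ball 0 e0" for e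
    using that M by (auto simp: e0_def pos_less_divide_eq)
  have pr: "rescaled_params \<nu> e x \<in> ball 0 r" if e: "e \<in> ball 0 e0" and x: "x \<in> ball 0 1" for e x
  proof -
    have x1: "\<bar>fst x\<bar> < 1" "\<bar>snd x\<bar> < 1" using x norm_fst_le'[of x] norm_snd_le'[of x] by auto
    have "norm (rescaled_params \<nu> e x) \<le> \<bar>e * (\<nu> * (1 + fst x))\<bar> + (\<bar>e * (\<nu> * snd x)\<bar> + \<bar>e\<^sup>2\<bar>)"
      unfolding rescaled_params_def using norm_Pair_le[of "e * (\<nu> * (1 + fst x))" "(e * (\<nu> * snd x), e\<^sup>2)"]
          norm_Pair_le[of "e * (\<nu> * snd x)" "e\<^sup>2"] by simp
    also have "\<dots> = \<bar>e\<bar> * (\<nu> * \<bar>1 + fst x\<bar> + \<nu> * \<bar>snd x\<bar> + \<bar>e\<bar>)"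
      using \<nu> unfolding abs_mult power2_eq_square by (simp add: distrib_left)
    also have "\<dots> \<le> \<bar>e\<bar> * (\<nu> * 2 + \<nu> * 1 + 1)"
      using x1 \<nu> e0r[OF e] by (intro mult_left_mono add_mono) auto
    also have "\<dots> \<le> \<bar>e\<bar> * M" using R by (intro mult_left_mono) (auto simp: M_def)
    finally show ?thesis using e0r[OF e] by simp
  qed
  have wr: "e *\<^sub>R w \<in> ball 0 r" if e: "e \<in> ball 0 e0" and w: "w \<in> ball 0 R" for e and w :: phase
  proof -
    have "norm (e *\<^sub>R w) \<le> \<bar>e\<bar> * M" using w \<nu> by (auto simp: M_def intro!: mult_left_mono)
    then show ?thesis using e0r[OF e] by simp
  qed
  note * = C(5)[OF pr wr]
  define Y :: "((real \<times> real) \<times> phase) set" where "Y = ball 0 1 \<times> ball 0 R"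
  define Y' :: "((real \<times> real) \<times> real) set" where "Y' = ball 0 1 \<times> ball 0 R"
  have Y: "open Y" "open Y'" by (auto simp: Y_def Y'_def intro!: open_Times)
  have D: "open (ball 0 e0 \<times> Y)" "open (ball 0 e0 \<times> Y')" using Y by (auto intro!: open_Times)
  have zR: "(0, z) \<in> ball (0::phase) R" if "z \<in> ball 0 R" for z using that by (simp add: zero_prod_def dist_Pair_Pair)
  have F1: "smooth_on (ball 0 e0 \<times> Y) (\<lambda>z. (case (rescaled_params \<nu> (fst z) (fst (snd z)), fst z *\<^sub>R snd (snd z)) of (p,
      w) \<Rightarrow> F p w))"
  proof (rule smooth_on_compose[OF F _ D(1)])
    show "smooth_on (ball 0 e0 \<times> Y) (\<lambda>z. (rescaled_params \<nu> (fst z) (fst (snd z)), fst z *\<^sub>R snd (snd z)))"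
      unfolding rescaled_params_def by (intro smooth_intros D)
    show "open (P \<times> W)" using P W by (intro open_Times)
    fix z :: "real \<times> (real \<times> real) \<times> phase" assume z: "z \<in> ball 0 e0 \<times> Y"
    have "fst z \<in> ball 0 e0" "fst (snd z) \<in> ball 0 1" "snd (snd z) \<in> ball 0 R" using z by (auto simp: Y_def)
    then have "rescaled_params \<nu> (fst z) (fst (snd z)) \<in> P" "fst z *\<^sub>R snd (snd z) \<in> W"
      using pr wr C(3,4) by blast+
    then show "(rescaled_params \<nu> (fst z) (fst (snd z)), fst z *\<^sub>R snd (snd z)) \<in> P \<times> W" by blast
  qed
  define L where "L y = ((- of_real (\<nu> * (1 + fst (fst y))) + \<i> * of_real (\<nu> * snd (fst y))) * fst (snd y)
      + a0 0 * of_real (snd (snd y)) * cnj (fst (snd y)),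
      2 * Re (b0 0 * (fst (snd y))\<^sup>2))" for y :: "(real \<times> real) \<times> phase"
  have e0_ev: "\<forall>\<^sub>F e in at 0. e \<in> ball 0 e0 \<and> e \<noteq> 0"
    unfolding eventually_at by (rule exI[of _ e0]) (use e0 in \<open>auto simp: dist_commute\<close>)
  have lim: "((\<lambda>e. inverse (e ^ 2) *\<^sub>R F (rescaled_params \<nu> e x) (e *\<^sub>R w)) \<longlongrightarrow> L (x, w)) (at 0)" if x: "x \<in> ball 0 1"
      and w: "w \<in> ball 0 R" for x w
  proof -
    obtain u z where uz: "w = (u, z)" by (cases w)
    \<comment> \<open>The cubic part at the rescaled point divided by e^2. Its limit is explicit,
      while the remainder of order 4 contributes only O(e^2) after the division.\<close>
    define S where "S e = (let p = rescaled_params \<nu> e x in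
        ((- of_real (\<nu> * (1 + fst x)) + \<i> * of_real (\<nu> * snd x)) * u + a0 p * of_real z * cnj u
          + of_real e * (a1 p * u\<^sup>2 * cnj u + a2 p * (of_real z)\<^sup>2 * u + a3 p * cnj u ^ 3),
        Re (b0 p * u\<^sup>2 + cnj (b0 p) * (cnj u)\<^sup>2) + e * (z + b1 p * z ^ 3 + b2 p * z * Re (u * cnj u))))" for e
    note ct = coeff_tendsto[OF rescaled_params_tendsto[of \<nu> x]]
    have "(S \<longlongrightarrow> ((- of_real (\<nu> * (1 + fst x)) + \<i> * of_real (\<nu> * snd x)) * u + a0 0 * of_real z * cnj u
          + of_real 0 * (a1 0 * u\<^sup>2 * cnj u + a2 0 * (of_real z)\<^sup>2 * u + a3 0 * cnj u ^ 3),
        Re (b0 0 * u\<^sup>2 + cnj (b0 0) * (cnj u)\<^sup>2) + 0 * (z + b1 0 * z ^ 3 + b2 0 * z * Re (u * cnj u)))) (at 0)"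
      unfolding S_def[abs_def] Let_def by (intro tendsto_intros ct)
    moreover have "((- of_real (\<nu> * (1 + fst x)) + \<i> * of_real (\<nu> * snd x)) * u + a0 0 * of_real z * cnj u
          + of_real 0 * (a1 0 * u\<^sup>2 * cnj u + a2 0 * (of_real z)\<^sup>2 * u + a3 0 * cnj u ^ 3),
        Re (b0 0 * u\<^sup>2 + cnj (b0 0) * (cnj u)\<^sup>2) + 0 * (z + b1 0 * z ^ 3 + b2 0 * z * Re (u * cnj u))) = L (x, w)"
      by (simp add: L_def uz power2_eq_square algebra_simps)
    ultimately have S: "(S \<longlongrightarrow> L (x, w)) (at 0)" by (simp only:)
    have cub: "cubic (rescaled_params \<nu> e x) (e *\<^sub>R w) = e\<^sup>2 *\<^sub>R S e" for e
      unfolding S_def Let_def cubic_part_def rescaled_params_def uz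
      by (simp add: scaleR_conv_of_real power2_eq_square power3_eq_cube complex_eq_iff algebra_simps)
    have bd: "norm (inverse (e ^ 2) *\<^sub>R F (rescaled_params \<nu> e x) (e *\<^sub>R w) - S e) \<le> C * norm w ^ 4 * e\<^sup>2"
        if e: "e \<in> ball 0 e0" "e \<noteq> 0" for e
    proof -
      have "inverse (e ^ 2) *\<^sub>R F (rescaled_params \<nu> e x) (e *\<^sub>R w) - S e = inverse (e ^ 2)
          *\<^sub>R (F (rescaled_params \<nu> e x) (e *\<^sub>R w) - cubic (rescaled_params \<nu> e x) (e *\<^sub>R w))"
        using e(2) by (simp add: cub scaleR_diff_right)
      also have "norm \<dots> \<le> inverse (e ^ 2) * (C * norm (e *\<^sub>R w) ^ 4)"
        using *[OF e(1) x e(1) w] by (simp add: mult_left_mono)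
      also have "\<dots> = C * norm w ^ 4 * e\<^sup>2" using e(2) by (simp add: power_mult_distrib field_simps eval_nat_numeral)
      finally show ?thesis .
    qed
    have "((\<lambda>e. inverse (e ^ 2) *\<^sub>R F (rescaled_params \<nu> e x) (e *\<^sub>R w) - S e) \<longlongrightarrow> 0) (at 0)"
    proof (rule Lim_null_comparison)
      show "\<forall>\<^sub>F e in at 0. norm (inverse (e ^ 2) *\<^sub>R F (rescaled_params \<nu> e x) (e *\<^sub>R w) - S e) \<le> C * norm w ^ 4 * e\<^sup>2"
        using e0_ev by eventually_elim (use bd in blast)
      have "((\<lambda>e. C * norm w ^ 4 * e\<^sup>2) \<longlongrightarrow> C * norm w ^ 4 * 0\<^sup>2) (at 0)" by (intro tendsto_intros)
      then show "((\<lambda>e. C * norm w ^ 4 * e\<^sup>2) \<longlongrightarrow> 0) (at 0)" by simp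
    qed
    from tendsto_add[OF this S] show ?thesis by simp
  qed
  obtain f where f: "smooth_on (ball 0 e0 \<times> Y) f"
    "\<And>s x. s \<in> ball 0 e0 \<Longrightarrow> x \<in> Y \<Longrightarrow> F (rescaled_params \<nu> s (fst x)) (s *\<^sub>R snd x) = s ^ 2 *\<^sub>R f (s, x)" "\<And>x. x \<in> Y \<Longrightarrow> f (0,
        x) = L x"
  proof (rule smooth_on_division_power[OF F1 Y(1) e0, of 2 L])
    show "((\<lambda>s. inverse (s ^ 2) *\<^sub>R (case (rescaled_params \<nu> (fst (s, x)) (fst (snd (s, x))), fst (s, x) *\<^sub>R snd (snd (s,
        x))) of (p, w) \<Rightarrow> F p w)) \<longlongrightarrow> L x) (at 0)"
      if "x \<in> Y" for x using lim[of "fst x" "snd x"] that by (auto simp: Y_def)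
  qed (use that in auto)
  have F2: "smooth_on (ball 0 e0 \<times> Y') (\<lambda>z. snd (case (rescaled_params \<nu> (fst z) (fst (snd z)), fst z *\<^sub>R (0,
      snd (snd z))) of (p, w) \<Rightarrow> F p w))"
  proof (intro smooth_on_snd D smooth_on_compose[OF F _ D(2)])
    show "smooth_on (ball 0 e0 \<times> Y') (\<lambda>z. (rescaled_params \<nu> (fst z) (fst (snd z)), fst z *\<^sub>R (0, snd (snd z))))"
      unfolding rescaled_params_def by (intro smooth_intros D)
    show "open (P \<times> W)" using P W by (intro open_Times)
    fix z :: "real \<times> (real \<times> real) \<times> real" assume z: "z \<in> ball 0 e0 \<times> Y'"
    have "fst z \<in> ball 0 e0" "fst (snd z) \<in> ball 0 1" "snd (snd z) \<in> ball 0 R" using z by (auto simp: Y'_def)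
    then have "rescaled_params \<nu> (fst z) (fst (snd z)) \<in> P" "fst z *\<^sub>R (0, snd (snd z)) \<in> W"
      using pr wr zR C(3,4) by blast+
    then show "(rescaled_params \<nu> (fst z) (fst (snd z)), fst z *\<^sub>R (0, snd (snd z))) \<in> P \<times> W" by blast
  qed
  have bd: "\<bar>inverse (e ^ 3) * snd (F (rescaled_params \<nu> e x) (e *\<^sub>R (0, z))) - (z + b1 (rescaled_params \<nu> e x)
      * z ^ 3)\<bar> \<le> C * \<bar>e\<bar> * z ^ 4"
    if e: "e \<in> ball 0 e0" "e \<noteq> 0" and x: "x \<in> ball 0 1" and z: "z \<in> ball 0 R" for e x z
  proof -
    have cub: "snd (cubic (rescaled_params \<nu> e x) (e *\<^sub>R (0, z))) = e ^ 3 * (z + b1 (rescaled_params \<nu> e x) * z ^ 3)"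
      unfolding cubic_part_def Let_def rescaled_params_def by (simp add: power2_eq_square power3_eq_cube algebra_simps)
    have "\<bar>snd (F (rescaled_params \<nu> e x) (e *\<^sub>R (0, z))) - e ^ 3 * (z + b1 (rescaled_params \<nu> e x) * z ^ 3)\<bar> \<le>
        norm (F (rescaled_params \<nu> e x) (e *\<^sub>R (0, z)) - cubic (rescaled_params \<nu> e x) (e *\<^sub>R (0, z)))"
      using norm_snd_le'[of "F (rescaled_params \<nu> e x) (e *\<^sub>R (0, z)) - cubic (rescaled_params \<nu> e x) (e *\<^sub>R (0, z))"]
          unfolding cub[symmetric] by simp
    also have "\<dots> \<le> C * norm (e *\<^sub>R (0::complex, z)) ^ 4" by (rule *[OF e(1) x e(1) zR[OF z]])
    also have "norm (e *\<^sub>R (0::complex, z)) ^ 4 = \<bar>e\<bar> ^ 4 * z ^ 4"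
        unfolding norm_scaleR by (simp add: norm_Pair power_mult_distrib)
    finally have 1: "\<bar>inverse (e ^ 3)\<bar> * \<bar>snd (F (rescaled_params \<nu> e x) (e *\<^sub>R (0, z))) - e ^ 3 * (z +
        b1 (rescaled_params \<nu> e x) * z ^ 3)\<bar> \<le> \<bar>inverse (e ^ 3)\<bar> * (C * (\<bar>e\<bar> ^ 4 * z ^ 4))"
      by (rule mult_left_mono) simp
    have eq1: "\<bar>inverse (e ^ 3)\<bar> * (C * (\<bar>e\<bar> ^ 4 * z ^ 4)) = C * \<bar>e\<bar> * z ^ 4"
      using e(2) by (simp add: power_abs[symmetric] abs_mult field_simps eval_nat_numeral)
    have "inverse (e ^ 3) * (e ^ 3 * c) = c" for c using e(2) by (simp add: field_simps)
    then have eq2: "\<bar>inverse (e ^ 3)\<bar> * \<bar>snd (F (rescaled_params \<nu> e x) (e *\<^sub>R (0, z))) - e ^ 3 * (z +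
        b1 (rescaled_params \<nu> e x) * z ^ 3)\<bar>
        = \<bar>inverse (e ^ 3) * snd (F (rescaled_params \<nu> e x) (e *\<^sub>R (0, z))) - (z + b1 (rescaled_params \<nu> e x) * z ^ 3)\<bar>"
      unfolding abs_mult[symmetric] right_diff_distrib by (simp only:)
    show ?thesis using 1 unfolding eq1 eq2 .
  qed
  have lim': "((\<lambda>e. inverse (e ^ 3) * snd (F (rescaled_params \<nu> e x) (e *\<^sub>R (0, z)))) \<longlongrightarrow> z + b1 0 * z ^ 3) (at 0)"
    if x: "x \<in> ball 0 1" and z: "z \<in> ball 0 R" for x z
  proof -
    have "((\<lambda>e. inverse (e ^ 3) * snd (F (rescaled_params \<nu> e x) (e *\<^sub>R (0, z))) - (z + b1 (rescaled_params \<nu> e x)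
        * z ^ 3)) \<longlongrightarrow> 0) (at 0)"
    proof (rule Lim_null_comparison)
      show "\<forall>\<^sub>F e in at 0. norm (inverse (e ^ 3) * snd (F (rescaled_params \<nu> e x) (e *\<^sub>R (0, z))) - (z +
          b1 (rescaled_params \<nu> e x) * z ^ 3)) \<le> C * \<bar>e\<bar> * z ^ 4"
        using e0_ev by eventually_elim (use bd x z in auto)
      have "((\<lambda>e. C * \<bar>e\<bar> * z ^ 4) \<longlongrightarrow> C * \<bar>0\<bar> * z ^ 4) (at 0)" by (intro tendsto_intros)
      then show "((\<lambda>e. C * \<bar>e\<bar> * z ^ 4) \<longlongrightarrow> 0) (at 0)" by simp
    qed
    moreover have "((\<lambda>e. z + b1 (rescaled_params \<nu> e x) * z ^ 3) \<longlongrightarrow> z + b1 0 * z ^ 3) (at 0)"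
      by (intro tendsto_intros coeff_tendsto rescaled_params_tendsto)
    ultimately show ?thesis using tendsto_add by fastforce
  qed
  obtain g where g: "smooth_on (ball 0 e0 \<times> Y') g"
    "\<And>s x. s \<in> ball 0 e0 \<Longrightarrow> x \<in> Y' \<Longrightarrow> snd (F (rescaled_params \<nu> s (fst x)) (s *\<^sub>R (0, snd x))) = s ^ 3 * g (s, x)"
    "\<And>x. x \<in> Y' \<Longrightarrow> g (0, x) = snd x + b1 0 * snd x ^ 3"
  proof (rule smooth_on_division_power[OF F2 Y(2) e0, of 3 "\<lambda>x. snd x + b1 0 * snd x ^ 3"])
    show "((\<lambda>s. inverse (s ^ 3) *\<^sub>R snd (case (rescaled_params \<nu> (fst (s, x)) (fst (snd (s, x))), fst (s, x) *\<^sub>R (0,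
        snd (snd (s, x)))) of (p, w) \<Rightarrow> F p w)) \<longlongrightarrow> snd x + b1 0 * snd x ^ 3) (at 0)"
      if "x \<in> Y'" for x using lim'[of "fst x" "snd x"] that by (auto simp: Y'_def)
  qed (use that in auto)
  show ?thesis
  proof (rule that[OF e0 C(1)])
    show "smooth_on (ball 0 e0 \<times> (ball 0 1 \<times> ball 0 R)) f" "smooth_on (ball 0 e0 \<times> (ball 0 1 \<times> ball 0 R)) g"
      using f(1) g(1) by (auto simp: Y_def Y'_def)
    fix e :: real and x z assume e: "e \<in> ball 0 e0" and x: "x \<in> ball (0::real \<times> real) 1" and z: "z \<in> ball (0::real) R"
    show "snd (f (e, x, (0, z))) = e * g (e, x, z)"
    proof (cases "e = 0")
      case True
      then show ?thesis using f(3)[of "(x, (0, z))"] x zR[OF z] by (simp add: Y_def L_def)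
    next
      case False
      have "e ^ 3 * g (e, x, z) = e ^ 2 * snd (f (e, x, (0, z)))"
        using g(2)[OF e, of "(x, z)"] f(2)[OF e, of "(x, (0, z))"] x z zR[OF z] by (simp add: Y_def Y'_def)
      then show ?thesis using False by (simp add: power2_eq_square power3_eq_cube)
    qed
    show "\<bar>g (e, x, z) - (z + b1 (rescaled_params \<nu> e x) * z ^ 3)\<bar> \<le> C * \<bar>e\<bar> * z ^ 4" if "e \<noteq> 0"
    proof -
      have "inverse (e ^ 3) * (e ^ 3 * g (e, x, z)) = g (e, x, z)"
        unfolding mult.assoc[symmetric] using that by simp
      moreover have "snd (F (rescaled_params \<nu> e x) (e *\<^sub>R (0, z))) = e ^ 3 * g (e, x, z)"
        using g(2)[OF e, of "(x, z)"] x z by (simp add: Y'_def)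
      ultimately show ?thesis using bd[OF e that x z] by (simp only:)
    qed
  next
    fix e :: real and x :: "real \<times> real" assume "e \<in> ball 0 e0" "x \<in> ball 0 1"
    then show "rescaled_params \<nu> e x \<in> P" using pr C(3) by blast
  next
    fix e :: real and w :: phase assume "e \<in> ball 0 e0" "w \<in> ball 0 R"
    then show "e *\<^sub>R w \<in> W" using wr C(4) by blast
  qed (use f(2,3) g(3) in \<open>auto simp: Y_def Y'_def L_def\<close>)
qed

text \<open>The units leave Im \<kappa> as the only free coefficient of the limit. Z is measured by
  the true height \<open>Z0\<close> of O+, so that O+ stays at Z = 1 for all parameters and the
  field on the axis has the exact factor Z (1 - Z).\<close>

theorem normal_form:
  obtains r \<nu> A Z0 \<kappa> f m K where "r > 0" "\<nu> > 0" "A \<noteq> 0" "Re \<kappa> = - 1 / 2"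
    "\<And>q. q \<in> ball 0 r \<Longrightarrow> Z0 q > 0"
    "smooth_on (ball 0 r \<times> ball 0 10) f" "smooth_on (ball 0 r \<times> ball 0 2) m"
    "\<And>d b V Z. norm (d, b, 0::real) < r \<Longrightarrow> norm (V, Z) < 10 \<Longrightarrow>
        f ((d, b, 0), (V, Z)) = ((- of_real (1 + d) + \<i> * of_real b) * V + 2 * of_real Z * cnj V, Re (\<kappa> * V\<^sup>2))"
    "\<And>q Z. norm q < r \<Longrightarrow> \<bar>Z\<bar> < 2 \<Longrightarrow> f (q, (0, Z)) = (0, snd (snd q) * (Z * (1 - Z)) * m (q, Z))"
    "\<And>q Z. norm q < r \<Longrightarrow> 0 \<le> Z \<Longrightarrow> Z \<le> 1 \<Longrightarrow> m (q, Z) > 0"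
    "\<And>d b e V Z. norm (d, b, e) < r \<Longrightarrow> norm (V, Z) < 10 \<Longrightarrow>
        rescaled_params \<nu> e (d, b) \<in> P \<and> (e *\<^sub>R (A * V), e * (Z0 (d, b, e) * Z)) \<in> W \<and>
        F (rescaled_params \<nu> e (d, b)) (e *\<^sub>R (A * V), e * (Z0 (d, b, e) * Z))
          = (e\<^sup>2 * \<nu>) *\<^sub>R (A * fst (f ((d, b, e), (V, Z))), Z0 (d, b, e) * snd (f ((d, b, e), (V, Z))))"
    "\<And>d b e. norm (d, b, e) < r \<Longrightarrow> e \<noteq> 0 \<Longrightarrow> \<bar>Z0 (d, b, e) - 1 / sqrt \<bar>b1 (rescaled_params \<nu> e (d, b))\<bar>\<bar> \<le> K * \<bar>e\<bar>"
proof -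

  \<comment> \<open>Units of time and amplitude\<close>
  define a where "a = norm (a0 0)"
  have a: "a > 0" using ab_neg by (auto simp: a_def)
  define zs where "zs = 1 / sqrt \<bar>b1 0\<bar>"
  have zs: "zs > 0" "b1 0 * zs\<^sup>2 = - 1" using b1_neg by (auto simp: zs_def power_divide)
  \<comment> \<open>Unit of time: the coefficient a zs of \<open>cnj u\<close> at O+ has to become
    2.\<close>
  define \<nu> where "\<nu> = a * zs / 2"
  have \<nu>: "\<nu> > 0" using a zs by (simp add: \<nu>_def)
  define c0 where "c0 = - Re (a0 0 * b0 0) / a"
  have c0: "c0 > 0" using ab_neg a by (simp add: c0_def divide_neg_pos)
  \<comment> \<open>Square of the unit of amplitude, fixed by Re \<kappa> = - 1 / 2. It is positive
    because Re (a0 b0) < 0.\<close>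
  define \<rho> where "\<rho> = \<nu> * zs / (4 * c0)"
  have \<rho>: "\<rho> > 0" using \<nu> zs c0 by (simp add: \<rho>_def)
  \<comment> \<open>The square root rotates u so that a0 cnj A is a positive multiple of A; b0 A^2
    then has the argument of a0 b0.\<close>
  define A where "A = csqrt (of_real (\<rho> / a) * a0 0)"
  have A2: "A\<^sup>2 = of_real (\<rho> / a) * a0 0" by (simp add: A_def)
  have normA: "norm A ^ 2 = \<rho>"
    using \<rho> a unfolding norm_power[symmetric] A2 by (simp add: norm_mult norm_divide a_def)
  have A0: "A \<noteq> 0" using normA \<rho> by auto
  have cnjA: "a0 0 * cnj A = of_real a * A"
  proof -
    have "A * cnj A = of_real \<rho>" using complex_norm_square[of A] normA by simp
    then have "A * (a0 0 * cnj A) = A * (of_real a * A)"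
      using A2 a by (simp add: power2_eq_square field_simps)
    then show ?thesis using A0 by simp
  qed
  define \<kappa> where "\<kappa> = 2 * (b0 0 * A\<^sup>2) / of_real (\<nu> * zs)"
  have \<kappa>: "Re \<kappa> = - 1 / 2"
  proof -
    have "Re (b0 0 * A\<^sup>2) = - \<rho> * c0"
      unfolding A2 c0_def using a by (simp add: field_simps)
    then have "Re \<kappa> = 2 * (- \<rho> * c0) / (\<nu> * zs)" unfolding \<kappa>_def by (simp add: Re_divide_of_real del: of_real_mult)
    then show ?thesis using \<nu> zs c0 by (simp add: \<rho>_def field_simps)
  qed
  \<comment> \<open>For norm (V, Z) < 10 the point (A V, Z0 Z) has norm at most 10 norm A + 20 zs,
    since Z0 \<le> 2 zs.\<close>
  define R where "R = 20 * (norm A + 2 * zs + 1)"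
  have R: "R > 0" using zs by (simp add: R_def add_nonneg_pos)
  obtain e0 C F1 g where e0: "e0 > 0" and C: "C > 0" and
    inP: "\<And>e x. e \<in> ball 0 e0 \<Longrightarrow> x \<in> ball 0 1 \<Longrightarrow> rescaled_params \<nu> e x \<in> P" and
    inW: "\<And>e w. e \<in> ball 0 e0 \<Longrightarrow> w \<in> ball 0 R \<Longrightarrow> e *\<^sub>R w \<in> W" and
    F1: "smooth_on (ball 0 e0 \<times> (ball 0 1 \<times> ball 0 R)) F1"
    "\<And>e x w. e \<in> ball 0 e0 \<Longrightarrow> x \<in> ball 0 1 \<Longrightarrow> w \<in> ball 0 R \<Longrightarrow> F (rescaled_params \<nu> e x) (e *\<^sub>R w) = e\<^sup>2 *\<^sub>R F1 (e, x, w)"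
    "\<And>x w. x \<in> ball 0 1 \<Longrightarrow> w \<in> ball 0 R \<Longrightarrow> F1 (0, x, w) =
       ((- of_real (\<nu> * (1 + fst x)) + \<i> * of_real (\<nu> * snd x)) * fst w + a0 0 * of_real (snd w) * cnj (fst w),
           2 * Re (b0 0 * (fst w)\<^sup>2))" and
    g: "smooth_on (ball 0 e0 \<times> (ball 0 1 \<times> ball 0 R)) g"
    "\<And>e x z. e \<in> ball 0 e0 \<Longrightarrow> x \<in> ball 0 1 \<Longrightarrow> z \<in> ball 0 R \<Longrightarrow> snd (F1 (e, x, (0, z))) = e * g (e, x, z)"
    "\<And>x z. x \<in> ball 0 1 \<Longrightarrow> z \<in> ball 0 R \<Longrightarrow> g (0, x, z) = z + b1 0 * z ^ 3"
    "\<And>e x z. e \<in> ball 0 e0 \<Longrightarrow> x \<in> ball 0 1 \<Longrightarrow> z \<in> ball 0 R \<Longrightarrow> e \<noteq> 0 \<Longrightarrow> \<bar>g (e, x, z) - (z + b1 (rescaled_params \<nu> e x)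
        * z ^ 3)\<bar> \<le> C * \<bar>e\<bar> * z ^ 4"
    by (rule rescaled_field[OF \<nu> R]) blast
  define Dg :: "(real \<times> (real \<times> real) \<times> real) set" where "Dg = ball 0 e0 \<times> (ball 0 1 \<times> ball 0 R)"
  have Dg: "open Dg" by (auto simp: Dg_def intro!: open_Times)
  have g': "smooth_on Dg g" using g(1) by (simp add: Dg_def)
  have R_eq: "R = 20 * norm A + 40 * zs + 20" by (simp add: R_def)
  then have zsR: "zs * 20 < R" using zs norm_ge_zero[of A] by linarith

  \<comment> \<open>The height of O+ as a smooth root\<close>
  define J where "J z = (snd (snd (snd (snd z))), (fst (snd (snd z)), fst (snd (snd (snd z)))), zs + fst (snd z))"
      for z :: "real \<times> real \<times> param"
  define Y where "Y = J -` Dg"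
  have J: "smooth_on UNIV J" unfolding J_def by (intro smooth_intros open_UNIV)
  have Y: "open Y" unfolding Y_def using Dg smooth_on_continuous[OF J] by (rule open_vimage)
  \<comment> \<open>A simplified Newton step: at zs the limit z + b1 z^3 has derivative 1 - 3 = - 2,
    so x + g / 2 has derivative 0 in x. A fixed point x gives the root zs + x of g.\<close>
  define n where "n z = fst (snd z) + g (J z) * (1/2)" for z
  have n: "smooth_on Y n" unfolding n_def
    by (intro smooth_intros Y smooth_on_compose[OF g' smooth_on_subset[OF J] Y Dg]) (auto simp: Y_def)
  have nearY: "(k, x, 0) \<in> Y" if "\<bar>x\<bar> < zs" for k x
    using that zs zsR e0 by (simp add: Y_def J_def Dg_def zero_prod_def)
  have n_eq: "n (k, x, 0) = x + ((zs + x) + b1 0 * (zs + x) ^ 3) / 2" if "\<bar>x\<bar> < zs" for k x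
    using nearY[OF that, of k] g(3)[of "(0, 0)" "zs + x"] by (simp add: n_def Y_def J_def Dg_def zero_prod_def)
  define KK :: "real set" where "KK = {0}"
  obtain r1 x where x: "r1 > 0" "smooth_on (ball 0 r1) x" "x 0 = 0"
    "\<And>p. p \<in> ball 0 r1 \<Longrightarrow> norm (x p) \<le> zs / 2"
    "\<And>p s. p \<in> ball 0 r1 \<Longrightarrow> (apply_bcontfun (const_bcontfun 0 :: real \<Rightarrow>\<^sub>C real) s, apply_bcontfun (x p) s, p) \<in> Y"
    "\<And>p. p \<in> ball 0 r1 \<Longrightarrow> \<exists>y. x p = y \<and> (\<forall>s. apply_bcontfun y s = n (apply_bcontfun (const_bcontfun 0 :: real \<Rightarrow>\<^sub>C real) s,
        apply_bcontfun (x p) s, p))"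
  proof (rule smooth_fixed_point[where K=KK and c="const_bcontfun 0" and n=n and L="\<lambda>y. y" and \<eta>="zs/2", OF _ _ Y _ n])
    show "compact KK" by (simp add: KK_def)
    show "apply_bcontfun (const_bcontfun 0) s \<in> KK" for s :: real by (simp add: KK_def const_bcontfun.rep_eq)
    show "zs / 2 > 0" using zs by simp
    show "bounded_linear (\<lambda>y :: real \<Rightarrow>\<^sub>C real. y)" by (rule bounded_linear_ident)
    fix k assume "k \<in> KK"
    show kY: "(k, 0, 0) \<in> Y" by (rule nearY) (use zs in simp)
    have zs3: "zs + b1 0 * zs ^ 3 = 0" using zs(2) by (simp add: power3_eq_cube power2_eq_square mult.assoc[symmetric])
    then show "n (k, 0, 0) = 0" using n_eq[of 0 k] zs by simp
    fix h :: real
    have "((\<lambda>t::real. (k, t *\<^sub>R h, 0::param)) has_derivative (\<lambda>t. (0, t *\<^sub>R h, 0))) (at 0)"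
      by (auto intro!: derivative_eq_intros)
    moreover have "(n has_derivative frechet_derivative n (at (k, 0, 0))) (at (k, 0 *\<^sub>R h, 0))"
      using smooth_on_has_derivative[OF n kY] by simp
    ultimately have 1: "((\<lambda>t. n (k, t *\<^sub>R h, 0)) has_derivative (\<lambda>t. frechet_derivative n (at (k, 0, 0)) (0, t *\<^sub>R h, 0))) (at 0)"
      using diff_chain_at[of "\<lambda>t::real. (k, t *\<^sub>R h, 0::param)"] by (fastforce simp: o_def)
    have "((\<lambda>t. t * h + ((zs + t * h) + b1 0 * (zs + t * h) ^ 3) / 2) has_real_derivative h + (h + b1 0 * (3 * h * zs\<^sup>2))
        / 2) (at 0)"
      by (auto intro!: derivative_eq_intros)
    moreover have "h + (h + b1 0 * (3 * h * zs\<^sup>2)) / 2 = 0"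
    proof -
      have eq: "b1 0 * (3 * h * zs\<^sup>2) = 3 * h * (b1 0 * zs\<^sup>2)" by simp
      show ?thesis unfolding eq zs(2) by simp
    qed
    ultimately have 2: "((\<lambda>t. t * h + ((zs + t * h) + b1 0 * (zs + t * h) ^ 3) / 2) has_derivative (\<lambda>t. 0)) (at 0)"
      using mult_zero_left[where 'a=real, abs_def] by (simp add: has_field_derivative_def)
    have "t * h + ((zs + t * h) + b1 0 * (zs + t * h) ^ 3) / 2 = n (k, t *\<^sub>R h, 0)" if t: "t \<in> ball 0 (zs / (1 + \<bar>h\<bar>))" for t
    proof -
      have "\<bar>t\<bar> * (1 + \<bar>h\<bar>) < zs" using t by (simp add: pos_less_divide_eq)
      then have "\<bar>t * h\<bar> < zs" using abs_ge_zero[of t] unfolding abs_mult distrib_left by linarith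
      then show ?thesis using n_eq[of "t * h" k] by simp
    qed
    then have "((\<lambda>t. n (k, t *\<^sub>R h, 0)) has_derivative (\<lambda>t. 0)) (at 0)"
      using has_derivative_transform_within_open[OF 2, of "ball 0 (zs / (1 + \<bar>h\<bar>))"] zs by simp
    from has_derivative_unique[OF 1 this] have "frechet_derivative n (at (k, 0, 0)) (0, 1 *\<^sub>R h, 0) = 0"
      by (rule fun_cong)
    then show "frechet_derivative n (at (k, 0, 0)) (0, h, 0) = 0" by simp
  qed (rule that)
  define Z0 where "Z0 q = zs + apply_bcontfun (x q) 0" for q
  have bl: "bounded_linear (\<lambda>g :: real \<Rightarrow>\<^sub>C real. apply_bcontfun g 0)"
    by (intro bounded_linear_intro[where K=1]) (auto simp: bounded_bcontfun)
  have Z0_smooth: "smooth_on (ball 0 r1) Z0" unfolding Z0_def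
    by (intro smooth_intros open_ball smooth_on_linear_compose[OF _ bl] x(2))
  have Z0_bd: "zs / 2 \<le> Z0 q" "Z0 q \<le> 2 * zs" if "q \<in> ball 0 r1" for q
    using bounded_bcontfun[of "x q" 0] x(4)[OF that] zs unfolding Z0_def by (auto simp: abs_le_iff)
  have q_in: "e \<in> ball 0 e0" "(d, b) \<in> ball 0 1" if "(d, b, e) \<in> ball 0 r1" for d b e :: real
    using x(5)[OF that, of 0] by (auto simp: Y_def J_def Dg_def)
  have Z0_root: "g (e, (d, b), Z0 (d, b, e)) = 0" if "(d, b, e) \<in> ball 0 r1" for d b e
    using x(6)[OF that] by (auto simp: n_def J_def Z0_def dest: spec[of _ 0])
  have Z0R: "\<bar>Z0 q * z\<bar> < R" if "q \<in> ball 0 r1" "\<bar>z\<bar> < 10" for q z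
  proof -
    have "\<bar>Z0 q * z\<bar> \<le> (2 * zs) * 10"
      unfolding abs_mult using Z0_bd[OF that(1)] that(2) zs by (intro mult_mono) auto
    then show ?thesis using zsR by simp
  qed
  have Z0_0: "Z0 (d, b, 0) = zs" if "(d, b, 0::real) \<in> ball 0 r1" for d b :: real
  proof -
    let ?z = "Z0 (d, b, 0)"
    have "?z + b1 0 * ?z ^ 3 = 0"
      using Z0_root[OF that] g(3)[OF q_in(2)[OF that], of ?z] Z0R[OF that, of 1] by simp
    then have "?z * (1 + b1 0 * ?z\<^sup>2) = 0" by (simp add: algebra_simps power2_eq_square power3_eq_cube)
    then have "b1 0 * ?z\<^sup>2 = b1 0 * zs\<^sup>2" using Z0_bd(1)[OF that] zs by auto
    then have "?z\<^sup>2 = zs\<^sup>2" using b1_neg by simp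
    then show ?thesis using Z0_bd(1)[OF that] zs by (simp add: power2_eq_iff)
  qed

  \<comment> \<open>Factorization of the field on the axis\<close>
  define Q where "Q = ball (0::param) r1"
  define q' where "q' q = (snd (snd q), (fst q, fst (snd q)))" for q :: param
  have oQ: "open Q" by (simp add: Q_def)
  define G where "G z = g (fst (q' (snd z)), snd (q' (snd z)), Z0 (snd z) * fst z)" for z :: "real \<times> param"
  have oD: "open (ball (0::real) 4 \<times> Q)" by (intro open_Times open_ball oQ)
  have Z0_s: "smooth_on X (\<lambda>z. Z0 (h z))" if "open X" "smooth_on X h" "\<And>z. z \<in> X \<Longrightarrow> h z \<in> Q"
      for X :: "'z::real_normed_vector set" and h
    by (rule smooth_on_compose[OF Z0_smooth that(2,1) open_ball]) (use that(3) in \<open>auto simp: Q_def\<close>)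
  have G: "smooth_on (ball 0 4 \<times> Q) G" unfolding G_def
  proof (rule smooth_on_compose[OF g' _ oD Dg])
    show "smooth_on (ball 0 4 \<times> Q) (\<lambda>z. (fst (q' (snd z)), snd (q' (snd z)), Z0 (snd z) * fst z))"
      unfolding q'_def fst_conv snd_conv by (intro smooth_intros oD Z0_s) auto
    fix z :: "real \<times> param" assume z: "z \<in> ball 0 4 \<times> Q"
    obtain s d b e where zz: "z = (s, d, b, e)" by (metis surj_pair)
    have q: "(d, b, e) \<in> ball 0 r1" and s: "\<bar>s\<bar> < 4" using z by (auto simp: zz Q_def)
    show "(fst (q' (snd z)), snd (q' (snd z)), Z0 (snd z) * fst z) \<in> Dg"
      using q_in[OF q] Z0R[OF q, of s] s by (simp add: Dg_def zz q'_def)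
  qed
  have g_0: "g (e, x, 0) = 0" if "e \<in> ball 0 e0" "x \<in> ball 0 1" for e x
  proof (cases "e = 0")
    case True
    then show ?thesis using g(3)[OF that(2), of 0] R by simp
  next
    case False
    have "e\<^sup>2 *\<^sub>R F1 (e, x, 0) = 0" using F1(2)[OF that, of 0] F_0[OF inP[OF that]] R by simp
    then have "F1 (e, x, 0) = 0" using False by simp
    then have "F1 (e, x, (0, 0)) = 0" by (simp add: zero_prod_def)
    then show ?thesis using g(2)[OF that, of 0] R False by simp
  qed
  \<comment> \<open>g vanishes at Z = 0 and at Z = 1, so the factors Z and 1 - Z split off one after
    the other by Hadamard's lemma. The radii 4, 3, 2 allow for the substitution of 1 - Z for
    Z.\<close>
  obtain G1 where G1: "smooth_on (ball 0 4 \<times> Q) G1" "\<And>s q. (s, q) \<in> ball 0 4 \<times> Q \<Longrightarrow> G (s, q) = s *\<^sub>R G1 (s, q)"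
  proof (rule smooth_on_division[OF G oD])
    fix s :: real and q :: param and t :: real assume "(s, q) \<in> ball 0 4 \<times> Q" "0 \<le> t" "t \<le> 1"
    then show "(t * s, q) \<in> ball 0 4 \<times> Q" using mult_left_le_one_le[of "\<bar>s\<bar>" t] by (auto simp: abs_mult)
  next
    fix q :: param assume "(0, q) \<in> ball (0::real) 4 \<times> Q"
    moreover obtain d b e where qq: "q = (d, b, e)" by (metis surj_pair)
    ultimately show "G (0, q) = 0" using g_0 q_in[of d b e] by (simp add: G_def q'_def Q_def)
  qed (rule that)
  have oD3: "open (ball (0::real) 3 \<times> Q)" by (intro open_Times open_ball oQ)
  have H: "smooth_on (ball 0 3 \<times> Q) (\<lambda>z. G1 (1 - fst z, snd z))"
    by (rule smooth_on_compose[OF G1(1) _ oD3 oD]) (auto intro!: smooth_intros oD3)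
  obtain H1 where H1: "smooth_on (ball 0 3 \<times> Q) H1" "\<And>s q. (s, q) \<in> ball 0 3 \<times> Q \<Longrightarrow> G1 (1 - s, q) = s *\<^sub>R H1 (s, q)"
  proof (rule smooth_on_division[OF H oD3])
    fix s :: real and q :: param and t :: real assume "(s, q) \<in> ball 0 3 \<times> Q" "0 \<le> t" "t \<le> 1"
    then show "(t * s, q) \<in> ball 0 3 \<times> Q" using mult_left_le_one_le[of "\<bar>s\<bar>" t] by (auto simp: abs_mult)
  next
    fix q :: param assume q: "(0, q) \<in> ball (0::real) 3 \<times> Q"
    obtain d b e where qq: "q = (d, b, e)" by (metis surj_pair)
    show "G1 (1 - fst (0::real, q), snd (0::real, q)) = 0"
      using G1(2)[of 1 q] q Z0_root[of d b e] by (simp add: G_def q'_def Q_def qq)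
  qed (use that in auto)
  define m2 where "m2 z = H1 (1 - snd z, fst z)" for z :: "param \<times> real"
  have oQ2: "open (Q \<times> ball (0::real) 2)" by (intro open_Times open_ball oQ)
  have m2: "smooth_on (Q \<times> ball 0 2) m2" unfolding m2_def
    by (rule smooth_on_compose[OF H1(1) _ oQ2 oD3]) (auto intro!: smooth_intros oQ2)
  have G_m2: "G (Z, q) = Z * (1 - Z) * m2 (q, Z)" if "q \<in> Q" "\<bar>Z\<bar> < 2" for q Z
    using G1(2)[of Z q] H1(2)[of "1 - Z" q] that by (simp add: m2_def)
  \<comment> \<open>In the open interval Z (1 - Z) can be cancelled, which leaves zs (1 + Z); the
    end points follow by continuity.\<close>
  have m2_0: "m2 (0, Z) \<ge> zs" if "Z \<in> {0..1}" for Z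
  proof (rule continuous_ge_on_closure[where S="{0<..<1}" and f="\<lambda>Z. m2 (0, Z)"])
    have "0 \<in> Q" using x(1) by (simp add: Q_def)
    then show "continuous_on (closure {0<..<1}) (\<lambda>Z. m2 (0, Z))"
      by (intro continuous_on_compose2[OF smooth_on_continuous[OF m2]]) (auto intro!: continuous_intros)
    show "Z \<in> closure {0<..<1}" using that by simp
    fix Z :: real assume Z: "Z \<in> {0<..<1}"
    have q0: "((0::real), (0::real), (0::real)) \<in> ball 0 r1" using x(1) by (simp add: zero_prod_def[symmetric])
    have "G (Z, 0) = zs * Z + b1 0 * (zs * Z) ^ 3"
      using g(3)[of "(0, 0)" "zs * Z"] Z0_0[OF q0] Z0R[OF q0, of Z] Z by (simp add: G_def q'_def zero_prod_def)
    also have "\<dots> = zs * Z + (b1 0 * zs\<^sup>2) * zs * Z ^ 3" by (simp add: power2_eq_square power3_eq_cube algebra_simps)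
    also have "\<dots> = Z * (1 - Z) * (zs * (1 + Z))" unfolding zs(2) by (simp add: power3_eq_cube algebra_simps)
    finally have "Z * (1 - Z) * m2 (0, Z) = Z * (1 - Z) * (zs * (1 + Z))" using G_m2[OF \<open>0 \<in> Q\<close>, of Z] Z by simp
    then have "m2 (0, Z) = zs * (1 + Z)" using Z by simp
    then show "zs \<le> m2 (0, Z)" using Z zs by (simp add: algebra_simps)
  qed
  obtain r2 where r2: "r2 > 0" "\<And>z y. z \<in> {0} \<times> {0..1} \<Longrightarrow> dist z y < r2 \<Longrightarrow> y \<in> Q \<times> ball 0 2 \<and> dist (m2 z) (m2 y) < zs"
  proof (rule uniformly_continuous_nbhd[OF _ _ oQ2 smooth_on_continuous[OF m2] zs(1)])
    show "compact ({0::param} \<times> {0..1::real})" by (intro compact_Times) auto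
    show "{0::param} \<times> {0..1::real} \<subseteq> Q \<times> ball 0 2" using x(1) by (auto simp: Q_def)
  qed (use that in blast)
  have b1_ev: "\<exists>r3>0. \<forall>p. norm p < r3 \<longrightarrow> b1 p < b1 0 / 2"
  proof -
    have "isCont b1 0" using smooth_on_continuous[OF coeffs(6)] P by (simp add: continuous_on_eq_continuous_at)
    then obtain d where "d > 0" "\<And>p. dist p 0 < d \<Longrightarrow> dist (b1 p) (b1 0) < - b1 0 / 2"
      unfolding continuous_at_eps_delta using b1_neg by (metis divide_pos_pos neg_0_less_iff_less zero_less_numeral)
    then show ?thesis by (intro exI[of _ d]) (fastforce simp: dist_real_def)
  qed
  then obtain r3 where r3: "r3 > 0" "\<And>p. norm p < r3 \<Longrightarrow> b1 p < b1 0 / 2" by blast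
  obtain r4 where r4: "r4 > 0" "\<And>d b e. norm (d, b, e) < r4 \<Longrightarrow> norm (rescaled_params \<nu> e (d, b)) < r3"
  proof -
    have "continuous_on UNIV (\<lambda>q. rescaled_params \<nu> (snd (snd q)) (fst q, fst (snd q)))"
      unfolding rescaled_params_def by (intro continuous_intros)
    then have "isCont (\<lambda>q. rescaled_params \<nu> (snd (snd q)) (fst q, fst (snd q))) 0"
      using continuous_on_eq_continuous_at[OF open_UNIV] by blast
    then obtain d where "d > 0" "\<And>q. dist q 0 < d \<Longrightarrow> dist (rescaled_params \<nu> (snd (snd q)) (fst q, fst (snd q)))
        (rescaled_params \<nu> (snd (snd (0::param))) (fst (0::param), fst (snd (0::param)))) < r3"
      unfolding continuous_at_eps_delta using r3(1) by metis
    moreover have "rescaled_params \<nu> (snd (snd (0::param))) (fst (0::param), fst (snd (0::param))) = 0"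
        by (simp add: rescaled_params_def zero_prod_def)
    ultimately show ?thesis using that[of d] by fastforce
  qed
  define r where "r = min r1 (min r2 r4)"
  have r: "r > 0" "r \<le> r1" "r \<le> r2" "r \<le> r4" using x(1) r2 r4 by (auto simp: r_def)
  have rQ: "q \<in> Q" "q \<in> ball 0 r1" if "norm q < r" for q using that r by (auto simp: Q_def)
  define f where "f z = (fst (F1 (fst (q' (fst z)), snd (q' (fst z)), (A * fst (snd z), Z0 (fst z) * snd (snd z))))
      / (of_real \<nu> * A),
      snd (F1 (fst (q' (fst z)), snd (q' (fst z)), (A * fst (snd z), Z0 (fst z) * snd (snd z)))) / (\<nu> * Z0 (fst z)))"
          for z :: "param \<times> phase"
  have in_R: "(A * V, Z0 q * Z) \<in> ball 0 R" if "norm q < r" "norm (V, Z) < 10" for q V Z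
  proof -
    have "norm V < 10" "\<bar>Z\<bar> < 10" using norm_fst_le'[of "(V, Z)"] norm_snd_le'[of "(V, Z)"] that by auto
    then have "norm A * norm V \<le> norm A * 10" "\<bar>Z0 q\<bar> * \<bar>Z\<bar> \<le> (2 * zs) * 10"
      using Z0_bd[OF rQ(2)[OF that(1)]] zs mult_mono[of "\<bar>Z0 q\<bar>" "2 * zs" "\<bar>Z\<bar>" 10] by (auto intro!: mult_left_mono)
    moreover have "norm (A * V, Z0 q * Z) \<le> norm A * norm V + \<bar>Z0 q\<bar> * \<bar>Z\<bar>"
      using norm_Pair_le[of "A * V" "Z0 q * Z"] by (simp add: norm_mult abs_mult)
    ultimately have "norm (A * V, Z0 q * Z) < R"
      unfolding R_eq using zs(1) norm_ge_zero[of A] by linarith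
    then show ?thesis by simp
  qed
  have orD: "open (ball (0::param) r \<times> ball (0::phase) 10)" "open (ball (0::param) r \<times> ball (0::real) 2)"
    by (intro open_Times open_ball)+
  have F1s: "smooth_on (ball 0 r \<times> ball 0 10) (\<lambda>z. F1 (fst (q' (fst z)), snd (q' (fst z)), (A * fst (snd z), Z0 (fst z)
      * snd (snd z))))"
  proof (rule smooth_on_compose[OF F1(1) _ orD(1)])
    show "smooth_on (ball 0 r \<times> ball 0 10) (\<lambda>z. (fst (q' (fst z)), snd (q' (fst z)), (A * fst (snd z), Z0 (fst z)
        * snd (snd z))))"
      unfolding q'_def fst_conv snd_conv using rQ by (intro smooth_intros orD Z0_s) auto
    show "open (ball 0 e0 \<times> ball (0 :: real \<times> real) 1 \<times> ball (0 :: phase) R)" by (intro open_Times open_ball)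
    fix z :: "param \<times> phase" assume z: "z \<in> ball 0 r \<times> ball 0 10"
    obtain d b e V Z where zz: "z = ((d, b, e), (V, Z))" by (metis surj_pair)
    show "(fst (q' (fst z)), snd (q' (fst z)), (A * fst (snd z), Z0 (fst z) * snd (snd z))) \<in> ball 0 e0 \<times> ball 0 1 \<times> ball 0 R"
      using q_in[of d b e] in_R[of "(d, b, e)" V Z] z rQ(2)[of "(d, b, e)"] by (simp add: zz q'_def)
  qed
  have Z0_pos: "Z0 q > 0" if "norm q < r" for q using Z0_bd(1)[OF rQ(2)[OF that]] zs by simp
  have f_smooth: "smooth_on (ball 0 r \<times> ball 0 10) f"
  proof -
    have "smooth_on (ball 0 r \<times> ball 0 10) (\<lambda>z. (fst (F1 (fst (q' (fst z)), snd (q' (fst z)), (A * fst (snd z),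
        Z0 (fst z) * snd (snd z)))) * (1 / (of_real \<nu> * A)),
      snd (F1 (fst (q' (fst z)), snd (q' (fst z)), (A * fst (snd z), Z0 (fst z) * snd (snd z)))) / (\<nu> * Z0 (fst z))))"
      using rQ Z0_pos \<nu> by (intro smooth_intros F1s orD Z0_s) (auto simp: less_imp_neq[symmetric])
    then show ?thesis by (simp add: f_def[abs_def])
  qed
  define m where "m z = m2 z / (\<nu> * Z0 (fst z))" for z :: "param \<times> real"
  have m_smooth: "smooth_on (ball 0 r \<times> ball 0 2) m" unfolding m_def
    using rQ Z0_pos \<nu> by (intro smooth_intros orD Z0_s smooth_on_subset[OF m2]) (auto simp: less_imp_neq[symmetric])
  define K where "K = C * (2 * zs) ^ 3 / sqrt (- b1 0 / 2)"
  show ?thesis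
  proof (rule that[OF r(1) \<nu> A0 \<kappa> _ f_smooth m_smooth])
    show "Z0 q > 0" if "q \<in> ball 0 r" for q using Z0_pos that by simp
    show "f ((d, b, 0), (V, Z)) = ((- of_real (1 + d) + \<i> * of_real b) * V + 2 * of_real Z * cnj V, Re (\<kappa> * V\<^sup>2))"
      if "norm (d, b, 0::real) < r" "norm (V, Z) < 10" for d b V Z
    proof -
      have q: "(d, b, 0::real) \<in> ball 0 r1" using rQ(2)[OF that(1)] .
      have F: "F1 (0, (d, b), (A * V, zs * Z)) = ((- of_real (\<nu> * (1 + d)) + \<i> * of_real (\<nu> * b)) * (A * V)
          + a0 0 * of_real (zs * Z) * cnj (A * V), 2 * Re (b0 0 * (A * V)\<^sup>2))"
        using F1(3)[OF q_in(2)[OF q], of "(A * V, zs * Z)"] in_R[OF that] Z0_0[OF q] by simp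
      have "a0 0 * of_real (zs * Z) * cnj (A * V) = (a0 0 * cnj A) * of_real (zs * Z) * cnj V" by simp
      also have "\<dots> = of_real \<nu> * A * (2 * of_real Z * cnj V)" unfolding cnjA \<nu>_def by simp
      finally have "fst (F1 (0, (d, b), (A * V, zs * Z))) = (of_real \<nu> * A) * ((- of_real (1 + d) + \<i> * of_real b) * V +
          2 * of_real Z * cnj V)"
        unfolding F by (simp add: algebra_simps)
      then have 1: "fst (F1 (0, (d, b), (A * V, zs * Z))) / (of_real \<nu> * A) = (- of_real (1 + d) + \<i> * of_real b) * V +
          2 * of_real Z * cnj V"
        using \<nu> A0 by (simp only: nonzero_mult_div_cancel_left mult_eq_0_iff of_real_eq_0_iff) simp
      have Re_scale: "Re (of_real s * c) = s * Re c" for s c by simp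
      have "snd (F1 (0, (d, b), (A * V, zs * Z))) = Re (of_real (\<nu> * zs) * (\<kappa> * V\<^sup>2))"
        unfolding F \<kappa>_def using \<nu> zs by (simp add: power_mult_distrib mult.assoc)
      also have "\<dots> = (\<nu> * zs) * Re (\<kappa> * V\<^sup>2)" using Re_scale by (simp only:)
      finally have 2: "snd (F1 (0, (d, b), (A * V, zs * Z))) / (\<nu> * zs) = Re (\<kappa> * V\<^sup>2)" using \<nu> zs by simp
      show ?thesis using 1 2 by (simp add: f_def q'_def Z0_0[OF q])
    qed
    show "f (q, (0, Z)) = (0, snd (snd q) * (Z * (1 - Z)) * m (q, Z))" if h: "norm q < r" "\<bar>Z\<bar> < 2" for q Z
    proof -
      obtain d b e where qq: "q = (d, b, e)" by (metis surj_pair)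
      have q: "(d, b, e) \<in> ball 0 r1" using rQ(2)[OF h(1)] by (simp add: qq)
      note qi = q_in[OF q]
      have zR: "Z0 q * Z \<in> ball 0 R" using Z0R[OF q, of Z] h(2) by (simp add: qq)
      have wR: "(0, Z0 q * Z) \<in> ball (0::phase) R" using zR by (simp add: zero_prod_def dist_Pair_Pair)
      have "fst (F1 (e, (d, b), (0, Z0 q * Z))) = 0"
      proof (cases "e = 0")
        case True
        then show ?thesis using F1(3)[OF qi(2) wR] by simp
      next
        case False
        have "fst (F (rescaled_params \<nu> e (d, b)) (e *\<^sub>R (0, Z0 q * Z))) = 0"
          using F_axis[OF inP[OF qi], of "e * (Z0 q * Z)"] inW[OF qi(1) wR] by simp
        then show ?thesis using F1(2)[OF qi wR] False by simp
      qed
      moreover have "snd (F1 (e, (d, b), (0, Z0 q * Z))) = e * (Z * (1 - Z) * m2 (q, Z))"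
        using g(2)[OF qi zR] G_m2[OF rQ(1)[OF h(1)] h(2)] by (simp add: G_def q'_def qq)
      ultimately show ?thesis by (simp add: f_def q'_def qq m_def)
    qed
    show "m (q, Z) > 0" if "norm q < r" "0 \<le> Z" "Z \<le> 1" for q Z
    proof -
      have "dist (m2 (0, Z)) (m2 (q, Z)) < zs"
        using r2(2)[of "(0, Z)" "(q, Z)"] that r by (auto simp: dist_Pair_Pair)
      then have "m2 (q, Z) > 0" using m2_0[of Z] that by (auto simp: dist_real_def)
      then show ?thesis using Z0_pos[OF that(1)] \<nu> by (simp add: m_def)
    qed
    show "rescaled_params \<nu> e (d, b) \<in> P \<and> (e *\<^sub>R (A * V), e * (Z0 (d, b, e) * Z)) \<in> W \<and>
        F (rescaled_params \<nu> e (d, b)) (e *\<^sub>R (A * V), e * (Z0 (d, b, e) * Z))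
          = (e\<^sup>2 * \<nu>) *\<^sub>R (A * fst (f ((d, b, e), (V, Z))), Z0 (d, b, e) * snd (f ((d, b, e), (V, Z))))"
      if "norm (d, b, e) < r" "norm (V, Z) < 10" for d b e V Z
    proof -
      note qi = q_in[OF rQ(2)[OF that(1)]]
      have "(e\<^sup>2 * \<nu>) *\<^sub>R (A * fst (f ((d, b, e), (V, Z))), Z0 (d, b, e) * snd (f ((d, b, e), (V, Z))))
          = e\<^sup>2 *\<^sub>R F1 (e, (d, b), (A * V, Z0 (d, b, e) * Z))"
        using \<nu> A0 Z0_pos[OF that(1)] by (simp add: f_def q'_def prod_eq_iff scaleR_conv_of_real)
      then show ?thesis using inP[OF qi] inW[OF qi(1) in_R[OF that]] F1(2)[OF qi in_R[OF that]] by simp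
    qed
    show "\<bar>Z0 (d, b, e) - 1 / sqrt \<bar>b1 (rescaled_params \<nu> e (d, b))\<bar>\<bar> \<le> K * \<bar>e\<bar>" if "norm (d, b, e) < r" "e \<noteq> 0" for d b e
    proof -
      let ?Z = "Z0 (d, b, e)"
      define \<beta> where "\<beta> = - b1 (rescaled_params \<nu> e (d, b))"
      have q: "(d, b, e) \<in> ball 0 r1" by (rule rQ(2)[OF that(1)])
      have \<beta>: "\<beta> > - b1 0 / 2" using r3(2)[OF r4(2)[of d b e]] that(1) r by (simp add: \<beta>_def)
      then have \<beta>0: "\<beta> > 0" using b1_neg by simp
      have "\<bar>?Z - \<beta> * ?Z ^ 3\<bar> \<le> C * \<bar>e\<bar> * ?Z ^ 4"
        using g(4)[OF q_in[OF q] _ that(2), of ?Z] Z0R[OF q, of 1] Z0_root[OF q] by (simp add: \<beta>_def abs_minus_commute)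
      moreover have "?Z - \<beta> * ?Z ^ 3 = ?Z * (1 - \<beta> * ?Z\<^sup>2)" "C * \<bar>e\<bar> * ?Z ^ 4 = ?Z * (C * \<bar>e\<bar> * ?Z ^ 3)"
        by (simp_all add: eval_nat_numeral algebra_simps)
      ultimately have "\<bar>1 - \<beta> * ?Z\<^sup>2\<bar> \<le> C * \<bar>e\<bar> * ?Z ^ 3"
        using Z0_pos[OF that(1)] by (simp add: abs_mult)
      \<comment> \<open>The cofactor 1 + sqrt \<beta> Z is at least 1, so the defect of the equation
        bounds the distance of Z from 1 / sqrt \<beta>.\<close>
      moreover have "1 - \<beta> * ?Z\<^sup>2 = (1 - sqrt \<beta> * ?Z) * (1 + sqrt \<beta> * ?Z)"
        using \<beta>0 by (simp add: algebra_simps power2_eq_square)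
      moreover have "\<bar>(1 - sqrt \<beta> * ?Z) * (1 + sqrt \<beta> * ?Z)\<bar> \<ge> \<bar>1 - sqrt \<beta> * ?Z\<bar> * 1"
        unfolding abs_mult using \<beta>0 Z0_pos[OF that(1)] by (intro mult_left_mono) auto
      ultimately have 1: "\<bar>1 - sqrt \<beta> * ?Z\<bar> \<le> C * \<bar>e\<bar> * ?Z ^ 3" by simp
      have "\<bar>?Z - 1 / sqrt \<beta>\<bar> = \<bar>1 - sqrt \<beta> * ?Z\<bar> / sqrt \<beta>"
      proof -
        have "?Z - 1 / sqrt \<beta> = (sqrt \<beta> * ?Z - 1) / sqrt \<beta>" using \<beta>0 by (simp add: diff_divide_distrib)
        then show ?thesis using \<beta>0 by (simp add: abs_minus_commute)
      qed
      also have "\<dots> \<le> C * \<bar>e\<bar> * ?Z ^ 3 / sqrt \<beta>" using 1 \<beta>0 by (intro divide_right_mono) auto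
      also have "\<dots> \<le> C * \<bar>e\<bar> * (2 * zs) ^ 3 / sqrt (- b1 0 / 2)"
        using Z0_bd(2)[OF q] Z0_pos[OF that(1)] C \<beta> \<beta>0 b1_neg
        by (intro frac_le mult_left_mono power_mono) auto
      finally show ?thesis using \<beta>0 by (simp add: K_def \<beta>_def mult.commute mult.left_commute)
    qed
  qed
qed

end

subsection \<open>Uniqueness of trajectories\<close>

text \<open>For a continuously differentiable f the difference of f and its derivative at w has a
  small Lipschitz constant near w. This controls differences of two trajectories, not merely the
  distance of one from w.\<close>

lemma strictly_differentiable:
  fixes f :: "'a::euclidean_space \<Rightarrow> 'b::real_normed_vector"
  assumes "smooth_on W f" "open W" "w \<in> W" "e > 0"
  obtains r where "r > 0" "ball w r \<subseteq> W"
    "\<And>u v. u \<in> ball w r \<Longrightarrow> v \<in> ball w r \<Longrightarrow> norm (f u - f v - frechet_derivative f (at w) (u - v)) \<le> e * norm (u - v)"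
proof -
  define N where "N = real DIM('a)"
  have N: "N > 0" by (simp add: N_def)
  let ?D = "\<lambda>y. frechet_derivative f (at y)"
  have "\<exists>d>0. \<forall>y. dist w y < d \<longrightarrow> y \<in> W \<and> dist (?D w i) (?D y i) < e / N" for i
    using uniformly_continuous_nbhd[of "{w}" W "\<lambda>y. ?D y i" "e / N"]
        smooth_on_continuous[OF smooth_on_derivative[OF assms(1), of i]] assms N
    by (metis compact_sing divide_pos_pos empty_subsetI insert_subset singletonI)
  then obtain d where d: "\<And>i. d i > 0" "\<And>i y. dist w y < d i \<Longrightarrow> y \<in> W \<and> dist (?D w i) (?D y i) < e / N" by metis
  obtain i0 :: 'a where i0: "i0 \<in> Basis" using nonempty_Basis by blast
  define r where "r = Min (d ` Basis)"
  have r: "r > 0" "\<And>i. i \<in> Basis \<Longrightarrow> r \<le> d i" using d by (auto simp: r_def)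
  have rW: "ball w r \<subseteq> W" using d(2)[of _ i0] r(2)[OF i0] by force
  show ?thesis
  proof (rule that[OF r(1) rW])
    fix u v assume uv: "u \<in> ball w r" "v \<in> ball w r"
    have der: "(f has_derivative ?D y) (at y)" if "y \<in> ball w r" for y
      using smooth_on_has_derivative[OF assms(1)] that rW by blast
    interpret D: bounded_linear "?D w" using der[of w] r has_derivative_bounded_linear by auto
    have "norm ((f u - ?D w u) - (f v - ?D w v)) \<le> e * norm (u - v)"
    proof (rule differentiable_bound[where S="ball w r" and f'="\<lambda>y h. ?D y h - ?D w h"])
      fix y assume y: "y \<in> ball w r"
      show "((\<lambda>y. f y - ?D w y) has_derivative (\<lambda>h. ?D y h - ?D w h)) (at y within ball w r)"
        by (intro has_derivative_diff has_derivative_at_withinI[OF der[OF y]]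
            bounded_linear_imp_has_derivative D.bounded_linear_axioms)
      interpret Dy: bounded_linear "?D y" using der[OF y] by (rule has_derivative_bounded_linear)
      show "onorm (\<lambda>h. ?D y h - ?D w h) \<le> e"
      proof (rule onorm_le)
        fix h
        have "?D y h - ?D w h = ?D y (\<Sum>i\<in>Basis. (h \<bullet> i) *\<^sub>R i) - ?D w (\<Sum>i\<in>Basis. (h \<bullet> i) *\<^sub>R i)"
          by (simp only: euclidean_representation)
        also have "\<dots> = (\<Sum>i\<in>Basis. (h \<bullet> i) *\<^sub>R (?D y i - ?D w i))"
          by (simp only: Dy.sum Dy.scaleR D.sum D.scaleR sum_subtractf[symmetric] scaleR_diff_right)
        also have "norm \<dots> \<le> (\<Sum>i\<in>(Basis::'a set). norm h * (e / N))"
        proof (rule sum_norm_le)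
          fix i :: 'a assume i: "i \<in> Basis"
          have "dist (?D w i) (?D y i) < e / N" using d(2)[of y i] y r(2)[OF i] by simp
          then show "norm ((h \<bullet> i) *\<^sub>R (?D y i - ?D w i)) \<le> norm h * (e / N)"
            using mult_mono[OF Basis_le_norm[OF i, of h], of "norm (?D y i - ?D w i)" "e / N"]
            by (simp add: dist_norm norm_minus_commute)
        qed
        also have "\<dots> = e * norm h" using N by (simp add: N_def)
        finally show "norm (?D y h - ?D w h) \<le> e * norm h" .
      qed
    qed (use uv in auto)
    then show "norm (f u - f v - ?D w (u - v)) \<le> e * norm (u - v)" by (simp add: D.diff algebra_simps)
  qed
qed

text \<open>A Gronwall estimate of the squared distance, in both time directions, shows that the set
  of coincidence is open; it is closed in T by continuity, and T is connected.\<close>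

lemma trajectories_unique:
  fixes f :: "'a::euclidean_space \<Rightarrow> 'a"
  assumes f: "smooth_on W f" "open W" and T: "open T" "connected T"
    and x: "\<And>t. t \<in> T \<Longrightarrow> x t \<in> W" "\<And>t. t \<in> T \<Longrightarrow> (x has_vector_derivative f (x t)) (at t)"
    and y: "\<And>t. t \<in> T \<Longrightarrow> y t \<in> W" "\<And>t. t \<in> T \<Longrightarrow> (y has_vector_derivative f (y t)) (at t)"
    and t0: "t0 \<in> T" "x t0 = y t0" and t: "t \<in> T"
  shows "x t = y (t::real)"
proof -
  have cx: "continuous_on T x"
    by (intro continuous_at_imp_continuous_on ballI has_vector_derivative_continuous[OF x(2)])
  have cy: "continuous_on T y"
    by (intro continuous_at_imp_continuous_on ballI has_vector_derivative_continuous[OF y(2)])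
  define S where "S = {t \<in> T. x t - y t = 0}"
  have "open S" unfolding open_contains_ball
  proof
    fix t1 assume "t1 \<in> S"
    then have t1: "t1 \<in> T" "x t1 = y t1" by (auto simp: S_def)
    obtain r where r: "r > 0" "ball (x t1) r \<subseteq> W"
      "\<And>u v. u \<in> ball (x t1) r \<Longrightarrow> v \<in> ball (x t1) r \<Longrightarrow> norm (f u - f v - frechet_derivative f (at (x t1)) (u - v)) \<le>
          1 * norm (u - v)"
      using strictly_differentiable[OF f x(1)[OF t1(1)], of 1] by auto
    have "bounded_linear (frechet_derivative f (at (x t1)))"
      using smooth_on_has_derivative[OF f(1) x(1)[OF t1(1)]] has_derivative_bounded_linear by blast
    then obtain K where K: "K > 0" "\<And>v. norm (frechet_derivative f (at (x t1)) v) \<le> norm v * K"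
      using bounded_linear.pos_bounded by blast
    define L where "L = K + 1"
    have lip: "norm (f u - f v) \<le> L * norm (u - v)" if "u \<in> ball (x t1) r" "v \<in> ball (x t1) r" for u v
      using r(3)[OF that] K(2)[of "u - v"] norm_triangle_ineq2[of "f u - f v" "frechet_derivative f (at (x t1)) (u - v)"]
      by (simp add: L_def algebra_simps)
    obtain d0 where d0: "d0 > 0" "ball t1 d0 \<subseteq> T" using T(1) t1(1) openE by blast
    have "isCont x t1" "isCont y t1" using x(2) y(2) t1(1) has_vector_derivative_continuous by blast+
    then obtain d1 d2 where d1: "d1 > 0" "\<And>t. dist t t1 < d1 \<Longrightarrow> dist (x t) (x t1) < r"
      and d2: "d2 > 0" "\<And>t. dist t t1 < d2 \<Longrightarrow> dist (y t) (y t1) < r"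
      unfolding continuous_at_eps_delta using r(1) by metis
    define d where "d = min d0 (min d1 d2)"
    have d: "d > 0" using d0 d1 d2 by (simp add: d_def)
    have near: "t \<in> T" "x t \<in> ball (x t1) r" "y t \<in> ball (x t1) r" if "t \<in> ball t1 d" for t
      using that d0(2) d1(2)[of t] d2(2)[of t] t1(2) by (auto simp: d_def dist_commute)
    define q where "q t = (x t - y t) \<bullet> (x t - y t)" for t
    have q_der: "(q has_real_derivative 2 * ((f (x t) - f (y t)) \<bullet> (x t - y t))) (at t)" if "t \<in> ball t1 d" for t
    proof -
      have "((\<lambda>t. x t - y t) has_vector_derivative f (x t) - f (y t)) (at t)"
        using near(1)[OF that] by (intro has_vector_derivative_diff x(2) y(2))
      then have "((\<lambda>t. x t - y t) has_derivative (\<lambda>h. h *\<^sub>R (f (x t) - f (y t)))) (at t)"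
        by (simp add: has_vector_derivative_def)
      from has_derivative_inner[OF this this] show ?thesis
        unfolding q_def has_field_derivative_def
        by (rule has_derivative_eq_rhs) (auto simp: fun_eq_iff inner_commute)
    qed
    have q_bd: "\<bar>2 * ((f (x t) - f (y t)) \<bullet> (x t - y t))\<bar> \<le> 2 * L * q t" if "t \<in> ball t1 d" for t
    proof -
      have "\<bar>(f (x t) - f (y t)) \<bullet> (x t - y t)\<bar> \<le> norm (f (x t) - f (y t)) * norm (x t - y t)"
        by (rule Cauchy_Schwarz_ineq2)
      also have "\<dots> \<le> L * norm (x t - y t) * norm (x t - y t)"
        using lip[OF near(2,3)[OF that]] by (intro mult_right_mono) auto
      finally show ?thesis by (simp add: q_def power2_norm_eq_inner[symmetric] power2_eq_square)
    qed
    have "q t = 0" if t: "t \<in> ball t1 d" for t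
    proof (cases "t \<ge> t1")
      case True
      have "exp (- (2 * L * t)) * q t \<le> exp (- (2 * L * t1)) * q t1"
      proof (rule DERIV_nonpos_imp_nonincreasing[OF True])
        fix s assume "t1 \<le> s" "s \<le> t"
        then have s: "s \<in> ball t1 d" using t by (auto simp: dist_real_def)
        have "((\<lambda>s. exp (- (2 * L * s)) * q s) has_real_derivative
            exp (- (2 * L * s)) * (2 * ((f (x s) - f (y s)) \<bullet> (x s - y s)) - 2 * L * q s)) (at s)"
          by (auto intro!: derivative_eq_intros q_der[OF s] simp: algebra_simps)
        moreover have "exp (- (2 * L * s)) * (2 * ((f (x s) - f (y s)) \<bullet> (x s - y s)) - 2 * L * q s) \<le> 0"
          using q_bd[OF s] by (intro mult_nonneg_nonpos) auto
        ultimately show "\<exists>y. ((\<lambda>s. exp (- (2 * L * s)) * q s) has_real_derivative y) (at s) \<and> y \<le> 0" by blast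
      qed
      then have "exp (- (2 * L * t)) * q t \<le> 0" by (simp add: q_def t1(2))
      then have "q t \<le> 0" by (simp add: mult_le_0_iff)
      then show ?thesis using inner_ge_zero[of "x t - y t"] by (simp add: q_def)
    next
      case False
      then have "t \<le> t1" by simp
      have "exp (2 * L * t) * q t \<le> exp (2 * L * t1) * q t1"
      proof (rule DERIV_nonneg_imp_nondecreasing[OF \<open>t \<le> t1\<close>])
        fix s assume "t \<le> s" "s \<le> t1"
        then have s: "s \<in> ball t1 d" using t by (auto simp: dist_real_def)
        have "((\<lambda>s. exp (2 * L * s) * q s) has_real_derivative
            exp (2 * L * s) * (2 * ((f (x s) - f (y s)) \<bullet> (x s - y s)) + 2 * L * q s)) (at s)"
          by (auto intro!: derivative_eq_intros q_der[OF s] simp: algebra_simps)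
        moreover have "exp (2 * L * s) * (2 * ((f (x s) - f (y s)) \<bullet> (x s - y s)) + 2 * L * q s) \<ge> 0"
          using q_bd[OF s] by (intro mult_nonneg_nonneg) auto
        ultimately show "\<exists>y. ((\<lambda>s. exp (2 * L * s) * q s) has_real_derivative y) (at s) \<and> 0 \<le> y" by blast
      qed
      then have "exp (2 * L * t) * q t \<le> 0" by (simp add: q_def t1(2))
      then have "q t \<le> 0" by (simp add: mult_le_0_iff)
      then show ?thesis using inner_ge_zero[of "x t - y t"] by (simp add: q_def)
    qed
    then have "ball t1 d \<subseteq> S" using near(1) by (auto simp: q_def S_def)
    then show "\<exists>e>0. ball t1 e \<subseteq> S" using d by blast
  qed
  moreover have "open (T \<inter> (\<lambda>t. x t - y t) -` (- {0}))"
    by (rule continuous_open_preimage[OF _ T(1)]) (auto intro!: continuous_intros cx cy)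
  ultimately have "S \<inter> T = {} \<or> (T \<inter> (\<lambda>t. x t - y t) -` (- {0})) \<inter> T = {}"
    by (intro connectedD[OF T(2)]) (auto simp: S_def)
  then show ?thesis using t0 t by (auto simp: S_def)
qed

lemma pos_def_bound:
  fixes B :: "'a::euclidean_space \<Rightarrow> 'a"
  assumes B: "bounded_linear B" and pos: "\<And>v. v \<noteq> 0 \<Longrightarrow> B v \<bullet> v > 0"
  obtains c where "c > 0" "\<And>v. c * (norm v)\<^sup>2 \<le> B v \<bullet> v"
proof -
  interpret B: bounded_linear B by fact
  let ?S = "sphere (0::'a) 1"
  have "continuous_on ?S (\<lambda>v. B v \<bullet> v)"
    by (intro continuous_intros bounded_linear.continuous_on[OF B])
  moreover have "?S \<noteq> {}" by simp
  ultimately obtain v0 where v0: "v0 \<in> ?S" "\<And>v. v \<in> ?S \<Longrightarrow> B v0 \<bullet> v0 \<le> B v \<bullet> v"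
    using continuous_attains_inf[OF compact_sphere, of 0 1 "\<lambda>v. B v \<bullet> v"] by blast
  show ?thesis
  proof (rule that)
    show "B v0 \<bullet> v0 > 0" using pos[of v0] v0(1) by (cases "v0 = 0") auto
    show "B v0 \<bullet> v0 * (norm v)\<^sup>2 \<le> B v \<bullet> v" for v
    proof (cases "v = 0")
      case False
      have "B v0 \<bullet> v0 \<le> B (v /\<^sub>R norm v) \<bullet> (v /\<^sub>R norm v)" by (rule v0(2)) (use False in simp)
      also have "\<dots> = B v \<bullet> v / (norm v)\<^sup>2" by (simp add: B.scaleR divide_inverse power2_eq_square)
      finally show ?thesis using False by (simp add: pos_le_divide_eq)
    qed (simp add: B.zero)
  qed
qed

text \<open>The quadratic form \<open>J v \<bullet> v\<close>, positive along the unstable direction and negative along the stable ones,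
  increases along differences of trajectories near the saddle and vanishes as \<open>t \<rightarrow> -\<infinity>\<close>.\<close>

lemma backward_asymptotic_unique:
  fixes f J :: "'a::euclidean_space \<Rightarrow> 'a"
  assumes f: "smooth_on W f" "open W" "e \<in> W"
    and J: "bounded_linear J" "\<And>v w. J v \<bullet> w = v \<bullet> J w" "\<And>v. v \<noteq> 0 \<Longrightarrow> J (frechet_derivative f (at e) v) \<bullet> v > 0"
  obtains r where "r > 0" "\<And>x y s. \<lbrakk>\<And>t. t \<le> s \<Longrightarrow> x t \<in> ball e r \<and> (x has_vector_derivative f (x t)) (at t);
      \<And>t. t \<le> s \<Longrightarrow> y t \<in> ball e r \<and> (y has_vector_derivative f (y t)) (at t);
      (x \<longlongrightarrow> e) at_bot; (y \<longlongrightarrow> e) at_bot; J (x s - y s) \<bullet> (x s - y s) \<le> 0\<rbrakk> \<Longrightarrow> x s = y (s::real)"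
proof -
  let ?D = "frechet_derivative f (at e)"
  have D: "bounded_linear ?D" using smooth_on_has_derivative[OF f(1,3)] by (rule has_derivative_bounded_linear)
  obtain c where c: "c > 0" "\<And>v. c * (norm v)\<^sup>2 \<le> J (?D v) \<bullet> v"
    using pos_def_bound[OF bounded_linear_compose[OF J(1) D] J(3)] by blast
  obtain K where K: "K > 0" "\<And>v. norm (J v) \<le> norm v * K" using bounded_linear.pos_bounded[OF J(1)] by blast
  interpret J: bounded_linear J by (rule J(1))
  \<comment> \<open>With the constant c / (2 K) the error of linearization costs at most half of the
    lower bound c, so the form still grows with the factor c / 2.\<close>
  obtain r where r: "r > 0" "ball e r \<subseteq> W"
    "\<And>u v. u \<in> ball e r \<Longrightarrow> v \<in> ball e r \<Longrightarrow> norm (f u - f v - ?D (u - v)) \<le> c / (2 * K) * norm (u - v)"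
    using strictly_differentiable[OF f, of "c / (2 * K)"] c(1) K(1) by auto
  have key: "J (f u - f v) \<bullet> (u - v) \<ge> c / 2 * (norm (u - v))\<^sup>2" if "u \<in> ball e r" "v \<in> ball e r" for u v
  proof -
    let ?E = "f u - f v - ?D (u - v)"
    have "\<bar>J ?E \<bullet> (u - v)\<bar> \<le> norm (J ?E) * norm (u - v)" by (rule Cauchy_Schwarz_ineq2)
    also have "\<dots> \<le> (c / (2 * K) * norm (u - v) * K) * norm (u - v)"
      using K r(3)[OF that] by (intro mult_right_mono order_trans[OF K(2)]) auto
    also have "\<dots> = c / 2 * (norm (u - v))\<^sup>2" using K(1) by (simp add: power2_eq_square)
    finally have "J ?E \<bullet> (u - v) \<ge> - (c / 2 * (norm (u - v))\<^sup>2)" by linarith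
    moreover have "J (f u - f v) \<bullet> (u - v) = J (?D (u - v)) \<bullet> (u - v) + J ?E \<bullet> (u - v)"
      by (simp add: J.diff inner_diff_left)
    ultimately show ?thesis using c(2)[of "u - v"] by linarith
  qed
  show ?thesis
  proof (rule that[OF r(1)])
    fix x y :: "real \<Rightarrow> 'a" and s
    assume x: "\<And>t. t \<le> s \<Longrightarrow> x t \<in> ball e r \<and> (x has_vector_derivative f (x t)) (at t)"
      and y: "\<And>t. t \<le> s \<Longrightarrow> y t \<in> ball e r \<and> (y has_vector_derivative f (y t)) (at t)"
      and lim: "(x \<longlongrightarrow> e) at_bot" "(y \<longlongrightarrow> e) at_bot" and le: "J (x s - y s) \<bullet> (x s - y s) \<le> 0"
    define V where "V t = J (x t - y t) \<bullet> (x t - y t)" for t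
    have V_der: "(V has_real_derivative 2 * (J (f (x t) - f (y t)) \<bullet> (x t - y t))) (at t)" if "t \<le> s" for t
    proof -
      have "((\<lambda>t. x t - y t) has_vector_derivative f (x t) - f (y t)) (at t)"
        using x[OF that] y[OF that] by (intro has_vector_derivative_diff) auto
      then have 1: "((\<lambda>t. x t - y t) has_derivative (\<lambda>h. h *\<^sub>R (f (x t) - f (y t)))) (at t)"
        by (simp add: has_vector_derivative_def)
      have 2: "((\<lambda>t. J (x t - y t)) has_derivative (\<lambda>h. J (h *\<^sub>R (f (x t) - f (y t))))) (at t)"
        by (rule J.has_derivative[OF 1])
      have e: "(\<lambda>h. J (x t - y t) \<bullet> (h *\<^sub>R (f (x t) - f (y t))) + J (h *\<^sub>R (f (x t) - f (y t))) \<bullet> (x t - y t))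
          = (*) (2 * (J (f (x t) - f (y t)) \<bullet> (x t - y t)))"
        using J(2)[of "x t - y t" "f (x t) - f (y t)"]
        by (auto simp: fun_eq_iff J.scaleR inner_commute)
      show ?thesis using has_derivative_inner[OF 2 1] unfolding V_def has_field_derivative_def e .
    qed
    have V_nonneg: "0 \<le> 2 * (J (f (x t) - f (y t)) \<bullet> (x t - y t))" if "t \<le> s" for t
    proof -
      have "0 \<le> c / 2 * (norm (x t - y t))\<^sup>2" using c(1) by simp
      then show ?thesis using key[of "x t" "y t"] x[OF that] y[OF that] by linarith
    qed
    have V_mono: "V t' \<le> V t" if "t' \<le> t" "t \<le> s" for t t'
      by (rule DERIV_nonneg_imp_nondecreasing[OF that(1)]) (use V_der V_nonneg that(2) order_trans in blast)
    have "((\<lambda>t. J (x t - y t) \<bullet> (x t - y t)) \<longlongrightarrow> J (e - e) \<bullet> (e - e)) at_bot"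
      by (intro tendsto_intros J.tendsto lim)
    then have V_lim: "(V \<longlongrightarrow> 0) at_bot" by (simp add: V_def[abs_def])
    have V_ge: "V t \<ge> 0" if "t \<le> s" for t
    proof (rule tendsto_upperbound[OF V_lim])
      show "\<forall>\<^sub>F t' in at_bot. V t' \<le> V t"
        using eventually_le_at_bot[of t] by eventually_elim (use V_mono that in blast)
    qed simp
    \<comment> \<open>V is nondecreasing with limit 0 at -\<infinity>, hence nonnegative. If x s
      \<noteq> y s it increases strictly at s, which gives V s > 0 against the assumption.\<close>
    show "x s = y s"
    proof (rule ccontr)
      assume "x s \<noteq> y s"
      then have "0 < c / 2 * (norm (x s - y s))\<^sup>2" using c(1) by simp
      then have "0 < 2 * (J (f (x s) - f (y s)) \<bullet> (x s - y s))" using key[of "x s" "y s"] x[of s] y[of s] by simp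
      from DERIV_pos_inc_left[OF V_der[OF order_refl] this]
      obtain d where d: "d > 0" "\<And>h. 0 < h \<Longrightarrow> h < d \<Longrightarrow> V (s - h) < V s" by blast
      have "V (s - d / 2) < V s" using d by auto
      then show False using V_ge[of "s - d / 2"] le d(1) by (simp add: V_def)
    qed
  qed
qed

subsection \<open>One-dimensional unstable manifolds\<close>

lemma trajectory_UNIV: "trajectory f W UNIV \<phi> \<longleftrightarrow> (\<forall>t. \<phi> t \<in> W \<and> (\<phi> has_vector_derivative f (\<phi> t)) (at t))"
  by (simp add: trajectory_def)

lemma trajectory_atMost:
  assumes "trajectory f W {..0} \<psi>"
  shows "\<And>t. t < 0 \<Longrightarrow> \<psi> t \<in> W \<and> (\<psi> has_vector_derivative f (\<psi> t)) (at t)" "continuous (at 0 within {..0}) \<psi>"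
proof -
  fix t :: real assume "t < 0"
  then have "t \<in> interior {..0}" "t \<in> {..0}" by simp_all
  moreover from this(2) have "\<psi> t \<in> W" "(\<psi> has_vector_derivative f (\<psi> t)) (at t within {..0})"
    using assms unfolding trajectory_def by blast+
  ultimately show "\<psi> t \<in> W \<and> (\<psi> has_vector_derivative f (\<psi> t)) (at t)"
    using at_within_interior[of t "{..0}"] by metis
next
  show "continuous (at 0 within {..0}) \<psi>"
    using assms by (auto simp: trajectory_def intro: has_vector_derivative_continuous)
qed

lemma shift_has_vector_derivative:
  fixes c :: real
  assumes "(x has_vector_derivative d) (at (t + c))"
  shows "((\<lambda>t. x (t + c)) has_vector_derivative d) (at t)"
proof -
  have "((\<lambda>t. t + c) has_vector_derivative 1) (at t)" by (auto intro!: derivative_eq_intros)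
  moreover have "(x has_vector_derivative d) (at ((\<lambda>t. t + c) t))" using assms by simp
  ultimately have "(x \<circ> (\<lambda>t. t + c) has_vector_derivative 1 *\<^sub>R d) (at t)" by (rule vector_diff_chain_at)
  then show ?thesis by (simp add: o_def)
qed

lemma filterlim_shift_at_bot: "filterlim (\<lambda>t::real. t + c) at_bot at_bot"
  unfolding filterlim_at_bot
proof
  fix Z
  show "\<forall>\<^sub>F t in at_bot. t + c \<le> Z" using eventually_le_at_bot[of "Z - c"] by eventually_elim simp
qed

lemma unstable_manifoldI:
  assumes "trajectory f W UNIV \<phi>" "(\<phi> \<longlongrightarrow> e) at_bot"
  shows "\<phi> s \<in> unstable_manifold f W e"
  unfolding unstable_manifold_def
proof (intro CollectI exI conjI)
  show "trajectory f W {..0} (\<lambda>t. \<phi> (t + s))"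
    unfolding trajectory_def
  proof
    fix t :: real
    have "\<phi> (t + s) \<in> W" "(\<phi> has_vector_derivative f (\<phi> (t + s))) (at (t + s))"
      using assms(1) by (simp_all add: trajectory_UNIV)
    then show "\<phi> (t + s) \<in> W \<and> ((\<lambda>t. \<phi> (t + s)) has_vector_derivative f (\<phi> (t + s))) (at t within {..0})"
      using has_vector_derivative_at_within shift_has_vector_derivative by blast
  qed
  show "((\<lambda>t. \<phi> (t + s)) \<longlongrightarrow> e) at_bot" by (rule filterlim_compose[OF assms(2) filterlim_shift_at_bot])
qed simp

text \<open>The form J is nonpositive on the kernel of \<xi>, so two trajectories leaving e near e
  and agreeing in \<xi> at one time coincide. By the intermediate value theorem \<phi> and \<phi>'
  take all small nonzero values of \<xi>, one for each sign, and the value 0 belongs to the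
  equilibrium; so every trajectory from e is a time shift of one of the three.\<close>

lemma unstable_manifold_1d:
  fixes f J R :: "phase \<Rightarrow> phase" and \<xi> :: "phase \<Rightarrow> real"
  assumes f: "smooth_on W f" "open W" "e \<in> W" "f e = 0"
    and J: "bounded_linear J" "\<And>v w. J v \<bullet> w = v \<bullet> J w" "\<And>v. v \<noteq> 0 \<Longrightarrow> J (frechet_derivative f (at e) v) \<bullet> v > 0"
    and \<xi>: "bounded_linear \<xi>" "\<And>v. \<xi> v = 0 \<Longrightarrow> J v \<bullet> v \<le> 0"
    and \<phi>: "trajectory f W UNIV \<phi>" "(\<phi> \<longlongrightarrow> e) at_bot" "\<phi> c \<noteq> e"
    and \<phi>': "trajectory f W UNIV \<phi>'" "(\<phi>' \<longlongrightarrow> e) at_bot" "\<And>t. \<xi> (\<phi>' t - e) = - \<xi> (\<phi> t - e)"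
  shows "unstable_manifold f W e = {e} \<union> range \<phi> \<union> range \<phi>'"
proof
  interpret \<xi>: bounded_linear \<xi> by (rule \<xi>(1))
  have const: "trajectory f W UNIV (\<lambda>t. e)" using f by (simp add: trajectory_def)
  show "{e} \<union> range \<phi> \<union> range \<phi>' \<subseteq> unstable_manifold f W e"
    using unstable_manifoldI[OF const, of e] unstable_manifoldI[OF \<phi>(1,2)] unstable_manifoldI[OF \<phi>'(1,2)] by auto
  obtain r where r: "r > 0" "\<And>x y s. \<lbrakk>\<And>t. t \<le> s \<Longrightarrow> x t \<in> ball e r \<and> (x has_vector_derivative f (x t)) (at t);
      \<And>t. t \<le> s \<Longrightarrow> y t \<in> ball e r \<and> (y has_vector_derivative f (y t)) (at t);
      (x \<longlongrightarrow> e) at_bot; (y \<longlongrightarrow> e) at_bot; J (x s - y s) \<bullet> (x s - y s) \<le> 0\<rbrakk> \<Longrightarrow> x s = y (s::real)"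
    using backward_asymptotic_unique[OF f(1-3) J] by blast
  have ev: "\<exists>T. \<forall>t\<le>T. x t \<in> ball e r" if "(x \<longlongrightarrow> e) at_bot" for x :: "real \<Rightarrow> phase"
    using tendstoD[OF that r(1)] by (auto simp: eventually_at_bot_linorder dist_commute)
  \<comment> \<open>A trajectory on \<open>{..0}\<close> has a two-sided derivative only at negative
    times. Hence the comparison is made at some s < 0, extended to all t < 0 by uniqueness, and to 0
    by continuity from the left.\<close>
  have compare: "\<psi> 0 = \<theta> (- s + t3)"
    if \<psi>: "trajectory f W {..0} \<psi>" "(\<psi> \<longlongrightarrow> e) at_bot" and s: "s < 0" "\<And>t. t \<le> s \<Longrightarrow> \<psi> t \<in> ball e r"
      and \<theta>: "trajectory f W UNIV \<theta>" "(\<theta> \<longlongrightarrow> e) at_bot" "\<And>t. t \<le> t3 \<Longrightarrow> \<theta> t \<in> ball e r" "\<xi> (\<theta> t3 - e) = \<xi> (\<psi> s - e)"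
    for \<psi> \<theta> s t3
  proof -
    let ?\<theta> = "\<lambda>t. \<theta> (t + (- s + t3))"
    have \<theta>': "?\<theta> t \<in> W \<and> (?\<theta> has_vector_derivative f (?\<theta> t)) (at t)" for t
    proof -
      have "\<theta> (t + (- s + t3)) \<in> W" "(\<theta> has_vector_derivative f (\<theta> (t + (- s + t3)))) (at (t + (- s + t3)))"
        using \<theta>(1) by (simp_all add: trajectory_UNIV)
      then show ?thesis using shift_has_vector_derivative by blast
    qed
    note \<psi>' = trajectory_atMost[OF \<psi>(1)]
    have "\<psi> s = ?\<theta> s"
    proof (rule r(2)[of s \<psi> ?\<theta>])
      show "\<psi> t \<in> ball e r \<and> (\<psi> has_vector_derivative f (\<psi> t)) (at t)" if "t \<le> s" for t
        using s that \<psi>'(1)[of t] by auto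
      show "?\<theta> t \<in> ball e r \<and> (?\<theta> has_vector_derivative f (?\<theta> t)) (at t)" if "t \<le> s" for t
        using that \<theta>' \<theta>(3)[of "t + (- s + t3)"] by auto
      show "(?\<theta> \<longlongrightarrow> e) at_bot" by (rule filterlim_compose[OF \<theta>(2) filterlim_shift_at_bot])
      have "\<xi> (\<psi> s - ?\<theta> s) = \<xi> (\<psi> s - e) - \<xi> (\<theta> t3 - e)" by (simp add: \<xi>.diff[symmetric])
      then show "J (\<psi> s - ?\<theta> s) \<bullet> (\<psi> s - ?\<theta> s) \<le> 0" using \<theta>(4) by (intro \<xi>(2)) simp
    qed (rule \<psi>(2))
    then have eq: "\<psi> t = ?\<theta> t" if "t < 0" for t
      using trajectories_unique[OF f(1,2), of "{..<0}" \<psi> ?\<theta> s t] \<psi>'(1) \<theta>' s(1) that by auto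
    have "(\<psi> \<longlongrightarrow> \<psi> 0) (at 0 within {..0})" using \<psi>'(2) by (simp add: continuous_within)
    then have "(\<psi> \<longlongrightarrow> \<psi> 0) (at_left 0)" by (rule tendsto_within_subset) auto
    moreover have "continuous (at 0) ?\<theta>" using \<theta>' has_vector_derivative_continuous by blast
    then have "(?\<theta> \<longlongrightarrow> ?\<theta> 0) (at 0)" by (simp only: continuous_at)
    then have "(?\<theta> \<longlongrightarrow> ?\<theta> 0) (at_left 0)" by (rule tendsto_within_subset) simp
    then have "(\<psi> \<longlongrightarrow> ?\<theta> 0) (at_left 0)"
      by (rule tendsto_cong[THEN iffD1, rotated]) (auto simp: eventually_at_filter eq)
    ultimately have "\<psi> 0 = ?\<theta> 0" using tendsto_unique trivial_limit_at_left_real by blast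
    then show ?thesis by simp
  qed
  obtain T1 where T1: "\<And>t. t \<le> T1 \<Longrightarrow> \<phi> t \<in> ball e r" using ev[OF \<phi>(2)] by blast
  obtain T2 where T2: "\<And>t. t \<le> T2 \<Longrightarrow> \<phi>' t \<in> ball e r" using ev[OF \<phi>'(2)] by blast
  define T where "T = min T1 T2"
  have \<phi>_ne: "\<phi> t \<noteq> e" for t
    using trajectories_unique[OF f(1,2), of UNIV \<phi> "\<lambda>t. e" t c] \<phi>(1,3) const by (auto simp: trajectory_UNIV)
  define a where "a = \<xi> (\<phi> T - e)"
  \<comment> \<open>Were it 0, the comparison with the constant trajectory would give \<phi> T =
    e.\<close>
  have a: "a \<noteq> 0"
  proof
    assume "a = 0"
    have "\<phi> T = e"
    proof (rule r(2)[of T \<phi> "\<lambda>t. e"])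
      show "\<phi> t \<in> ball e r \<and> (\<phi> has_vector_derivative f (\<phi> t)) (at t)" if "t \<le> T" for t
        using T1[of t] that \<phi>(1) by (auto simp: T_def trajectory_UNIV)
      show "J (\<phi> T - e) \<bullet> (\<phi> T - e) \<le> 0" using \<open>a = 0\<close> by (intro \<xi>(2)) (simp add: a_def)
    qed (use r(1) \<phi>(2) f(4) in auto)
    then show False using \<phi>_ne by blast
  qed
  have ivt: "\<exists>t3\<le>T. \<xi> (\<theta> t3 - e) = b" if \<theta>: "trajectory f W UNIV \<theta>" "(\<theta> \<longlongrightarrow> e) at_bot" and b: "b \<noteq> 0" "\<bar>b\<bar> < \<bar>a\<bar>"
      "b * \<xi> (\<theta> T - e) > 0" "\<bar>\<xi> (\<theta> T - e)\<bar> = \<bar>a\<bar>" for \<theta> b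
  proof -
    let ?h = "\<lambda>t. \<xi> (\<theta> t - e)"
    have "(\<theta> has_vector_derivative f (\<theta> t)) (at t)" for t using \<theta>(1) by (simp add: trajectory_UNIV)
    then have "continuous (at t) \<theta>" for t by (rule has_vector_derivative_continuous)
    then have c: "continuous_on A ?h" for A
      by (intro continuous_at_imp_continuous_on ballI continuous_intros \<xi>.continuous)
    have "(?h \<longlongrightarrow> \<xi> (e - e)) at_bot" by (intro \<xi>.tendsto tendsto_intros \<theta>(2))
    then have "(?h \<longlongrightarrow> 0) at_bot" by (simp add: \<xi>.zero)
    then have "\<forall>\<^sub>F t in at_bot. dist (?h t) 0 < \<bar>b\<bar>" by (rule tendstoD) (use b in simp)
    then have "\<forall>\<^sub>F t in at_bot. dist (?h t) 0 < \<bar>b\<bar> \<and> t \<le> T"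
      using eventually_le_at_bot[of T] by eventually_elim simp
    from eventually_happens'[OF trivial_limit_at_bot_linorder this]
    obtain t2 where t2: "\<bar>?h t2\<bar> < \<bar>b\<bar>" "t2 \<le> T" by (auto simp: dist_real_def)
    show ?thesis
    proof (cases "b > 0")
      case True
      then have "?h T > 0" using b(3) by (simp add: zero_less_mult_iff)
      then have "?h t2 \<le> b" "b \<le> ?h T" using t2 b True by auto
      then show ?thesis using IVT'[of ?h t2 b T, OF _ _ t2(2) c] by blast
    next
      case False
      then have "?h T < 0" using b(1,3) by (simp add: zero_less_mult_iff)
      then have "b \<le> ?h t2" "?h T \<le> b" using t2 b False by auto
      then show ?thesis using IVT2'[of ?h T b t2, OF _ _ t2(2) c] by blast
    qed
  qed
  show "unstable_manifold f W e \<subseteq> {e} \<union> range \<phi> \<union> range \<phi>'"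
  proof
    fix x assume "x \<in> unstable_manifold f W e"
    then obtain \<psi> where \<psi>: "trajectory f W {..0} \<psi>" "\<psi> 0 = x" "(\<psi> \<longlongrightarrow> e) at_bot" by (auto simp: unstable_manifold_def)
    obtain T0 where T0: "\<And>t. t \<le> T0 \<Longrightarrow> \<psi> t \<in> ball e r" using ev[OF \<psi>(3)] by blast
    have "((\<lambda>t. \<xi> (\<psi> t - e)) \<longlongrightarrow> \<xi> (e - e)) at_bot" by (intro \<xi>.tendsto tendsto_intros \<psi>(3))
    then have "((\<lambda>t. \<xi> (\<psi> t - e)) \<longlongrightarrow> 0) at_bot" by (simp add: \<xi>.zero)
    then have "\<forall>\<^sub>F t in at_bot. dist (\<xi> (\<psi> t - e)) 0 < \<bar>a\<bar>" by (rule tendstoD) (use a in simp)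
    then have "\<forall>\<^sub>F t in at_bot. dist (\<xi> (\<psi> t - e)) 0 < \<bar>a\<bar> \<and> t \<le> min T0 (-1)"
      using eventually_le_at_bot[of "min T0 (-1)"] by eventually_elim simp
    from eventually_happens'[OF trivial_limit_at_bot_linorder this]
    obtain s where s: "\<bar>\<xi> (\<psi> s - e)\<bar> < \<bar>a\<bar>" "s \<le> min T0 (-1)" by (auto simp: dist_real_def)
    have s0: "s < 0" and sb: "\<And>t. t \<le> s \<Longrightarrow> \<psi> t \<in> ball e r" using s(2) T0 by auto
    define b where "b = \<xi> (\<psi> s - e)"
    note cmp = compare[OF \<psi>(1,3) s0 sb]
    consider "b = 0" | "b \<noteq> 0" "b * a > 0" | "b \<noteq> 0" "b * (- a) > 0"
      using a by (metis linorder_neqE_linordered_idom mult_eq_0_iff mult_minus_right neg_0_less_iff_less)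
    then show "x \<in> {e} \<union> range \<phi> \<union> range \<phi>'"
    proof cases
      case 1
      then have "\<psi> 0 = e" using cmp[of "\<lambda>t. e" 0] const r(1) by (simp add: b_def \<xi>.zero)
      then show ?thesis using \<psi>(2) by simp
    next
      case 2
      have "\<exists>t3\<le>T. \<xi> (\<phi> t3 - e) = b"
        by (rule ivt[OF \<phi>(1,2)]) (use 2 s(1) in \<open>simp_all add: a_def b_def\<close>)
      then obtain t3 where "t3 \<le> T" "\<xi> (\<phi> t3 - e) = b" by blast
      then have "\<psi> 0 = \<phi> (- s + t3)" using T1 by (intro cmp \<phi>) (auto simp: T_def b_def)
      then show ?thesis using \<psi>(2) by blast
    next
      case 3
      have "\<exists>t3\<le>T. \<xi> (\<phi>' t3 - e) = b"
        by (rule ivt[OF \<phi>'(1,2)]) (use 3 s(1) in \<open>simp_all add: a_def b_def \<phi>'(3)\<close>)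
      then obtain t3 where "t3 \<le> T" "\<xi> (\<phi>' t3 - e) = b" by blast
      then have "\<psi> 0 = \<phi>' (- s + t3)" using T2 by (intro cmp \<phi>') (auto simp: T_def b_def)
      then show ?thesis using \<psi>(2) by blast
    qed
  qed
qed

subsection \<open>Saddles\<close>

text \<open>The invariant subspace is presented as the image of an injective linear map, so that the
  sign of the spectrum is read off from the quadratic form of \<open>B\<close>. For an eigenvector v
  + i w the terms with Im c cancel in B v \<bullet> v + B w \<bullet> w.\<close>

lemma range_splitting:
  fixes g :: "'x::euclidean_space \<Rightarrow> phase" and A :: "phase \<Rightarrow> phase"
  assumes g: "linear g" "inj g" and A: "\<And>x. A (g x) = g (B x)"
  shows "subspace (range g)" "dim (range g) = DIM('x)" "A ` range g \<subseteq> range g"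
    "(\<And>x. x \<noteq> 0 \<Longrightarrow> B x \<bullet> x < 0) \<Longrightarrow> eigenvalue_on A (range g) c \<Longrightarrow> Re c < 0"
    "(\<And>x. x \<noteq> 0 \<Longrightarrow> B x \<bullet> x > 0) \<Longrightarrow> eigenvalue_on A (range g) c \<Longrightarrow> Re c > 0"
proof -
  show "subspace (range g)" using g(1) by (rule linear_subspace_image[OF _ subspace_UNIV])
  show "dim (range g) = DIM('x)" using dim_image_eq[of g UNIV] g by simp
  show "A ` range g \<subseteq> range g" using A by auto
  interpret g: linear g by (rule g(1))
  have key: "\<exists>v w. (v \<noteq> 0 \<or> w \<noteq> 0) \<and> B v \<bullet> v + B w \<bullet> w = Re c * (v \<bullet> v + w \<bullet> w)" if ev: "eigenvalue_on A (range g) c"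
  proof -
    obtain v w where vw: "(g v, g w) \<noteq> (0, 0)" "A (g v) = Re c *\<^sub>R g v - Im c *\<^sub>R g w" "A (g w) = Im c *\<^sub>R g v + Re c *\<^sub>R g w"
      using ev unfolding eigenvalue_on_def by blast
    have "g (B v) = g (Re c *\<^sub>R v - Im c *\<^sub>R w)" "g (B w) = g (Im c *\<^sub>R v + Re c *\<^sub>R w)"
      using vw(2,3) by (simp_all add: A g.diff g.add g.scale)
    then have B: "B v = Re c *\<^sub>R v - Im c *\<^sub>R w" "B w = Im c *\<^sub>R v + Re c *\<^sub>R w" using g(2) by (auto dest: injD)
    have "B v \<bullet> v + B w \<bullet> w = Re c * (v \<bullet> v + w \<bullet> w)"
      unfolding B by (simp add: inner_diff_left inner_add_left inner_commute algebra_simps)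
    moreover have "v \<noteq> 0 \<or> w \<noteq> 0" using vw(1) by (auto simp: g.zero)
    ultimately show ?thesis by blast
  qed
  have pos: "v \<bullet> v + w \<bullet> w > 0" if "v \<noteq> 0 \<or> w \<noteq> 0" for v w :: 'x
    using that inner_ge_zero[of v] inner_ge_zero[of w] inner_gt_zero_iff[of v] inner_gt_zero_iff[of w] by linarith
  show "Re c < 0" if B: "\<And>x. x \<noteq> 0 \<Longrightarrow> B x \<bullet> x < 0" and ev: "eigenvalue_on A (range g) c"
  proof -
    obtain v w where vw: "v \<noteq> 0 \<or> w \<noteq> 0" "B v \<bullet> v + B w \<bullet> w = Re c * (v \<bullet> v + w \<bullet> w)" using key[OF ev] by blast
    have "B v \<bullet> v \<le> 0" "B w \<bullet> w \<le> 0" using B[of v] B[of w] by (cases "v = 0"; cases "w = 0"; simp add: less_imp_le)+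
    then have "B v \<bullet> v + B w \<bullet> w < 0" using B[of v] B[of w] vw(1) by linarith
    then show ?thesis using pos[OF vw(1)] vw(2) by (simp add: mult_less_0_iff)
  qed
  show "Re c > 0" if B: "\<And>x. x \<noteq> 0 \<Longrightarrow> B x \<bullet> x > 0" and ev: "eigenvalue_on A (range g) c"
  proof -
    obtain v w where vw: "v \<noteq> 0 \<or> w \<noteq> 0" "B v \<bullet> v + B w \<bullet> w = Re c * (v \<bullet> v + w \<bullet> w)" using key[OF ev] by blast
    have "B v \<bullet> v \<ge> 0" "B w \<bullet> w \<ge> 0" using B[of v] B[of w] by (cases "v = 0"; cases "w = 0"; simp add: less_imp_le)+
    then have "B v \<bullet> v + B w \<bullet> w > 0" using B[of v] B[of w] vw(1) by linarith
    then show ?thesis using pos[OF vw(1)] vw(2) by (simp add: zero_less_mult_iff)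
  qed
qed

lemma saddleI:
  fixes g :: "'x::euclidean_space \<Rightarrow> phase" and h :: "real \<Rightarrow> phase"
  assumes "f e = 0" "(f has_derivative A) (at e)" and d: "DIM('x) = 2"
    and g: "linear g" "inj g" "\<And>x. A (g x) = g (B x)" "\<And>x. x \<noteq> 0 \<Longrightarrow> B x \<bullet> x < 0"
    and h: "linear h" "inj h" "\<And>x. A (h x) = h (l * x)" "l > 0"
  shows "saddle f e"
proof -
  have A: "frechet_derivative f (at e) = A" using frechet_derivative_at[OF assms(2)] by simp
  have "(l * x) \<bullet> x > 0" if "x \<noteq> 0" for x
  proof -
    have "0 < l * x\<^sup>2" using h(4) that by simp
    then show ?thesis by (simp add: power2_eq_square mult.assoc)
  qed
  note H = range_splitting[where g=h and A=A and B="\<lambda>x. l * x", OF h(1-3)]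
  note G = range_splitting[where g=g and A=A and B=B, OF g(1-3)]
  have "dim (range h) = 1" using H(2) by simp
  moreover have "dim (range g) = 2" using G(2) d by simp
  moreover have "\<forall>c. eigenvalue_on A (range g) c \<longrightarrow> Re c < 0" using G(4) g(4) by blast
  moreover have "\<forall>c. eigenvalue_on A (range h) c \<longrightarrow> Re c > 0"
    using H(5) \<open>\<And>x. x \<noteq> 0 \<Longrightarrow> (l * x) \<bullet> x > 0\<close> by blast
  moreover have "f differentiable (at e)" using assms(2) unfolding differentiable_def by blast
  ultimately show ?thesis
    unfolding saddle_def A Let_def using assms(1) G(1,3) H(1,3) by blast
qed

text \<open>Solution by quadrature: the logistic curve \<open>Lg\<close> already runs from 0 to z0,
  only with the wrong speed. The new time \<open>T\<close> is the primitive of 1 / h, and its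
  inverse \<open>S\<close> is the wanted reparametrization. The bounds of m on the compact interval
  make \<open>T\<close> a bijection of the line and give the decay at -\<infinity>.\<close>

lemma axis_trajectory:
  fixes m :: "real \<Rightarrow> real"
  assumes z0: "z0 > 0" and m: "continuous_on {0..z0} m" "\<And>z. z \<in> {0..z0} \<Longrightarrow> m z > 0"
  obtains \<zeta> where "\<And>t. (\<zeta> has_real_derivative \<zeta> t * (z0 - \<zeta> t) * m (\<zeta> t)) (at t)"
    "range \<zeta> = {0<..<z0}" "(\<zeta> \<longlongrightarrow> 0) at_bot"
proof -
  define Lg where "Lg s = z0 / (1 + exp (- s))" for s
  have ep: "1 + exp (- s) > 0" for s :: real by (simp add: add_pos_pos)
  have Lg_range: "Lg s \<in> {0<..<z0}" for s
    using z0 ep[of s] by (simp add: Lg_def pos_divide_less_eq)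
  have Lg_deriv: "(Lg has_real_derivative Lg s * (z0 - Lg s) / z0) (at s)" for s
  proof -
    have "(Lg has_real_derivative z0 * exp (- s) / (1 + exp (- s))\<^sup>2) (at s)"
      unfolding Lg_def[abs_def] using ep[of s] by (auto intro!: derivative_eq_intros simp: power2_eq_square)
    moreover have "z0 * exp (- s) / (1 + exp (- s))\<^sup>2 = Lg s * (z0 - Lg s) / z0"
      using z0 ep[of s] by (simp add: Lg_def power2_eq_square divide_simps) (simp add: algebra_simps)
    ultimately show ?thesis by simp
  qed
  have ne: "{0..z0} \<noteq> {}" using z0 by simp
  obtain za where za: "za \<in> {0..z0}" "\<And>z. z \<in> {0..z0} \<Longrightarrow> m za \<le> m z"
    using continuous_attains_inf[OF compact_Icc ne m(1)] by blast
  obtain zb where zb: "zb \<in> {0..z0}" "\<And>z. z \<in> {0..z0} \<Longrightarrow> m z \<le> m zb"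
    using continuous_attains_sup[OF compact_Icc ne m(1)] by blast
  define H0 where "H0 = z0 * m za"
  define H1 where "H1 = z0 * m zb"
  have H: "H0 > 0" "H1 > 0" using z0 m(2)[OF za(1)] m(2)[OF zb(1)] by (auto simp: H0_def H1_def)
  define h where "h s = z0 * m (Lg s)" for s
  have Lg_cl: "Lg s \<in> {0..z0}" for s using Lg_range[of s] by simp
  have h: "H0 \<le> h s" "h s \<le> H1" "h s > 0" for s
    using za(2)[OF Lg_cl[of s]] zb(2)[OF Lg_cl[of s]] m(2)[OF Lg_cl[of s]] z0 by (auto simp: H0_def H1_def h_def)
  have Lg_cont: "continuous_on UNIV Lg"
    by (intro continuous_at_imp_continuous_on ballI DERIV_isCont[OF Lg_deriv])
  have h_cont: "continuous_on UNIV h" unfolding h_def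
    by (intro continuous_intros continuous_on_compose2[OF m(1) Lg_cont]) (use Lg_cl in auto)
  define k where "k s = 1 / h s" for s
  have k_cont: "continuous_on UNIV k" unfolding k_def
    by (intro continuous_intros h_cont) (metis h(3) less_irrefl)
  have k: "1 / H1 \<le> k s" "k s \<le> 1 / H0" for s
    using h[of s] H by (auto simp: k_def intro!: divide_left_mono mult_pos_pos)
  define T where "T = primitive k"
  have T_deriv: "(T has_real_derivative k s) (at s)" for s
    unfolding T_def by (rule primitive_deriv[OF k_cont])
  have T0: "T 0 = 0" by (simp add: T_def)
  have T_lower: "(a - b) / H1 \<le> T a - T b" if "b \<le> a" for a b
  proof -
    have "T b - b / H1 \<le> T a - a / H1"
    proof (rule DERIV_nonneg_imp_nondecreasing[OF that])
      fix s
      have "((\<lambda>s. T s - s / H1) has_real_derivative k s - 1 / H1) (at s)"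
        by (intro DERIV_diff T_deriv DERIV_cdivide DERIV_ident)
      then show "\<exists>y. ((\<lambda>s. T s - s / H1) has_real_derivative y) (at s) \<and> 0 \<le> y" using k(1)[of s] by auto
    qed
    then show ?thesis by (simp add: diff_divide_distrib)
  qed
  have T_upper: "T a - T b \<le> (a - b) / H0" if "b \<le> a" for a b
  proof -
    have "b / H0 - T b \<le> a / H0 - T a"
    proof (rule DERIV_nonneg_imp_nondecreasing[OF that])
      fix s
      have "((\<lambda>s. s / H0 - T s) has_real_derivative 1 / H0 - k s) (at s)"
        by (intro DERIV_diff T_deriv DERIV_cdivide DERIV_ident)
      then show "\<exists>y. ((\<lambda>s. s / H0 - T s) has_real_derivative y) (at s) \<and> 0 \<le> y" using k(2)[of s] by auto
    qed
    then show ?thesis by (simp add: diff_divide_distrib)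
  qed
  have T_surj: "\<exists>s. T s = t" for t
  proof -
    have "T (- (\<bar>t\<bar> * H1)) \<le> t"
      using T_lower[of "- (\<bar>t\<bar> * H1)" 0] H by (simp add: T0)
    moreover have "t \<le> T (\<bar>t\<bar> * H1)"
      using T_lower[of 0 "\<bar>t\<bar> * H1"] H by (simp add: T0)
    moreover have "- (\<bar>t\<bar> * H1) \<le> \<bar>t\<bar> * H1" using H by simp
    moreover have "continuous_on {- (\<bar>t\<bar> * H1)..\<bar>t\<bar> * H1} T"
      by (intro continuous_at_imp_continuous_on ballI DERIV_isCont[OF T_deriv])
    ultimately show ?thesis using IVT'[of T] by blast
  qed
  define S where "S t = (SOME s. T s = t)" for t
  have TS: "T (S t) = t" for t unfolding S_def using T_surj by (rule someI_ex)
  have S_lip: "\<bar>S a - S b\<bar> \<le> H1 * \<bar>a - b\<bar>" for a b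
  proof (cases "S b \<le> S a")
    case True
    then show ?thesis using T_lower[OF True] H(2) by (simp add: TS pos_divide_le_eq mult.commute abs_le_iff)
      (smt (verit) mult_left_mono H(2))
  next
    case False
    then have "S a \<le> S b" by simp
    from T_lower[OF this] have "S b - S a \<le> (b - a) * H1" using H(2) by (simp add: TS pos_divide_le_eq)
    also have "\<dots> \<le> \<bar>a - b\<bar> * H1" using H(2) by (intro mult_right_mono) auto
    finally show ?thesis using False by (simp add: mult.commute)
  qed
  have ST: "S (T s) = s" for s
  proof (cases "S (T s) \<le> s")
    case True
    then show ?thesis using T_lower[OF True] H(2) by (simp add: TS divide_le_0_iff)
  next
    case False
    then show ?thesis using T_lower[of s "S (T s)"] H(2) by (simp add: TS divide_le_0_iff)
  qed
  have S_cont: "isCont S t" for t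
    unfolding continuous_at_eps_delta
  proof (intro allI impI)
    fix e :: real assume "e > 0"
    show "\<exists>d>0. \<forall>x'. dist x' t < d \<longrightarrow> dist (S x') (S t) < e"
    proof (intro exI[of _ "e / H1"] conjI allI impI)
      fix x' assume "dist x' t < e / H1"
      then have "H1 * \<bar>x' - t\<bar> < e" using H by (simp add: dist_real_def pos_less_divide_eq mult.commute)
      then show "dist (S x') (S t) < e" using S_lip[of x' t] by (simp add: dist_real_def)
    qed (use \<open>e > 0\<close> H in simp)
  qed
  have S_deriv: "(S has_real_derivative h (S t)) (at t)" for t
  proof -
    have "(S has_real_derivative inverse (k (S t))) (at t)"
      by (rule DERIV_inverse_function[where f=T and a="t - 1" and b="t + 1"])
        (use T_deriv TS S_cont k(1)[of "S t"] H h(3)[of "S t"] in \<open>auto simp: k_def\<close>)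
    then show ?thesis by (simp add: k_def)
  qed
  define \<zeta> where "\<zeta> t = Lg (S t)" for t
  show ?thesis
  proof (rule that[of \<zeta>])
    show "(\<zeta> has_real_derivative \<zeta> t * (z0 - \<zeta> t) * m (\<zeta> t)) (at t)" for t
      using DERIV_chain2[OF Lg_deriv S_deriv, of t] z0 unfolding \<zeta>_def h_def by (simp add: mult.assoc)
    show "range \<zeta> = {0<..<z0}"
    proof
      show "range \<zeta> \<subseteq> {0<..<z0}" using Lg_range by (auto simp: \<zeta>_def simp del: greaterThanLessThan_iff)
      show "{0<..<z0} \<subseteq> range \<zeta>"
      proof
        fix z assume "z \<in> {0<..<z0}"
        then have z: "0 < z" "z < z0" by auto
        define s where "s = ln (z / (z0 - z))"
        have "exp (- s) = (z0 - z) / z" using z by (simp add: s_def exp_minus exp_ln)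
        then have "1 + exp (- s) = z0 / z" using z by (simp add: field_simps)
        then have "Lg s = z" using z by (simp add: Lg_def)
        then have "\<zeta> (T s) = z" by (simp add: \<zeta>_def ST)
        then show "z \<in> range \<zeta>" by blast
      qed
    qed
    show "(\<zeta> \<longlongrightarrow> 0) at_bot"
    proof (rule tendsto_sandwich[OF _ _ tendsto_const])
      show "\<forall>\<^sub>F t in at_bot. 0 \<le> \<zeta> t" using Lg_range by (auto simp: \<zeta>_def less_imp_le)
      show "\<forall>\<^sub>F t in at_bot. \<zeta> t \<le> z0 * exp (H0 * t)"
        using eventually_le_at_bot[of 0]
      proof eventually_elim
        case (elim t)
        have "S t \<le> 0"
        proof (rule ccontr)
          assume "\<not> S t \<le> 0"
          then have "0 < S t / H1" using H by simp
          then show False using T_lower[of 0 "S t"] elim \<open>\<not> S t \<le> 0\<close> by (simp add: T0 TS)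
        qed
        then have "- t \<le> - S t / H0" using T_upper[of "S t" 0] by (simp add: T0 TS)
        then have St: "S t \<le> H0 * t" using H by (simp add: pos_divide_le_eq mult.commute)
        have "Lg (S t) \<le> z0 / exp (- S t)" unfolding Lg_def using z0 ep[of "S t"] by (intro divide_left_mono mult_pos_pos) auto
        also have "\<dots> = z0 * exp (S t)" by (simp add: exp_minus divide_inverse)
        also have "\<dots> \<le> z0 * exp (H0 * t)" using St z0 by simp
        finally show ?case by (simp add: \<zeta>_def)
      qed
      have "filterlim (\<lambda>t. H0 * t) at_bot at_bot"
        by (rule filterlim_tendsto_pos_mult_at_bot[OF tendsto_const H(1) filterlim_ident])
      then have "((\<lambda>t. exp (H0 * t)) \<longlongrightarrow> 0) at_bot" by (rule filterlim_compose[OF exp_at_bot])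
      then show "((\<lambda>t. z0 * exp (H0 * t)) \<longlongrightarrow> 0) at_bot" by (rule tendsto_mult_right_zero)
    qed
  qed
qed

subsection \<open>The four-winged connection\<close>

lemma Z4_sym_simps: "Z4_sym v = (\<i> * fst v, - snd v)" by (simp add: Z4_sym_def split_beta)

lemma Z4_sym_bounded_linear: "bounded_linear Z4_sym"
  unfolding Z4_sym_simps[abs_def]
  by (intro bounded_linear_Pair bounded_linear_minus bounded_linear_snd bounded_linear_compose[OF bounded_linear_mult_right] bounded_linear_fst)

lemma Z4_sym_powers:
  "(Z4_sym ^^ 1) v = Z4_sym v" "(Z4_sym ^^ 2) v = (- fst v, snd v)" "(Z4_sym ^^ 3) v = (- \<i> * fst v, - snd v)"
      "(Z4_sym ^^ 4) v = v"
  by (simp_all add: eval_nat_numeral Z4_sym_simps)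

lemma trajectory_Z4:
  assumes "trajectory G W T \<phi>" "\<forall>w\<in>W. G (Z4_sym w) = Z4_sym (G w)" "Z4_sym ` W = W"
  shows "trajectory G W T ((Z4_sym ^^ k) \<circ> \<phi>)"
proof (induction k)
  case 0
  then show ?case using assms(1) by simp
next
  case (Suc k)
  let ?\<psi> = "(Z4_sym ^^ k) \<circ> \<phi>"
  have eq: "(Z4_sym ^^ Suc k) \<circ> \<phi> = (\<lambda>t. Z4_sym (?\<psi> t))" by (simp add: fun_eq_iff)
  show ?case unfolding eq trajectory_def
  proof
    fix t assume "t \<in> T"
    then have \<psi>: "?\<psi> t \<in> W" "(?\<psi> has_vector_derivative G (?\<psi> t)) (at t within T)" using Suc unfolding trajectory_def by blast+
    have "((\<lambda>t. Z4_sym (?\<psi> t)) has_vector_derivative Z4_sym (G (?\<psi> t))) (at t within T)"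
      by (rule bounded_linear.has_vector_derivative[OF Z4_sym_bounded_linear \<psi>(2)])
    moreover have "Z4_sym (?\<psi> t) \<in> W" using \<psi>(1) assms(3) by blast
    ultimately show "Z4_sym (?\<psi> t) \<in> W \<and> ((\<lambda>t. Z4_sym (?\<psi> t)) has_vector_derivative G (Z4_sym (?\<psi> t))) (at t within T)"
      using assms(2) \<psi>(1) by simp
  qed
qed

lemma tendsto_Z4: "(\<phi> \<longlongrightarrow> (0, z)) F \<Longrightarrow> (((Z4_sym ^^ k) \<circ> \<phi>) \<longlongrightarrow> (0, (- 1) ^ k * z)) F"
proof (induction k)
  case (Suc k)
  have "((\<lambda>t. Z4_sym (((Z4_sym ^^ k) \<circ> \<phi>) t)) \<longlongrightarrow> Z4_sym (0, (- 1) ^ k * z)) F"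
    by (rule bounded_linear.tendsto[OF Z4_sym_bounded_linear]) (use Suc in blast)
  moreover have "Z4_sym (0, (- 1) ^ k * z) = (0, (- 1) ^ Suc k * z)" by (simp add: Z4_sym_simps)
  ultimately show ?case by (simp add: o_def)
qed (simp add: o_def)

text \<open>The reverse inclusion is the forward one for the third power, which is the inverse of
  \<open>Z4_sym\<close>.\<close>

lemma unstable_manifold_Z4:
  assumes "\<forall>w\<in>W. G (Z4_sym w) = Z4_sym (G w)" "Z4_sym ` W = W"
  shows "unstable_manifold G W (0, - z) = Z4_sym ` unstable_manifold G W (0, z)"
proof -
  have 1: "(Z4_sym ^^ k) x \<in> unstable_manifold G W (0, (- 1) ^ k * z)" if x: "x \<in> unstable_manifold G W (0, z)" for k x z
  proof -
    obtain \<psi> where "trajectory G W {..0} \<psi>" "\<psi> 0 = x" "(\<psi> \<longlongrightarrow> (0, z)) at_bot" using x by (auto simp: unstable_manifold_def)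
    then show ?thesis unfolding unstable_manifold_def using trajectory_Z4[OF _ assms] tendsto_Z4
      by (intro CollectI exI[of _ "(Z4_sym ^^ k) \<circ> \<psi>"]) (auto simp: o_def)
  qed
  show ?thesis
  proof
    show "Z4_sym ` unstable_manifold G W (0, z) \<subseteq> unstable_manifold G W (0, - z)" using 1[of _ z 1] by auto
    show "unstable_manifold G W (0, - z) \<subseteq> Z4_sym ` unstable_manifold G W (0, z)"
    proof
      fix x assume "x \<in> unstable_manifold G W (0, - z)"
      then have "(Z4_sym ^^ 3) x \<in> unstable_manifold G W (0, z)" using 1[of x "- z" 3] by simp
      moreover have "Z4_sym ((Z4_sym ^^ 3) x) = x" by (simp add: Z4_sym_powers) (simp add: Z4_sym_simps)
      ultimately show "x \<in> Z4_sym ` unstable_manifold G W (0, z)" by (metis imageI)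
    qed
  qed
qed

text \<open>As a real matrix, u to \<alpha> u + \<beta> cnj u has diagonal entries Re (\<alpha> +
  \<beta>) and Re (\<alpha> - \<beta>), and its determinant is their product plus (Im \<alpha>)^2 -
  (Im \<beta>)^2, which is negative by the third hypothesis. So the eigenvalues are real of opposite
  sign, and the signs on the diagonal keep the explicit eigenvectors nonzero.\<close>

lemma real_saddle_matrix:
  fixes \<alpha> \<beta> :: complex
  assumes "Re (\<alpha> + \<beta>) > 0" "Re (\<alpha> - \<beta>) < 0" "(Im \<alpha>)\<^sup>2 < - (Re (\<alpha> + \<beta>) * Re (\<alpha> - \<beta>))"
  obtains p q \<rho> \<mu> where "\<alpha> * p + \<beta> * cnj p = of_real \<rho> * p" "\<alpha> * q + \<beta> * cnj q = of_real \<mu> * q"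
    "p \<noteq> 0" "q \<noteq> 0" "\<rho> > 0" "\<mu> < (0::real)"
proof -
  define m11 where "m11 = Re \<alpha> + Re \<beta>"
  define m12 where "m12 = Im \<beta> - Im \<alpha>"
  define m21 where "m21 = Im \<alpha> + Im \<beta>"
  define m22 where "m22 = Re \<alpha> - Re \<beta>"
  have h: "m11 > 0" "m22 < 0" "(Im \<alpha>)\<^sup>2 < - (m11 * m22)" using assms by (simp_all add: m11_def m22_def)
  have N: "\<alpha> * Complex x y + \<beta> * cnj (Complex x y) = Complex (m11 * x + m12 * y) (m21 * x + m22 * y)" for x y
    by (simp add: complex_eq_iff m11_def m12_def m21_def m22_def algebra_simps)
  have "m12 * m21 = (Im \<beta>)\<^sup>2 - (Im \<alpha>)\<^sup>2" by (simp add: m12_def m21_def power2_eq_square algebra_simps)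
  then have det: "m11 * m22 - m12 * m21 < 0" using h(3) zero_le_power2[of "Im \<beta>"] by linarith
  define tr where "tr = m11 + m22"
  define d where "d = m11 * m22 - m12 * m21"
  define \<Delta> where "\<Delta> = sqrt (tr\<^sup>2 - 4 * d)"
  have \<Delta>2: "\<Delta>\<^sup>2 = tr\<^sup>2 - 4 * d" 
  proof -
    have "d < 0" using det by (simp add: d_def)
    then have "0 \<le> tr\<^sup>2 - 4 * d" using zero_le_power2[of tr] by linarith
    then show ?thesis by (simp add: \<Delta>_def)
  qed
  have "\<bar>tr\<bar> < \<Delta>" unfolding \<Delta>_def
    using det real_sqrt_less_mono[of "tr\<^sup>2" "tr\<^sup>2 - 4 * d"] by (simp add: d_def)
  then have sgn: "(tr + \<Delta>) / 2 > 0" "(tr - \<Delta>) / 2 < 0" by (simp_all add: abs_less_iff)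
  have root: "\<rho> * \<rho> = tr * \<rho> - d" if "\<rho> = (tr + \<Delta>) / 2 \<or> \<rho> = (tr - \<Delta>) / 2" for \<rho>
  proof -
    have "2 * \<rho> - tr = \<Delta> \<or> 2 * \<rho> - tr = - \<Delta>" using that by auto
    then have "(2 * \<rho> - tr)\<^sup>2 = \<Delta>\<^sup>2" by (elim disjE) simp_all
    then have "4 * (\<rho> * \<rho>) = 4 * (tr * \<rho>) - 4 * d" unfolding \<Delta>2 by (simp add: power2_eq_square algebra_simps)
    then show ?thesis by linarith
  qed
  define l where "l = (tr + \<Delta>) / 2"
  define k where "k = (tr - \<Delta>) / 2"
  have lk: "l * l = (m11 + m22) * l - (m11 * m22 - m12 * m21)" "k * k = (m11 + m22) * k - (m11 * m22 - m12 * m21)"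
    using root[of l] root[of k] by (auto simp: l_def k_def tr_def d_def)
  show ?thesis
  proof (rule that[of "Complex (l - m22) m21" l "Complex m12 (k - m11)" k])
    show "\<alpha> * Complex (l - m22) m21 + \<beta> * cnj (Complex (l - m22) m21) = of_real l * Complex (l - m22) m21"
      unfolding N using lk(1) by (simp add: complex_eq_iff algebra_simps)
    show "\<alpha> * Complex m12 (k - m11) + \<beta> * cnj (Complex m12 (k - m11)) = of_real k * Complex m12 (k - m11)"
      unfolding N using lk(2) by (simp add: complex_eq_iff algebra_simps)
    show "l > 0" "k < 0" using sgn by (simp_all add: l_def k_def)
    then show "Complex (l - m22) m21 \<noteq> 0" "Complex m12 (k - m11) \<noteq> 0" using h(1,2) by (auto simp: complex_eq_iff)
  qed
qed

lemma pos_combination: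
  fixes a b x y :: real
  assumes "a > 0" "b > 0" "x \<noteq> 0 \<or> y \<noteq> 0"
  shows "a * x\<^sup>2 + b * y\<^sup>2 > 0"
  using assms by (cases "x = 0") (auto intro!: add_pos_nonneg)

text \<open>The indefinite form is z^2 - |u|^2 with \<xi> = z at O, and |A|^2 Re ((u / A)^2) - z^2
  with \<xi> = Re (u / A) at O+; O- is reached by the symmetry. The third condition on \<alpha> and
  \<beta> is at once the saddle condition and the discriminant condition under which the form at O+
  increases.\<close>

theorem four_winged_connectionI:
  fixes G :: "phase \<Rightarrow> phase"
  assumes W: "open W" "Z4_sym ` W = W" and G: "smooth_on W G" and eqv: "\<forall>w\<in>W. G (Z4_sym w) = Z4_sym (G w)"
    and z0: "z0 > 0" and seg: "\<And>z. 0 \<le> z \<Longrightarrow> z \<le> z0 \<Longrightarrow> (0, z) \<in> W"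
    and D0: "(G has_derivative (\<lambda>v. (c0 * fst v, \<mu> * snd v))) (at 0)" "Re c0 < 0" "\<mu> > 0"
    and axis: "\<And>z. 0 \<le> z \<Longrightarrow> z \<le> z0 \<Longrightarrow> G (0, z) = (0, z * (z0 - z) * m z)" "continuous_on {0..z0} m" "\<And>z. z \<in> {0..z0} \<Longrightarrow> m z > 0"
    and Dp: "(G has_derivative (\<lambda>v. (\<alpha> * fst v + \<beta> * (A / cnj A) * cnj (fst v), - l * snd v))) (at (0, z0))" "A \<noteq> 0" "l > 0"
    and \<alpha>\<beta>: "Re (\<alpha> + \<beta>) > 0" "Re (\<alpha> - \<beta>) < 0" "(Im \<alpha>)\<^sup>2 < - (Re (\<alpha> + \<beta>) * Re (\<alpha> - \<beta>))"
    and \<phi>: "trajectory G W UNIV \<phi>" "(\<phi> \<longlongrightarrow> (0, z0)) at_bot" "(\<phi> \<longlongrightarrow> 0) at_top" "fst (\<phi> 0) \<noteq> 0"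
  shows "four_winged_connection G W z0"
proof -
  have G0: "G 0 = 0" using axis(1)[of 0] z0 by (simp add: zero_prod_def)
  have Gp: "G (0, z0) = 0" using axis(1)[of z0] z0 by (simp add: zero_prod_def)
  have W0: "0 \<in> W" using seg[of 0] z0 by (simp add: zero_prod_def)
  have Wp: "(0, z0) \<in> W" using seg[of z0] z0 by simp
  note traj = trajectory_Z4[OF \<phi>(1) eqv W(2)]
  have saddle0: "saddle G (0, 0)"
  proof (rule saddleI[where g="\<lambda>u::complex. (u, 0)" and B="\<lambda>u. c0 * u" and h="\<lambda>z. (0, z)" and l=\<mu>])
    show "(G has_derivative (\<lambda>v. (c0 * fst v, \<mu> * snd v))) (at (0, 0))" using D0(1) by (simp add: zero_prod_def)
    show "linear (\<lambda>u::complex. (u, 0::real))" "linear (\<lambda>z::real. (0::complex, z))" by (auto intro!: linearI)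
    show "(c0 * u) \<bullet> u < 0" if "u \<noteq> 0" for u
    proof -
      have "(c0 * u) \<bullet> u = Re c0 * (norm u)\<^sup>2"
        unfolding cmod_power2 inner_complex_def by (simp add: algebra_simps power2_eq_square)
      then show ?thesis using D0(2) that by (simp add: mult_neg_pos)
    qed
  qed (use G0 D0(3) in \<open>auto simp: inj_def zero_prod_def\<close>)
  obtain p q \<rho> \<sigma> where pq: "\<alpha> * p + \<beta> * cnj p = of_real \<rho> * p" "\<alpha> * q + \<beta> * cnj q = of_real \<sigma> * q"
    "p \<noteq> 0" "q \<noteq> 0" "\<rho> > 0" "\<sigma> < 0"
    by (rule real_saddle_matrix[OF \<alpha>\<beta>]) blast
  let ?D = "\<lambda>v::phase. (\<alpha> * fst v + \<beta> * (A / cnj A) * cnj (fst v), - l * snd v)"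
  have D_scale: "\<alpha> * (of_real s * (A * v)) + \<beta> * (A / cnj A) * cnj (of_real s * (A * v)) = of_real s * A * (\<alpha> * v +
      \<beta> * cnj v)" for s v
    using Dp(2) by (simp add: algebra_simps)
  define g where "g x = (of_real (fst x) * (A * q), snd x)" for x :: "real \<times> real"
  define h where "h s = (of_real s * (A * p), 0::real)" for s
  define B where "B x = (\<sigma> * fst x, - l * snd x)" for x :: "real \<times> real"
  have gh: "linear g" "inj g" "linear h" "inj h"
    using pq(3,4) Dp(2) by (auto intro!: linearI injI simp: g_def h_def algebra_simps scaleR_conv_of_real prod_eq_iff)
  have Dg: "?D (g x) = g (B x)" for x
    unfolding g_def B_def fst_conv snd_conv D_scale pq(2) by simp
  have Dh: "?D (h s) = h (\<rho> * s)" for s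
    unfolding h_def fst_conv snd_conv D_scale pq(1) by simp
  have B: "B x \<bullet> x < 0" if "x \<noteq> 0" for x
  proof -
    have "B x \<bullet> x = - (- \<sigma> * (fst x)\<^sup>2 + l * (snd x)\<^sup>2)" by (simp add: B_def inner_prod_def power2_eq_square)
    moreover have "- \<sigma> * (fst x)\<^sup>2 + l * (snd x)\<^sup>2 > 0"
      by (rule pos_combination) (use that pq(6) Dp(3) in \<open>auto simp: prod_eq_iff\<close>)
    ultimately show ?thesis by simp
  qed
  have saddle1: "saddle G (0, z0)"
    by (rule saddleI[OF Gp Dp(1) _ gh(1,2) Dg B gh(3,4) Dh pq(5)]) auto
  have Gm: "G (0, - z0) = 0" 
  proof -
    have "G (Z4_sym (0, z0)) = Z4_sym (G (0, z0))" using eqv Wp by blast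
    then show ?thesis by (simp add: Z4_sym_simps Gp zero_prod_def)
  qed
  have saddle2: "saddle G (0, - z0)"
  proof -
    \<comment> \<open>The inverse of \<open>Z4_sym\<close>; conjugation carries the derivative and
      the splitting from O+ to O-.\<close>
    let ?I = "\<lambda>v::phase. (- \<i> * fst v, - snd v)"
    have I: "bounded_linear ?I"
      by (intro bounded_linear_Pair bounded_linear_minus bounded_linear_snd bounded_linear_compose[OF bounded_linear_mult_right] bounded_linear_fst)
    have IZ: "?I (Z4_sym v) = v" "Z4_sym (?I v) = v" for v by (simp_all add: Z4_sym_simps)
    have IW: "?I v \<in> W" if "v \<in> W" for v using W(2) that IZ by (metis imageE)
    have "(G has_derivative ?D) (at (?I (0, - z0)))" using Dp(1) by simp
    from bounded_linear.has_derivative[OF Z4_sym_bounded_linear diff_chain_at[OF bounded_linear_imp_has_derivative[OF I] this]]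
    have "((\<lambda>v. Z4_sym (G (?I v))) has_derivative (\<lambda>v. Z4_sym (?D (?I v)))) (at (0, - z0))" by (simp add: o_def)
    moreover have "Z4_sym (G (?I v)) = G v" if "v \<in> W" for v using eqv IW[OF that] IZ(2) by metis
    moreover have "(0, - z0) \<in> W" using Wp W(2) by (metis IZ(1) Z4_sym_simps fst_conv imageI mult_zero_right snd_conv)
    ultimately have d: "(G has_derivative (\<lambda>v. Z4_sym (?D (?I v)))) (at (0, - z0))"
      using has_derivative_transform_within_open[OF _ W(1), of _ _ "(0, - z0)" UNIV G] by blast
    have lZ: "linear Z4_sym" using Z4_sym_bounded_linear by (rule bounded_linear.linear)
    have iZ: "inj Z4_sym" by (metis IZ(1) injI)
    show ?thesis
    proof (rule saddleI[OF Gm d, where g="Z4_sym \<circ> g" and B=B and h="Z4_sym \<circ> h" and l=\<rho>])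
      show "linear (Z4_sym \<circ> g)" "linear (Z4_sym \<circ> h)" using gh(1,3) lZ by (auto intro: linear_compose)
      show "inj (Z4_sym \<circ> g)" "inj (Z4_sym \<circ> h)" using gh(2,4) iZ by (auto intro: inj_compose)
      show "Z4_sym (?D (?I ((Z4_sym \<circ> g) x))) = (Z4_sym \<circ> g) (B x)" for x
        unfolding o_def IZ(1) Dg ..
      show "Z4_sym (?D (?I ((Z4_sym \<circ> h) x))) = (Z4_sym \<circ> h) (\<rho> * x)" for x
        unfolding o_def IZ(1) Dh ..
    qed (use B pq(5) in auto)
  qed
  have UM0: "unstable_manifold G W (0, 0) = {0} \<times> {- z0<..<z0}"
  proof -
    \<comment> \<open>The solution on the positive half axis and its image under the symmetry are
      the two trajectories with opposite \<xi> that leave O.\<close>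
    obtain \<zeta> where \<zeta>: "\<And>t. (\<zeta> has_real_derivative \<zeta> t * (z0 - \<zeta> t) * m (\<zeta> t)) (at t)"
      "range \<zeta> = {0<..<z0}" "(\<zeta> \<longlongrightarrow> 0) at_bot"
      using axis_trajectory[OF z0 axis(2,3)] by blast
    have r\<zeta>: "0 < \<zeta> t" "\<zeta> t < z0" for t using \<zeta>(2) by (metis greaterThanLessThan_iff rangeI)+
    define \<theta> where "\<theta> t = (0::complex, \<zeta> t)" for t
    have t1: "trajectory G W UNIV \<theta>" unfolding trajectory_UNIV
    proof
      fix t
      have "(\<theta> has_vector_derivative (0, \<zeta> t * (z0 - \<zeta> t) * m (\<zeta> t))) (at t)"
        unfolding \<theta>_def using \<zeta>(1)[of t] unfolding has_real_derivative_iff_has_vector_derivative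
        by (intro has_vector_derivative_Pair has_vector_derivative_const)
      then show "\<theta> t \<in> W \<and> (\<theta> has_vector_derivative G (\<theta> t)) (at t)"
        using axis(1)[of "\<zeta> t"] seg[of "\<zeta> t"] r\<zeta>[of t] by (simp add: \<theta>_def less_imp_le)
    qed
    have l1: "(\<theta> \<longlongrightarrow> (0, 0)) at_bot" unfolding \<theta>_def by (intro tendsto_intros \<zeta>(3))
    note t2 = trajectory_Z4[OF t1 eqv W(2), of 1]
    have l2: "(((Z4_sym ^^ 1) \<circ> \<theta>) \<longlongrightarrow> (0, 0)) at_bot" using tendsto_Z4[OF l1, of 1] by simp
    have fd: "frechet_derivative G (at (0, 0)) = (\<lambda>v. (c0 * fst v, \<mu> * snd v))"
      using frechet_derivative_at[OF D0(1)] by (simp add: zero_prod_def)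
    have "unstable_manifold G W (0, 0) = {(0, 0)} \<union> range \<theta> \<union> range ((Z4_sym ^^ 1) \<circ> \<theta>)"
    proof (rule unstable_manifold_1d[OF G W(1), where J="\<lambda>v. (- fst v, snd v)" and \<xi>=snd and c=0])
      show "(0, 0) \<in> W" "G (0, 0) = 0" using W0 G0 by (simp_all add: zero_prod_def)
      show "bounded_linear (\<lambda>v::phase. (- fst v, snd v))"
        by (intro bounded_linear_Pair bounded_linear_minus bounded_linear_snd bounded_linear_fst)
      fix v :: phase
      show "(- fst v, snd v) \<bullet> w = v \<bullet> (- fst w, snd w)" for w by (simp add: inner_prod_def)
      show "(- fst (frechet_derivative G (at (0, 0)) v), snd (frechet_derivative G (at (0, 0)) v)) \<bullet> v > 0" if "v \<noteq> 0"
      proof -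
        have "(- (c0 * fst v), \<mu> * snd v) \<bullet> v = - Re c0 * (norm (fst v))\<^sup>2 + \<mu> * (snd v)\<^sup>2"
          unfolding cmod_power2 inner_prod_def inner_complex_def by (simp add: algebra_simps power2_eq_square)
        moreover have "- Re c0 * (norm (fst v))\<^sup>2 + \<mu> * (snd v)\<^sup>2 > 0"
          by (rule pos_combination) (use that D0(2,3) in \<open>auto simp: prod_eq_iff\<close>)
        ultimately show ?thesis by (simp add: fd)
      qed
      show "(- fst v, snd v) \<bullet> v \<le> 0" if "snd v = 0" using that by (simp add: inner_prod_def)
      show "\<theta> 0 \<noteq> (0, 0)" using r\<zeta>[of 0] by (simp add: \<theta>_def)
      show "snd (((Z4_sym ^^ 1) \<circ> \<theta>) t - (0, 0)) = - snd (\<theta> t - (0, 0))" for t by (simp add: Z4_sym_simps)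
    qed (use t1 t2 l1 l2 bounded_linear_snd in auto)
    also have "range \<theta> = {0} \<times> {0<..<z0}" unfolding \<theta>_def using \<zeta>(2) by auto
    also have "range ((Z4_sym ^^ 1) \<circ> \<theta>) = {0} \<times> {- z0<..<0}"
    proof -
      have "range ((Z4_sym ^^ 1) \<circ> \<theta>) = (\<lambda>z. (0, - z)) ` {0<..<z0}"
        unfolding \<zeta>(2)[symmetric] by (auto simp: \<theta>_def Z4_sym_simps)
      also have "\<dots> = {0} \<times> uminus ` {0<..<z0}" by (auto simp del: image_uminus_greaterThanLessThan)
      finally show ?thesis by (simp only: image_uminus_greaterThanLessThan minus_zero)
    qed
    also have "{(0, 0)} \<union> {0} \<times> {0<..<z0} \<union> {0} \<times> {- z0<..<0} = {0::complex} \<times> ({0} \<union> {0<..<z0} \<union> {- z0<..<0})" by blast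
    also have "{0} \<union> {0<..<z0} \<union> {- z0<..<0} = {- z0<..<z0}" using z0 by auto
    finally show ?thesis .
  qed
  have uniq: "x t = y t" if "trajectory G W UNIV x" "trajectory G W UNIV y" "x s = y s" for x y s t
    using trajectories_unique[OF G W(1) open_UNIV connected_UNIV, of x y s t] that unfolding trajectory_UNIV by auto
  have shift: "trajectory G W UNIV (\<lambda>t. x (t + s))" if "trajectory G W UNIV x" for x s
    using that shift_has_vector_derivative unfolding trajectory_UNIV by blast
  have UM1: "unstable_manifold G W (0, z0) = {(0, z0)} \<union> range \<phi> \<union> range ((Z4_sym ^^ 2) \<circ> \<phi>)"
  proof -
    \<comment> \<open>In the coordinate V = u / A the first component is complex conjugation, so the
      form is positive for real V and negative for imaginary V.\<close>
    let ?J = "\<lambda>v::phase. (A / cnj A * cnj (fst v), - snd v)"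
    have fd: "frechet_derivative G (at (0, z0)) = ?D" using frechet_derivative_at[OF Dp(1)] by simp
    have Jin: "?J v \<bullet> v = (norm A)\<^sup>2 * Re ((fst v / A)\<^sup>2) - (snd v)\<^sup>2" for v
    proof -
      have "A / cnj A * cnj (fst v) = A * cnj (fst v / A)" by simp
      moreover have "(A * cnj V) \<bullet> (A * V) = (norm A)\<^sup>2 * Re (V\<^sup>2)" for V
        unfolding cmod_power2 inner_complex_def by (simp add: power2_eq_square algebra_simps)
      from this[of "fst v / A"] have "(A * cnj (fst v / A)) \<bullet> fst v = (norm A)\<^sup>2 * Re ((fst v / A)\<^sup>2)" using Dp(2) by simp
      ultimately show ?thesis by (simp add: inner_prod_def power2_eq_square)
    qed
    show ?thesis
    proof (rule unstable_manifold_1d[OF G W(1) Wp Gp, where J="?J" and \<xi>="\<lambda>v. Re (fst v / A)" and c=0])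
      show "bounded_linear ?J"
        by (intro bounded_linear_Pair bounded_linear_minus bounded_linear_snd bounded_linear_compose[OF bounded_linear_mult_right]
            bounded_linear_compose[OF bounded_linear_cnj] bounded_linear_fst)
      show "bounded_linear (\<lambda>v::phase. Re (fst v / A))" unfolding divide_inverse
        by (intro bounded_linear_compose[OF bounded_linear_Re] bounded_linear_compose[OF bounded_linear_mult_left]
            bounded_linear_fst)
      fix v :: phase
      show "?J v \<bullet> w = v \<bullet> ?J w" for w
      proof -
        have "(a * cnj x) \<bullet> y = x \<bullet> (a * cnj y)" for a x y :: complex by (simp add: inner_complex_def algebra_simps)
        then show ?thesis by (simp only: inner_prod_def fst_conv snd_conv) simp
      qed
      show "?J (frechet_derivative G (at (0, z0)) v) \<bullet> v > 0" if "v \<noteq> 0"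
      proof -
        define V where "V = fst v / A"
        have v: "fst v = A * V" using Dp(2) by (simp add: V_def)
        define x where "x = Re V" define y where "y = Im V"
        define a where "a = Re (\<alpha> + \<beta>)" define b where "b = - Re (\<alpha> - \<beta>)" define k where "k = Im \<alpha>"
        have ab: "a > 0" "b > 0" "k\<^sup>2 < a * b"
          using \<alpha>\<beta>(1,2) unfolding a_def b_def k_def mult_minus_right by (simp, simp) (rule \<alpha>\<beta>(3))
        have f: "fst (?D v) = A * (\<alpha> * V + \<beta> * cnj V)" using Dp(2) by (simp add: v algebra_simps)
        have "A / cnj A * cnj (fst (?D v)) = A * cnj (\<alpha> * V + \<beta> * cnj V)" unfolding f using Dp(2) by simp
        then have "?J (?D v) \<bullet> v = (A * cnj (\<alpha> * V + \<beta> * cnj V)) \<bullet> (A * V) + l * (snd v)\<^sup>2"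
          by (simp add: inner_prod_def v power2_eq_square)
        also have "(A * cnj (\<alpha> * V + \<beta> * cnj V)) \<bullet> (A * V) = (norm A)\<^sup>2 * (cnj (\<alpha> * V + \<beta> * cnj V) \<bullet> V)"
          unfolding cmod_power2 inner_complex_def by (simp add: power2_eq_square algebra_simps)
        also have "cnj (\<alpha> * V + \<beta> * cnj V) \<bullet> V = a * x\<^sup>2 - 2 * k * x * y + b * y\<^sup>2"
          by (simp add: inner_complex_def a_def b_def k_def x_def y_def power2_eq_square algebra_simps)
        finally have eq: "?J (?D v) \<bullet> v = (norm A)\<^sup>2 * (a * x\<^sup>2 - 2 * k * x * y + b * y\<^sup>2) + l * (snd v)\<^sup>2" .
        have pos: "a * x\<^sup>2 - 2 * k * x * y + b * y\<^sup>2 > 0" if "x \<noteq> 0 \<or> y \<noteq> 0"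
        proof -
          have "a * (a * x\<^sup>2 - 2 * k * x * y + b * y\<^sup>2) = (a * x - k * y)\<^sup>2 + (a * b - k\<^sup>2) * y\<^sup>2"
            by (simp add: power2_eq_square algebra_simps)
          also have "\<dots> > 0"
          proof (cases "y = 0")
            case True
            then show ?thesis using that ab by simp
          next
            case False
            then show ?thesis using ab by (intro add_nonneg_pos) auto
          qed
          finally show ?thesis using ab(1) by (simp add: zero_less_mult_iff)
        qed
        show ?thesis unfolding fd eq
        proof (cases "V = 0")
          case True
          then have "snd v \<noteq> 0" using that v by (auto simp: prod_eq_iff)
          then show "0 < (norm A)\<^sup>2 * (a * x\<^sup>2 - 2 * k * x * y + b * y\<^sup>2) + l * (snd v)\<^sup>2"
            using True Dp(3) by (simp add: x_def y_def)
        next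
          case False
          then have "x \<noteq> 0 \<or> y \<noteq> 0" by (auto simp: x_def y_def complex_eq_iff)
          then show "0 < (norm A)\<^sup>2 * (a * x\<^sup>2 - 2 * k * x * y + b * y\<^sup>2) + l * (snd v)\<^sup>2"
            using mult_pos_pos[OF _ pos, of "(norm A)\<^sup>2"] Dp(2,3) by (intro add_pos_nonneg) auto
        qed
      qed
      show "?J v \<bullet> v \<le> 0" if "Re (fst v / A) = 0"
      proof -
        have "Re ((fst v / A)\<^sup>2) = - ((Im (fst v / A))\<^sup>2)" unfolding Re_power2 using that by simp
        then have "(norm A)\<^sup>2 * Re ((fst v / A)\<^sup>2) \<le> 0" by (simp add: mult_nonneg_nonpos)
        then show ?thesis unfolding Jin using zero_le_power2[of "snd v"] by linarith
      qed
      show "\<phi> 0 \<noteq> (0, z0)" using \<phi>(4) by auto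
      show "trajectory G W UNIV ((Z4_sym ^^ 2) \<circ> \<phi>)" by (rule traj)
      show "(((Z4_sym ^^ 2) \<circ> \<phi>) \<longlongrightarrow> (0, z0)) at_bot" using tendsto_Z4[OF \<phi>(2), of 2] by simp
      show "Re (fst (((Z4_sym ^^ 2) \<circ> \<phi>) t - (0, z0)) / A) = - Re (fst (\<phi> t - (0, z0)) / A)" for t
        by (simp add: Z4_sym_powers)
    qed (rule \<phi>)+
  qed
  have ne: "((Z4_sym ^^ k) \<circ> \<phi>) t \<noteq> (0, z0)" if "k < 4" "even k" for k t
  proof
    assume eq: "((Z4_sym ^^ k) \<circ> \<phi>) t = (0, z0)"
    have "trajectory G W UNIV (\<lambda>t. (0, z0))" using Wp Gp by (simp add: trajectory_UNIV)
    from uniq[OF traj this eq, of 0] have "(Z4_sym ^^ k) (\<phi> 0) = (0, z0)" by simp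
    moreover have "k = 0 \<or> k = 2" using that by presburger
    ultimately show False using \<phi>(4) by (auto simp: Z4_sym_powers prod_eq_iff)
  qed
  \<comment> \<open>Wings that meet agree up to a time shift. The limits at -\<infinity> then force
    k to be even, so k = 2. With shift 0 the u component would vanish at time 0; with any other
    shift \<phi> would be periodic, and its limit at +\<infinity> would make it 0 at time 0.\<close>
  have disj: "\<phi> t \<noteq> (Z4_sym ^^ k) (\<phi> s)" if k: "0 < k" "k < 4" for k s t
  proof
    assume eq: "\<phi> t = (Z4_sym ^^ k) (\<phi> s)"
    have eq': "\<phi> (r + (t - s)) = (Z4_sym ^^ k) (\<phi> r)" for r
      using uniq[OF shift[OF \<phi>(1), of "t - s"] traj[of k], of s r] eq by simp
    have lim: "((\<lambda>r. \<phi> (r + (t - s))) \<longlongrightarrow> (0, z0)) at_bot"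
      by (rule filterlim_compose[OF \<phi>(2) filterlim_shift_at_bot])
    have "((\<lambda>r. (Z4_sym ^^ k) (\<phi> r)) \<longlongrightarrow> (0, (- 1) ^ k * z0)) at_bot"
      using tendsto_Z4[OF \<phi>(2), of k] by (simp add: o_def)
    then have "(0::complex, z0) = (0, (- 1) ^ k * z0)"
      using lim unfolding eq' using tendsto_unique trivial_limit_at_bot_linorder by blast
    then have "even k" using z0 by (cases "even k") auto
    then have k2: "k = 2" using k by presburger
    have per: "\<phi> (r + 2 * (t - s)) = \<phi> r" for r
      using eq'[of "r + (t - s)"] eq'[of r] by (simp add: k2 Z4_sym_powers algebra_simps)
    show False
    proof (cases "t = s")
      case True
      then show False using eq'[of 0] \<phi>(4) by (simp add: k2 Z4_sym_powers prod_eq_iff)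
    next
      case False
      define T where "T = 2 * \<bar>t - s\<bar>"
      have T: "T > 0" using False by (simp add: T_def)
      have per': "\<phi> (r + T) = \<phi> r" for r
      proof -
        have per2: "\<phi> (r + 2 * (s - t)) = \<phi> r" using per[of "r + 2 * (s - t)"] by (simp add: algebra_simps)
        have "T = 2 * (t - s) \<or> T = 2 * (s - t)" by (auto simp: T_def abs_if)
        then show ?thesis using per[of r] per2 by metis
      qed
      have pern: "\<phi> (r + real n * T) = \<phi> r" for n r
      proof (induction n)
        case (Suc n)
        then show ?case using per'[of "r + real n * T"] by (simp add: algebra_simps)
      qed simp
      have f1: "filterlim (\<lambda>n. r + real n * T) at_top sequentially" for r
        by (intro filterlim_tendsto_add_at_top[OF tendsto_const] filterlim_at_top_mult_tendsto_pos[OF tendsto_const T]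
            filterlim_real_sequentially)
      have "((\<lambda>n. \<phi> (0 + real n * T)) \<longlonglongrightarrow> 0)" by (rule filterlim_compose[OF \<phi>(3) f1])
      then have "(\<lambda>n. \<phi> 0) \<longlonglongrightarrow> 0" unfolding pern .
      then have "\<phi> 0 = 0" using LIMSEQ_const_iff by blast
      then show False using \<phi>(4) by simp
    qed
  qed
  have inj: "inj Z4_sym" by (rule injI) (simp add: Z4_sym_simps prod_eq_iff)
  have disj': "range ((Z4_sym ^^ j) \<circ> \<phi>) \<inter> range ((Z4_sym ^^ k) \<circ> \<phi>) = {}" if "j < k" "k < 4" for j k
  proof -
    have "((Z4_sym ^^ j) \<circ> \<phi>) t \<noteq> ((Z4_sym ^^ k) \<circ> \<phi>) s" for t s
    proof
      assume "((Z4_sym ^^ j) \<circ> \<phi>) t = ((Z4_sym ^^ k) \<circ> \<phi>) s"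
      moreover have "(Z4_sym ^^ k) = (Z4_sym ^^ j) \<circ> (Z4_sym ^^ (k - j))" using that by (simp add: funpow_add[symmetric])
      ultimately have "(Z4_sym ^^ j) (\<phi> t) = (Z4_sym ^^ j) ((Z4_sym ^^ (k - j)) (\<phi> s))" by simp
      then have "\<phi> t = (Z4_sym ^^ (k - j)) (\<phi> s)" using inj_fn[OF inj, of j] by (auto dest: injD)
      then show False using disj[of "k - j" t s] that by auto
    qed
    then show ?thesis by blast
  qed
  show ?thesis unfolding four_winged_connection_def
  proof (intro conjI exI[of _ \<phi>] allI impI)
    fix k :: nat assume "k < 4"
    show "trajectory G W UNIV ((Z4_sym ^^ k) \<circ> \<phi>)" by (rule traj)
    show "(((Z4_sym ^^ k) \<circ> \<phi>) \<longlongrightarrow> (0, (- 1) ^ k * z0)) at_bot" by (rule tendsto_Z4[OF \<phi>(2)])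
    show "(((Z4_sym ^^ k) \<circ> \<phi>) \<longlongrightarrow> (0, 0)) at_top"
      using tendsto_Z4[of \<phi> 0 at_top k] \<phi>(3) by (simp add: zero_prod_def)
  next
    fix j k :: nat assume "j < 4" "k < 4" "j \<noteq> k"
    then show "range ((Z4_sym ^^ j) \<circ> \<phi>) \<inter> range ((Z4_sym ^^ k) \<circ> \<phi>) = {}"
      using disj'[of j k] disj'[of k j] by (cases "j < k") auto
  next
    have n0: "(0, z0) \<notin> range \<phi>" "(0, z0) \<notin> range ((Z4_sym ^^ 2) \<circ> \<phi>)" using ne[of 0] ne[of 2] by fastforce+
    then show "unstable_manifold G W (0, z0) - {(0, z0)} = range \<phi> \<union> range ((Z4_sym ^^ 2) \<circ> \<phi>)" unfolding UM1 by blast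
    have "unstable_manifold G W (0, - z0) = Z4_sym ` ({(0, z0)} \<union> range \<phi> \<union> range ((Z4_sym ^^ 2) \<circ> \<phi>))"
      unfolding unstable_manifold_Z4[OF eqv W(2)] UM1 ..
    also have "\<dots> = {(0, - z0)} \<union> (Z4_sym ` range \<phi> \<union> Z4_sym ` range ((Z4_sym ^^ 2) \<circ> \<phi>))"
      by (simp add: image_Un Z4_sym_simps)
    finally have "unstable_manifold G W (0, - z0) - {(0, - z0)} = Z4_sym ` range \<phi> \<union> Z4_sym ` range ((Z4_sym ^^ 2) \<circ> \<phi>)"
      using n0 inj by (auto simp: Z4_sym_simps prod_eq_iff)
    moreover have "Z4_sym ` range \<phi> = range (Z4_sym \<circ> \<phi>)" "Z4_sym ` range ((Z4_sym ^^ 2) \<circ> \<phi>) = range ((Z4_sym ^^ 3) \<circ> \<phi>)"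
      by (simp_all add: image_image image_comp o_def eval_nat_numeral)
    ultimately show "unstable_manifold G W (0, - z0) - {(0, - z0)} = range (Z4_sym \<circ> \<phi>) \<union> range ((Z4_sym ^^ 3) \<circ> \<phi>)" by simp
  qed (use z0 saddle0 saddle1 saddle2 UM0 in auto)
qed

subsection \<open>The bifurcation function\<close>

lemma quadratic_remainder_derivative:
  fixes g :: "'a::real_normed_vector \<Rightarrow> 'b::real_normed_vector"
  assumes "r > 0" "\<And>w. w \<in> ball 0 r \<Longrightarrow> norm (g w) \<le> C * (norm w)\<^sup>2"
  shows "(g has_derivative (\<lambda>v. 0)) (at 0)"
  unfolding has_derivative_at_alt
proof (intro conjI allI impI)
  fix e :: real assume e: "e > 0"
  have g0: "g 0 = 0" using assms(2)[of 0] assms(1) by simp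
  define d where "d = min r (e / (\<bar>C\<bar> + 1))"
  have d: "d > 0" using assms(1) e by (auto simp: d_def intro!: divide_pos_pos)
  show "\<exists>d>0. \<forall>y. norm (y - 0) < d \<longrightarrow> norm (g y - g 0 - 0) \<le> e * norm (y - 0)"
  proof (intro exI conjI allI impI)
    fix y :: 'a assume y: "norm (y - 0) < d"
    have "norm y * (\<bar>C\<bar> + 1) \<le> e" using y by (simp add: d_def pos_less_divide_eq)
    have "norm (g y) \<le> C * (norm y)\<^sup>2" using assms(2)[of y] y by (simp add: d_def)
    also have "\<dots> \<le> (\<bar>C\<bar> + 1) * (norm y)\<^sup>2" by (intro mult_right_mono) auto
    also have "\<dots> = (norm y * (\<bar>C\<bar> + 1)) * norm y" by (simp add: power2_eq_square)
    also have "\<dots> \<le> e * norm y" using \<open>norm y * (\<bar>C\<bar> + 1) \<le> e\<close> by (intro mult_right_mono) auto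
    finally show "norm (g y - g 0 - 0) \<le> e * norm (y - 0)" by (simp add: g0)
  qed (rule d)
qed simp

context z4_family
begin

text \<open>For norm w < 1 the cubic terms and the remainder of order 4 are bounded by multiples of
  norm w ^ 2, just as the quadratic terms are, so the linear part of \<open>cubic\<close> is the
  derivative.\<close>

lemma derivative_at_0:
  assumes "r > 0" "r \<le> 1" "\<And>w. w \<in> ball 0 r \<Longrightarrow> norm (F (\<gamma>, \<beta>, \<mu>) w - cubic (\<gamma>, \<beta>, \<mu>) w) \<le> C * norm w ^ 4" "C > 0"
  shows "(F (\<gamma>, \<beta>, \<mu>) has_derivative (\<lambda>v. ((- of_real \<gamma> + \<i> * of_real \<beta>) * fst v, \<mu> * snd v))) (at 0)"
proof -
  let ?p = "(\<gamma>, \<beta>, \<mu>)" and ?L = "\<lambda>v::phase. ((- of_real \<gamma> + \<i> * of_real \<beta>) * fst v, \<mu> * snd v)"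
  define M where "M = norm (a0 ?p) + norm (a1 ?p) + norm (a2 ?p) + norm (a3 ?p) + 2 * norm (b0 ?p) + \<bar>b1 ?p\<bar> + \<bar>b2 ?p\<bar>"
  have cub: "norm (cubic ?p w - ?L w) \<le> M * (norm w)\<^sup>2" if w: "norm w < 1" for w
  proof -
    define u where "u = fst w"
    define z where "z = snd w"
    have ww: "w = (u, z)" by (simp add: u_def z_def)
    have u: "norm u \<le> norm w" and z: "\<bar>z\<bar> \<le> norm w" using norm_fst_le'[of w] norm_snd_le'[of w] by (auto simp: u_def z_def)
    let ?n = "(norm w)\<^sup>2"
    have n3: "norm w ^ 3 \<le> ?n" using w power_decreasing[of 2 3 "norm w"] by simp
    have b2': "x * y \<le> ?n" if "0 \<le> x" "x \<le> norm w" "0 \<le> y" "y \<le> norm w" for x y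
      using mult_mono[OF that(2,4) norm_ge_zero that(3)] by (simp add: power2_eq_square)
    have b3: "x * y * z \<le> ?n" if "0 \<le> x" "x \<le> norm w" "0 \<le> y" "y \<le> norm w" "0 \<le> z" "z \<le> norm w" for x y z
      using mult_mono[OF b2'[OF that(1-4)] that(6) zero_le_power2 that(5)] n3 by (simp add: power2_eq_square power3_eq_cube)
    have "cubic ?p w - ?L w = (a0 ?p * of_real z * cnj u + a1 ?p * u\<^sup>2 * cnj u + a2 ?p * (of_real z)\<^sup>2 * u + a3 ?p * cnj u ^ 3,
        Re (b0 ?p * u\<^sup>2 + cnj (b0 ?p) * (cnj u)\<^sup>2) + b1 ?p * z ^ 3 + b2 ?p * z * Re (u * cnj u))"
      by (simp add: cubic_part_def ww Let_def)
    also have "norm \<dots> \<le> norm (a0 ?p * of_real z * cnj u + a1 ?p * u\<^sup>2 * cnj u + a2 ?p * (of_real z)\<^sup>2 * u + a3 ?p * cnj u ^ 3)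
       + \<bar>Re (b0 ?p * u\<^sup>2 + cnj (b0 ?p) * (cnj u)\<^sup>2) + b1 ?p * z ^ 3 + b2 ?p * z * Re (u * cnj u)\<bar>"
      by (rule order_trans[OF norm_Pair_le]) simp
    also have "norm (a0 ?p * of_real z * cnj u + a1 ?p * u\<^sup>2 * cnj u + a2 ?p * (of_real z)\<^sup>2 * u + a3 ?p * cnj u ^ 3)
       \<le> norm (a0 ?p) * ?n + norm (a1 ?p) * ?n + norm (a2 ?p) * ?n + norm (a3 ?p) * ?n"
    proof (intro norm_triangle_mono)
      show "norm (a0 ?p * of_real z * cnj u) \<le> norm (a0 ?p) * ?n"
        using mult_left_mono[OF b2'[of "\<bar>z\<bar>" "norm u"], of "norm (a0 ?p)"] u z by (simp add: norm_mult mult.assoc)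
      show "norm (a1 ?p * u\<^sup>2 * cnj u) \<le> norm (a1 ?p) * ?n"
        using mult_left_mono[OF b3[of "norm u" "norm u" "norm u"], of "norm (a1 ?p)"]
            u by (simp add: norm_mult power2_eq_square mult.assoc)
      show "norm (a2 ?p * (of_real z)\<^sup>2 * u) \<le> norm (a2 ?p) * ?n"
        using mult_left_mono[OF b3[of "\<bar>z\<bar>" "\<bar>z\<bar>" "norm u"], of "norm (a2 ?p)"]
            u z by (simp add: norm_mult norm_power power2_eq_square mult.assoc)
      show "norm (a3 ?p * cnj u ^ 3) \<le> norm (a3 ?p) * ?n"
        using mult_left_mono[OF b3[of "norm u" "norm u" "norm u"], of "norm (a3 ?p)"]
            u by (simp add: norm_mult norm_power power3_eq_cube mult.assoc)
    qed
    also have "\<bar>Re (b0 ?p * u\<^sup>2 + cnj (b0 ?p) * (cnj u)\<^sup>2) + b1 ?p * z ^ 3 + b2 ?p * z * Re (u * cnj u)\<bar>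
       \<le> 2 * norm (b0 ?p) * ?n + \<bar>b1 ?p\<bar> * ?n + \<bar>b2 ?p\<bar> * ?n"
    proof (intro abs_triangle_ineq[THEN order_trans] add_mono)
      have "\<bar>Re (b0 ?p * u\<^sup>2 + cnj (b0 ?p) * (cnj u)\<^sup>2)\<bar> \<le> norm (b0 ?p * u\<^sup>2) + norm (cnj (b0 ?p) * (cnj u)\<^sup>2)"
        using abs_Re_le_cmod norm_triangle_ineq order_trans by blast
      also have "\<dots> = 2 * norm (b0 ?p) * (norm u * norm u)" by (simp add: norm_mult norm_power power2_eq_square)
      also have "\<dots> \<le> 2 * norm (b0 ?p) * ?n" using b2'[of "norm u" "norm u"] u by (intro mult_left_mono) auto
      finally show "\<bar>Re (b0 ?p * u\<^sup>2 + cnj (b0 ?p) * (cnj u)\<^sup>2)\<bar> \<le> 2 * norm (b0 ?p) * ?n" .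
      show "\<bar>b1 ?p * z ^ 3\<bar> \<le> \<bar>b1 ?p\<bar> * ?n"
        using mult_left_mono[OF b3[of "\<bar>z\<bar>" "\<bar>z\<bar>" "\<bar>z\<bar>"], of "\<bar>b1 ?p\<bar>"]
            z by (simp add: abs_mult power_abs power3_eq_cube mult.assoc)
      have "Re (u * cnj u) = norm u * norm u" by (simp add: complex_norm_square[symmetric] power2_eq_square flip: of_real_mult)
      then show "\<bar>b2 ?p * z * Re (u * cnj u)\<bar> \<le> \<bar>b2 ?p\<bar> * ?n"
        using mult_left_mono[OF b3[of "\<bar>z\<bar>" "norm u" "norm u"], of "\<bar>b2 ?p\<bar>"] z u by (simp add: abs_mult mult.assoc)
    qed
    finally show ?thesis by (simp add: M_def algebra_simps)
  qed
  have "((\<lambda>w. F ?p w - ?L w) has_derivative (\<lambda>v. 0)) (at 0)"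
  proof (rule quadratic_remainder_derivative[OF assms(1)])
    fix w :: phase assume w: "w \<in> ball 0 r"
    then have w1: "norm w < 1" using assms(2) by simp
    have "norm w ^ 4 \<le> norm w ^ 2" using w1 power_decreasing[of 2 4 "norm w"] by simp
    then have "C * norm w ^ 4 \<le> C * (norm w)\<^sup>2" using assms(4) by (intro mult_left_mono) auto
    then show "norm (F ?p w - ?L w) \<le> (C + M) * (norm w)\<^sup>2"
      using assms(3)[OF w] cub[OF w1] norm_triangle_ineq[of "F ?p w - cubic ?p w" "cubic ?p w - ?L w"]
      by (simp add: algebra_simps)
  qed
  moreover have "bounded_linear ?L"
    by (intro bounded_linear_Pair bounded_linear_compose[OF bounded_linear_mult_right] bounded_linear_fst bounded_linear_snd)
  then have "(?L has_derivative ?L) (at 0)" by (rule bounded_linear_imp_has_derivative)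
  ultimately have "((\<lambda>w. (F ?p w - ?L w) + ?L w) has_derivative (\<lambda>v. 0 + ?L v)) (at 0)" by (rule has_derivative_add)
  then show ?thesis by simp
qed

lemma F_even: "F p (- u, z) = (- fst (F p (u, z)), snd (F p (u, z)))" if "p \<in> P" "(u, z) \<in> W"
proof -
  have "Z4_sym (u, z) \<in> W" using that(2) W by blast
  then have "F p (Z4_sym (Z4_sym (u, z))) = Z4_sym (Z4_sym (F p (u, z)))" using equivariant that by metis
  then show ?thesis by (simp add: Z4_sym_simps mult.assoc[symmetric])
qed

theorem heteroclinic_connection:
  "\<exists>\<kappa>>0. \<exists>\<mu>0>0. \<exists>h :: real \<Rightarrow> real \<Rightarrow> real. \<exists>K :: real.
     h 0 0 = 0 \<and> smooth_bifurcation_function \<kappa> \<mu>0 h \<and>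
     (\<forall>(\<beta>, \<mu>) \<in> small_region \<kappa> \<mu>0. \<mu> > 0 \<longrightarrow>
        (let p = (h \<beta> \<mu>, \<beta>, \<mu>) in
         p \<in> P \<and>
         (\<exists>z0. \<bar>z0 - sqrt (\<mu> / \<bar>b1 p\<bar>)\<bar> \<le> K * \<mu> \<and>
               four_winged_connection (F p) W z0)))"
proof -
  obtain r \<nu> A Z0 c f m K where r: "r > 0" and \<nu>: "\<nu> > 0" and A: "A \<noteq> 0" and c: "Re c = - 1 / 2" and
    Z0: "\<And>q. q \<in> ball 0 r \<Longrightarrow> Z0 q > 0" and
    f: "smooth_on (ball 0 r \<times> ball 0 10) f" and m: "smooth_on (ball 0 r \<times> ball 0 2) m" and
    f0: "\<And>d b V Z. norm (d, b, 0::real) < r \<Longrightarrow> norm (V, Z) < 10 \<Longrightarrow>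
        f ((d, b, 0), (V, Z)) = ((- of_real (1 + d) + \<i> * of_real b) * V + 2 * of_real Z * cnj V, Re (c * V\<^sup>2))" and
    fax: "\<And>q Z. norm q < r \<Longrightarrow> \<bar>Z\<bar> < 2 \<Longrightarrow> f (q, (0, Z)) = (0, snd (snd q) * (Z * (1 - Z)) * m (q, Z))" and
    m_pos: "\<And>q Z. norm q < r \<Longrightarrow> 0 \<le> Z \<Longrightarrow> Z \<le> 1 \<Longrightarrow> m (q, Z) > 0" and
    F_f: "\<And>d b e V Z. norm (d, b, e) < r \<Longrightarrow> norm (V, Z) < 10 \<Longrightarrow>
        rescaled_params \<nu> e (d, b) \<in> P \<and> (e *\<^sub>R (A * V), e * (Z0 (d, b, e) * Z)) \<in> W \<and>
        F (rescaled_params \<nu> e (d, b)) (e *\<^sub>R (A * V), e * (Z0 (d, b, e) * Z))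
          = (e\<^sup>2 * \<nu>) *\<^sub>R (A * fst (f ((d, b, e), (V, Z))), Z0 (d, b, e) * snd (f ((d, b, e), (V, Z))))" and
    K: "\<And>d b e. norm (d, b, e) < r \<Longrightarrow> e \<noteq> 0 \<Longrightarrow> \<bar>Z0 (d, b, e) - 1 / sqrt \<bar>b1 (rescaled_params \<nu> e (d, b))\<bar>\<bar> \<le> K * \<bar>e\<bar>"
    by (rule normal_form) blast
  obtain C rj where C: "C > 0" and rj: "rj > 0"
    and jet_rj: "\<And>p w. p \<in> ball 0 rj \<Longrightarrow> w \<in> ball 0 rj \<Longrightarrow> norm (F p w - cubic p w) \<le> C * norm w ^ 4"
    by (rule jet_bound) blast

  \<comment> \<open>Linearization of the normal form at O+\<close>
  define Df where "Df q v = frechet_derivative f (at (q, (0, 1))) (0, v)" for q and v :: phase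
  have w1: "(0, 1) \<in> ball (0::phase) 10" by (simp add: zero_prod_def dist_Pair_Pair)
  have f_at: "(f has_derivative frechet_derivative f (at (q, (0, 1)))) (at (q, (0, 1)))" if "norm q < r" for q
    using smooth_on_has_derivative[OF f, of "(q, (0, 1))"] that w1 by simp
  have Df: "((\<lambda>w. f (q, w)) has_derivative Df q) (at (0, 1))" if "norm q < r" for q
  proof -
    have "((\<lambda>w::phase. (q, w)) has_derivative (\<lambda>v. (0, v))) (at (0, 1))" by (auto intro!: derivative_eq_intros)
    from diff_chain_at[OF this f_at[OF that]] show ?thesis by (simp add: o_def Df_def[abs_def])
  qed
  \<comment> \<open>The values at 1 and \<i> determine the real-linear map on V, which is then
    written as al V + be cnj V. In the limit it is - V + 2 cnj V, so al = - 1 and be = 2; the strict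
    inequalities of \<open>real_saddle_matrix\<close> hold there and hence nearby.\<close>
  define N1 where "N1 q = fst (Df q (1, 0))" for q
  define Ni where "Ni q = fst (Df q (\<i>, 0))" for q
  define al where "al q = (N1 q - \<i> * Ni q) / 2" for q
  define be where "be q = (N1 q + \<i> * Ni q) / 2" for q
  have N_cont: "continuous_on (ball 0 r) N1" "continuous_on (ball 0 r) Ni"
  proof -
    have "continuous_on (ball 0 r) (\<lambda>q. Df q v)" for v unfolding Df_def
      by (rule continuous_on_compose2[OF smooth_on_continuous[OF smooth_on_derivative[OF f, of "(0, v)"]]])
        (use w1 in \<open>auto intro!: continuous_intros\<close>)
    then show "continuous_on (ball 0 r) N1" "continuous_on (ball 0 r) Ni"
      unfolding N1_def Ni_def by (auto intro: continuous_on_fst)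
  qed
  have N0: "N1 0 = 1" "Ni 0 = - 3 * \<i>"
  proof -
    have dir: "fst (Df 0 (V, 0)) = - V + 2 * cnj V" if V: "norm V = 1" for V
    proof -
      have "((\<lambda>t::real. (t *\<^sub>R V, 1::real)) has_derivative (\<lambda>t. (t *\<^sub>R V, 0))) (at 0)" by (auto intro!: derivative_eq_intros)
      moreover have "((\<lambda>w. f (0, w)) has_derivative Df 0) (at (0 *\<^sub>R V, 1))" using Df[of 0] r by simp
      ultimately have "((\<lambda>t. f (0, (t *\<^sub>R V, 1))) has_derivative (\<lambda>t. Df 0 (t *\<^sub>R V, 0))) (at 0)"
        using diff_chain_at[of "\<lambda>t::real. (t *\<^sub>R V, 1::real)"] by (fastforce simp: o_def)
      then have 1: "((\<lambda>t. fst (f (0, (t *\<^sub>R V, 1)))) has_derivative (\<lambda>t. fst (Df 0 (t *\<^sub>R V, 0)))) (at 0)"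
        by (rule has_derivative_fst)
      have 2: "((\<lambda>t::real. t *\<^sub>R (- V + 2 * cnj V)) has_derivative (\<lambda>t. t *\<^sub>R (- V + 2 * cnj V))) (at 0)"
        by (auto intro!: derivative_eq_intros)
      have "t *\<^sub>R (- V + 2 * cnj V) = fst (f (0, (t *\<^sub>R V, 1)))" if "t \<in> ball 0 1" for t
      proof -
        have "norm (t *\<^sub>R V, 1::real) < 10" using norm_Pair_le[of "t *\<^sub>R V" "1::real"] that V by simp
        then show ?thesis using f0[of 0 0 "t *\<^sub>R V" 1] r by (simp add: zero_prod_def scaleR_conv_of_real algebra_simps)
      qed
      then have "((\<lambda>t. fst (f (0, (t *\<^sub>R V, 1)))) has_derivative (\<lambda>t. t *\<^sub>R (- V + 2 * cnj V))) (at 0)"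
        using has_derivative_transform_within_open[OF 2, of "ball 0 1"] by simp
      from has_derivative_unique[OF 1 this] have "fst (Df 0 (1 *\<^sub>R V, 0)) = 1 *\<^sub>R (- V + 2 * cnj V)" by (rule fun_cong)
      then show ?thesis by simp
    qed
    show "N1 0 = 1" "Ni 0 = - 3 * \<i>" using dir[of 1] dir[of \<i>] by (simp_all add: N1_def Ni_def)
  qed
  have albe_cont: "continuous_on (ball 0 r) al" "continuous_on (ball 0 r) be"
    unfolding al_def be_def by (intro continuous_intros N_cont; simp)+
  have albe0: "al 0 = - 1" "be 0 = 2" by (simp_all add: al_def be_def N0 complex_eq_iff)
  obtain r5 where r5: "r5 > 0" "\<And>q. norm q < r5 \<Longrightarrow> Re (al q + be q) > 0 \<and> Re (al q - be q) < 0 \<and> (Im (al q))\<^sup>2 < -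
      (Re (al q + be q) * Re (al q - be q))"
  proof -
    have o: "open (ball 0 r \<inter> (\<lambda>q. (Re (al q + be q), Re (al q - be q), - (Re (al q + be q) * Re (al q - be q))
        - (Im (al q))\<^sup>2)) -` ({0<..} \<times> {..<0} \<times> {0<..}))"
      by (intro continuous_open_preimage continuous_intros albe_cont open_Times) auto
    moreover have "0 \<in> ball 0 r \<inter> (\<lambda>q. (Re (al q + be q), Re (al q - be q), - (Re (al q + be q) * Re (al q - be q))
        - (Im (al q))\<^sup>2)) -` ({0<..} \<times> {..<0} \<times> {0<..})"
      using r by (simp add: albe0)
    ultimately obtain s where "s > 0" "ball 0 s \<subseteq> ball 0 r \<inter> (\<lambda>q. (Re (al q + be q), Re (al q - be q), - (Re (al q +
        be q) * Re (al q - be q)) - (Im (al q))\<^sup>2)) -` ({0<..} \<times> {..<0} \<times> {0<..})"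
      using openE by blast
    then show ?thesis by (intro that[of s]) (auto simp: subset_iff)
  qed
  obtain r6 where r6: "r6 > 0" "\<And>d b e. norm (d, b, e) < r6 \<Longrightarrow> norm (rescaled_params \<nu> e (d, b)) < rj"
  proof -
    have "continuous_on UNIV (\<lambda>q. rescaled_params \<nu> (snd (snd q)) (fst q, fst (snd q)))"
      unfolding rescaled_params_def by (intro continuous_intros)
    then have "isCont (\<lambda>q. rescaled_params \<nu> (snd (snd q)) (fst q, fst (snd q))) 0"
      using continuous_on_eq_continuous_at[OF open_UNIV] by blast
    then obtain d where "d > 0" "\<And>q. dist q 0 < d \<Longrightarrow> dist (rescaled_params \<nu> (snd (snd q)) (fst q, fst (snd q)))
        (rescaled_params \<nu> (snd (snd (0::param))) (fst (0::param), fst (snd (0::param)))) < rj"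
      unfolding continuous_at_eps_delta using rj by metis
    moreover have "rescaled_params \<nu> (snd (snd (0::param))) (fst (0::param), fst (snd (0::param))) = 0"
        by (simp add: rescaled_params_def zero_prod_def)
    ultimately show ?thesis using that[of d] by fastforce
  qed
  define R where "R = min (min r r5) (min r6 1)"
  have R: "R > 0" "R \<le> r" "R \<le> r5" "R \<le> r6" "R \<le> 1" using r r5 r6 by (auto simp: R_def)

  \<comment> \<open>From an orbit of the normal form to the four wings\<close>
  have connection: "four_winged_connection (F (rescaled_params \<nu> e (d, b))) W (e * Z0 (d, b, e))"
    if q: "norm (d, b, e) < R" and e: "e > 0"
      and w: "\<And>t. (w has_vector_derivative f ((d, b, e), w t)) (at t)" "\<And>t. norm (w t) < 4"
        "(w \<longlongrightarrow> (0, 1)) at_bot" "(w \<longlongrightarrow> (0, 0)) at_top" "fst (w 0) \<noteq> 0"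
    for d b e w
  proof -
    let ?q = "(d, b, e)" and ?p = "rescaled_params \<nu> e (d, b)"
    have qr: "norm ?q < r" using q R by simp
    define Z where "Z = Z0 ?q"
    have Z: "Z > 0" using Z0[of ?q] qr by (simp add: Z_def)
    define z0 where "z0 = e * Z"
    have z0: "z0 > 0" using e Z by (simp add: z0_def)
    have pP: "?p \<in> P" using F_f[OF qr, of 0 0] by simp
    define G where "G = F ?p"
    have G_f: "(e *\<^sub>R (A * V), e * (Z * s)) \<in> W" "G (e *\<^sub>R (A * V), e * (Z * s)) = (e\<^sup>2 * \<nu>) *\<^sub>R (A * fst (f (?q, (V,
        s))), Z * snd (f (?q, (V, s))))"
      if "norm (V, s) < 10" for V s using F_f[OF qr that] by (simp_all add: Z_def G_def)
    have G: "smooth_on W G"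
    proof -
      have "smooth_on W (\<lambda>w. (\<lambda>(p, w). F p w) (?p, w))"
        by (rule smooth_on_compose[OF F]) (use P W pP in \<open>auto intro!: smooth_intros open_Times\<close>)
      then show ?thesis by (simp add: G_def)
    qed
    have axis: "G (0, e * (Z * s)) = (0, (e\<^sup>2 * \<nu>) * (Z * (e * (s * (1 - s)) * m (?q, s))))" "(0, e * (Z * s)) \<in> W"
        if "\<bar>s\<bar> < 2" for s
    proof -
      have "norm (0::complex, s) < 10" using that by (simp add: norm_Pair)
      from G_f[OF this] fax[OF qr that] show "G (0, e * (Z * s)) = (0, (e\<^sup>2 * \<nu>) * (Z * (e * (s * (1 - s)) * m (?q,
          s))))" "(0, e * (Z * s)) \<in> W"
        by simp_all
    qed
    have sc: "z = e * (Z * (z / z0))" "0 \<le> z / z0" "z / z0 \<le> 1" if "0 \<le> z" "z \<le> z0" for z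
      using that z0 e Z by (auto simp: z0_def)
    have par: "?p = (e * (\<nu> * (1 + d)), e * (\<nu> * b), e\<^sup>2)" by (simp add: rescaled_params_def)
    have d1: "\<bar>d\<bar> < 1" using norm_fst_le'[of ?q] q R by simp
    let ?E = "\<lambda>v::phase. (e *\<^sub>R (A * fst v), e * (Z * snd v))"
    have El: "bounded_linear ?E"
      by (intro bounded_linear_Pair bounded_linear_compose[OF bounded_linear_scaleR_right]
          bounded_linear_compose[OF bounded_linear_mult_right] bounded_linear_fst bounded_linear_snd)
    let ?I = "\<lambda>v::phase. ((1 / e) *\<^sub>R (fst v / A), snd v / z0)"
    have Il: "bounded_linear ?I" unfolding divide_inverse
      by (intro bounded_linear_Pair bounded_linear_compose[OF bounded_linear_scaleR_right]
          bounded_linear_compose[OF bounded_linear_mult_left] bounded_linear_fst bounded_linear_snd)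
    have EI: "?E (?I v) = v" for v using e A Z by (simp add: z0_def prod_eq_iff)
    have even: "snd (f (?q, (- V, s))) = snd (f (?q, (V, s)))" if "norm (V, s) < 10" for V s
    proof -
      have n: "norm (- V, s) < 10" using that by (simp add: norm_Pair)
      have "G (- (e *\<^sub>R (A * V)), e * (Z * s)) = (- fst (G (e *\<^sub>R (A * V), e * (Z * s))), snd (G (e *\<^sub>R (A * V), e * (Z * s))))"
        unfolding G_def by (rule F_even[OF pP G_f(1)[OF that]])
      then show ?thesis using G_f(2)[OF that] G_f(2)[OF n] e \<nu> Z by simp
    qed
    \<comment> \<open>The z component of the field is even in V, so its derivative in V vanishes on
      the axis; together with the invariance of the axis this makes the linearization block
      diagonal.\<close>
    have DV: "snd (Df ?q (V, 0)) = 0" for V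
    proof -
      interpret D: bounded_linear "Df ?q" using Df[OF qr] by (rule has_derivative_bounded_linear)
      have "((\<lambda>t::real. (t *\<^sub>R V, 1::real)) has_derivative (\<lambda>t. (t *\<^sub>R V, 0))) (at 0)" by (auto intro!: derivative_eq_intros)
      moreover have "((\<lambda>w. f (?q, w)) has_derivative Df ?q) (at (0 *\<^sub>R V, 1))" using Df[OF qr] by simp
      ultimately have "((\<lambda>t. f (?q, (t *\<^sub>R V, 1))) has_derivative (\<lambda>t. Df ?q (t *\<^sub>R V, 0))) (at 0)"
        using diff_chain_at[of "\<lambda>t::real. (t *\<^sub>R V, 1::real)"] by (fastforce simp: o_def)
      then have 1: "((\<lambda>t. snd (f (?q, (t *\<^sub>R V, 1)))) has_derivative (\<lambda>t. snd (Df ?q (t *\<^sub>R V, 0)))) (at 0)"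
        by (rule has_derivative_snd)
      have "((\<lambda>t::real. - t) has_derivative (\<lambda>t. - t)) (at 0)" by (auto intro!: derivative_eq_intros)
      moreover have "((\<lambda>t. snd (f (?q, (t *\<^sub>R V, 1)))) has_derivative (\<lambda>t. snd (Df ?q (t *\<^sub>R V, 0)))) (at (- 0))" using 1 by simp
      ultimately have 2: "((\<lambda>t. snd (f (?q, ((- t) *\<^sub>R V, 1)))) has_derivative (\<lambda>t. snd (Df ?q ((- t) *\<^sub>R V, 0)))) (at 0)"
        using diff_chain_at[of "\<lambda>t::real. - t"] by (fastforce simp: o_def)
      define s where "s = 1 / (1 + norm V)"
      have s: "s > 0" by (auto simp: s_def intro!: divide_pos_pos add_pos_nonneg)
      have ev: "snd (f (?q, ((- t) *\<^sub>R V, 1))) = snd (f (?q, (t *\<^sub>R V, 1)))" if "t \<in> ball 0 s" for t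
      proof -
        have "\<bar>t\<bar> * (1 + norm V) < 1" using that by (simp add: s_def pos_less_divide_eq add_pos_nonneg)
        then have "norm (t *\<^sub>R V) < 1" using abs_ge_zero[of t] unfolding norm_scaleR distrib_left by linarith
        then have "norm (t *\<^sub>R V, 1::real) < 10" using norm_Pair_le[of "t *\<^sub>R V" "1::real"] by simp
        from even[OF this] show ?thesis by simp
      qed
      have "((\<lambda>t. snd (f (?q, (t *\<^sub>R V, 1)))) has_derivative (\<lambda>t. snd (Df ?q ((- t) *\<^sub>R V, 0)))) (at 0)"
        using has_derivative_transform_within_open[OF 2, of "ball 0 s"] s ev by simp
      from has_derivative_unique[OF 1 this] have "snd (Df ?q (1 *\<^sub>R V, 0)) = snd (Df ?q ((- 1) *\<^sub>R V, 0))" by (rule fun_cong)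
      moreover have "Df ?q ((- 1) *\<^sub>R V, 0) = - Df ?q (V, 0)" using D.scaleR[of "- 1" "(V, 0)"] by simp
      ultimately show ?thesis by simp
    qed
    \<comment> \<open>At Z = 1 only the factor 1 - Z of the axis field contributes to the
      derivative.\<close>
    have DZ: "Df ?q (0, s) = (0, - (e * m (?q, 1)) * s)" for s
    proof -
      interpret D: bounded_linear "Df ?q" using Df[OF qr] by (rule has_derivative_bounded_linear)
      have "((\<lambda>t::real. (0::complex, t)) has_derivative (\<lambda>t. (0, t))) (at 1)" by (auto intro!: derivative_eq_intros)
      from diff_chain_at[OF this Df[OF qr]] have 1: "((\<lambda>t. f (?q, (0, t))) has_derivative (\<lambda>t. Df ?q (0, t))) (at 1)"
          by (simp add: o_def)
      have "smooth_on (ball 0 2) (\<lambda>t. m (?q, t))"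
        by (rule smooth_on_compose[OF m]) (use qr in \<open>auto intro!: smooth_intros open_Times\<close>)
      from smooth_on_has_derivative[OF this, of 1] obtain m' where "((\<lambda>t. m (?q, t)) has_derivative m') (at 1)" by auto
      then have 2: "((\<lambda>t. (0::complex, e * (t * (1 - t)) * m (?q, t))) has_derivative (\<lambda>t. (0, - (e * m (?q, 1)) * t))) (at 1)"
        by (auto intro!: derivative_eq_intros simp: fun_eq_iff algebra_simps)
      have "(0, e * (t * (1 - t)) * m (?q, t)) = f (?q, (0, t))" if "t \<in> ball 0 2" for t
        using fax[OF qr, of t] that by simp
      then have "((\<lambda>t. f (?q, (0, t))) has_derivative (\<lambda>t. (0, - (e * m (?q, 1)) * t))) (at 1)"
        by (rule has_derivative_transform_within_open[OF 2 open_ball[of 0 2], rotated]) simp_all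
      from has_derivative_unique[OF 1 this] show ?thesis by (rule fun_cong)
    qed
    have DN: "Df ?q v = (al ?q * fst v + be ?q * cnj (fst v), - (e * m (?q, 1)) * snd v)" for v
    proof -
      interpret D: bounded_linear "Df ?q" using Df[OF qr] by (rule has_derivative_bounded_linear)
      let ?V = "fst v"
      have "v = Re ?V *\<^sub>R (1, 0) + Im ?V *\<^sub>R (\<i>, 0) + (0, snd v)" by (simp add: prod_eq_iff complex_eq_iff)
      then have "Df ?q v = Re ?V *\<^sub>R Df ?q (1, 0) + Im ?V *\<^sub>R Df ?q (\<i>, 0) + Df ?q (0, snd v)"
        by (metis D.add D.scaleR)
      moreover have "Df ?q (1, 0) = (N1 ?q, 0)" "Df ?q (\<i>, 0) = (Ni ?q, 0)" using DV by (simp_all add: N1_def Ni_def prod_eq_iff)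
      moreover have "of_real (Re ?V) * N1 ?q + of_real (Im ?V) * Ni ?q = al ?q * ?V + be ?q * cnj ?V"
        by (simp add: al_def be_def complex_eq_iff field_simps)
      ultimately show ?thesis by (simp add: DZ scaleR_conv_of_real)
    qed
    have G_der: "(G has_derivative (\<lambda>v. (of_real (e * \<nu>) * al ?q * fst v + of_real (e * \<nu>) * be ?q * (A / cnj A)
        * cnj (fst v), - (e\<^sup>2 * \<nu> * m (?q, 1)) * snd v))) (at (0, z0))"
    proof -
      define H where "H v = (e\<^sup>2 * \<nu>) *\<^sub>R (A * fst v, Z * snd v)" for v :: phase
      have H: "bounded_linear H" unfolding H_def
        by (intro bounded_linear_compose[OF bounded_linear_scaleR_right]
            bounded_linear_Pair bounded_linear_compose[OF bounded_linear_mult_right] bounded_linear_fst bounded_linear_snd)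
      have I1: "?I (0, z0) = (0, 1)" using z0 by simp
      have "((\<lambda>w. f (?q, w)) has_derivative Df ?q) (at (?I (0, z0)))" unfolding I1 by (rule Df[OF qr])
      from bounded_linear.has_derivative[OF H diff_chain_at[OF bounded_linear_imp_has_derivative[OF Il] this]]
      have 1: "((\<lambda>v. H (f (?q, ?I v))) has_derivative (\<lambda>v. H (Df ?q (?I v)))) (at (0, z0))" by (simp add: o_def)
      have "open (?I -` ball 0 10)"
        by (rule open_vimage[OF open_ball]) (rule linear_continuous_on[OF Il])
      moreover have "(0, z0) \<in> ?I -` ball 0 10" using I1 w1 by simp
      moreover have "H (f (?q, ?I v)) = G v" if "v \<in> ?I -` ball 0 10" for v
      proof -
        have "norm (?I v) < 10" using that by simp
        from G_f(2)[OF this] have "G (?E (?I v)) = H (f (?q, ?I v))" by (simp add: H_def)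
        then show ?thesis unfolding EI by simp
      qed
      ultimately have "(G has_derivative (\<lambda>v. H (Df ?q (?I v)))) (at (0, z0))"
        using has_derivative_transform_within_open[OF 1, of "?I -` ball 0 10" G] by blast
      moreover have "H (Df ?q (?I v)) = (of_real (e * \<nu>) * al ?q * fst v + of_real (e * \<nu>) * be ?q * (A / cnj A)
          * cnj (fst v), - (e\<^sup>2 * \<nu> * m (?q, 1)) * snd v)" for v
      proof -
        have "(e\<^sup>2 * \<nu>) *\<^sub>R (A * (al ?q * ((1 / e) *\<^sub>R (fst v / A)) + be ?q * cnj ((1 / e) *\<^sub>R (fst v / A))))
            = of_real (e * \<nu>) * al ?q * fst v + of_real (e * \<nu>) * be ?q * (A / cnj A) * cnj (fst v)"
          using e A by (simp add: scaleR_conv_of_real field_simps power2_eq_square)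
        moreover have "(e\<^sup>2 * \<nu>) * (Z * (- (e * m (?q, 1)) * (snd v / z0))) = - (e\<^sup>2 * \<nu> * m (?q, 1)) * snd v"
          using e Z by (simp add: z0_def field_simps)
        ultimately show ?thesis unfolding DN H_def by simp
      qed
      ultimately show ?thesis by simp
    qed
    have alq: "Re (al ?q + be ?q) > 0" "Re (al ?q - be ?q) < 0" "(Im (al ?q))\<^sup>2 < - (Re (al ?q + be ?q) * Re (al ?q - be ?q))"
      using r5(2)[of ?q] q R by auto
    \<comment> \<open>The positive factor of the axis field in the original coordinate: e^3 \<nu> Z
      comes from the rescaling, and 1 / z0^2 from rewriting Z (1 - Z) as z (z0 - z) / z0^2.\<close>
    define M where "M z = e ^ 3 * \<nu> * Z / z0\<^sup>2 * m (?q, z / z0)" for z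
    define \<phi> where "\<phi> t = ?E (w (e * \<nu> * t))" for t
    have en: "e * \<nu> > 0" using e \<nu> by simp
    have "four_winged_connection G W z0"
    proof (rule four_winged_connectionI[OF W(1,3) G _ z0, where ?c0.0="- of_real (e * (\<nu> * (1 + d)))
        + \<i> * of_real (e * (\<nu> * b))" and \<mu>="e\<^sup>2"
          and m=M and \<alpha>="of_real (e * \<nu>) * al ?q" and \<beta>="of_real (e * \<nu>) * be ?q" and A=A and l="e\<^sup>2 * \<nu> * m (?q, 1)" and \<phi>=\<phi>])
      show "\<forall>w\<in>W. G (Z4_sym w) = Z4_sym (G w)" using equivariant pP by (simp add: G_def)
      show "(0, z) \<in> W" if "0 \<le> z" "z \<le> z0" for z
        using axis(2)[of "z / z0"] sc[OF that] by auto
      show "(G has_derivative (\<lambda>v. ((- of_real (e * (\<nu> * (1 + d))) + \<i> * of_real (e * (\<nu> * b))) * fst v, e\<^sup>2 * snd v))) (at 0)"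
        unfolding G_def par
      proof (rule derivative_at_0[of "min rj 1" _ _ _ C])
        fix w :: phase assume "w \<in> ball 0 (min rj 1)"
        then show "norm (F (e * (\<nu> * (1 + d)), e * (\<nu> * b), e\<^sup>2) w - cubic (e * (\<nu> * (1 + d)), e * (\<nu> * b), e\<^sup>2) w) \<le>
            C * norm w ^ 4"
          using jet_rj[of ?p w] r6(2)[of d b e] q R by (simp add: par)
      qed (use rj C in auto)
      show "Re (- of_real (e * (\<nu> * (1 + d))) + \<i> * of_real (e * (\<nu> * b))) < 0" using e \<nu> d1 by simp
      show "G (0, z) = (0, z * (z0 - z) * M z)" if z: "0 \<le> z" "z \<le> z0" for z
      proof -
        have "G (0, z) = (0, (e\<^sup>2 * \<nu>) * (Z * (e * (z / z0 * (1 - z / z0)) * m (?q, z / z0))))"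
          using axis(1)[of "z / z0"] sc[OF z] by auto
        also have "(e\<^sup>2 * \<nu>) * (Z * (e * (z / z0 * (1 - z / z0)) * m (?q, z / z0))) = z * (z0 - z) * M z"
          using z0 by (simp add: M_def field_simps power2_eq_square power3_eq_cube)
        finally show ?thesis .
      qed
      show "continuous_on {0..z0} M" unfolding M_def
        by (intro continuous_intros continuous_on_compose2[OF smooth_on_continuous[OF m]])
          (use z0 qr sc in \<open>auto simp: less_imp_le pos_divide_less_eq\<close>)
      show "M z > 0" if "z \<in> {0..z0}" for z
        using m_pos[OF qr, of "z / z0"] sc[of z] that e \<nu> Z z0 by (simp add: M_def)
      show "e\<^sup>2 * \<nu> * m (?q, 1) > 0" using m_pos[OF qr, of 1] e \<nu> by simp
      show "Re (of_real (e * \<nu>) * al ?q + of_real (e * \<nu>) * be ?q) > 0" using alq(1) en by (simp add: distrib_left[symmetric])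
      show "Re (of_real (e * \<nu>) * al ?q - of_real (e * \<nu>) * be ?q) < 0" using alq(2)
          en by (simp add: right_diff_distrib[symmetric] mult_pos_neg)
      show "(Im (of_real (e * \<nu>) * al ?q))\<^sup>2 < - (Re (of_real (e * \<nu>) * al ?q + of_real (e * \<nu>) * be ?q)
          * Re (of_real (e * \<nu>) * al ?q - of_real (e * \<nu>) * be ?q))"
      proof -
        have "(e * \<nu>)\<^sup>2 * (Im (al ?q))\<^sup>2 < (e * \<nu>)\<^sup>2 * - (Re (al ?q + be ?q) * Re (al ?q - be ?q))"
          using alq(3) en by (intro mult_strict_left_mono) auto
        then show ?thesis by (simp add: power2_eq_square algebra_simps)
      qed
      show "trajectory G W UNIV \<phi>" unfolding trajectory_UNIV
      proof
        fix t
        have "((\<lambda>t. e * \<nu> * t) has_vector_derivative e * \<nu>) (at t)" by (auto intro!: derivative_eq_intros)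
        from vector_diff_chain_at[OF this w(1)]
        have "((\<lambda>t. w (e * \<nu> * t)) has_vector_derivative (e * \<nu>) *\<^sub>R f (?q, w (e * \<nu> * t))) (at t)" by (simp add: o_def)
        from bounded_linear.has_vector_derivative[OF El this]
        have 1: "(\<phi> has_vector_derivative ?E ((e * \<nu>) *\<^sub>R f (?q, w (e * \<nu> * t)))) (at t)" by (simp add: \<phi>_def[abs_def])
        have n: "norm (fst (w (e * \<nu> * t)), snd (w (e * \<nu> * t))) < 10" using w(2)[of "e * \<nu> * t"] by simp
        have "G (\<phi> t) = ?E ((e * \<nu>) *\<^sub>R f (?q, w (e * \<nu> * t)))" using G_f(2)[OF n]
          by (simp add: \<phi>_def scaleR_conv_of_real power2_eq_square)
        then show "\<phi> t \<in> W \<and> (\<phi> has_vector_derivative G (\<phi> t)) (at t)" using 1 G_f(1)[OF n] by (simp add: \<phi>_def)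
      qed
      have "filterlim (\<lambda>t. e * \<nu> * t) at_bot at_bot"
        by (rule filterlim_tendsto_pos_mult_at_bot[OF tendsto_const en filterlim_ident])
      from bounded_linear.tendsto[OF El filterlim_compose[OF w(3) this]]
      show "(\<phi> \<longlongrightarrow> (0, z0)) at_bot" by (simp add: \<phi>_def[abs_def] z0_def)
      have "filterlim (\<lambda>t. e * \<nu> * t) at_top at_top"
        by (rule filterlim_tendsto_pos_mult_at_top[OF tendsto_const en filterlim_ident])
      from bounded_linear.tendsto[OF El filterlim_compose[OF w(4) this]]
      show "(\<phi> \<longlongrightarrow> 0) at_top" by (simp add: \<phi>_def[abs_def] zero_prod_def)
      show "fst (\<phi> 0) \<noteq> 0" using w(5) e A by (simp add: \<phi>_def)
    qed (use G_der e A in auto)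
    then show ?thesis by (simp add: G_def z0_def Z_def)
  qed

  \<comment> \<open>The bifurcation function and its domain\<close>
  obtain r' D where D: "r' > 0" "smooth_on (ball 0 r') D" "D 0 = 0"
    "\<And>p. p \<in> ball 0 r' \<Longrightarrow> \<bar>D p\<bar> \<le> R / 4" "\<And>p. p \<in> ball 0 r' \<Longrightarrow> (D p, p) \<in> ball 0 r"
    "\<And>p. p \<in> ball 0 r' \<Longrightarrow> \<exists>w. (\<forall>t. (w has_vector_derivative f ((D p, p), w t)) (at t)) \<and> (\<forall>t. norm (w t) < 4) \<and>
        (w \<longlongrightarrow> (0, 1)) at_bot \<and> (w \<longlongrightarrow> (0, 0)) at_top \<and> fst (w 0) \<noteq> 0"
    using connecting_orbit[OF r f m f0 fax c, of "R / 4"] R(1) by auto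
  \<comment> \<open>For |b|, |e| < d0 the pair (b, e) has norm below 2 d0 \<le> r', and with |D|
    \<le> R / 4 the full parameter stays below R / 4 + 2 d0 \<le> R / 2.\<close>
  define d0 where "d0 = min r' (R / 4) / 2"
  have d0: "d0 > 0" "2 * d0 \<le> r'" "8 * d0 \<le> R" using D(1) R(1) by (auto simp: d0_def)
  have inr': "(b, e) \<in> ball 0 r'" if "\<bar>b\<bar> < d0" "\<bar>e\<bar> < d0" for b e
    using norm_Pair_le[of b e] that d0(2) by simp
  have qR: "norm (D (b, e), b, e) < R" if "\<bar>b\<bar> < d0" "\<bar>e\<bar> < d0" for b e
    using norm_Pair_le[of "D (b, e)" "(b, e)"] norm_Pair_le[of b e] D(4)[OF inr'[OF that]] that d0 by simp
  \<comment> \<open>This is \<gamma> in the variables (B, \<epsilon>); since \<beta> = \<epsilon>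
    \<nu> b, the argument b of \<open>D\<close> is B / \<nu>.\<close>
  define H where "H x = snd x * (\<nu> * (1 + D (fst x / \<nu>, snd x)))" for x
  define U where "U = {- (\<nu> * d0)<..<\<nu> * d0} \<times> {- d0<..<d0}"
  have oU: "open U" by (auto simp: U_def intro!: open_Times)
  have U: "\<bar>fst x / \<nu>\<bar> < d0" "\<bar>snd x\<bar> < d0" if "x \<in> U" for x
    using that \<nu> by (auto simp: U_def abs_less_iff pos_divide_less_eq mult.commute minus_less_iff)
  have H_smooth: "smooth_on U H"
  proof -
    have "smooth_on U (\<lambda>x. D (fst x / \<nu>, snd x))"
      by (rule smooth_on_compose[OF D(2) _ oU open_ball]) (use \<nu> oU U inr' in \<open>auto intro!: smooth_intros\<close>)
    then show ?thesis unfolding H_def by (intro smooth_intros oU)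
  qed
  \<comment> \<open>At \<mu> = 0 the square root is 0 and the quotient is 0 by the convention for
    division, so \<open>H\<close> gives the value 0; the region contains only \<beta> = 0
    there.\<close>
  define h where "h \<beta> \<mu> = H (\<beta> / sqrt \<mu>, sqrt \<mu>)" for \<beta> \<mu>
  \<comment> \<open>Half of the admissible width, so that the non-strict condition |\<beta>| \<le>
    \<kappa> sqrt \<mu> with \<mu> > 0 stays inside the open set \<Omega>, where h is
    smooth.\<close>
  define \<kappa> where "\<kappa> = \<nu> * d0 / 2"
  define \<mu>0 where "\<mu>0 = d0\<^sup>2"
  have \<kappa>: "\<kappa> > 0" "\<kappa> < \<nu> * d0" and \<mu>0: "\<mu>0 > 0" "sqrt \<mu>0 = d0" using \<nu> d0 by (auto simp: \<kappa>_def \<mu>0_def)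
  define \<Omega> where "\<Omega> = {x :: real \<times> real. 0 < snd x \<and> snd x < \<mu>0 \<and> \<bar>fst x\<bar> < \<nu> * d0 * sqrt (snd x)}"
  have in_U: "(\<beta> / sqrt \<mu>, sqrt \<mu>) \<in> U" if "0 < \<mu>" "\<mu> < \<mu>0" "\<bar>\<beta>\<bar> < \<nu> * d0 * sqrt \<mu>" for \<beta> \<mu>
  proof -
    have "sqrt \<mu> < d0" using that(2) \<mu>0(2) real_sqrt_less_mono by metis
    moreover have "\<bar>\<beta> / sqrt \<mu>\<bar> < \<nu> * d0" using that by (simp add: pos_divide_less_eq)
    then have "- (\<nu> * d0) < \<beta> / sqrt \<mu>" "\<beta> / sqrt \<mu> < \<nu> * d0" unfolding abs_less_iff by linarith+
    moreover have "- d0 < sqrt \<mu>" using that d0(1) by (simp add: less_le_trans[of _ 0])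
    ultimately show ?thesis by (simp add: U_def)
  qed
  have o\<Omega>: "open \<Omega>" unfolding \<Omega>_def
    by (intro open_Collect_conj open_Collect_less continuous_intros)
  have h_smooth: "smooth_on \<Omega> (\<lambda>(\<beta>, \<mu>). h \<beta> \<mu>)"
  proof -
    have "smooth_on \<Omega> (\<lambda>x. H (fst x / sqrt (snd x), sqrt (snd x)))"
    proof (rule smooth_on_compose[OF H_smooth _ o\<Omega> oU])
      show "smooth_on \<Omega> (\<lambda>x. (fst x / sqrt (snd x), sqrt (snd x)))"
        by (intro smooth_intros o\<Omega>) (auto simp: \<Omega>_def)
    qed (use in_U in \<open>auto simp: \<Omega>_def\<close>)
    then show ?thesis by (simp add: h_def[abs_def] split_beta')
  qed
  have region: "(\<beta>, \<mu>) \<in> \<Omega> \<or> (\<beta> = 0 \<and> \<mu> = 0)" if "(\<beta>, \<mu>) \<in> small_region \<kappa> \<mu>0" for \<beta> \<mu>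
  proof (cases "\<mu> > 0")
    case True
    then have "\<kappa> * sqrt \<mu> < \<nu> * d0 * sqrt \<mu>" using \<kappa>(2) by (intro mult_strict_right_mono) auto
    then show ?thesis using that True unfolding small_region_def \<Omega>_def mem_Collect_eq split fst_conv snd_conv by linarith
  next
    case False
    then show ?thesis using that by (auto simp: small_region_def)
  qed
  have h0: "h \<beta> 0 = 0" for \<beta> by (simp add: h_def H_def)
  have h_bound: "\<bar>h (fst x) (snd x)\<bar> \<le> 2 * \<nu> * sqrt (snd x)" if "x \<in> small_region \<kappa> \<mu>0" for x
  proof -
    obtain \<beta> \<mu> where x: "x = (\<beta>, \<mu>)" by (cases x)
    from region[of \<beta> \<mu>] that x consider "(\<beta>, \<mu>) \<in> \<Omega>" | "\<mu> = 0" by auto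
    then show ?thesis
    proof cases
      case 1
      then have u: "(\<beta> / sqrt \<mu>, sqrt \<mu>) \<in> U" and \<mu>: "\<mu> > 0" using in_U by (auto simp: \<Omega>_def)
      have "\<bar>D (\<beta> / sqrt \<mu> / \<nu>, sqrt \<mu>)\<bar> \<le> 1"
        using D(4)[OF inr'[of "\<beta> / sqrt \<mu> / \<nu>" "sqrt \<mu>"]] U[OF u] R by simp
      then have "\<nu> * \<bar>1 + D (\<beta> / sqrt \<mu> / \<nu>, sqrt \<mu>)\<bar> \<le> \<nu> * 2" using \<nu> by (intro mult_left_mono) auto
      then have "sqrt \<mu> * (\<nu> * \<bar>1 + D (\<beta> / sqrt \<mu> / \<nu>, sqrt \<mu>)\<bar>) \<le> sqrt \<mu> * (\<nu> * 2)"
          using \<mu> by (simp only: mult_left_mono real_sqrt_ge_zero less_imp_le)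
      moreover have "\<bar>h \<beta> \<mu>\<bar> = sqrt \<mu> * (\<nu> * \<bar>1 + D (\<beta> / sqrt \<mu> / \<nu>, sqrt \<mu>)\<bar>)"
        using \<mu> \<nu> by (simp add: h_def H_def abs_mult)
      ultimately show ?thesis by (simp add: x ac_simps)
    qed (simp add: x h0)
  qed
  have h_cont: "continuous_on (small_region \<kappa> \<mu>0) (\<lambda>(\<beta>, \<mu>). h \<beta> \<mu>)"
    unfolding continuous_on_eq_continuous_within
  proof
    fix x assume x: "x \<in> small_region \<kappa> \<mu>0"
    then consider "x \<in> \<Omega>" | "x = (0, 0)" using region[of "fst x" "snd x"] by (cases x) auto
    then show "continuous (at x within small_region \<kappa> \<mu>0) (\<lambda>(\<beta>, \<mu>). h \<beta> \<mu>)"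
    proof cases
      case 1
      then have "isCont (\<lambda>(\<beta>, \<mu>). h \<beta> \<mu>) x"
        using smooth_on_continuous[OF h_smooth] o\<Omega> by (simp add: continuous_on_eq_continuous_at)
      then show ?thesis by (rule continuous_at_imp_continuous_within)
    next
      case 2
      \<comment> \<open>At the corner of the region the formula through sqrt \<mu> is not a smooth
        composition; continuity there comes from h = O(sqrt \<mu>).\<close>
      have "((\<lambda>x. h (fst x) (snd x)) \<longlongrightarrow> 0) (at (0, 0) within small_region \<kappa> \<mu>0)"
      proof (rule Lim_null_comparison)
        show "\<forall>\<^sub>F x in at (0, 0) within small_region \<kappa> \<mu>0. norm (h (fst x) (snd x)) \<le> 2 * \<nu> * sqrt (snd x)"
          unfolding eventually_at_filter by (intro always_eventually) (use h_bound in auto)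
        have "((\<lambda>x. 2 * \<nu> * sqrt (snd x)) \<longlongrightarrow> 2 * \<nu> * sqrt (snd (0::real, 0::real))) (at (0, 0) within small_region \<kappa> \<mu>0)"
          by (intro tendsto_intros)
        then show "((\<lambda>x. 2 * \<nu> * sqrt (snd x)) \<longlongrightarrow> 0) (at (0::real, 0) within small_region \<kappa> \<mu>0)" by simp
      qed
      then show ?thesis by (simp add: 2 continuous_within h0 split_beta')
    qed
  qed
  have int: "interior (small_region \<kappa> \<mu>0) \<subseteq> \<Omega>"
  proof
    fix x assume x: "x \<in> interior (small_region \<kappa> \<mu>0)"
    obtain \<beta> \<mu> where xx: "x = (\<beta>, \<mu>)" by (cases x)
    obtain s where s: "s > 0" "ball x s \<subseteq> small_region \<kappa> \<mu>0" using x by (auto simp: mem_interior)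
    have "(\<beta>, \<mu> - s / 2) \<in> ball x s" using s(1) by (simp add: xx dist_Pair_Pair dist_real_def)
    then have "\<mu> - s / 2 \<ge> 0" using s(2) by (auto simp: small_region_def)
    then have "\<mu> > 0" using s(1) by linarith
    moreover have "x \<in> small_region \<kappa> \<mu>0" using x interior_subset by blast
    ultimately show "x \<in> \<Omega>" using region[of \<beta> \<mu>] xx by auto
  qed
  have bif: "smooth_bifurcation_function \<kappa> \<mu>0 h"
    unfolding smooth_bifurcation_function_def
  proof (intro conjI exI[of _ H] ballI)
    show "smooth_on (interior (small_region \<kappa> \<mu>0)) (\<lambda>(\<beta>, \<mu>). h \<beta> \<mu>)" by (rule smooth_on_subset[OF h_smooth int])
    show "smooth_on ({- \<kappa><..<\<kappa>} \<times> {- sqrt \<mu>0<..<sqrt \<mu>0}) H"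
      by (rule smooth_on_subset[OF H_smooth]) (use \<kappa> \<mu>0 in \<open>auto simp: U_def\<close>)
    fix B \<epsilon> assume "\<epsilon> \<in> {0..<sqrt \<mu>0}"
    then show "h (\<epsilon> * B) (\<epsilon>\<^sup>2) = H (B, \<epsilon>)" by (cases "\<epsilon> = 0") (auto simp: h_def H_def)
  qed (rule h_cont)
  show ?thesis
  proof (rule exI[of _ \<kappa>], rule conjI[OF \<kappa>(1)], rule exI[of _ \<mu>0], rule conjI[OF \<mu>0(1)], rule exI[of _ h],
      rule exI[of _ K], intro conjI bif)
    show "h 0 0 = 0" by (rule h0)
    have main: "(let p = (h \<beta> \<mu>, \<beta>, \<mu>) in p \<in> P \<and> (\<exists>z0. \<bar>z0 - sqrt (\<mu> / \<bar>b1 p\<bar>)\<bar> \<le> K * \<mu> \<and> four_winged_connection (F p) W z0))"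
      if reg: "(\<beta>, \<mu>) \<in> small_region \<kappa> \<mu>0" and \<mu>: "\<mu> > 0" for \<beta> \<mu>
    proof -
      define e where "e = sqrt \<mu>"
      define b where "b = \<beta> / sqrt \<mu> / \<nu>"
      have "(\<beta> / sqrt \<mu>, sqrt \<mu>) \<in> U" using region[OF reg] \<mu> in_U by (auto simp: \<Omega>_def)
      from U[OF this] have be: "\<bar>b\<bar> < d0" "\<bar>e\<bar> < d0" by (simp_all add: b_def e_def)
      have e: "e > 0" using \<mu> by (simp add: e_def)
      define d where "d = D (b, e)"
      have qq: "norm (d, b, e) < R" using qR[OF be] by (simp add: d_def)
      have p: "(h \<beta> \<mu>, \<beta>, \<mu>) = rescaled_params \<nu> e (d, b)"
        using \<mu> \<nu> by (simp add: rescaled_params_def h_def H_def e_def b_def d_def)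
      obtain w where w: "\<forall>t. (w has_vector_derivative f ((D (b, e), (b, e)), w t)) (at t)" "\<forall>t. norm (w t) < 4"
        "(w \<longlongrightarrow> (0, 1)) at_bot" "(w \<longlongrightarrow> (0, 0)) at_top" "fst (w 0) \<noteq> 0"
        using D(6)[OF inr'[OF be]] by blast
      have con: "four_winged_connection (F (rescaled_params \<nu> e (d, b))) W (e * Z0 (d, b, e))"
        by (rule connection[OF qq e]) (use w in \<open>auto simp: d_def\<close>)
      have pP: "rescaled_params \<nu> e (d, b) \<in> P" using F_f[of d b e 0 0] qq R by simp
      \<comment> \<open>The height of O+ is e times \<open>Z0\<close>, so the error O(e) of
        \<open>Z0\<close> becomes O(e^2) = O(\<mu>).\<close>
      have "\<bar>e * Z0 (d, b, e) - sqrt (\<mu> / \<bar>b1 (rescaled_params \<nu> e (d, b))\<bar>)\<bar> = e * \<bar>Z0 (d, b, e)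
          - 1 / sqrt \<bar>b1 (rescaled_params \<nu> e (d, b))\<bar>\<bar>"
      proof -
        have "e * Z0 (d, b, e) - sqrt (\<mu> / \<bar>b1 (rescaled_params \<nu> e (d, b))\<bar>) = e * (Z0 (d, b, e)
            - 1 / sqrt \<bar>b1 (rescaled_params \<nu> e (d, b))\<bar>)"
          by (simp add: real_sqrt_divide e_def right_diff_distrib)
        then show ?thesis using e by (simp add: abs_mult)
      qed
      also have "\<dots> \<le> e * (K * \<bar>e\<bar>)" using K[of d b e] qq R e by (intro mult_left_mono) auto
      also have "\<dots> = K * \<mu>" using \<mu> by (simp add: e_def)
      finally show ?thesis unfolding p Let_def using con pP by blast
    qed
    show "\<forall>(\<beta>, \<mu>) \<in> small_region \<kappa> \<mu>0. \<mu> > 0 \<longrightarrow>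
        (let p = (h \<beta> \<mu>, \<beta>, \<mu>) in p \<in> P \<and> (\<exists>z0. \<bar>z0 - sqrt (\<mu> / \<bar>b1 p\<bar>)\<bar> \<le> K * \<mu> \<and> four_winged_connection (F p) W z0))"
      using main by blast
  qed
qed

end

theorem theorem1p2:
  fixes F :: "param \<Rightarrow> phase \<Rightarrow> phase"
    and P :: "param set" and W :: "phase set"
    and a0 a1 a2 a3 b0 :: "param \<Rightarrow> complex" and b1 b2 :: "param \<Rightarrow> real"
  assumes "open P" and "0 \<in> P" and "open W" and "0 \<in> W" and "Z4_sym ` W = W"
    and "smooth_on (P \<times> W) (\<lambda>(p, w). F p w)"
    and "smooth_on P a0" and "smooth_on P a1" and "smooth_on P a2" and "smooth_on P a3"
    and "smooth_on P b0" and "smooth_on P b1" and "smooth_on P b2"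
    and "\<forall>p\<in>P. \<forall>w\<in>W. F p (Z4_sym w) = Z4_sym (F p w)"
    and "(\<lambda>(p, w). norm (F p w - cubic_part a0 a1 a2 a3 b0 b1 b2 p w))
           \<in> O[nhds (0, 0)](\<lambda>(p, w). norm w ^ 4)"
    and "b1 0 < 0" and "Re (a0 0 * b0 0) < 0"
  shows "\<exists>\<kappa>>0. \<exists>\<mu>0>0. \<exists>h :: real \<Rightarrow> real \<Rightarrow> real. \<exists>K :: real.
           h 0 0 = 0 \<and> smooth_bifurcation_function \<kappa> \<mu>0 h \<and>
           (\<forall>(\<beta>, \<mu>) \<in> small_region \<kappa> \<mu>0. \<mu> > 0 \<longrightarrow>
              (let p = (h \<beta> \<mu>, \<beta>, \<mu>) in
               p \<in> P \<and>
               (\<exists>z0. \<bar>z0 - sqrt (\<mu> / \<bar>b1 p\<bar>)\<bar> \<le> K * \<mu> \<and>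
                     four_winged_connection (F p) W z0)))"
proof -
  interpret z4_family F P W a0 a1 a2 a3 b0 b1 b2
    using assms by unfold_locales
  show ?thesis by (rule heteroclinic_connection)
qed

end
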